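(* There holds the operator bound $$\|\mathcal{T}_6(f_1,f_2,f_3,f_4,f_5)\|_X\le C_X\prod_{k=1}^5\|f_k\|_X$$ (with $C_X$ a constant depending only on $X$, and for all $f_1,\dots,f_5\in X$) for each of the following spaces $X$: (i) $X=L^2$, with $C_X=2\sqrt{3}/\pi$; (ii) $X=L^{2,\sigma}$, for any $\sigma\ge0$; (iii) $X=H^\sigma$, for any $\sigma\ge0$; (iv) $X=L^{\infty,s}$, for any $s>1/2$; (v) $X=L^{p,s}$, for any $p\ge2$ and $s>1/2-1/p$.
   Context: All functions are $\mathbb{R}\to\mathbb{C}$. $H=-\Delta+x^2$ on $L^2(\mathbb{R})$, and $e^{itH}$ is the unitary propagator of $iu_t+Hu=0$ (so $e^{itH}\phi_n=e^{it(2n+1)}\phi_n$ for the Hermite functions $\phi_n$, $H\phi_n=(2n+1)\phi_n$). Define $$\mathcal{T}_6(f_1,\dots,f_5)=\frac{12}{\pi}\int_{-\pi/4}^{\pi/4}e^{-itH}\left[(e^{itH}f_1)(e^{itH}f_2)(e^{itH}f_3)\overline{(e^{itH}f_4)(e^{itH}f_5)}\right]dt ,$$ equivalently, by duality, $\int_{\mathbb{R}}\mathcal{T}_6(f_1,\dots,f_5)\overline{g}\,dx=\frac{12}{\pi}\int_{-\pi/4}^{\pi/4}\int_{\mathbb{R}}(e^{itH}f_1)(e^{itH}f_2)(e^{itH}f_3)\overline{(e^{itH}f_4)(e^{itH}f_5)(e^{itH}g)}\,dx\,dt$ for $g\in L^2$. With $\langle x\rangle=\sqrt{1+x^2}$: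 $\|f\|_{L^{p,s}}=\|\langle x\rangle^sf\|_{L^p}$ for $2\le p\le\infty$, and $\|f\|_{H^\sigma}=\|\langle\xi\rangle^\sigma\widehat{f}\|_{L^2}$, where $\widehat{f}(\xi)=(2\pi)^{-1/2}\int_{\mathbb{R}} e^{-ix\xi}f(x)\,dx$. *)

theory Defs
  imports "HOL-Analysis.Analysis" "HOL-Probability.Essential_Supremum"
begin

section \<open>Weighted Lebesgue spaces\<close>

text \<open>
  Elements of function spaces are Borel measurable representatives \<^typ>\<open>real \<Rightarrow> complex\<close>;
  equality in such a space is equality almost everywhere. The exponent ranges over the extended
  reals, so that \<^term>\<open>\<infinity>\<close> is allowed.
\<close>

definition Lp :: "ereal \<Rightarrow> (real \<Rightarrow> complex) set" where
  "Lp p = {f \<in> borel_measurable lborel.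
     if p = \<infinity> then esssup lborel (\<lambda>x. ereal (norm (f x))) < \<infinity>
     else integrable lborel (\<lambda>x. norm (f x) powr real_of_ereal p)}"

definition Lp_norm :: "ereal \<Rightarrow> (real \<Rightarrow> complex) \<Rightarrow> real" where
  "Lp_norm p f =
     (if p = \<infinity> then real_of_ereal (esssup lborel (\<lambda>x. ereal (norm (f x))))
      else (LINT x|lborel. norm (f x) powr real_of_ereal p) powr (1 / real_of_ereal p))"

abbreviation L2 :: "(real \<Rightarrow> complex) set" where
  "L2 \<equiv> Lp 2"

definition japanese_bracket :: "real \<Rightarrow> real" where
  "japanese_bracket x = sqrt (1 + x\<^sup>2)"

definition weight :: "real \<Rightarrow> (real \<Rightarrow> complex) \<Rightarrow> real \<Rightarrow> complex" where
  "weight s f = (\<lambda>x. (japanese_bracket x powr s) *\<^sub>R f x)"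

definition Lps :: "ereal \<Rightarrow> real \<Rightarrow> (real \<Rightarrow> complex) set" where
  "Lps p s = {f. weight s f \<in> Lp p}"

definition Lps_norm :: "ereal \<Rightarrow> real \<Rightarrow> (real \<Rightarrow> complex) \<Rightarrow> real" where
  "Lps_norm p s f = Lp_norm p (weight s f)"

text \<open>
  Convergence in \<open>L\<^sup>2\<close>. The nonnegative integral is used so that a difference that is not square
  integrable counts as being at distance \<^term>\<open>\<infinity>\<close>, not \<open>0\<close>.
\<close>

definition L2_tendsto ::
  "('b \<Rightarrow> real \<Rightarrow> complex) \<Rightarrow> (real \<Rightarrow> complex) \<Rightarrow> 'b filter \<Rightarrow> bool" where
  "L2_tendsto u v F \<longleftrightarrow>
     ((\<lambda>r. \<integral>\<^sup>+ x. ennreal ((norm (u r x - v x))\<^sup>2) \<partial>lborel) \<longlongrightarrow> 0) F"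


section \<open>Fourier transform and Sobolev spaces\<close>

text \<open>
  The Fourier integral need not converge for a general element of \<open>L\<^sup>2\<close>; as usual, the transform is
  the limit in \<open>L\<^sup>2\<close> of the truncated integrals (unique up to a null set).
\<close>

definition truncated_fourier :: "(real \<Rightarrow> complex) \<Rightarrow> real \<Rightarrow> real \<Rightarrow> complex" where
  "truncated_fourier f R = (\<lambda>\<xi>. complex_of_real ((2 * pi) powr (- 1 / 2)) *
     (LINT x:{-R..R}|lborel. exp (- (\<i> * complex_of_real (x * \<xi>))) * f x))"

definition fourier :: "(real \<Rightarrow> complex) \<Rightarrow> real \<Rightarrow> complex" where
  "fourier f = (SOME F. F \<in> L2 \<and> L2_tendsto (truncated_fourier f) F at_top)"

definition Sobolev :: "real \<Rightarrow> (real \<Rightarrow> complex) set" where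
  "Sobolev \<sigma> = {f \<in> L2. weight \<sigma> (fourier f) \<in> L2}"

definition Sobolev_norm :: "real \<Rightarrow> (real \<Rightarrow> complex) \<Rightarrow> real" where
  "Sobolev_norm \<sigma> f = Lp_norm 2 (weight \<sigma> (fourier f))"


section \<open>The propagator of the harmonic oscillator\<close>

definition vderiv :: "(real \<Rightarrow> complex) \<Rightarrow> real \<Rightarrow> complex" where
  "vderiv f = (\<lambda>x. vector_derivative f (at x))"

definition schwartz :: "(real \<Rightarrow> complex) \<Rightarrow> bool" where
  "schwartz f \<longleftrightarrow>
     (\<forall>n x. ((vderiv ^^ n) f) differentiable (at x)) \<and>
     (\<forall>n k. bounded (range (\<lambda>x. (x ^ k) *\<^sub>R (vderiv ^^ n) f x)))"

definition harmonic_oscillator :: "(real \<Rightarrow> complex) \<Rightarrow> real \<Rightarrow> complex" where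
  "harmonic_oscillator f = (\<lambda>x. - (vderiv (vderiv f) x) + (x\<^sup>2) *\<^sub>R f x)"

text \<open>
  The unitary propagator of \<open>i u\<^sub>t + H u = 0\<close> is the strongly continuous one-parameter unitary
  group on \<open>L\<^sup>2\<close> whose generator is \<open>i H\<close> (surjectivity of each member follows from the group law).
  It suffices to prescribe the generator on Schwartz functions, because \<open>H\<close> is essentially
  self-adjoint there; this determines the group up to null sets.
\<close>

definition unitary_group :: "(real \<Rightarrow> (real \<Rightarrow> complex) \<Rightarrow> real \<Rightarrow> complex) \<Rightarrow> bool" where
  "unitary_group U \<longleftrightarrow>
     (\<forall>t. \<forall>f\<in>L2. U t f \<in> L2 \<and> Lp_norm 2 (U t f) = Lp_norm 2 f) \<and>
     (\<forall>t a b. \<forall>f\<in>L2. \<forall>g\<in>L2.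
        AE x in lborel. U t (\<lambda>y. a * f y + b * g y) x = a * U t f x + b * U t g x) \<and>
     (\<forall>f\<in>L2. AE x in lborel. U 0 f x = f x) \<and>
     (\<forall>s t. \<forall>f\<in>L2. AE x in lborel. U (s + t) f x = U s (U t f) x) \<and>
     (\<forall>f\<in>L2. L2_tendsto (\<lambda>t. U t f) f (at 0))"

definition is_propagator :: "(real \<Rightarrow> (real \<Rightarrow> complex) \<Rightarrow> real \<Rightarrow> complex) \<Rightarrow> bool" where
  "is_propagator U \<longleftrightarrow> unitary_group U \<and>
     (\<forall>f. schwartz f \<longrightarrow>
        L2_tendsto (\<lambda>t x. (U t f x - f x) / complex_of_real t)
          (\<lambda>x. \<i> * harmonic_oscillator f x) (at 0))"

definition expitH :: "real \<Rightarrow> (real \<Rightarrow> complex) \<Rightarrow> real \<Rightarrow> complex" where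
  "expitH = (SOME U. is_propagator U)"


section \<open>The quintic operator\<close>

text \<open>
  The product inside the time integral need not lie in \<open>L\<^sup>2\<close> for each single \<open>t\<close>, so the operator
  is defined by duality. The integral is iterated (first \<open>x\<close>, then \<open>t\<close>): \<^const>\<open>expitH\<close> fixes
  a representative separately for each \<open>t\<close>, and the iterated integral does not depend on
  these choices.
\<close>

definition T6_form ::
  "(real \<Rightarrow> complex) \<Rightarrow> (real \<Rightarrow> complex) \<Rightarrow> (real \<Rightarrow> complex) \<Rightarrow> (real \<Rightarrow> complex) \<Rightarrow>
   (real \<Rightarrow> complex) \<Rightarrow> (real \<Rightarrow> complex) \<Rightarrow> complex" where
  "T6_form f1 f2 f3 f4 f5 g = complex_of_real (12 / pi) *
     (LINT t:{-(pi/4)..pi/4}|lborel. (LINT x|lborel.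
        expitH t f1 x * expitH t f2 x * expitH t f3 x *
        cnj (expitH t f4 x * expitH t f5 x * expitH t g x)))"

definition T6 ::
  "(real \<Rightarrow> complex) \<Rightarrow> (real \<Rightarrow> complex) \<Rightarrow> (real \<Rightarrow> complex) \<Rightarrow> (real \<Rightarrow> complex) \<Rightarrow>
   (real \<Rightarrow> complex) \<Rightarrow> real \<Rightarrow> complex" where
  "T6 f1 f2 f3 f4 f5 = (SOME h. h \<in> L2 \<and>
     (\<forall>g\<in>L2. (LINT x|lborel. h x * cnj (g x)) = T6_form f1 f2 f3 f4 f5 g))"

definition T6_bounded_by ::
  "(real \<Rightarrow> complex) set \<Rightarrow> ((real \<Rightarrow> complex) \<Rightarrow> real) \<Rightarrow> real \<Rightarrow> bool" where
  "T6_bounded_by X N C \<longleftrightarrow>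
     (\<forall>f1\<in>X. \<forall>f2\<in>X. \<forall>f3\<in>X. \<forall>f4\<in>X. \<forall>f5\<in>X.
        T6 f1 f2 f3 f4 f5 \<in> X \<and>
        N (T6 f1 f2 f3 f4 f5) \<le> C * (N f1 * N f2 * N f3 * N f4 * N f5))"

end

theory Submission
  imports Defs "HOL-Probability.Levy" "HOL-Probability.Sinc_Integral"
begin

text \<open>
  The coherent states \<open>exp (- x\<^sup>2 / 2 + 2 * x * z - z\<^sup>2)\<close> span a dense subspace of \<open>L\<^sup>2\<close>, and both the
  propagator and the Fourier transform act on them by rotating the parameter \<open>z\<close>, the propagator up to
  a phase. On coherent states the space-time form is a Bessel integral, and it agrees with the average of
  \<open>f1 y1 * f2 y2 * f3 y3 * cnj (f4 x1 * f5 x2 * g x3)\<close> over all \<open>x\<close> in \<open>\<real>\<^sup>3\<close> and all rotations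
  \<open>y\<close> of \<open>x\<close> about the axis \<open>(1, 1, 1)\<close>. Density and the resulting \<open>L\<^sup>6\<close> Strichartz bound
  carry this to \<open>L\<^sup>2\<close>, so that the operator is dominated by a positive averaging operator.

  Rotations preserve Lebesgue measure, and the Cauchy--Schwarz inequality gives the sharp \<open>L\<^sup>2\<close>
  bound. They preserve the norm, so the weight of \<open>x3\<close> is dominated by the weights of \<open>y1\<close>, \<open>y2\<close>,
  \<open>y3\<close>, which gives the weighted \<open>L\<^sup>2\<close> bound. The average commutes with the Fourier transform,
  whence the Sobolev bound. In \<open>L\<^sup>\<infinity>\<close> one of the weights at \<open>y\<close> absorbs that of \<open>x3\<close>, and
  the remaining four are paired by the Cauchy--Schwarz inequality in \<open>(x1, x2)\<close>. The Jacobian from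
  \<open>(x1, x2)\<close> to two of the \<open>y\<close> is, up to sign, an entry of the rotation matrix, and the inverse of its square
  root is integrable in the angle. The remaining spaces follow by Hoelder's inequality for the positive average,
  interpolating between weighted \<open>L\<^sup>2\<close> and \<open>L\<^sup>\<infinity>\<close>.
\<close>

section \<open>The Hilbert space of square integrable functions\<close>

text \<open>The obstacle is a circularity: absolute convergence of the space-time form on
  \<open>L2\<close> is the Strichartz bound, and that bound is meant to come from equality with the
  average. The form is therefore introduced twice. On finite combinations of coherent states
  (\<open>C.form\<close>) every orbit is bounded and convergence is elementary. Equality with
  \<open>A.form\<close> there, read with all six arguments equal, is the sextic bound, and only then
  is the form on all of \<open>L2\<close> (\<open>T.form\<close>) available. Equality on coherent
  states rests on two facts. The integral of
  \<open>exp (p * cis \<alpha> + q * cis (- \<alpha>))\<close> over a period depends on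
  \<open>p * q\<close> alone (\<open>bess_eq\<close>). The time integral and the angle integral lead
  to different \<open>p\<close> and \<open>q\<close>, whose products agree by Lagrange's identity in
  the plane orthogonal to the diagonal. \<open>expitH\<close> fixes its representatives time by
  time, so the double integrals use \<open>osc\<close>, a version of the flow that is jointly
  measurable in time and space.\<close>

definition SQ :: "(real \<Rightarrow> complex) set" where
  "SQ = {f \<in> borel_measurable borel. integrable lborel (\<lambda>x. (norm (f x))\<^sup>2)}"

definition nrm :: "(real \<Rightarrow> complex) \<Rightarrow> real" where
  "nrm f = sqrt (LINT x|lborel. (norm (f x))\<^sup>2)"

lemma L2_eq: "L2 = SQ"
  by (simp add: Lp_def SQ_def)

lemma Lp_norm_2_eq: "Lp_norm 2 = nrm"
  by (simp add: Lp_norm_def nrm_def powr_half_sqrt fun_eq_iff)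

lemmas nrm_eq = nrm_def

lemma L2_iff:
  "f \<in> SQ \<longleftrightarrow> f \<in> borel_measurable borel \<and> integrable lborel (\<lambda>x. (norm (f x))\<^sup>2)"
  by (simp add: SQ_def)

lemma L2_measurable [measurable_dest]: "f \<in> SQ \<Longrightarrow> f \<in> borel_measurable borel"
  by (simp add: L2_iff)

lemma L2_integrable: "f \<in> SQ \<Longrightarrow> integrable lborel (\<lambda>x. (norm (f x))\<^sup>2)"
  by (simp add: L2_iff)

lemma nrm_nonneg [simp]: "0 \<le> nrm f"
  by (simp add: nrm_eq)

lemma nrm_sq: "(nrm f)\<^sup>2 = (LINT x|lborel. (norm (f x))\<^sup>2)"
  by (simp add: nrm_eq)

lemma nn_integral_nrm:
  assumes "f \<in> SQ"
  shows "(\<integral>\<^sup>+x. (ennreal (norm (f x)))\<^sup>2 \<partial>lborel) = ennreal ((nrm f)\<^sup>2)"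
  using nn_integral_eq_integral[OF L2_integrable[OF assms]] by (simp add: nrm_sq ennreal_power)

text \<open>The bridge back from \<open>ennreal\<close>: later estimates are proved for nonnegative
  integrals, where integrability is no issue, and one such estimate yields membership and norm bound
  together.\<close>

lemma L2_I_nn:
  assumes [measurable]: "f \<in> borel_measurable borel"
    and C: "(\<integral>\<^sup>+x. (ennreal (norm (f x)))\<^sup>2 \<partial>lborel) \<le> ennreal (C\<^sup>2)" "0 \<le> C"
  shows "f \<in> SQ" "nrm f \<le> C"
proof -
  have "integrable lborel (\<lambda>x. (norm (f x))\<^sup>2)"
    using C by (intro integrableI_bounded) (auto simp: ennreal_power intro: le_less_trans)
  then show *: "f \<in> SQ" by (simp add: L2_iff)
  have "ennreal ((nrm f)\<^sup>2) \<le> ennreal (C\<^sup>2)"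
    using C(1) by (simp add: nn_integral_nrm[OF *])
  then have "(nrm f)\<^sup>2 \<le> C\<^sup>2" by simp
  then show "nrm f \<le> C" using C(2) by (rule power2_le_imp_le)
qed

lemma L2_dominated:
  assumes "g \<in> SQ" and [measurable]: "f \<in> borel_measurable borel"
    and "AE x in lborel. norm (f x) \<le> norm (g x)"
  shows "f \<in> SQ" "nrm f \<le> nrm g"
proof -
  have "(\<integral>\<^sup>+x. (ennreal (norm (f x)))\<^sup>2 \<partial>lborel) \<le> (\<integral>\<^sup>+x. (ennreal (norm (g x)))\<^sup>2 \<partial>lborel)"
    using assms(3) by (intro nn_integral_mono_AE) (auto elim!: eventually_mono intro!: power_mono)
  also have "\<dots> = ennreal ((nrm g)\<^sup>2)" by (rule nn_integral_nrm) fact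
  finally have *: "(\<integral>\<^sup>+x. (ennreal (norm (f x)))\<^sup>2 \<partial>lborel) \<le> ennreal ((nrm g)\<^sup>2)" .
  show "f \<in> SQ" "nrm f \<le> nrm g" by (rule L2_I_nn[OF assms(2) *], simp)+
qed

lemma L2_cong_AE:
  assumes "f \<in> SQ" "g \<in> borel_measurable borel" "AE x in lborel. g x = f x"
  shows "g \<in> SQ"
  using assms by (intro L2_dominated(1)[of f g]) (auto elim: eventually_mono)

lemma nrm_cong_AE:
  assumes [measurable]: "f \<in> borel_measurable borel" "g \<in> borel_measurable borel"
    and "AE x in lborel. f x = g x"
  shows "nrm f = nrm g"
proof -
  have "(LINT x|lborel. (norm (f x))\<^sup>2) = (LINT x|lborel. (norm (g x))\<^sup>2)"
    using assms(3) by (intro integral_cong_AE) (auto elim!: eventually_mono)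
  then show ?thesis by (simp add: nrm_eq)
qed

lemma L2_zero [simp]: "(\<lambda>x. 0) \<in> SQ"
  by (simp add: L2_iff)

lemma nrm_zero [simp]: "nrm (\<lambda>x. 0) = 0"
  by (simp add: nrm_eq)

lemma L2_scale [simp, intro]: "f \<in> SQ \<Longrightarrow> (\<lambda>x. c * f x) \<in> SQ"
  by (auto simp: L2_iff norm_mult power_mult_distrib)

lemma nrm_scale [simp]: "nrm (\<lambda>x. c * f x) = norm c * nrm f"
  by (simp add: nrm_eq norm_mult power_mult_distrib real_sqrt_mult)

lemma norm_add_sq_le: "(norm (a + b :: complex))\<^sup>2 \<le> 2 * (norm a)\<^sup>2 + 2 * (norm b)\<^sup>2"
proof -
  have "(norm (a + b))\<^sup>2 \<le> (norm a + norm b)\<^sup>2" by (intro power_mono norm_triangle_ineq) auto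
  also have "\<dots> \<le> 2 * (norm a)\<^sup>2 + 2 * (norm b)\<^sup>2"
    using zero_le_power2[of "norm a - norm b"] by (simp add: power2_eq_square algebra_simps)
  finally show ?thesis .
qed

lemma L2_add [simp, intro]:
  assumes "f \<in> SQ" "g \<in> SQ" shows "(\<lambda>x. f x + g x) \<in> SQ"
proof -
  have [measurable]: "f \<in> borel_measurable borel" "g \<in> borel_measurable borel"
    using assms by auto
  have "integrable lborel (\<lambda>x. (norm (f x + g x))\<^sup>2)"
    using assms
    by (intro Bochner_Integration.integrable_bound
          [of lborel "\<lambda>x. 2 * (norm (f x))\<^sup>2 + 2 * (norm (g x))\<^sup>2" "\<lambda>x. (norm (f x + g x))\<^sup>2"])
       (auto simp: L2_iff norm_add_sq_le)
  then show ?thesis by (simp add: L2_iff)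
qed

lemma L2_uminus [simp, intro]: "f \<in> SQ \<Longrightarrow> (\<lambda>x. - f x) \<in> SQ"
  using L2_scale[of f "-1"] by simp

lemma L2_diff [simp, intro]: "f \<in> SQ \<Longrightarrow> g \<in> SQ \<Longrightarrow> (\<lambda>x. f x - g x) \<in> SQ"
  using L2_add[of f "\<lambda>x. - g x"] by simp

lemma nrm_uminus [simp]: "nrm (\<lambda>x. - f x) = nrm f"
  by (simp add: nrm_eq)

lemma nrm_diff_commute: "nrm (\<lambda>x. f x - g x) = nrm (\<lambda>x. g x - f x)"
  by (simp add: nrm_eq norm_minus_commute)

section \<open>Inner product, triangle inequality and polarization\<close>

definition ip :: "(real \<Rightarrow> complex) \<Rightarrow> (real \<Rightarrow> complex) \<Rightarrow> complex" where
  "ip f g = (LINT x|lborel. f x * cnj (g x))"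

lemma borel_measurable_cnj [measurable]:
  "f \<in> borel_measurable M \<Longrightarrow> (\<lambda>x. cnj (f x)) \<in> borel_measurable M"
  using measurable_compose[of f M borel cnj borel]
  by (simp add: borel_measurable_continuous_onI continuous_on_cnj)

lemma cauchy_schwarz_nn_real:
  assumes [measurable]: "f \<in> borel_measurable M" "g \<in> borel_measurable M"
    and "(\<integral>\<^sup>+x. (f x)\<^sup>2 \<partial>M) \<le> ennreal (a\<^sup>2)" "(\<integral>\<^sup>+x. (g x)\<^sup>2 \<partial>M) \<le> ennreal (b\<^sup>2)" "0 \<le> a" "0 \<le> b"
  shows "(\<integral>\<^sup>+x. f x * g x \<partial>M) \<le> ennreal (a * b)"
proof -
  have "(\<integral>\<^sup>+x. f x * g x \<partial>M)\<^sup>2 \<le> (\<integral>\<^sup>+x. (f x)\<^sup>2 \<partial>M) * (\<integral>\<^sup>+x. (g x)\<^sup>2 \<partial>M)"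
    by (rule Cauchy_Schwarz_nn_integral) auto
  also have "\<dots> \<le> ennreal (a\<^sup>2) * ennreal (b\<^sup>2)" by (intro mult_mono assms) auto
  also have "\<dots> = (ennreal (a * b))\<^sup>2"
    using assms by (simp add: ennreal_mult power_mult_distrib ennreal_power)
  finally have le: "(\<integral>\<^sup>+x. f x * g x \<partial>M)\<^sup>2 \<le> (ennreal (a * b))\<^sup>2" .
  show ?thesis
  proof (cases "\<integral>\<^sup>+x. f x * g x \<partial>M")
    case (real r)
    then have "r\<^sup>2 \<le> (a * b)\<^sup>2" using le assms(5,6) by (simp add: ennreal_power ennreal_le_iff)
    then have "r \<le> a * b" by (rule power2_le_imp_le) (simp add: assms)
    then show ?thesis using real by (simp add: ennreal_leI)
  next
    case top
    then have "(ennreal (a * b))\<^sup>2 = top" using le by (simp add: top_unique)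
    then show ?thesis by (simp add: power2_eq_square ennreal_mult_eq_top_iff)
  qed
qed

lemma L2_mult_nn:
  assumes "f \<in> SQ" "g \<in> SQ"
  shows "(\<integral>\<^sup>+x. ennreal (norm (f x * g x)) \<partial>lborel) \<le> ennreal (nrm f * nrm g)"
proof -
  have [measurable]: "f \<in> borel_measurable borel" "g \<in> borel_measurable borel"
    using assms by auto
  have "(\<integral>\<^sup>+x. ennreal (norm (f x)) * ennreal (norm (g x)) \<partial>lborel) \<le> ennreal (nrm f * nrm g)"
    using assms by (intro cauchy_schwarz_nn_real) (auto simp: nn_integral_nrm)
  then show ?thesis by (simp add: norm_mult ennreal_mult)
qed

lemma L2_cnj [simp, intro]: "f \<in> SQ \<Longrightarrow> (\<lambda>x. cnj (f x)) \<in> SQ"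
  by (auto simp: L2_iff)

lemma nrm_cnj [simp]: "nrm (\<lambda>x. cnj (f x)) = nrm f"
  by (simp add: nrm_eq)

lemma L2_mult_integrable:
  assumes "f \<in> SQ" "g \<in> SQ" shows "integrable lborel (\<lambda>x. f x * g x)"
proof (rule integrableI_bounded)
  have [measurable]: "f \<in> borel_measurable borel" "g \<in> borel_measurable borel"
    using assms by auto
  show "(\<lambda>x. f x * g x) \<in> borel_measurable lborel" by measurable
  show "(\<integral>\<^sup>+x. ennreal (norm (f x * g x)) \<partial>lborel) < \<infinity>"
    using L2_mult_nn[OF assms] by (rule le_less_trans) simp
qed

lemma ip_integrable [simp, intro]:
  "f \<in> SQ \<Longrightarrow> g \<in> SQ \<Longrightarrow> integrable lborel (\<lambda>x. f x * cnj (g x))"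
  by (intro L2_mult_integrable) auto

lemma norm_ip_le:
  assumes "f \<in> SQ" "g \<in> SQ" shows "norm (ip f g) \<le> nrm f * nrm g"
proof -
  have "ennreal (norm (ip f g)) \<le> (\<integral>\<^sup>+x. ennreal (norm (f x * cnj (g x))) \<partial>lborel)"
    unfolding ip_def using assms by (intro integral_norm_bound_ennreal) auto
  also have "\<dots> \<le> ennreal (nrm f * nrm g)" using L2_mult_nn[of f "\<lambda>x. cnj (g x)"] assms by auto
  finally show ?thesis by (simp add: ennreal_le_iff)
qed

lemma ip_self: "ip f f = complex_of_real ((nrm f)\<^sup>2)"
  unfolding ip_def nrm_sq integral_complex_of_real[symmetric]
  by (simp only: complex_norm_square)

lemma ip_cnj: "cnj (ip f g) = ip g f"
proof -
  have "(LINT x|lborel. g x * cnj (f x)) = (LINT x|lborel. cnj (f x * cnj (g x)))"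
    by (simp add: mult.commute)
  also have "\<dots> = cnj (LINT x|lborel. f x * cnj (g x))" by (rule Bochner_Integration.integral_cnj)
  finally show ?thesis by (simp add: ip_def)
qed

lemma ip_add_left: "f \<in> SQ \<Longrightarrow> g \<in> SQ \<Longrightarrow> h \<in> SQ \<Longrightarrow> ip (\<lambda>x. f x + g x) h = ip f h + ip g h"
  unfolding ip_def by (simp add: distrib_right Bochner_Integration.integral_add)

lemma ip_diff_left: "f \<in> SQ \<Longrightarrow> g \<in> SQ \<Longrightarrow> h \<in> SQ \<Longrightarrow> ip (\<lambda>x. f x - g x) h = ip f h - ip g h"
  unfolding ip_def by (simp add: left_diff_distrib Bochner_Integration.integral_diff)

lemma ip_scale_left: "ip (\<lambda>x. c * f x) h = c * ip f h"
  unfolding ip_def by (simp add: mult.assoc)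

lemma ip_add_right: "f \<in> SQ \<Longrightarrow> g \<in> SQ \<Longrightarrow> h \<in> SQ \<Longrightarrow> ip h (\<lambda>x. f x + g x) = ip h f + ip h g"
  unfolding ip_def by (simp add: distrib_left Bochner_Integration.integral_add)

lemma ip_diff_right: "f \<in> SQ \<Longrightarrow> g \<in> SQ \<Longrightarrow> h \<in> SQ \<Longrightarrow> ip h (\<lambda>x. f x - g x) = ip h f - ip h g"
  unfolding ip_def by (simp add: right_diff_distrib Bochner_Integration.integral_diff)

lemma ip_scale_right: "ip h (\<lambda>x. c * f x) = cnj c * ip h f"
  unfolding ip_def by (simp add: mult.left_commute[of _ "cnj c"])

lemma ip_zero_right [simp]: "ip h (\<lambda>x. 0) = 0" and ip_zero_left [simp]: "ip (\<lambda>x. 0) h = 0"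
  by (simp_all add: ip_def)

lemma ip_cong_AE:
  assumes [measurable]: "f \<in> borel_measurable borel" "f' \<in> borel_measurable borel"
     "g \<in> borel_measurable borel" "g' \<in> borel_measurable borel"
    and "AE x in lborel. f x = f' x" "AE x in lborel. g x = g' x"
  shows "ip f g = ip f' g'"
  unfolding ip_def
proof (rule integral_cong_AE)
  show "AE x in lborel. f x * cnj (g x) = f' x * cnj (g' x)"
    using assms(5,6) by eventually_elim simp
qed measurable

lemma nrm_add_sq:
  assumes "f \<in> SQ" "g \<in> SQ"
  shows "(nrm (\<lambda>x. f x + g x))\<^sup>2 = (nrm f)\<^sup>2 + 2 * Re (ip f g) + (nrm g)\<^sup>2"
proof -
  have "complex_of_real ((nrm (\<lambda>x. f x + g x))\<^sup>2) = ip f f + ip f g + cnj (ip f g) + ip g g"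
    using assms unfolding ip_self[symmetric] ip_cnj
    by (simp add: ip_add_left ip_add_right)
  also have "\<dots> = complex_of_real ((nrm f)\<^sup>2 + 2 * Re (ip f g) + (nrm g)\<^sup>2)"
    by (simp add: ip_self complex_eq_iff)
  finally show ?thesis by (simp only: of_real_eq_iff)
qed

lemma nrm_diff_sq:
  assumes "f \<in> SQ" "g \<in> SQ"
  shows "(nrm (\<lambda>x. f x - g x))\<^sup>2 = (nrm f)\<^sup>2 - 2 * Re (ip f g) + (nrm g)\<^sup>2"
  using nrm_add_sq[of f "\<lambda>x. (-1) * g x"] assms
  by (simp only: ip_scale_right L2_scale nrm_scale) simp

lemma nrm_triangle:
  assumes "f \<in> SQ" "g \<in> SQ" shows "nrm (\<lambda>x. f x + g x) \<le> nrm f + nrm g"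
proof (rule power2_le_imp_le)
  have "Re (ip f g) \<le> nrm f * nrm g"
    using complex_Re_le_cmod[of "ip f g"] norm_ip_le[OF assms] by linarith
  then show "(nrm (\<lambda>x. f x + g x))\<^sup>2 \<le> (nrm f + nrm g)\<^sup>2"
    using nrm_add_sq[OF assms] by (simp add: power2_sum)
qed simp

lemma nrm_triangle_diff:
  assumes "f \<in> SQ" "g \<in> SQ" "h \<in> SQ"
  shows "nrm (\<lambda>x. f x - h x) \<le> nrm (\<lambda>x. f x - g x) + nrm (\<lambda>x. g x - h x)"
  using nrm_triangle[of "\<lambda>x. f x - g x" "\<lambda>x. g x - h x"] assms by simp

lemma nrm_diff_le: "f \<in> SQ \<Longrightarrow> g \<in> SQ \<Longrightarrow> nrm (\<lambda>x. f x - g x) \<le> nrm f + nrm g"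
  using nrm_triangle[of f "\<lambda>x. - g x"] by simp

lemma nrm_diff_abs:
  assumes "f \<in> SQ" "g \<in> SQ" shows "\<bar>nrm f - nrm g\<bar> \<le> nrm (\<lambda>x. f x - g x)"
  using nrm_triangle_diff[OF assms(1,2) L2_zero] nrm_triangle_diff[OF assms(2,1) L2_zero]
    nrm_diff_commute[of f g] by simp

lemma nrm_eq_0_iff:
  assumes "f \<in> SQ" shows "nrm f = 0 \<longleftrightarrow> (AE x in lborel. f x = 0)"
  using integral_nonneg_eq_0_iff_AE[OF L2_integrable[OF assms]] by (simp add: nrm_eq)

lemma nrm_diff_eq_0_iff:
  assumes "f \<in> SQ" "g \<in> SQ"
  shows "nrm (\<lambda>x. f x - g x) = 0 \<longleftrightarrow> (AE x in lborel. f x = g x)"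
  using nrm_eq_0_iff[of "\<lambda>x. f x - g x"] assms by simp

text \<open>Norms alone determine the inner product; this is how \<open>isometry_ip\<close> turns
  preservation of norms into preservation of \<open>ip\<close>.\<close>

lemma polarization:
  assumes "f \<in> SQ" "g \<in> SQ"
  shows "4 * ip f g = of_real ((nrm (\<lambda>x. f x + g x))\<^sup>2 - (nrm (\<lambda>x. f x - g x))\<^sup>2)
     + \<i> * of_real ((nrm (\<lambda>x. f x + \<i> * g x))\<^sup>2 - (nrm (\<lambda>x. f x - \<i> * g x))\<^sup>2)"
  using assms by (simp add: nrm_add_sq nrm_diff_sq ip_scale_right complex_eq_iff)

lemma ip_eq_AE:
  assumes "f \<in> SQ" "g \<in> SQ" and "\<And>h. h \<in> SQ \<Longrightarrow> ip f h = ip g h"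
  shows "AE x in lborel. f x = g x"
proof -
  have "ip (\<lambda>x. f x - g x) (\<lambda>x. f x - g x) = 0"
    using assms by (simp add: ip_diff_left)
  then have "nrm (\<lambda>x. f x - g x) = 0" by (simp add: ip_self)
  then show ?thesis using assms by (simp add: nrm_diff_eq_0_iff)
qed

lemma L2_tendsto_iff:
  assumes "\<And>r. u r \<in> SQ" "v \<in> SQ"
  shows "L2_tendsto u v F \<longleftrightarrow> ((\<lambda>r. nrm (\<lambda>x. u r x - v x)) \<longlongrightarrow> 0) F"
proof -
  have "(\<integral>\<^sup>+ x. ennreal ((norm (u r x - v x))\<^sup>2) \<partial>lborel) = ennreal ((nrm (\<lambda>x. u r x - v x))\<^sup>2)" for r
    using nn_integral_nrm[of "\<lambda>x. u r x - v x"] assms by (simp add: ennreal_power)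
  then have "L2_tendsto u v F \<longleftrightarrow> ((\<lambda>r. (nrm (\<lambda>x. u r x - v x))\<^sup>2) \<longlongrightarrow> 0) F"
    unfolding L2_tendsto_def by (simp add: tendsto_ennreal_iff flip: ennreal_0)
  also have "\<dots> \<longleftrightarrow> ((\<lambda>r. nrm (\<lambda>x. u r x - v x)) \<longlongrightarrow> 0) F"
  proof
    assume "((\<lambda>r. (nrm (\<lambda>x. u r x - v x))\<^sup>2) \<longlongrightarrow> 0) F"
    from tendsto_real_sqrt[OF this] show "((\<lambda>r. nrm (\<lambda>x. u r x - v x)) \<longlongrightarrow> 0) F"
      by simp
  next
    assume "((\<lambda>r. nrm (\<lambda>x. u r x - v x)) \<longlongrightarrow> 0) F"
    from tendsto_power[OF this, of 2] show "((\<lambda>r. (nrm (\<lambda>x. u r x - v x))\<^sup>2) \<longlongrightarrow> 0) F"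
      by simp
  qed
  finally show ?thesis .
qed

text \<open>The bound is assumed only from index \<open>N\<close> on, because it is applied to tails
  \<open>s m - s n\<close>, which are controlled for \<open>m \<ge> n\<close> only.\<close>

lemma L2_fatou:
  assumes s: "\<And>n. s n \<in> SQ" "\<And>n. n \<ge> N \<Longrightarrow> nrm (s n) \<le> C"
    and [measurable]: "f \<in> borel_measurable borel"
    and lim: "AE x in lborel. (\<lambda>n. s n x) \<longlonglongrightarrow> f x"
  shows "f \<in> SQ" "nrm f \<le> C"
proof -
  have [measurable]: "s n \<in> borel_measurable borel" for n using s by auto
  have C: "0 \<le> C" using s(2)[of N] nrm_nonneg[of "s N"] by linarith
  have "(\<integral>\<^sup>+x. (ennreal (norm (f x)))\<^sup>2 \<partial>lborel) =
      (\<integral>\<^sup>+x. liminf (\<lambda>n. (ennreal (norm (s n x)))\<^sup>2) \<partial>lborel)"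
  proof (rule nn_integral_cong_AE)
    show "AE x in lborel. (ennreal (norm (f x)))\<^sup>2 = liminf (\<lambda>n. (ennreal (norm (s n x)))\<^sup>2)"
      using lim
    proof eventually_elim
      case (elim x)
      then have "(\<lambda>n. ennreal ((norm (s n x))\<^sup>2)) \<longlonglongrightarrow> ennreal ((norm (f x))\<^sup>2)"
        by (intro tendsto_ennrealI tendsto_intros)
      then show ?case by (simp add: ennreal_power lim_imp_Liminf[symmetric])
    qed
  qed
  also have "\<dots> \<le> liminf (\<lambda>n. \<integral>\<^sup>+x. (ennreal (norm (s n x)))\<^sup>2 \<partial>lborel)"
    by (rule nn_integral_liminf) auto
  also have "\<dots> = liminf (\<lambda>n. ennreal ((nrm (s n))\<^sup>2))" by (simp add: nn_integral_nrm s)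
  also have "\<dots> \<le> liminf (\<lambda>n. ennreal (C\<^sup>2))"
    by (rule Liminf_mono) (auto simp: eventually_sequentially intro!: exI[of _ N] ennreal_leI power_mono s)
  also have "\<dots> = ennreal (C\<^sup>2)" by (simp add: Liminf_const)
  finally have *: "(\<integral>\<^sup>+x. (ennreal (norm (f x)))\<^sup>2 \<partial>lborel) \<le> ennreal (C\<^sup>2)" .
  show "f \<in> SQ" "nrm f \<le> C" by (rule L2_I_nn[OF assms(3) * C])+
qed

text \<open>The squared increments have integrals of order \<open>1 / 4 ^ n\<close>, so their sum
  stays integrable after weighting by \<open>2 ^ n\<close>. Where the weighted sum is finite, the
  increments are bounded by a geometric sequence of ratio \<open>1 / sqrt 2\<close>.\<close>

lemma L2_fast_cauchy_AE:
  assumes s: "\<And>n. s n \<in> SQ" and fast: "\<And>n. nrm (\<lambda>x. s (Suc n) x - s n x) \<le> C / 2 ^ n"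
  shows "AE x in lborel. convergent (\<lambda>n. s n x)"
proof -
  have [measurable]: "s n \<in> borel_measurable borel" for n using s by auto
  define D where "D n x = (ennreal (norm (s (Suc n) x - s n x)))\<^sup>2" for n x
  have [measurable]: "D n \<in> borel_measurable borel" for n unfolding D_def by measurable
  have C: "0 \<le> C" using fast[of 0] order_trans[OF nrm_nonneg[of "\<lambda>x. s (Suc 0) x - s 0 x"]] by simp
  have "(\<integral>\<^sup>+x. (\<Sum>n. 2 ^ n * D n x) \<partial>lborel) = (\<Sum>n. \<integral>\<^sup>+x. 2 ^ n * D n x \<partial>lborel)"
    by (rule nn_integral_suminf) measurable
  also have "\<dots> \<le> (\<Sum>n. ennreal (C\<^sup>2 * (1/2) ^ n))"
  proof (rule suminf_le)
    fix n
    have "(\<integral>\<^sup>+x. 2 ^ n * D n x \<partial>lborel) = 2 ^ n * ennreal ((nrm (\<lambda>x. s (Suc n) x - s n x))\<^sup>2)"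
      unfolding D_def using s by (simp add: nn_integral_cmult nn_integral_nrm)
    also have "\<dots> \<le> 2 ^ n * ennreal ((C / 2 ^ n)\<^sup>2)"
      by (intro mult_left_mono ennreal_leI power_mono fast) auto
    also have "\<dots> = ennreal (2 ^ n) * ennreal ((C / 2 ^ n)\<^sup>2)"
      by (simp flip: ennreal_power)
    also have "\<dots> = ennreal (2 ^ n * (C / 2 ^ n)\<^sup>2)" by (simp add: ennreal_mult)
    also have "2 ^ n * (C / 2 ^ n)\<^sup>2 = C\<^sup>2 * (1/2) ^ n"
      by (simp add: power2_eq_square power_divide field_simps)
    finally show "(\<integral>\<^sup>+x. 2 ^ n * D n x \<partial>lborel) \<le> ennreal (C\<^sup>2 * (1/2) ^ n)" .
  qed auto
  also have "\<dots> < \<infinity>"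
    by (subst suminf_ennreal2) (auto intro!: summable_mult)
  finally have "AE x in lborel. (\<Sum>n. 2 ^ n * D n x) \<noteq> \<infinity>"
    by (intro nn_integral_PInf_AE) auto
  then show ?thesis
  proof eventually_elim
    case (elim x)
    then obtain S where S: "(\<Sum>n. 2 ^ n * D n x) = ennreal S" "0 \<le> S"
      by (cases "\<Sum>n. 2 ^ n * D n x") auto
    have le: "norm (s (Suc n) x - s n x) \<le> sqrt S * (1 / sqrt 2) ^ n" for n
    proof -
      have "2 ^ n * D n x \<le> (\<Sum>n. 2 ^ n * D n x)"
        using sum_le_suminf[of "\<lambda>n. 2 ^ n * D n x" "{n}"] by simp
      then have "ennreal (2 ^ n * (norm (s (Suc n) x - s n x))\<^sup>2) \<le> ennreal S"
        unfolding S(1) by (simp add: D_def ennreal_mult ennreal_power flip: ennreal_power[of 2])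
      then have "2 ^ n * (norm (s (Suc n) x - s n x))\<^sup>2 \<le> S" using S(2) by (simp add: ennreal_le_iff)
      then have "(norm (s (Suc n) x - s n x))\<^sup>2 \<le> S / 2 ^ n" by (simp add: field_simps)
      then have "norm (s (Suc n) x - s n x) \<le> sqrt (S / 2 ^ n)" by (rule real_le_rsqrt)
      also have "\<dots> = sqrt S * (1 / sqrt 2) ^ n"
        by (simp add: real_sqrt_divide real_sqrt_power power_divide)
      finally show ?thesis .
    qed
    have "summable (\<lambda>n. s (Suc n) x - s n x)"
      by (rule summable_comparison_test'[of "\<lambda>n. sqrt S * (1 / sqrt 2) ^ n" 0])
         (auto intro!: summable_mult summable_geometric le)
    then show "convergent (\<lambda>n. s n x)"
      by (simp add: summable_iff_convergent sum_lessThan_telescope[of "\<lambda>n. s n x"] convergent_diff_const_right_iff)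
  qed
qed

text \<open>Rapid convergence makes the pointwise limit exist almost everywhere, so no subsequences are
  needed.\<close>

lemma L2_fast_cauchy:
  assumes s: "\<And>n. s n \<in> SQ" and fast: "\<And>n. nrm (\<lambda>x. s (Suc n) x - s n x) \<le> C / 2 ^ n"
  defines "f \<equiv> \<lambda>x. lim (\<lambda>n. s n x)"
  shows "AE x in lborel. (\<lambda>n. s n x) \<longlonglongrightarrow> f x" "f \<in> SQ" "\<And>n. nrm (\<lambda>x. f x - s n x) \<le> 2 * C / 2 ^ n"
proof -
  have m [measurable]: "s n \<in> borel_measurable borel" for n using s by auto
  have fm [measurable]: "f \<in> borel_measurable borel" unfolding f_def by measurable
  show lim: "AE x in lborel. (\<lambda>n. s n x) \<longlonglongrightarrow> f x"
    using L2_fast_cauchy_AE[OF s fast] by (simp add: f_def convergent_LIMSEQ_iff)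
  \<comment> \<open>The subtracted remainder \<open>2 * C / 2 ^ (n + k)\<close> strengthens the
    claim just enough for the induction on \<open>k\<close> to close.\<close>
  have tel: "nrm (\<lambda>x. s (n + k) x - s n x) \<le> 2 * C / 2 ^ n - 2 * C / 2 ^ (n + k)" for n k
  proof (induction k)
    case (Suc k)
    have "nrm (\<lambda>x. s (n + Suc k) x - s n x) \<le>
        nrm (\<lambda>x. s (Suc (n + k)) x - s (n + k) x) + nrm (\<lambda>x. s (n + k) x - s n x)"
      using nrm_triangle_diff[of "s (n + Suc k)" "s (n + k)" "s n"] s by simp
    also have "\<dots> \<le> C / 2 ^ (n + k) + (2 * C / 2 ^ n - 2 * C / 2 ^ (n + k))"
      by (intro add_mono fast Suc)
    also have "\<dots> = 2 * C / 2 ^ n - 2 * C / 2 ^ (n + Suc k)" by (simp add: field_simps)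
    finally show ?case .
  qed simp
  have C: "0 \<le> C" using fast[of 0] order_trans[OF nrm_nonneg[of "\<lambda>x. s (Suc 0) x - s 0 x"]] by simp
  have d: "(\<lambda>x. f x - s n x) \<in> SQ \<and> nrm (\<lambda>x. f x - s n x) \<le> 2 * C / 2 ^ n" for n
  proof (rule conjI)
    let ?t = "\<lambda>m x. s m x - s n x"
    have b: "nrm (?t m) \<le> 2 * C / 2 ^ n" if "m \<ge> n" for m
    proof -
      have "0 \<le> 2 * C / 2 ^ m" using C by simp
      then show ?thesis using tel[of n "m - n"] that by simp
    qed
    have c: "AE x in lborel. (\<lambda>m. ?t m x) \<longlonglongrightarrow> f x - s n x"
      using lim by eventually_elim (intro tendsto_intros)
    show "(\<lambda>x. f x - s n x) \<in> SQ" by (rule L2_fatou(1)[of ?t n, OF _ b _ c]) (auto simp: s)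
    show "nrm (\<lambda>x. f x - s n x) \<le> 2 * C / 2 ^ n"
      by (rule L2_fatou(2)[of ?t n, OF _ b _ c]) (auto simp: s)
  qed
  then show "\<And>n. nrm (\<lambda>x. f x - s n x) \<le> 2 * C / 2 ^ n" by blast
  have "(\<lambda>x. (f x - s 0 x) + s 0 x) \<in> SQ" using d[of 0] s by (intro L2_add) auto
  then show "f \<in> SQ" by simp
qed

section \<open>Coherent states\<close>

text \<open>This is the characteristic function of the standard normal law, multiplied by
  \<open>sqrt (2 * pi)\<close>.\<close>

lemma gaussian_normal:
  "has_bochner_integral lborel (\<lambda>x. exp (complex_of_real (- x\<^sup>2 / 2) + \<i> * of_real (t * x)))
     (complex_of_real (sqrt (2 * pi) * exp (- t\<^sup>2 / 2)))"
proof -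
  have eq: "std_normal_density x *\<^sub>R iexp (t * x) =
      complex_of_real (1 / sqrt (2 * pi)) * exp (complex_of_real (- x\<^sup>2 / 2) + \<i> * of_real (t * x))" for x
    by (simp add: normal_density_def mult_exp_exp scaleR_conv_of_real exp_of_real[symmetric])
  have "char std_normal_distribution t = (LINT x|lborel. std_normal_density x *\<^sub>R iexp (t * x))"
    unfolding char_def by (subst integral_density) (auto simp: normal_density_nonneg)
  then have c: "(LINT x|lborel. std_normal_density x *\<^sub>R iexp (t * x)) = complex_of_real (exp (- t\<^sup>2 / 2))"
    by (simp add: char_std_normal_distribution)
  have "integrable lborel (\<lambda>x. std_normal_density x *\<^sub>R iexp (t * x))"
    by (rule Bochner_Integration.integrable_bound[OF integrable_normal_density[of 1 0]]) auto
  with c have "has_bochner_integral lborel (\<lambda>x. std_normal_density x *\<^sub>R iexp (t * x)) (complex_of_real (exp (- t\<^sup>2 / 2)))"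
    by (simp add: has_bochner_integral_iff)
  from has_bochner_integral_mult_right[OF this, of "complex_of_real (sqrt (2 * pi))"]
  show ?thesis unfolding eq by simp
qed

text \<open>With \<open>u = p + \<i> * q\<close>, the real substitution
  \<open>p / a + x / r\<close>, where \<open>r = sqrt (2 * a)\<close>, completes the square in the
  real part. The imaginary part \<open>q\<close> survives as the frequency \<open>2 * q / r\<close>,
  so no contour has to be shifted.\<close>

lemma gaussian_complex:
  assumes "0 < a"
  shows "has_bochner_integral lborel (\<lambda>x. exp (complex_of_real (- (a * x\<^sup>2)) + 2 * of_real x * u))
     (complex_of_real (sqrt (pi / a)) * exp (u\<^sup>2 / of_real a))"
proof -
  define p q r where "p = Re u" and "q = Im u" and "r = sqrt (2 * a)"
  have r: "r > 0" "r\<^sup>2 = 2 * a" using assms by (auto simp: r_def)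
  have u: "u = of_real p + \<i> * of_real q" by (simp add: p_def q_def complex_eq_iff)
  let ?c = "exp (complex_of_real (p\<^sup>2 / a) + \<i> * of_real (2 * q * p / a))"
  have e: "- (a * (p / a + 1 / r * x)\<^sup>2) + 2 * (p / a + 1 / r * x) * p = - x\<^sup>2 / 2 + p\<^sup>2 / a"
    "2 * (p / a + 1 / r * x) * q = (2 * q / r) * x + 2 * q * p / a" for x
  proof -
    have "a * (p / a + 1 / r * x)\<^sup>2 = p\<^sup>2 / a + 2 * p * x / r + a * x\<^sup>2 / r\<^sup>2"
      using assms r(1) by (simp add: power2_eq_square field_simps)
    also have "a * x\<^sup>2 / r\<^sup>2 = x\<^sup>2 / 2" using assms by (simp add: r)
    finally have 1: "a * (p / a + 1 / r * x)\<^sup>2 = p\<^sup>2 / a + 2 * p * x / r + x\<^sup>2 / 2" .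
    show "- (a * (p / a + 1 / r * x)\<^sup>2) + 2 * (p / a + 1 / r * x) * p = - x\<^sup>2 / 2 + p\<^sup>2 / a"
      unfolding 1 using assms r(1) by (simp add: power2_eq_square field_simps)
    show "2 * (p / a + 1 / r * x) * q = (2 * q / r) * x + 2 * q * p / a"
      using assms r(1) by (simp add: field_simps)
  qed
  have eq: "exp (complex_of_real (- (a * (p / a + 1 / r * x)\<^sup>2)) + 2 * of_real (p / a + 1 / r * x) * u) =
      ?c * exp (complex_of_real (- x\<^sup>2 / 2) + \<i> * of_real ((2 * q / r) * x))" for x
  proof -
    have "complex_of_real (- (a * (p / a + 1 / r * x)\<^sup>2)) + 2 * of_real (p / a + 1 / r * x) * u =
       of_real (- (a * (p / a + 1 / r * x)\<^sup>2) + 2 * (p / a + 1 / r * x) * p)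
         + \<i> * of_real (2 * (p / a + 1 / r * x) * q)"
      unfolding u by (simp add: complex_eq_iff)
    also have "\<dots> = (complex_of_real (p\<^sup>2 / a) + \<i> * of_real (2 * q * p / a)) +
        (complex_of_real (- x\<^sup>2 / 2) + \<i> * of_real ((2 * q / r) * x))"
      unfolding e by (simp add: complex_eq_iff)
    finally show ?thesis by (simp only: exp_add)
  qed
  have "has_bochner_integral lborel
      (\<lambda>x. exp (complex_of_real (- (a * (p / a + 1 / r * x)\<^sup>2)) + 2 * of_real (p / a + 1 / r * x) * u))
      (?c * complex_of_real (sqrt (2 * pi) * exp (- (2 * q / r)\<^sup>2 / 2)))"
    unfolding eq by (intro has_bochner_integral_mult_right gaussian_normal)
  also have "?c * complex_of_real (sqrt (2 * pi) * exp (- (2 * q / r)\<^sup>2 / 2)) =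
      (complex_of_real (sqrt (pi / a)) * exp (u\<^sup>2 / of_real a)) /\<^sub>R \<bar>1 / r\<bar>"
  proof -
    have "- (2 * q / r)\<^sup>2 / 2 = - q\<^sup>2 / a" using assms r by (simp add: power_divide power_mult_distrib)
    then have "?c * complex_of_real (exp (- (2 * q / r)\<^sup>2 / 2)) = exp (complex_of_real (p\<^sup>2 / a) + \<i> * of_real (2 * q * p / a) + of_real (- q\<^sup>2 / a))"
      by (simp only: exp_add exp_of_real of_real_minus)
    also have "complex_of_real (p\<^sup>2 / a) + \<i> * of_real (2 * q * p / a) + of_real (- q\<^sup>2 / a) = u\<^sup>2 / of_real a"
      unfolding u using assms by (simp add: power2_eq_square field_simps)
    finally have 1: "?c * complex_of_real (exp (- (2 * q / r)\<^sup>2 / 2)) = exp (u\<^sup>2 / of_real a)" .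
    have 2: "sqrt (2 * pi) = sqrt (pi / a) * r"
      unfolding r_def real_sqrt_mult[symmetric] using assms by simp
    show ?thesis unfolding 2 using r(1)
      by (simp add: 1[symmetric] scaleR_conv_of_real mult_ac)
  qed
  finally show ?thesis
    using lborel_has_bochner_integral_real_affine_iff[of "1 / r"
        "\<lambda>x. exp (complex_of_real (- (a * x\<^sup>2)) + 2 * of_real x * u)" _ "p / a"] r(1) by simp
qed

text \<open>The generating function of the Hermite functions: the coefficient of
  \<open>z ^ n\<close> is a multiple of the \<open>n\<close>-th one. An operator that multiplies the
  \<open>n\<close>-th Hermite function by \<open>u ^ n\<close> therefore replaces \<open>z\<close>
  by \<open>u * z\<close>.\<close>

definition coh :: "complex \<Rightarrow> real \<Rightarrow> complex" where
  "coh z x = exp (- (of_real x)\<^sup>2 / 2 + 2 * of_real x * z - z\<^sup>2)"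

lemma coh_measurable [measurable]: "coh z \<in> borel_measurable borel"
  unfolding coh_def by measurable

lemma continuous_coh [continuous_intros]:
  "continuous_on A f \<Longrightarrow> continuous_on A g \<Longrightarrow> continuous_on A (\<lambda>x. coh (f x) (g x))"
  unfolding coh_def by (intro continuous_intros) auto

lemma coh_mult_cnj:
  "coh z x * cnj (coh w x) = exp (- (z\<^sup>2 + (cnj w)\<^sup>2)) * exp (complex_of_real (- (1 * x\<^sup>2)) + 2 * of_real x * (z + cnj w))"
  unfolding coh_def exp_cnj mult_exp_exp by (simp add: algebra_simps)

lemma coh_mult_integral:
  "has_bochner_integral lborel (\<lambda>x. coh z x * cnj (coh w x)) (of_real (sqrt pi) * exp (2 * z * cnj w))"
proof -
  have "exp (- (z\<^sup>2 + (cnj w)\<^sup>2)) * exp ((z + cnj w)\<^sup>2) = exp (2 * z * cnj w)"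
    by (simp add: mult_exp_exp power2_sum)
  then have "exp (- (z\<^sup>2 + (cnj w)\<^sup>2)) * (complex_of_real (sqrt (pi / 1)) * exp ((z + cnj w)\<^sup>2 / of_real 1)) =
     of_real (sqrt pi) * exp (2 * z * cnj w)"
    by (simp only: mult.left_commute[of "exp (- _)"]) simp
  then show ?thesis unfolding coh_mult_cnj
    using has_bochner_integral_mult_right[OF gaussian_complex[of 1 "z + cnj w"], of "exp (- (z\<^sup>2 + (cnj w)\<^sup>2))"]
    by (simp only: zero_less_one simp_thms)
qed

lemma coh_L2 [simp, intro]: "coh z \<in> SQ"
proof -
  have "integrable lborel (\<lambda>x. Re (coh z x * cnj (coh z x)))"
    using coh_mult_integral[of z z] by (intro integrable_Re) (simp add: has_bochner_integral_iff)
  then show ?thesis by (simp add: L2_iff complex_mult_cnj cmod_power2)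
qed

lemma ip_coh: "ip (coh z) (coh w) = of_real (sqrt pi) * exp (2 * z * cnj w)"
  unfolding ip_def using coh_mult_integral by (simp add: has_bochner_integral_iff)

section \<open>Fourier uniqueness and density of the coherent states\<close>

lemma real_fourier_zero_AE:
  fixes k :: "real \<Rightarrow> real"
  assumes k: "integrable lborel k"
    and zero: "\<And>t. (LINT x|lborel. k x *\<^sub>R iexp (t * x)) = 0"
  shows "AE x in lborel. k x = 0"
proof -
  note [measurable] = borel_measurable_integrable[OF k]
  define p n where "p x = max 0 (k x)" and "n x = max 0 (- k x)" for x
  have int: "integrable lborel p" "integrable lborel n"
    unfolding p_def n_def using k by (auto intro!: integrable_max)
  have [measurable]: "p \<in> borel_measurable borel" "n \<in> borel_measurable borel"
    using int by (auto dest: borel_measurable_integrable)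
  have nn: "0 \<le> p x" "0 \<le> n x" and kpn: "k x = p x - n x" for x by (auto simp: p_def n_def)
  have inte: "integrable lborel (\<lambda>x. g x *\<^sub>R iexp (t * x))" if "integrable lborel g" for t and g :: "real \<Rightarrow> real"
    using that by (rule Bochner_Integration.integrable_bound) (use that in auto)
  have eq: "(LINT x|lborel. p x *\<^sub>R iexp (t * x)) = (LINT x|lborel. n x *\<^sub>R iexp (t * x))" for t
    using zero[of t] inte[OF int(1), of t] inte[OF int(2), of t] by (simp add: kpn scaleR_diff_left)
  define P where "P = integral\<^sup>L lborel p"
  have "complex_of_real (integral\<^sup>L lborel p) = complex_of_real (integral\<^sup>L lborel n)"
    using eq[of 0] by (simp add: scaleR_conv_of_real)
  then have Pn: "integral\<^sup>L lborel n = P" by (simp add: P_def)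
  have P0: "0 \<le> P" unfolding P_def by (simp add: nn)
  show ?thesis
  proof (cases "P = 0")
    case True
    have "AE x in lborel. p x = 0" "AE x in lborel. n x = 0"
      using True Pn integral_nonneg_eq_0_iff_AE[OF int(1)] integral_nonneg_eq_0_iff_AE[OF int(2)] nn
      by (auto simp: P_def)
    then show ?thesis by eventually_elim (simp add: kpn)
  next
    case False
    then have P: "P > 0" using P0 by simp
    have dist: "real_distribution (density lborel (\<lambda>x. ennreal (g x / P)))"
      if [measurable]: "g \<in> borel_measurable borel" and "\<And>x. 0 \<le> g x" "integrable lborel g" "integral\<^sup>L lborel g = P" for g
    proof (rule real_distribution.intro)
      have "(\<integral>\<^sup>+x. ennreal (g x / P) \<partial>lborel) = ennreal (integral\<^sup>L lborel (\<lambda>x. g x / P))"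
        using that P by (intro nn_integral_eq_integral) auto
      then show "prob_space (density lborel (\<lambda>x. ennreal (g x / P)))"
        using that P by (intro prob_spaceI) (simp add: emeasure_density)
    qed (simp add: real_distribution_axioms_def)
    have ch: "char (density lborel (\<lambda>x. ennreal (g x / P))) t = (LINT x|lborel. g x *\<^sub>R iexp (t * x)) / P"
      if [measurable]: "g \<in> borel_measurable borel" and "\<And>x. 0 \<le> g x" for g t
    proof -
      have "char (density lborel (\<lambda>x. ennreal (g x / P))) t = (LINT x|lborel. (g x / P) *\<^sub>R iexp (t * x))"
        unfolding char_def using that P by (subst integral_density) auto
      also have "\<dots> = (LINT x|lborel. (1 / of_real P) * (g x *\<^sub>R iexp (t * x)))"
        by (intro Bochner_Integration.integral_cong) (auto simp: scaleR_conv_of_real)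
      also have "\<dots> = (1 / of_real P) * (LINT x|lborel. g x *\<^sub>R iexp (t * x))"
        by (rule integral_mult_right_zero)
      finally show ?thesis by (simp only: times_divide_eq_left mult_1)
    qed
    \<comment> \<open>The hypothesis at frequency 0 gives both parts of \<open>k\<close> the mass
      \<open>P\<close>, and at the other frequencies it equates the characteristic functions of the
      normalized parts. Levy's uniqueness theorem then identifies the two laws.\<close>
    have "density lborel (\<lambda>x. ennreal (p x / P)) = density lborel (\<lambda>x. ennreal (n x / P))"
    proof (intro Levy_uniqueness dist)
      show "char (density lborel (\<lambda>x. ennreal (p x / P))) = char (density lborel (\<lambda>x. ennreal (n x / P)))"
        by (rule ext) (simp only: ch nn eq \<open>p \<in> borel_measurable borel\<close> \<open>n \<in> borel_measurable borel\<close>)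
    qed (use int nn Pn in \<open>auto simp: P_def\<close>)
    then have "AE x in lborel. ennreal (p x / P) = ennreal (n x / P)"
      by (intro sigma_finite_measure.density_unique[OF sigma_finite_lborel]) auto
    then show ?thesis
    proof eventually_elim
      case (elim x)
      then have "p x = n x" using P nn[of x] by simp
      then show ?case by (simp add: kpn)
    qed
  qed
qed

text \<open>Conjugating the transform at \<open>- t\<close> gives the transform of
  \<open>cnj k\<close> at \<open>t\<close>, so the transforms of the real part and of the imaginary
  part vanish separately.\<close>

lemma fourier_zero_AE:
  fixes k :: "real \<Rightarrow> complex"
  assumes k: "integrable lborel k"
    and zero: "\<And>t. (LINT x|lborel. k x * iexp (t * x)) = 0"
  shows "AE x in lborel. k x = 0"
proof -
  note [measurable] = borel_measurable_integrable[OF k]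
  have i: "integrable lborel (\<lambda>x. k x * iexp (t * x))" for t
  proof (rule Bochner_Integration.integrable_bound[OF k])
    show "AE x in lborel. norm (k x * iexp (t * x)) \<le> norm (k x)"
      by (simp add: norm_mult del: of_real_mult)
  qed measurable
  have i': "integrable lborel (\<lambda>x. cnj (k x * iexp (t * x)))" for t
    by (intro integrable_cnj i)
  have z': "(LINT x|lborel. cnj (k x * iexp (t * x))) = 0" for t
    using arg_cong[OF zero[of t], of cnj] by (simp only: Bochner_Integration.integral_cnj complex_cnj_zero)
  have R: "Re (k x) *\<^sub>R iexp (t * x) = (1/2) * (k x * iexp (t * x) + cnj (k x * iexp (- t * x)))"
    and I: "Im (k x) *\<^sub>R iexp (t * x) = (- \<i>/2) * (k x * iexp (t * x) - cnj (k x * iexp (- t * x)))" for x t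
    by (auto simp: complex_eq_iff exp_eq_polar cis.ctr field_simps)
  have "AE x in lborel. Re (k x) = 0"
    using k by (intro real_fourier_zero_AE integrable_Re)
      (simp_all only: R integral_mult_right_zero Bochner_Integration.integral_add[OF i i'] zero z', simp_all)
  moreover have "AE x in lborel. Im (k x) = 0"
    using k by (intro real_fourier_zero_AE integrable_Im)
      (simp_all only: I integral_mult_right_zero Bochner_Integration.integral_diff[OF i i'] zero z', simp_all)
  ultimately show ?thesis by eventually_elim (simp add: complex_eq_iff)
qed

text \<open>Purely imaginary parameters suffice: pairing with \<open>coh (- \<i> * t / 2)\<close>
  is, up to a Gaussian factor in \<open>t\<close>, the Fourier transform of \<open>h\<close> times a
  Gaussian without zeros. Integrability of the pairings is assumed in place of
  \<open>h \<in> SQ\<close>, so that the lemma also applies to Fourier integrals not yet known to be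
  square integrable.\<close>

lemma orth_coh_AE:
  assumes [measurable]: "h \<in> borel_measurable borel"
    and i: "\<And>z. integrable lborel (\<lambda>x. h x * cnj (coh z x))"
    and zero: "\<And>z. (LINT x|lborel. h x * cnj (coh z x)) = 0"
  shows "AE x in lborel. h x = 0"
proof -
  define k where "k x = h x * cnj (coh 0 x)" for x
  have eq: "k x * iexp (t * x) = exp (- of_real (t\<^sup>2 / 4)) * (h x * cnj (coh (- \<i> * of_real t / 2) x))" for x t
  proof -
    have "cnj (coh 0 x) * iexp (t * x) = exp (- of_real (t\<^sup>2 / 4)) * cnj (coh (- \<i> * of_real t / 2) x)"
      by (simp add: coh_def exp_cnj mult_exp_exp exp_add[symmetric] power_divide power_mult_distrib algebra_simps)
    then show ?thesis by (simp add: k_def mult_ac)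
  qed
  have "AE x in lborel. k x = 0"
  proof (rule fourier_zero_AE)
    show "integrable lborel k" unfolding k_def by (rule i)
    show "(LINT x|lborel. k x * iexp (t * x)) = 0" for t
      unfolding eq by (simp only: integral_mult_right_zero zero mult_zero_right)
  qed
  then show ?thesis by eventually_elim (simp add: k_def coh_def)
qed

lemma L2_orth_coh_AE:
  assumes "h \<in> SQ" "\<And>z. ip h (coh z) = 0"
  shows "AE x in lborel. h x = 0"
  using assms by (intro orth_coh_AE) (auto simp: ip_def)

text \<open>A finite combination of coherent states, kept as a list of coefficients and parameters.
  The argument \<open>u\<close> turns all parameters at once, so one list describes a function
  together with all its rotations.\<close>

definition comb :: "(complex \<times> complex) list \<Rightarrow> complex \<Rightarrow> real \<Rightarrow> complex" where
  "comb cs u x = (\<Sum>(c, z)\<leftarrow>cs. c * coh (u * z) x)"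

lemma comb_simps [simp]:
  "comb [] u = (\<lambda>x. 0)"
  "comb ((c, z) # cs) u = (\<lambda>x. c * coh (u * z) x + comb cs u x)"
  "comb (cs @ ds) u = (\<lambda>x. comb cs u x + comb ds u x)"
  by (simp_all add: comb_def fun_eq_iff)

lemma comb_scale: "comb (map (\<lambda>(c, z). (a * c, z)) cs) u = (\<lambda>x. a * comb cs u x)"
  by (induction cs) (auto simp: fun_eq_iff algebra_simps)

lemma comb_diff: "comb (cs @ map (\<lambda>(c, z). ((-1) * c, z)) ds) u = (\<lambda>x. comb cs u x - comb ds u x)"
  unfolding comb_simps comb_scale by simp

lemma comb_rotate: "comb (map (\<lambda>(c, z). (c, v * z)) cs) u = comb cs (u * v)"
  by (induction cs) (auto simp: fun_eq_iff mult.assoc)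

lemma comb_L2 [simp, intro]: "comb cs u \<in> SQ"
  by (induction cs) auto

lemma continuous_comb [continuous_intros]:
  "continuous_on A f \<Longrightarrow> continuous_on A g \<Longrightarrow> continuous_on A (\<lambda>x. comb cs (f x) (g x))"
proof (induction cs)
  case (Cons c cs)
  then show ?case by (cases c) (auto intro!: continuous_intros)
qed simp

lemma comb_measurable [measurable]: "comb cs u \<in> borel_measurable borel"
  by (rule L2_measurable) simp

text \<open>By \<open>ip_coh\<close> the inner product of two coherent states depends only on
  \<open>z * cnj w\<close>, which a common unimodular factor does not change.\<close>

lemma ip_comb_rotate:
  assumes "norm u = 1"
  shows "ip (comb cs u) (comb ds u) = ip (comb cs 1) (comb ds 1)"
proof -
  have u: "u * cnj u = 1" using assms by (simp add: complex_norm_square[symmetric])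
  have 1: "ip (coh (u * z)) (coh (u * w)) = ip (coh z) (coh w)" for z w
  proof -
    have "2 * (u * z) * cnj (u * w) = (u * cnj u) * (2 * z * cnj w)" by simp
    then show ?thesis by (simp only: ip_coh u mult_1)
  qed
  have 2: "ip (coh (u * z)) (comb ds u) = ip (coh z) (comb ds 1)" for z
  proof (induction ds)
    case (Cons d ds)
    then show ?case by (cases d) (simp add: ip_add_right ip_scale_right 1)
  qed simp
  show ?thesis
  proof (induction cs)
    case (Cons c cs)
    then show ?case by (cases c) (simp add: ip_add_left ip_scale_left 2)
  qed simp
qed

lemma nrm_comb_rotate:
  assumes "norm u = 1" shows "nrm (comb cs u) = nrm (comb cs 1)"
proof -
  have "complex_of_real ((nrm (comb cs u))\<^sup>2) = complex_of_real ((nrm (comb cs 1))\<^sup>2)"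
    using ip_comb_rotate[OF assms, of cs cs] by (simp only: ip_self)
  then have "(nrm (comb cs u))\<^sup>2 = (nrm (comb cs 1))\<^sup>2" by (simp only: of_real_eq_iff)
  then show ?thesis by simp
qed

text \<open>In particular, lists that represent the same function have rotations that agree almost
  everywhere: turning the parameters is well defined on functions.\<close>

lemma nrm_comb_diff_rotate:
  assumes "norm u = 1"
  shows "nrm (\<lambda>x. comb cs u x - comb ds u x) = nrm (\<lambda>x. comb cs 1 x - comb ds 1 x)"
  using nrm_comb_rotate[OF assms, of "cs @ map (\<lambda>(c, z). ((-1) * c, z)) ds"] by (simp only: comb_diff)

text \<open>First variation: if the inner product were nonzero, subtracting a small multiple of
  \<open>ip r h\<close> times \<open>h\<close> would shorten \<open>r\<close>.\<close>

lemma minimal_orth: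
  assumes r: "r \<in> SQ" and h: "h \<in> SQ" and min: "\<And>c. nrm r \<le> nrm (\<lambda>x. r x - c * h x)"
  shows "ip r h = 0"
proof (rule ccontr)
  assume ne: "ip r h \<noteq> 0"
  \<comment> \<open>A step so short that the quadratic term stays below the linear gain; the summand
    1 also covers \<open>nrm h = 0\<close>.\<close>
  define s where "s = 1 / (1 + (nrm h)\<^sup>2)"
  have pos: "0 < 1 + (nrm h)\<^sup>2" by (simp add: add_pos_nonneg)
  have s: "s > 0" "s * (nrm h)\<^sup>2 < 1" using pos by (auto simp: s_def field_simps)
  let ?c = "of_real s * ip r h"
  have "(nrm r)\<^sup>2 \<le> (nrm (\<lambda>x. r x - ?c * h x))\<^sup>2" by (intro power_mono min) auto
  also have "\<dots> = (nrm r)\<^sup>2 - 2 * Re (cnj ?c * ip r h) + (norm ?c * nrm h)\<^sup>2"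
    using r h by (simp add: nrm_diff_sq ip_scale_right del: complex_cnj_mult)
  also have "cnj ?c * ip r h = of_real (s * (norm (ip r h))\<^sup>2)"
    by (simp only: complex_cnj_mult complex_cnj_complex_of_real of_real_mult complex_norm_square mult_ac)
  also have "(norm ?c * nrm h)\<^sup>2 = s * (norm (ip r h))\<^sup>2 * (s * (nrm h)\<^sup>2)"
    using s by (simp add: norm_mult power2_eq_square)
  finally have "2 * (s * (norm (ip r h))\<^sup>2) \<le> s * (norm (ip r h))\<^sup>2 * (s * (nrm h)\<^sup>2)" by simp
  moreover have "s * (norm (ip r h))\<^sup>2 * (s * (nrm h)\<^sup>2) < s * (norm (ip r h))\<^sup>2 * 1"
    using s ne by (intro mult_strict_left_mono) auto
  moreover have "s * (norm (ip r h))\<^sup>2 > 0" using s ne by simp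
  ultimately show False by linarith
qed

text \<open>A minimizing sequence converges to the nearest point of the closed span; the difference is
  orthogonal to all coherent states and hence vanishes.\<close>

lemma comb_dense:
  assumes f: "f \<in> SQ" and e: "0 < e"
  obtains cs where "nrm (\<lambda>x. f x - comb cs 1 x) < e"
proof -
  define \<delta> where "\<delta> = (INF cs. (nrm (\<lambda>x. f x - comb cs 1 x))\<^sup>2)"
  have bdd: "bdd_below (range (\<lambda>cs. (nrm (\<lambda>x. f x - comb cs 1 x))\<^sup>2))" by (rule bdd_belowI[of _ 0]) auto
  have lower: "\<delta> \<le> (nrm (\<lambda>x. f x - comb cs 1 x))\<^sup>2" for cs
    unfolding \<delta>_def by (rule cINF_lower[OF bdd]) simp
  have ex: "\<exists>cs. (nrm (\<lambda>x. f x - comb cs 1 x))\<^sup>2 < \<delta> + d" if "d > 0" for d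
  proof -
    have "\<delta> < \<delta> + d" using that by simp
    then show ?thesis unfolding \<delta>_def by (subst (asm) cINF_less_iff[OF _ bdd]) auto
  qed
  have "\<forall>n. \<exists>cs. (nrm (\<lambda>x. f x - comb cs 1 x))\<^sup>2 < \<delta> + (1/4) ^ n" by (intro allI ex) simp
  then obtain s where s: "\<And>n. (nrm (\<lambda>x. f x - comb (s n) 1 x))\<^sup>2 < \<delta> + (1/4) ^ n" by metis
  define g where "g n = comb (s n) 1" for n
  have g [simp]: "g n \<in> SQ" for n by (simp add: g_def)
  have cauchy: "nrm (\<lambda>x. g (Suc n) x - g n x) \<le> 2 / 2 ^ n" for n
  proof (rule power2_le_imp_le)
    let ?a = "\<lambda>x. f x - g n x" and ?b = "\<lambda>x. f x - g (Suc n) x"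
    have L: "?a \<in> SQ" "?b \<in> SQ" using f by auto
    \<comment> \<open>The mean of two approximants is again a combination, so its squared distance
      from \<open>f\<close> is at least \<open>\<delta>\<close>. The parallelogram law then bounds
      the distance between the approximants, and the excess \<open>(1/4) ^ n\<close> gives the rate
      \<open>2 / 2 ^ n\<close>.\<close>
    have "nrm (\<lambda>x. ?a x + ?b x) = nrm (\<lambda>x. 2 * (f x - comb (map (\<lambda>(c, z). ((1/2) * c, z)) (s n @ s (Suc n))) 1 x))"
      by (rule arg_cong[of _ _ nrm]) (simp only: comb_scale comb_simps g_def, simp add: algebra_simps)
    then have "(nrm (\<lambda>x. ?a x + ?b x))\<^sup>2 \<ge> 4 * \<delta>"
      using lower[of "map (\<lambda>(c, z). ((1/2) * c, z)) (s n @ s (Suc n))"]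
      by (simp only: nrm_scale power_mult_distrib) simp
    moreover have "(nrm (\<lambda>x. ?a x + ?b x))\<^sup>2 + (nrm (\<lambda>x. ?a x - ?b x))\<^sup>2 = 2 * (nrm ?a)\<^sup>2 + 2 * (nrm ?b)\<^sup>2"
      using L by (simp only: nrm_add_sq nrm_diff_sq)
    moreover have "(nrm ?a)\<^sup>2 < \<delta> + (1/4) ^ n" using s[of n] by (simp add: g_def)
    moreover have "(nrm ?b)\<^sup>2 < \<delta> + (1/4) ^ n"
      using s[of "Suc n"] power_decreasing[of n "Suc n" "1/4::real"] unfolding g_def by linarith
    moreover have "nrm (\<lambda>x. ?a x - ?b x) = nrm (\<lambda>x. g (Suc n) x - g n x)" by simp
    ultimately have "(nrm (\<lambda>x. g (Suc n) x - g n x))\<^sup>2 \<le> 4 * (1/4) ^ n" by simp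
    also have "(4::real) * (1/4) ^ n = (2 / 2 ^ n)\<^sup>2"
      by (simp add: power_divide power_mult[symmetric] power_mult_distrib) (simp add: power_mult[of 2 2 n, simplified] mult.commute[of n])
    finally show "(nrm (\<lambda>x. g (Suc n) x - g n x))\<^sup>2 \<le> (2 / 2 ^ n)\<^sup>2" .
  qed simp
  define G where "G = (\<lambda>x. lim (\<lambda>n. g n x))"
  have G [simp]: "G \<in> SQ" and Glim: "\<And>n. nrm (\<lambda>x. G x - g n x) \<le> 2 * 2 / 2 ^ n"
    unfolding G_def using L2_fast_cauchy[OF g cauchy] by auto
  have lim0: "(\<lambda>n. nrm (\<lambda>x. G x - g n x)) \<longlonglongrightarrow> 0"
  proof (rule tendsto_sandwich[of "\<lambda>_. 0" _ _ "\<lambda>n. 2 * 2 / 2 ^ n :: real"])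
    show "(\<lambda>n. 2 * 2 / 2 ^ n :: real) \<longlonglongrightarrow> 0"
      using tendsto_mult_right_zero[OF LIMSEQ_power_zero[of "1/2::real"], of "4"] by (simp add: power_divide)
  qed (use Glim in \<open>auto intro!: always_eventually\<close>)
  define r where "r = (\<lambda>x. f x - G x)"
  have r [simp]: "r \<in> SQ" using f by (simp add: r_def)
  have conv: "(\<lambda>n. nrm (\<lambda>x. f x - g n x - k x)) \<longlonglongrightarrow> nrm (\<lambda>x. r x - k x)" if k: "k \<in> SQ" for k
  proof -
    have "norm (nrm (\<lambda>x. f x - g n x - k x) - nrm (\<lambda>x. r x - k x)) \<le> nrm (\<lambda>x. G x - g n x)" for n
      using nrm_diff_abs[of "\<lambda>x. f x - g n x - k x" "\<lambda>x. r x - k x"] f k by (simp add: r_def)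
    then have "(\<lambda>n. nrm (\<lambda>x. f x - g n x - k x) - nrm (\<lambda>x. r x - k x)) \<longlonglongrightarrow> 0"
      by (intro Lim_null_comparison[OF _ lim0] always_eventually allI)
    then show ?thesis by (simp add: LIM_zero_cancel)
  qed
  have rmin: "\<delta> \<le> (nrm (\<lambda>x. r x - c * coh z x))\<^sup>2" for c z
  proof (rule LIMSEQ_le_const[OF tendsto_power[OF conv]])
    have "(\<lambda>x. f x - g n x - c * coh z x) = (\<lambda>x. f x - comb ((c, z) # s n) 1 x)" for n
      by (simp add: g_def fun_eq_iff)
    then show "\<exists>N. \<forall>n\<ge>N. \<delta> \<le> (nrm (\<lambda>x. f x - g n x - c * coh z x))\<^sup>2"
      using lower[of "(c, z) # s _"] by auto
  qed simp
  have rle: "(nrm r)\<^sup>2 \<le> \<delta>"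
  proof (rule LIMSEQ_le)
    show "(\<lambda>n. (nrm (\<lambda>x. f x - g n x))\<^sup>2) \<longlonglongrightarrow> (nrm r)\<^sup>2"
      using tendsto_power[OF conv[OF L2_zero]] by simp
    show "(\<lambda>n. \<delta> + (1/4) ^ n) \<longlonglongrightarrow> \<delta>"
      using tendsto_add[OF tendsto_const[of \<delta>] LIMSEQ_power_zero[of "1/4::real"]] by simp
    show "\<exists>N. \<forall>n\<ge>N. (nrm (\<lambda>x. f x - g n x))\<^sup>2 \<le> \<delta> + (1/4) ^ n"
      using s by (auto simp: g_def intro: less_imp_le)
  qed
  have "AE x in lborel. r x = 0"
  proof (rule L2_orth_coh_AE[OF r minimal_orth])
    show "nrm r \<le> nrm (\<lambda>x. r x - c * coh z x)" for c z
      using order_trans[OF rle rmin[of c z]] by (rule power2_le_imp_le) simp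
  qed auto
  then have "nrm r = 0" by (simp add: nrm_eq_0_iff)
  then have "\<delta> \<le> 0" using rmin[of 0 0] by simp
  moreover obtain cs where "(nrm (\<lambda>x. f x - comb cs 1 x))\<^sup>2 < \<delta> + e\<^sup>2" using ex[of "e\<^sup>2"] e by auto
  ultimately have "(nrm (\<lambda>x. f x - comb cs 1 x))\<^sup>2 < e\<^sup>2" by simp
  then have "nrm (\<lambda>x. f x - comb cs 1 x) < e" using e by (auto intro: power2_less_imp_less)
  then show ?thesis by (rule that)
qed

lemma nrm_approx_eq_AE:
  assumes "F \<in> SQ" "G \<in> SQ" and "\<And>e. 0 < e \<Longrightarrow> nrm (\<lambda>x. F x - G x) \<le> K * e"
  shows "AE x in lborel. F x = G x"
proof -
  have "nrm (\<lambda>x. F x - G x) \<le> 0"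
  proof (rule field_le_epsilon)
    fix e :: real assume e: "0 < e"
    have "nrm (\<lambda>x. F x - G x) \<le> K * (e / (1 + \<bar>K\<bar>))" using e by (intro assms) auto
    also have "\<dots> = (K / (1 + \<bar>K\<bar>)) * e" by simp
    also have "\<dots> \<le> 1 * e" using e by (intro mult_right_mono) (auto simp: field_simps)
    finally show "nrm (\<lambda>x. F x - G x) \<le> 0 + e" by simp
  qed
  then have "nrm (\<lambda>x. F x - G x) = 0" using nrm_nonneg[of "\<lambda>x. F x - G x"] by linarith
  then show ?thesis using assms by (simp add: nrm_diff_eq_0_iff)
qed

lemma nrm_tendsto:
  assumes "\<And>n. s n \<in> SQ" "f \<in> SQ" "k \<in> SQ" and "((\<lambda>n. nrm (\<lambda>x. s n x - f x)) \<longlongrightarrow> 0) F"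
  shows "((\<lambda>n. nrm (\<lambda>x. s n x - k x)) \<longlongrightarrow> nrm (\<lambda>x. f x - k x)) F"
proof -
  have "norm (nrm (\<lambda>x. s n x - k x) - nrm (\<lambda>x. f x - k x)) \<le> nrm (\<lambda>x. s n x - f x)" for n
    using nrm_diff_abs[of "\<lambda>x. s n x - k x" "\<lambda>x. f x - k x"] assms(1)[of n] assms(2,3) by simp
  then have "((\<lambda>n. nrm (\<lambda>x. s n x - k x) - nrm (\<lambda>x. f x - k x)) \<longlongrightarrow> 0) F"
    by (intro Lim_null_comparison[OF _ assms(4)] always_eventually allI)
  then show ?thesis by (simp add: LIM_zero_cancel)
qed

text \<open>The natural test function is \<open>r\<close> itself, which need not be a combination;
  it is tested against an approximation of \<open>r\<close> instead, at an arbitrarily small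
  cost.\<close>

lemma nrm_le_dual:
  assumes r: "r \<in> SQ" and b: "\<And>cs. norm (ip r (comb cs 1)) \<le> B * nrm (comb cs 1)" and B: "0 \<le> B"
  shows "nrm r \<le> B"
proof (cases "nrm r = 0")
  case False
  then have pos: "nrm r > 0" using nrm_nonneg[of r] by linarith
  have "nrm r * nrm r \<le> nrm r * B"
  proof (rule field_le_epsilon)
    fix e :: real assume e: "0 < e"
    \<comment> \<open>Chosen so that the two errors \<open>B * d\<close> and
      \<open>nrm r * d\<close> add up to \<open>e\<close>.\<close>
    define d where "d = e / (nrm r + B)"
    have d: "d > 0" using e pos B by (simp add: d_def)
    obtain cs where cs: "nrm (\<lambda>x. r x - comb cs 1 x) < d" using comb_dense[OF r d] .
    have "nrm r * nrm r = norm (ip r r)" by (simp only: ip_self norm_of_real) (simp add: power2_eq_square)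
    also have "ip r r = ip r (comb cs 1) + ip r (\<lambda>x. r x - comb cs 1 x)"
      using r by (simp add: ip_diff_right)
    also have "norm \<dots> \<le> B * nrm (comb cs 1) + nrm r * nrm (\<lambda>x. r x - comb cs 1 x)"
      using r by (intro norm_triangle_le add_mono b norm_ip_le) auto
    also have "\<dots> \<le> B * (nrm r + d) + nrm r * d"
    proof (intro add_mono mult_left_mono)
      show "nrm (comb cs 1) \<le> nrm r + d"
        using nrm_diff_abs[of r "comb cs 1"] r cs by simp
    qed (use B cs in auto)
    also have "\<dots> = nrm r * B + d * (nrm r + B)" by (simp add: algebra_simps)
    also have "\<dots> = nrm r * B + e" using pos B by (simp add: d_def)
    finally show "nrm r * nrm r \<le> nrm r * B + e" .
  qed
  then show ?thesis using pos by simp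
qed (use B in simp)

text \<open>The span is kept apart from its completion because orbits starting in it are bounded
  functions, uniformly in time.\<close>

definition cspan :: "(real \<Rightarrow> complex) set" where
  "cspan = range (\<lambda>cs. comb cs 1)"

lemma cspan_L2: "f \<in> cspan \<Longrightarrow> f \<in> SQ"
  by (auto simp: cspan_def)

lemma comb_cspan [simp]: "comb cs u \<in> cspan"
  using comb_rotate[of u cs 1] by (auto simp: cspan_def image_iff) metis

lemma coh_cspan [simp]: "coh z \<in> cspan"
  using comb_cspan[of "[(1, z)]" 1] by simp

text \<open>The unspecified scalar factor \<open>h c\<close> covers linear and conjugate linear
  functionals at once; both occur among the slots of the sextic forms.\<close>

lemma cspan_functional_zero:
  assumes add: "\<And>f g. f \<in> cspan \<Longrightarrow> g \<in> cspan \<Longrightarrow> D (\<lambda>x. f x + g x) = D f + (D g :: complex)"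
    and scale: "\<And>f c. f \<in> cspan \<Longrightarrow> D (\<lambda>x. c * f x) = h c * D f"
    and coh: "\<And>z. D (coh z) = 0" and f: "f \<in> cspan"
  shows "D f = 0"
proof -
  have "D (comb cs 1) = 0" for cs
  proof (induction cs)
    case Nil
    show ?case using scale[of "coh 0" 0] coh[of 0] by simp
  next
    case (Cons c cs)
    obtain a z where c: "c = (a, z)" by (cases c)
    have "(\<lambda>x. a * coh z x) = comb [(a, z)] 1" by simp
    then have "(\<lambda>x. a * coh z x) \<in> cspan" by (simp only: comb_cspan)
    then show ?case using Cons add[of "\<lambda>x. a * coh z x" "comb cs 1"] scale[of "coh z" a] coh[of z]
      by (simp add: c)
  qed
  then show ?thesis using f by (auto simp: cspan_def)
qed

lemma L2_functional_zero:
  assumes add: "\<And>f g. f \<in> SQ \<Longrightarrow> g \<in> SQ \<Longrightarrow> D (\<lambda>x. f x + g x) = D f + (D g :: complex)"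
    and scale: "\<And>f c. f \<in> SQ \<Longrightarrow> D (\<lambda>x. c * f x) = h c * D f"
    and bound: "\<And>f. f \<in> SQ \<Longrightarrow> norm (D f) \<le> K * nrm f"
    and coh: "\<And>z. D (coh z) = 0" and f: "f \<in> SQ"
  shows "D f = 0"
proof -
  have "norm (D f) \<le> 0"
  proof (rule field_le_epsilon)
    fix e :: real assume e: "0 < e"
    obtain cs where cs: "nrm (\<lambda>x. f x - comb cs 1 x) < e / (1 + \<bar>K\<bar>)"
      using comb_dense[OF f, of "e / (1 + \<bar>K\<bar>)"] e by (auto simp: add_pos_nonneg)
    have "D (comb cs 1) = 0"
      by (rule cspan_functional_zero[of D h]) (auto simp: add scale coh cspan_L2)
    then have "D f = D (\<lambda>x. f x - comb cs 1 x)"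
      using add[of "\<lambda>x. f x - comb cs 1 x" "comb cs 1"] f by simp
    also have "norm \<dots> \<le> K * nrm (\<lambda>x. f x - comb cs 1 x)" using f by (intro bound) auto
    also have "\<dots> \<le> (1 + \<bar>K\<bar>) * (e / (1 + \<bar>K\<bar>))" using cs by (intro mult_mono) auto
    also have "\<dots> = e" by (simp add: field_simps)
    finally show "norm (D f) \<le> 0 + e" by simp
  qed
  then show ?thesis by simp
qed

text \<open>Linearity is asked for almost everywhere only, since the operators in question produce
  representatives. Norms ignore null sets, and polarization needs nothing but norms.\<close>

lemma isometry_ip:
  assumes T: "\<And>f. f \<in> SQ \<Longrightarrow> T f \<in> SQ" "\<And>f. f \<in> SQ \<Longrightarrow> nrm (T f) = nrm f"
    and lin: "\<And>a b f g. f \<in> SQ \<Longrightarrow> g \<in> SQ \<Longrightarrow>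
        AE x in lborel. T (\<lambda>y. a * f y + b * g y) x = a * T f x + b * T g x"
    and fg: "f \<in> SQ" "g \<in> SQ"
  shows "ip (T f) (T g) = ip f g"
proof -
  have e: "nrm (\<lambda>x. T f x + b * T g x) = nrm (\<lambda>x. f x + b * g x)" for b
  proof -
    have "nrm (T (\<lambda>y. 1 * f y + b * g y)) = nrm (\<lambda>x. 1 * T f x + b * T g x)"
      using T lin[of f g 1 b] fg by (intro nrm_cong_AE L2_measurable L2_add T L2_scale) auto
    then show ?thesis using T fg by simp
  qed
  have "4 * ip (T f) (T g) = 4 * ip f g"
    unfolding polarization[OF fg] polarization[OF T(1)[OF fg(1)] T(1)[OF fg(2)]]
    using e[of 1] e[of "-1"] e[of \<i>] e[of "-\<i>"] by simp
  then show ?thesis by simp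
qed

section \<open>Rotation of coherent states\<close>

text \<open>The approximating list is chosen once for \<open>f\<close>, independently of the
  rotation \<open>u\<close>; this makes the limit defining \<open>phi\<close> measurable in
  \<open>u\<close> as well.\<close>

definition apx :: "(real \<Rightarrow> complex) \<Rightarrow> nat \<Rightarrow> (complex \<times> complex) list" where
  "apx f n = (SOME cs. nrm (\<lambda>x. f x - comb cs 1 x) \<le> 1 / 2 ^ n)"

text \<open>For unimodular \<open>u\<close> this is the isometric extension of \<open>coh z \<mapsto> coh (u * z)\<close>. The pointwise limit
  is jointly measurable in \<open>u\<close> and \<open>x\<close>.\<close>

definition phi :: "complex \<Rightarrow> (real \<Rightarrow> complex) \<Rightarrow> real \<Rightarrow> complex" where
  "phi u f x = lim (\<lambda>n. comb (apx f n) u x)"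

lemma apx: "f \<in> SQ \<Longrightarrow> nrm (\<lambda>x. f x - comb (apx f n) 1 x) \<le> 1 / 2 ^ n"
proof -
  assume "f \<in> SQ"
  then obtain cs where "nrm (\<lambda>x. f x - comb cs 1 x) < 1 / 2 ^ n"
    using comb_dense[of f "1 / 2 ^ n"] by auto
  then have "nrm (\<lambda>x. f x - comb cs 1 x) \<le> 1 / 2 ^ n" by simp
  then show ?thesis unfolding apx_def by (rule someI)
qed

lemma apx_cauchy:
  assumes f: "f \<in> SQ" and u: "norm u = 1"
  shows "nrm (\<lambda>x. comb (apx f (Suc n)) u x - comb (apx f n) u x) \<le> 2 / 2 ^ n"
proof -
  have "nrm (\<lambda>x. comb (apx f (Suc n)) 1 x - comb (apx f n) 1 x) \<le>
      nrm (\<lambda>x. comb (apx f (Suc n)) 1 x - f x) + nrm (\<lambda>x. f x - comb (apx f n) 1 x)"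
    using f by (intro nrm_triangle_diff) auto
  also have "\<dots> \<le> 1 / 2 ^ Suc n + 1 / 2 ^ n"
    using apx[OF f] by (intro add_mono) (auto simp: nrm_diff_commute[of _ f] simp del: power_Suc)
  also have "\<dots> \<le> 2 / 2 ^ n" by (simp add: field_simps)
  finally show ?thesis by (simp add: nrm_comb_diff_rotate[OF u])
qed

lemma phi_facts:
  assumes f: "f \<in> SQ" and u: "norm u = 1"
  shows phi_L2: "phi u f \<in> SQ"
    and phi_AE_lim: "AE x in lborel. (\<lambda>n. comb (apx f n) u x) \<longlonglongrightarrow> phi u f x"
    and phi_apx: "nrm (\<lambda>x. phi u f x - comb (apx f n) u x) \<le> 4 / 2 ^ n"
proof -
  have eq: "phi u f = (\<lambda>x. lim (\<lambda>n. comb (apx f n) u x))" by (rule ext) (rule phi_def)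
  note * = L2_fast_cauchy[of "\<lambda>n. comb (apx f n) u" 2, OF comb_L2 apx_cauchy[OF f u], folded eq]
  show "phi u f \<in> SQ" by (rule *(2))
  show "AE x in lborel. (\<lambda>n. comb (apx f n) u x) \<longlonglongrightarrow> phi u f x" using *(1) by (simp add: phi_def)
  show "nrm (\<lambda>x. phi u f x - comb (apx f n) u x) \<le> 4 / 2 ^ n" using *(3)[of n] by (simp add: phi_def)
qed

lemma phi_measurable_pair:
  "(\<lambda>p. phi (fst p) f (snd p)) \<in> borel_measurable (borel \<Otimes>\<^sub>M borel)"
proof -
  have [measurable]: "(\<lambda>p. comb cs (fst p) (snd p)) \<in> borel_measurable (borel \<Otimes>\<^sub>M borel)" for cs
    unfolding borel_prod by (intro borel_measurable_continuous_onI continuous_intros)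
  show ?thesis unfolding phi_def by measurable
qed

lemma const_over_power_tendsto_0: "(\<lambda>n. c / 2 ^ n) \<longlonglongrightarrow> (0::real)"
  using tendsto_mult_right_zero[OF LIMSEQ_power_zero[of "1/2::real"], of c] by (simp add: power_divide)

text \<open>Both sides are limits of the distances from the rotated approximants to
  \<open>comb cs u\<close>, which equal the unrotated distances. Isometry in this form, against
  arbitrary combinations, yields all the laws of \<open>phi\<close>.\<close>

lemma phi_key:
  assumes f: "f \<in> SQ" and u: "norm u = 1"
  shows "nrm (\<lambda>x. phi u f x - comb cs u x) = nrm (\<lambda>x. f x - comb cs 1 x)"
proof (rule LIMSEQ_unique)
  have "(\<lambda>n. nrm (\<lambda>x. comb (apx f n) u x - phi u f x)) \<longlonglongrightarrow> 0"
    using phi_apx[OF f u]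
    by (intro tendsto_sandwich[OF _ _ tendsto_const const_over_power_tendsto_0[of 4]])
       (auto simp: nrm_diff_commute[of _ "phi u f"])
  then show "(\<lambda>n. nrm (\<lambda>x. comb (apx f n) u x - comb cs u x)) \<longlonglongrightarrow> nrm (\<lambda>x. phi u f x - comb cs u x)"
    using phi_L2[OF f u] by (intro nrm_tendsto) auto
  have "(\<lambda>n. nrm (\<lambda>x. comb (apx f n) 1 x - f x)) \<longlonglongrightarrow> 0"
    using apx[OF f]
    by (intro tendsto_sandwich[OF _ _ tendsto_const const_over_power_tendsto_0[of 1]])
       (auto simp: nrm_diff_commute[of _ "f"])
  then show "(\<lambda>n. nrm (\<lambda>x. comb (apx f n) u x - comb cs u x)) \<longlonglongrightarrow> nrm (\<lambda>x. f x - comb cs 1 x)"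
    unfolding nrm_comb_diff_rotate[OF u] using f by (intro nrm_tendsto) auto
qed

text \<open>A function approximated by the rotations of the combinations that approximate
  \<open>f\<close> is \<open>phi u f\<close>, by \<open>phi_key\<close> and the triangle inequality.
  The laws of composition and linearity below are instances.\<close>

lemma phi_eqI:
  assumes f: "f \<in> SQ" and u: "norm u = 1" and F: "F \<in> SQ"
    and le: "\<And>e. 0 < e \<Longrightarrow> \<exists>cs. nrm (\<lambda>x. f x - comb cs 1 x) \<le> K * e \<and> nrm (\<lambda>x. F x - comb cs u x) \<le> K * e"
  shows "AE x in lborel. F x = phi u f x"
proof (rule nrm_approx_eq_AE[OF F phi_L2[OF f u]])
  fix e :: real assume "0 < e"
  then obtain cs where cs: "nrm (\<lambda>x. f x - comb cs 1 x) \<le> K * e" "nrm (\<lambda>x. F x - comb cs u x) \<le> K * e"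
    using le by blast
  have "nrm (\<lambda>x. F x - phi u f x) \<le> nrm (\<lambda>x. F x - comb cs u x) + nrm (\<lambda>x. comb cs u x - phi u f x)"
    using F phi_L2[OF f u] by (intro nrm_triangle_diff) auto
  also have "\<dots> \<le> K * e + K * e"
    using cs phi_key[OF f u, of cs] nrm_diff_commute[of "phi u f"] by (intro add_mono) auto
  finally show "nrm (\<lambda>x. F x - phi u f x) \<le> (2 * K) * e" by simp
qed

lemma phi_nrm: "f \<in> SQ \<Longrightarrow> norm u = 1 \<Longrightarrow> nrm (phi u f) = nrm f"
  using phi_key[of f u "[]"] by simp

lemma phi_comb: "norm u = 1 \<Longrightarrow> AE x in lborel. comb cs (u * v) x = phi u (comb cs v) x"
  by (rule phi_eqI[where K = 1])
     (auto intro!: exI[of _ "map (\<lambda>(c, z). (c, v * z)) cs"] simp: comb_rotate)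

lemma phi_coh: "norm u = 1 \<Longrightarrow> AE x in lborel. coh (u * z) x = phi u (coh z) x"
  using phi_comb[of u "[(1, z)]" 1] by simp

lemma phi_one: "f \<in> SQ \<Longrightarrow> AE x in lborel. f x = phi 1 f x"
proof (rule phi_eqI[where K = 1])
  fix e :: real assume f: "f \<in> SQ" "0 < e"
  obtain cs where "nrm (\<lambda>x. f x - comb cs 1 x) < e" using comb_dense[OF f] .
  then show "\<exists>cs. nrm (\<lambda>x. f x - comb cs 1 x) \<le> 1 * e \<and> nrm (\<lambda>x. f x - comb cs 1 x) \<le> 1 * e"
    by (intro exI[of _ cs]) auto
qed auto

lemma phi_phi:
  assumes f: "f \<in> SQ" and u: "norm u = 1" and v: "norm v = 1"
  shows "AE x in lborel. phi u (phi v f) x = phi (u * v) f x"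
proof (rule phi_eqI[where K = 1])
  show "f \<in> SQ" "phi u (phi v f) \<in> SQ" "norm (u * v) = 1" using assms by (auto simp: norm_mult phi_L2)
  fix e :: real assume "0 < e"
  then obtain cs where cs: "nrm (\<lambda>x. f x - comb cs 1 x) < e" using comb_dense[OF f] by blast
  have "nrm (\<lambda>x. phi u (phi v f) x - comb (map (\<lambda>(c, z). (c, v * z)) cs) u x) = nrm (\<lambda>x. phi v f x - comb (map (\<lambda>(c, z). (c, v * z)) cs) 1 x)"
    using assms by (intro phi_key phi_L2)
  then have "nrm (\<lambda>x. phi u (phi v f) x - comb cs (u * v) x) = nrm (\<lambda>x. f x - comb cs 1 x)"
    by (simp add: comb_rotate phi_key[OF f v])
  then show "\<exists>cs. nrm (\<lambda>x. f x - comb cs 1 x) \<le> 1 * e \<and> nrm (\<lambda>x. phi u (phi v f) x - comb cs (u * v) x) \<le> 1 * e"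
    using cs by (intro exI[of _ cs]) auto
qed

lemma phi_lin:
  assumes f: "f \<in> SQ" and g: "g \<in> SQ" and u: "norm u = 1"
  shows "AE x in lborel. phi u (\<lambda>y. a * f y + b * g y) x = a * phi u f x + b * phi u g x"
proof -
  have *: "nrm (\<lambda>x. (a * F x + b * G x) - (a * P x + b * Q x)) \<le> (norm a + norm b) * e"
    if "F \<in> SQ" "G \<in> SQ" "P \<in> SQ" "Q \<in> SQ" "nrm (\<lambda>x. F x - P x) \<le> e" "nrm (\<lambda>x. G x - Q x) \<le> e" for F G P Q e
  proof -
    have "nrm (\<lambda>x. a * (F x - P x) + b * (G x - Q x)) \<le> nrm (\<lambda>x. a * (F x - P x)) + nrm (\<lambda>x. b * (G x - Q x))"
      using that by (intro nrm_triangle L2_scale L2_diff)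
    also have "\<dots> \<le> norm a * e + norm b * e"
      using that unfolding nrm_scale by (intro add_mono mult_left_mono) auto
    finally show ?thesis by (simp add: algebra_simps)
  qed
  have "AE x in lborel. a * phi u f x + b * phi u g x = phi u (\<lambda>y. a * f y + b * g y) x"
  proof (rule phi_eqI[where K = "norm a + norm b"])
    fix e :: real assume e: "0 < e"
    obtain cs where cs: "nrm (\<lambda>x. f x - comb cs 1 x) < e" using comb_dense[OF f e] .
    obtain ds where ds: "nrm (\<lambda>x. g x - comb ds 1 x) < e" using comb_dense[OF g e] .
    let ?c = "map (\<lambda>(c, z). (a * c, z)) cs @ map (\<lambda>(c, z). (b * c, z)) ds"
    have 1: "nrm (\<lambda>x. (a * f x + b * g x) - comb ?c 1 x) \<le> (norm a + norm b) * e"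
      unfolding comb_simps comb_scale using f g cs ds by (intro *) auto
    have 2: "nrm (\<lambda>x. (a * phi u f x + b * phi u g x) - comb ?c u x) \<le> (norm a + norm b) * e"
      unfolding comb_simps comb_scale using f g cs ds u
      by (intro *) (auto simp: phi_L2 phi_key)
    show "\<exists>cs. nrm (\<lambda>x. (a * f x + b * g x) - comb cs 1 x) \<le> (norm a + norm b) * e \<and>
        nrm (\<lambda>x. (a * phi u f x + b * phi u g x) - comb cs u x) \<le> (norm a + norm b) * e"
      using 1 2 by (intro exI[of _ ?c] conjI)
  qed (use assms in \<open>auto simp: phi_L2\<close>)
  then show ?thesis by eventually_elim simp
qed

lemma ip_phi: "f \<in> SQ \<Longrightarrow> g \<in> SQ \<Longrightarrow> norm u = 1 \<Longrightarrow> ip (phi u f) (phi u g) = ip f g"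
  by (rule isometry_ip[where T = "phi u"]) (auto simp: phi_L2 phi_nrm intro!: phi_lin)

lemma ip_phi_coh:
  assumes f: "f \<in> SQ" and u: "norm u = 1"
  shows "ip (phi u f) (coh z) = ip f (coh (cnj u * z))"
proof -
  have uc: "u * (cnj u * z) = z"
    using u by (simp add: mult.assoc[symmetric] complex_norm_square[symmetric])
  have "ip (phi u f) (coh z) = ip (phi u f) (phi u (coh (cnj u * z)))"
    using phi_coh[OF u, of "cnj u * z"] assms
    by (intro ip_cong_AE) (auto simp: uc intro: L2_measurable phi_L2)
  also have "\<dots> = ip f (coh (cnj u * z))" using assms by (intro ip_phi) auto
  finally show ?thesis .
qed

text \<open>The rotated state has the same norm, so the squared distance is twice the real part of a
  difference of explicit inner products, which is continuous in \<open>u\<close>.\<close>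

lemma nrm_coh_rotate_tendsto:
  assumes u: "(u \<longlongrightarrow> 1) F" "\<And>r. norm (u r) = 1"
  shows "((\<lambda>r. nrm (\<lambda>x. coh (u r * z) x - coh z x)) \<longlongrightarrow> 0) F"
proof -
  have eq: "(nrm (coh (u r * z)))\<^sup>2 = (nrm (coh z))\<^sup>2" for r
    using nrm_comb_rotate[OF u(2), of "[(1, z)]" r] by simp
  have z: "complex_of_real ((nrm (coh z))\<^sup>2) = of_real (sqrt pi) * exp (2 * z * cnj z)"
    unfolding ip_self[symmetric] by (rule ip_coh)
  have "(nrm (\<lambda>x. coh (u r * z) x - coh z x))\<^sup>2 = 2 * Re (of_real (sqrt pi) * exp (2 * z * cnj z)
      - of_real (sqrt pi) * exp (2 * (u r * z) * cnj z))" for r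
    using z by (simp only: nrm_diff_sq coh_L2 eq ip_coh minus_complex.sel Re_complex_of_real z[symmetric]) simp
  moreover have "((\<lambda>r. 2 * Re (of_real (sqrt pi) * exp (2 * z * cnj z)
      - of_real (sqrt pi) * exp (2 * (u r * z) * cnj z))) \<longlongrightarrow> 2 * Re (of_real (sqrt pi) * exp (2 * z * cnj z)
      - of_real (sqrt pi) * exp (2 * (1 * z) * cnj z))) F"
    by (intro tendsto_intros u)
  ultimately have "((\<lambda>r. (nrm (\<lambda>x. coh (u r * z) x - coh z x))\<^sup>2) \<longlongrightarrow> 0) F" by simp
  from tendsto_real_sqrt[OF this] show ?thesis by simp
qed

lemma nrm_comb_rotate_tendsto:
  assumes u: "(u \<longlongrightarrow> 1) F" "\<And>r. norm (u r) = 1"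
  shows "((\<lambda>r. nrm (\<lambda>x. comb cs (u r) x - comb cs 1 x)) \<longlongrightarrow> 0) F"
proof (induction cs)
  case (Cons c cs)
  obtain a z where c: "c = (a, z)" by (cases c)
  have A: "((\<lambda>r. norm a * nrm (\<lambda>x. coh (u r * z) x - coh z x) + nrm (\<lambda>x. comb cs (u r) x - comb cs 1 x)) \<longlongrightarrow> norm a * 0 + 0) F"
    by (intro tendsto_intros Cons nrm_coh_rotate_tendsto u)
  have B: "norm (nrm (\<lambda>x. comb (c # cs) (u r) x - comb (c # cs) 1 x)) \<le>
      norm a * nrm (\<lambda>x. coh (u r * z) x - coh z x) + nrm (\<lambda>x. comb cs (u r) x - comb cs 1 x)" for r
  proof -
    have "nrm (\<lambda>x. a * (coh (u r * z) x - coh z x) + (comb cs (u r) x - comb cs 1 x)) \<le>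
      nrm (\<lambda>x. a * (coh (u r * z) x - coh z x)) + nrm (\<lambda>x. comb cs (u r) x - comb cs 1 x)"
      by (intro nrm_triangle) auto
    also have "(\<lambda>x. a * (coh (u r * z) x - coh z x) + (comb cs (u r) x - comb cs 1 x)) =
        (\<lambda>x. comb (c # cs) (u r) x - comb (c # cs) 1 x)" by (simp add: c algebra_simps)
    finally show ?thesis by (simp only: nrm_scale) simp
  qed
  show ?case
    by (rule Lim_null_comparison[OF _ A[unfolded mult_zero_right add_0_left]])
       (intro always_eventually allI B)
qed simp

lemma phi_tendsto:
  assumes f: "f \<in> SQ" and u: "(u \<longlongrightarrow> 1) F" "\<And>r. norm (u r) = 1"
  shows "((\<lambda>r. nrm (\<lambda>x. phi (u r) f x - f x)) \<longlongrightarrow> 0) F"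
proof (rule tendstoI)
  fix e :: real assume e: "0 < e"
  then obtain cs where cs: "nrm (\<lambda>x. f x - comb cs 1 x) < e / 4" using comb_dense[OF f, of "e / 4"] by auto
  have "\<forall>\<^sub>F r in F. dist (nrm (\<lambda>x. comb cs (u r) x - comb cs 1 x)) 0 < e / 4"
    by (rule tendstoD[OF nrm_comb_rotate_tendsto[OF u]]) (use e in simp)
  then show "\<forall>\<^sub>F r in F. dist (nrm (\<lambda>x. phi (u r) f x - f x)) 0 < e"
  proof eventually_elim
    case (elim r)
    have "nrm (\<lambda>x. phi (u r) f x - f x) \<le> nrm (\<lambda>x. phi (u r) f x - comb cs (u r) x) + nrm (\<lambda>x. comb cs (u r) x - f x)"
      using f u phi_L2 by (intro nrm_triangle_diff) auto
    also have "nrm (\<lambda>x. comb cs (u r) x - f x) \<le> nrm (\<lambda>x. comb cs (u r) x - comb cs 1 x) + nrm (\<lambda>x. comb cs 1 x - f x)"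
      using f by (intro nrm_triangle_diff) auto
    also have "nrm (\<lambda>x. phi (u r) f x - comb cs (u r) x) = nrm (\<lambda>x. f x - comb cs 1 x)"
      by (rule phi_key[OF f u(2)])
    finally show ?case using cs elim e by (simp add: nrm_diff_commute[of _ f])
  qed
qed

text \<open>The \<open>n\<close>-th Hermite function must acquire the phase
  \<open>cis ((2 * n + 1) * t)\<close>. The part \<open>cis (2 * n * t)\<close> is the rotation of
  the parameter, and \<open>cis t\<close> is the ground state energy.\<close>

definition osc :: "real \<Rightarrow> (real \<Rightarrow> complex) \<Rightarrow> real \<Rightarrow> complex" where
  "osc t f x = cis t * phi (cis (2 * t)) f x"

lemma osc_L2 [simp, intro]: "f \<in> SQ \<Longrightarrow> osc t f \<in> SQ"
  unfolding osc_def[abs_def] by (intro L2_scale phi_L2) auto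

lemma osc_nrm: "f \<in> SQ \<Longrightarrow> nrm (osc t f) = nrm f"
  unfolding osc_def[abs_def] by (simp add: phi_nrm)

lemma osc_lin:
  assumes "f \<in> SQ" "g \<in> SQ"
  shows "AE x in lborel. osc t (\<lambda>y. a * f y + b * g y) x = a * osc t f x + b * osc t g x"
  using phi_lin[OF assms, of "cis (2 * t)" a b] unfolding osc_def
  by (simp add: algebra_simps) (auto elim: eventually_mono simp: algebra_simps)

lemma phi_cong:
  assumes "f \<in> SQ" "g \<in> SQ" "AE x in lborel. f x = g x" "norm u = 1"
  shows "AE x in lborel. phi u f x = phi u g x"
proof -
  have "nrm (phi u (\<lambda>y. 1 * f y + (-1) * g y)) = nrm (\<lambda>y. 1 * f y + (-1) * g y)"
    using assms by (intro phi_nrm) auto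
  also have "\<dots> = 0" using assms by (simp add: nrm_diff_eq_0_iff)
  finally have "AE x in lborel. phi u (\<lambda>y. 1 * f y + (-1) * g y) x = 0"
    using assms by (subst (asm) nrm_eq_0_iff) (auto intro!: phi_L2)
  with phi_lin[OF assms(1,2,4), of 1 "-1"] show ?thesis by eventually_elim simp
qed

lemma osc_cong:
  assumes "f \<in> SQ" "g \<in> SQ" "AE x in lborel. f x = g x"
  shows "AE x in lborel. osc t f x = osc t g x"
  using phi_cong[OF assms, of "cis (2 * t)"] unfolding osc_def by auto

lemma osc_add:
  assumes f: "f \<in> SQ" shows "AE x in lborel. osc (s + t) f x = osc s (osc t f) x"
proof -
  have "AE x in lborel. phi (cis (2 * s)) (osc t f) x = cis t * phi (cis (2 * s)) (phi (cis (2 * t)) f) x"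
    using phi_lin[of "phi (cis (2 * t)) f" "\<lambda>x. 0" "cis (2 * s)" "cis t" 0] f
    by (simp add: osc_def[abs_def] phi_L2)
  moreover have "AE x in lborel. phi (cis (2 * s)) (phi (cis (2 * t)) f) x = phi (cis (2 * s) * cis (2 * t)) f x"
    using f by (intro phi_phi) auto
  ultimately show ?thesis
    by eventually_elim (simp add: osc_def cis_mult algebra_simps)
qed

lemma osc_0: "f \<in> SQ \<Longrightarrow> AE x in lborel. osc 0 f x = f x"
  using phi_one[of f] by (simp add: osc_def) (auto elim: eventually_mono)

lemma osc_coh: "AE x in lborel. osc t (coh z) x = cis t * coh (cis (2 * t) * z) x"
  using phi_coh[of "cis (2 * t)" z] by (simp add: osc_def) (auto elim: eventually_mono)

lemma ip_osc: "f \<in> SQ \<Longrightarrow> g \<in> SQ \<Longrightarrow> ip (osc t f) (osc t g) = ip f g"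
  by (rule isometry_ip[where T = "osc t"]) (auto simp: osc_nrm intro!: osc_lin)

lemma ip_osc_coh: "f \<in> SQ \<Longrightarrow> ip (osc t f) (coh z) = ip f (\<lambda>x. cis (- t) * coh (cis (- (2 * t)) * z) x)"
  unfolding osc_def[abs_def] by (simp add: ip_scale_left ip_scale_right ip_phi_coh cis_cnj)

lemma osc_tendsto:
  assumes f: "f \<in> SQ" shows "((\<lambda>t. nrm (\<lambda>x. osc t f x - f x)) \<longlongrightarrow> 0) (at 0)"
proof (rule Lim_null_comparison[OF always_eventually], rule allI)
  fix t
  have "nrm (\<lambda>x. osc t f x - f x) \<le> nrm (\<lambda>x. osc t f x - cis t * f x) + nrm (\<lambda>x. cis t * f x - f x)"
    using f by (intro nrm_triangle_diff) auto
  also have "(\<lambda>x. osc t f x - cis t * f x) = (\<lambda>x. cis t * (phi (cis (2 * t)) f x - f x))"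
    by (simp add: osc_def algebra_simps)
  also have "(\<lambda>x. cis t * f x - f x) = (\<lambda>x. (cis t - 1) * f x)" by (simp add: algebra_simps)
  finally show "norm (nrm (\<lambda>x. osc t f x - f x)) \<le> nrm (\<lambda>x. phi (cis (2 * t)) f x - f x) + norm (cis t - 1) * nrm f"
    by simp
next
  have c: "((\<lambda>t. cis (k * t)) \<longlongrightarrow> cis (k * 0)) (at 0)" for k :: real
    unfolding cis_conv_exp by (intro tendsto_intros)
  have "((\<lambda>t. nrm (\<lambda>x. phi (cis (2 * t)) f x - f x) + norm (cis t - 1) * nrm f) \<longlongrightarrow> 0 + norm (cis 0 - 1) * nrm f) (at 0)"
    using c[of 2] c[of 1] f by (intro tendsto_intros phi_tendsto) auto
  then show "((\<lambda>t. nrm (\<lambda>x. phi (cis (2 * t)) f x - f x) + norm (cis t - 1) * nrm f) \<longlongrightarrow> 0) (at 0)" by simp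
qed

lemma unitary_group_osc: "unitary_group osc"
  unfolding unitary_group_def L2_eq Lp_norm_2_eq
  by (auto simp: osc_nrm osc_lin osc_0 osc_add osc_tendsto L2_tendsto_iff)

section \<open>The propagator of the harmonic oscillator\<close>

text \<open>\<open>exp (M * \<bar>x\<bar>)\<close> is at most
  \<open>exp (M * x) + exp (- M * x)\<close>, so two coherent states with the real parameters
  \<open>M / 2\<close> and \<open>- M / 2\<close> form a majorant.\<close>

lemma gauss_bound_L2: "(\<lambda>x. complex_of_real (exp (- x\<^sup>2 / 2 + M * \<bar>x\<bar>))) \<in> SQ"
proof -
  define g where "g x = of_real (exp (M\<^sup>2 / 4)) * (coh (of_real (M / 2)) x + coh (of_real (- M / 2)) x)" for x
  have g: "g x = of_real (exp (- x\<^sup>2 / 2 + M * x) + exp (- x\<^sup>2 / 2 - M * x))" for x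
  proof -
    have "coh (of_real (M / 2)) x = of_real (exp (- x\<^sup>2 / 2 + M * x - M\<^sup>2 / 4))"
      "coh (of_real (- M / 2)) x = of_real (exp (- x\<^sup>2 / 2 - M * x - M\<^sup>2 / 4))"
      unfolding coh_def exp_of_real[symmetric] by (simp_all add: power_divide mult.commute)
    then show ?thesis
      unfolding g_def by (simp only: of_real_add[symmetric] of_real_mult[symmetric] distrib_left mult_exp_exp) simp
  qed
  show ?thesis
  proof (rule L2_dominated(1))
    show "g \<in> SQ" unfolding g_def by (intro L2_scale L2_add coh_L2)
    show "AE x in lborel. norm (complex_of_real (exp (- x\<^sup>2 / 2 + M * \<bar>x\<bar>))) \<le> norm (g x)"
    proof (rule AE_I2)
      fix x :: real
      have "norm (g x) = exp (- x\<^sup>2 / 2 + M * x) + exp (- x\<^sup>2 / 2 - M * x)"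
        unfolding g norm_of_real by (rule abs_of_nonneg) (simp add: add_nonneg_nonneg)
      then show "norm (complex_of_real (exp (- x\<^sup>2 / 2 + M * \<bar>x\<bar>))) \<le> norm (g x)"
        by (cases "x \<ge> 0") (simp_all add: abs_if)
    qed
  qed measurable
qed

lemma norm_coh_le: "norm (coh z x) \<le> exp ((norm z)\<^sup>2) * exp (- x\<^sup>2 / 2 + 2 * norm z * \<bar>x\<bar>)"
proof -
  have "Re (- (of_real x)\<^sup>2 / 2 + 2 * of_real x * z - z\<^sup>2) \<le> (norm z)\<^sup>2 + (- x\<^sup>2 / 2 + 2 * norm z * \<bar>x\<bar>)"
  proof -
    have "x * Re z \<le> \<bar>x\<bar> * norm z"
      using abs_Re_le_cmod[of z] abs_mult[of x "Re z"] abs_ge_self[of "x * Re z"]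
      by (smt (verit) mult_left_mono abs_ge_zero)
    moreover have "- Re (z\<^sup>2) \<le> (norm z)\<^sup>2"
      using abs_Re_le_cmod[of "z\<^sup>2"] by (simp add: norm_power)
    ultimately show ?thesis by (simp add: mult.commute mult.left_commute)
  qed
  then show ?thesis unfolding coh_def norm_exp_eq_Re exp_add[symmetric] by simp
qed

text \<open>The velocity at time 0 of the orbit of \<open>coh z\<close>, found by differentiating
  the exponent; \<open>osc_coh_rate_eq\<close> shows it to be \<open>\<i>\<close> times the
  oscillator applied to \<open>coh z\<close>.\<close>

definition osc_coh_rate :: "complex \<Rightarrow> real \<Rightarrow> complex" where
  "osc_coh_rate z x = \<i> * ((1 + 4 * of_real x * z - 4 * z\<^sup>2) * coh z x)"

lemma norm_iexp_minus_1:
  "norm (exp (\<i> * of_real t) - 1) \<le> \<bar>t\<bar>" "norm (exp (\<i> * of_real t) - 1 - \<i> * of_real t) \<le> t\<^sup>2"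
  using Taylor_exp[of "\<i> * of_real t" 0] Taylor_exp[of "\<i> * of_real t" 1]
  by (auto simp: norm_mult algebra_simps power2_eq_square)

lemma one_plus_le_exp: "1 + \<bar>x\<bar> \<le> exp \<bar>x::real\<bar>"
  by simp

text \<open>A Taylor estimate of second order in \<open>t\<close> with a fixed square integrable
  envelope in \<open>x\<close>. The orbit is \<open>coh z x * exp \<eta>\<close> with
  \<open>\<eta>\<close> affine in \<open>x\<close> and of size \<open>\<bar>t\<bar>\<close>, so the
  remainder costs only an exponential of a multiple of \<open>\<bar>x\<bar>\<close>, which the
  Gaussian absorbs.\<close>

lemma coh_rate_bound:
  obtains K M where "0 \<le> K" "\<And>t x. \<bar>t\<bar> \<le> 1 \<Longrightarrow>
    norm (cis t * coh (cis (2 * t) * z) x - coh z x - of_real t * osc_coh_rate z x)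
      \<le> t\<^sup>2 * (K * exp (- x\<^sup>2 / 2 + M * \<bar>x\<bar>))"
proof -
  \<comment> \<open>Collects the coefficients of \<open>\<eta>\<close>, so that
    \<open>norm \<eta> \<le> \<bar>t\<bar> * (A * (1 + \<bar>x\<bar>))\<close>.\<close>
  define A where "A = 1 + 4 * norm z + 4 * (norm z)\<^sup>2"
  have A: "A \<ge> 1" by (simp add: A_def)
  define K where "K = (A\<^sup>2 * exp A + 4 * A) * exp ((norm z)\<^sup>2)"
  define M where "M = A + 2 + 2 * norm z"
  show ?thesis
  proof (rule that)
    show "0 \<le> K" using A by (simp add: K_def)
    fix t x :: real assume t: "\<bar>t\<bar> \<le> 1"
    define e2 where "e2 = exp (\<i> * of_real (2 * t)) - 1"
    define e4 where "e4 = exp (\<i> * of_real (4 * t)) - 1"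
    define \<eta> where "\<eta> = \<i> * of_real t + 2 * of_real x * z * e2 - z\<^sup>2 * e4"
    define y where "y = 1 + \<bar>x\<bar>"
    have y: "y \<ge> 1" "y \<le> exp \<bar>x\<bar>" "\<bar>x\<bar> \<le> y" by (simp_all add: y_def)
    have e: "norm e2 \<le> 2 * \<bar>t\<bar>" "norm (e2 - \<i> * of_real (2 * t)) \<le> 4 * t\<^sup>2"
      "norm e4 \<le> 4 * \<bar>t\<bar>" "norm (e4 - \<i> * of_real (4 * t)) \<le> 16 * t\<^sup>2"
      unfolding e2_def e4_def using norm_iexp_minus_1[of "2 * t"] norm_iexp_minus_1[of "4 * t"]
      by (auto simp: abs_mult power_mult_distrib)
    have split: "cis t * coh (cis (2 * t) * z) x = coh z x * exp \<eta>"
    proof -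
      have "cis t * coh (cis (2 * t) * z) x = exp (\<i> * of_real t + (- (of_real x)\<^sup>2 / 2 + 2 * of_real x * (exp (\<i> * of_real (2 * t)) * z) - (exp (\<i> * of_real (2 * t)) * z)\<^sup>2))"
        by (simp add: coh_def cis_conv_exp exp_add[symmetric])
      also have "(exp (\<i> * of_real (2 * t)) * z)\<^sup>2 = exp (\<i> * of_real (4 * t)) * z\<^sup>2"
        by (simp add: power_mult_distrib exp_double[symmetric] mult.left_commute)
      also have "exp (\<i> * of_real t + (- (of_real x)\<^sup>2 / 2 + 2 * of_real x * (exp (\<i> * of_real (2 * t)) * z) - exp (\<i> * of_real (4 * t)) * z\<^sup>2)) = coh z x * exp \<eta>"
        unfolding coh_def \<eta>_def e2_def e4_def exp_add[symmetric] by (simp add: algebra_simps)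
      finally show ?thesis .
    qed
    have "norm \<eta> \<le> \<bar>t\<bar> + 2 * \<bar>x\<bar> * norm z * (2 * \<bar>t\<bar>) + (norm z)\<^sup>2 * (4 * \<bar>t\<bar>)"
    proof -
      have "norm \<eta> \<le> norm (\<i> * of_real t + 2 * of_real x * z * e2) + norm (z\<^sup>2 * e4)"
        unfolding \<eta>_def by (rule norm_triangle_ineq4)
      also have "norm (\<i> * of_real t + 2 * of_real x * z * e2) \<le> \<bar>t\<bar> + norm (2 * of_real x * z * e2)"
        by (rule order_trans[OF norm_triangle_ineq]) (simp add: norm_mult)
      also have "norm (2 * of_real x * z * e2) \<le> 2 * \<bar>x\<bar> * norm z * (2 * \<bar>t\<bar>)"
        unfolding norm_mult using e(1) by (intro mult_mono) auto
      also have "norm (z\<^sup>2 * e4) \<le> (norm z)\<^sup>2 * (4 * \<bar>t\<bar>)"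
        unfolding norm_mult norm_power using e(3) by (intro mult_mono) auto
      finally show ?thesis by simp
    qed
    also have "\<dots> \<le> \<bar>t\<bar> * (A * y)"
    proof -
      have "0 \<le> 4 * norm z + \<bar>x\<bar> + 4 * (norm z)\<^sup>2 * \<bar>x\<bar>" by simp
      then have "1 + 4 * \<bar>x\<bar> * norm z + 4 * (norm z)\<^sup>2 \<le> A * y"
        unfolding A_def y_def by (simp add: algebra_simps)
      from mult_left_mono[OF this, of "\<bar>t\<bar>"] show ?thesis by (simp add: algebra_simps)
    qed
    finally have n1: "norm \<eta> \<le> \<bar>t\<bar> * (A * y)" .
    have n1': "norm \<eta> \<le> A * y"
    proof -
      have "0 \<le> A * y" using A y by (intro mult_nonneg_nonneg) auto
      from n1 mult_right_mono[OF t this] show ?thesis by linarith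
    qed
    have eq2: "\<eta> - \<i> * of_real t * (1 + 4 * of_real x * z - 4 * z\<^sup>2) = 2 * of_real x * z * (e2 - \<i> * of_real (2 * t)) - z\<^sup>2 * (e4 - \<i> * of_real (4 * t))"
      unfolding \<eta>_def by (simp add: algebra_simps)
    have "norm (\<eta> - \<i> * of_real t * (1 + 4 * of_real x * z - 4 * z\<^sup>2)) \<le> 2 * \<bar>x\<bar> * norm z * (4 * t\<^sup>2) + (norm z)\<^sup>2 * (16 * t\<^sup>2)"
    proof -
      have "norm (2 * of_real x * z * (e2 - \<i> * of_real (2 * t))) \<le> 2 * \<bar>x\<bar> * norm z * (4 * t\<^sup>2)"
        unfolding norm_mult[of "2 * of_real x * z"] using e(2) by (intro mult_mono) (auto simp: norm_mult)
      moreover have "norm (z\<^sup>2 * (e4 - \<i> * of_real (4 * t))) \<le> (norm z)\<^sup>2 * (16 * t\<^sup>2)"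
        unfolding norm_mult[of "z\<^sup>2"] norm_power using e(4) by (intro mult_mono) auto
      ultimately show ?thesis unfolding eq2 by (intro order_trans[OF norm_triangle_ineq4]) simp
    qed
    also have "\<dots> \<le> t\<^sup>2 * (4 * A * y)"
    proof -
      have "0 \<le> 4 + 4 * \<bar>x\<bar> + 16 * norm z + 8 * norm z * \<bar>x\<bar> + 16 * (norm z)\<^sup>2 * \<bar>x\<bar>" by simp
      then have "8 * \<bar>x\<bar> * norm z + 16 * (norm z)\<^sup>2 \<le> 4 * A * y"
        unfolding A_def y_def by (simp add: algebra_simps)
      from mult_left_mono[OF this, of "t\<^sup>2"] show ?thesis by (simp add: algebra_simps)
    qed
    finally have n2: "norm (\<eta> - \<i> * of_real t * (1 + 4 * of_real x * z - 4 * z\<^sup>2)) \<le> t\<^sup>2 * (4 * A * y)" .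
    have n3: "norm (exp \<eta> - 1 - \<eta>) \<le> t\<^sup>2 * (A\<^sup>2 * y\<^sup>2 * exp (A * y))"
    proof -
      have "norm (exp \<eta> - 1 - \<eta>) \<le> exp \<bar>Re \<eta>\<bar> * (norm \<eta>)\<^sup>2"
        using Taylor_exp[of \<eta> 1] by (simp add: algebra_simps numeral_2_eq_2)
      also have "\<dots> \<le> exp (A * y) * (\<bar>t\<bar> * (A * y))\<^sup>2"
        using n1 n1' abs_Re_le_cmod[of \<eta>] by (intro mult_mono power_mono) auto
      finally show ?thesis by (simp add: power_mult_distrib mult_ac)
    qed
    have "norm (exp \<eta> - 1 - of_real t * (\<i> * (1 + 4 * of_real x * z - 4 * z\<^sup>2))) \<le>
        norm (exp \<eta> - 1 - \<eta>) + norm (\<eta> - \<i> * of_real t * (1 + 4 * of_real x * z - 4 * z\<^sup>2))"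
      by (rule order_trans[OF _ norm_triangle_ineq]) (simp add: algebra_simps)
    also have "\<dots> \<le> t\<^sup>2 * (A\<^sup>2 * y\<^sup>2 * exp (A * y)) + t\<^sup>2 * (4 * A * y)"
      by (intro add_mono n2 n3)
    also have "\<dots> = t\<^sup>2 * (A\<^sup>2 * (y\<^sup>2 * exp (A * y)) + 4 * A * y)" by (simp add: algebra_simps)
    also have "\<dots> \<le> t\<^sup>2 * ((A\<^sup>2 * exp A + 4 * A) * exp ((A + 2) * \<bar>x\<bar>))"
    proof (rule mult_left_mono)
      have "y\<^sup>2 \<le> exp (2 * \<bar>x\<bar>)" using power_mono[OF y(2), of 2] y by (simp add: exp_double)
      then have "y\<^sup>2 * exp (A * y) \<le> exp (2 * \<bar>x\<bar>) * exp (A * y)" by (rule mult_right_mono) simp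
      also have "\<dots> = exp A * exp ((A + 2) * \<bar>x\<bar>)" by (simp add: y_def mult_exp_exp algebra_simps)
      finally have 1: "A\<^sup>2 * (y\<^sup>2 * exp (A * y)) \<le> A\<^sup>2 * (exp A * exp ((A + 2) * \<bar>x\<bar>))" by (rule mult_left_mono) simp
      have "\<bar>x\<bar> \<le> (A + 2) * \<bar>x\<bar>" using A by (simp add: algebra_simps)
      then have "y \<le> exp ((A + 2) * \<bar>x\<bar>)" using y(2) by (intro order_trans[OF y(2)]) simp
      then have "4 * A * y \<le> 4 * A * exp ((A + 2) * \<bar>x\<bar>)" using A by (intro mult_left_mono) auto
      with 1 show "A\<^sup>2 * (y\<^sup>2 * exp (A * y)) + 4 * A * y \<le> (A\<^sup>2 * exp A + 4 * A) * exp ((A + 2) * \<bar>x\<bar>)"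
        by (simp add: algebra_simps)
    qed simp
    finally have n4: "norm (exp \<eta> - 1 - of_real t * (\<i> * (1 + 4 * of_real x * z - 4 * z\<^sup>2)))
        \<le> t\<^sup>2 * ((A\<^sup>2 * exp A + 4 * A) * exp ((A + 2) * \<bar>x\<bar>))" .
    have "cis t * coh (cis (2 * t) * z) x - coh z x - of_real t * osc_coh_rate z x =
        coh z x * (exp \<eta> - 1 - of_real t * (\<i> * (1 + 4 * of_real x * z - 4 * z\<^sup>2)))"
      unfolding split osc_coh_rate_def by (simp add: algebra_simps)
    then have "norm (cis t * coh (cis (2 * t) * z) x - coh z x - of_real t * osc_coh_rate z x) =
        norm (coh z x) * norm (exp \<eta> - 1 - of_real t * (\<i> * (1 + 4 * of_real x * z - 4 * z\<^sup>2)))"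
      by (simp add: norm_mult)
    also have "\<dots> \<le> (exp ((norm z)\<^sup>2) * exp (- x\<^sup>2 / 2 + 2 * norm z * \<bar>x\<bar>)) * (t\<^sup>2 * ((A\<^sup>2 * exp A + 4 * A) * exp ((A + 2) * \<bar>x\<bar>)))"
      by (intro mult_mono norm_coh_le n4) auto
    also have "\<dots> = t\<^sup>2 * (K * (exp (- x\<^sup>2 / 2 + 2 * norm z * \<bar>x\<bar>) * exp ((A + 2) * \<bar>x\<bar>)))"
      by (simp add: K_def)
    also have "exp (- x\<^sup>2 / 2 + 2 * norm z * \<bar>x\<bar>) * exp ((A + 2) * \<bar>x\<bar>) = exp (- x\<^sup>2 / 2 + M * \<bar>x\<bar>)"
      unfolding mult_exp_exp by (simp add: M_def algebra_simps)
    finally show "norm (cis t * coh (cis (2 * t) * z) x - coh z x - of_real t * osc_coh_rate z x)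
      \<le> t\<^sup>2 * (K * exp (- x\<^sup>2 / 2 + M * \<bar>x\<bar>))" .
  qed
qed

lemma coh_mult_id_L2: "(\<lambda>x. of_real x * coh z x) \<in> SQ"
proof (rule L2_dominated(1))
  show "(\<lambda>x. of_real (exp ((norm z)\<^sup>2)) * complex_of_real (exp (- x\<^sup>2 / 2 + (1 + 2 * norm z) * \<bar>x\<bar>))) \<in> SQ"
    by (intro L2_scale gauss_bound_L2)
  show "AE x in lborel. norm (of_real x * coh z x) \<le> norm (of_real (exp ((norm z)\<^sup>2)) * complex_of_real (exp (- x\<^sup>2 / 2 + (1 + 2 * norm z) * \<bar>x\<bar>)))"
  proof (rule AE_I2)
    fix x :: real
    have "norm (of_real x * coh z x) \<le> exp \<bar>x\<bar> * (exp ((norm z)\<^sup>2) * exp (- x\<^sup>2 / 2 + 2 * norm z * \<bar>x\<bar>))"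
      unfolding norm_mult using one_plus_le_exp[of x] by (intro mult_mono norm_coh_le) (auto simp del: exp_ge_add_one_self)
    also have "\<dots> = norm (of_real (exp ((norm z)\<^sup>2)) * complex_of_real (exp (- x\<^sup>2 / 2 + (1 + 2 * norm z) * \<bar>x\<bar>)))"
      by (simp add: norm_mult mult_exp_exp algebra_simps)
    finally show "norm (of_real x * coh z x) \<le> norm (of_real (exp ((norm z)\<^sup>2)) * complex_of_real (exp (- x\<^sup>2 / 2 + (1 + 2 * norm z) * \<bar>x\<bar>)))" .
  qed
qed measurable

lemma osc_coh_rate_L2 [simp, intro]: "osc_coh_rate z \<in> SQ"
proof -
  have "osc_coh_rate z = (\<lambda>x. (\<i> * (1 - 4 * z\<^sup>2)) * coh z x + (\<i> * 4 * z) * (of_real x * coh z x))"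
    by (simp add: osc_coh_rate_def fun_eq_iff algebra_simps)
  then show ?thesis by (simp only: L2_add L2_scale coh_L2 coh_mult_id_L2)
qed

lemma coh_rate_L2:
  obtains B where "\<And>t. \<bar>t\<bar> \<le> 1 \<Longrightarrow>
    nrm (\<lambda>x. cis t * coh (cis (2 * t) * z) x - coh z x - of_real t * osc_coh_rate z x) \<le> B * t\<^sup>2"
proof -
  obtain K M where K: "0 \<le> K" "\<And>t x. \<bar>t\<bar> \<le> 1 \<Longrightarrow>
    norm (cis t * coh (cis (2 * t) * z) x - coh z x - of_real t * osc_coh_rate z x)
      \<le> t\<^sup>2 * (K * exp (- x\<^sup>2 / 2 + M * \<bar>x\<bar>))" by (rule coh_rate_bound[where z = z]) blast
  let ?g = "\<lambda>x. complex_of_real (exp (- x\<^sup>2 / 2 + M * \<bar>x\<bar>))"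
  show ?thesis
  proof (rule that)
    fix t :: real assume t: "\<bar>t\<bar> \<le> 1"
    have "nrm (\<lambda>x. cis t * coh (cis (2 * t) * z) x - coh z x - of_real t * osc_coh_rate z x) \<le> nrm (\<lambda>x. of_real (t\<^sup>2 * K) * ?g x)"
    proof (rule L2_dominated(2)[OF L2_scale[OF gauss_bound_L2] L2_measurable])
      show "AE x in lborel. norm (cis t * coh (cis (2 * t) * z) x - coh z x - of_real t * osc_coh_rate z x) \<le> norm (of_real (t\<^sup>2 * K) * ?g x)"
        using K(2)[OF t] by (intro AE_I2) (simp only: norm_mult norm_of_real abs_mult abs_exp_cancel abs_of_nonneg[OF K(1)] abs_power2 mult.assoc)
    qed (intro L2_diff L2_scale coh_L2 osc_coh_rate_L2)
    also have "\<dots> = (K * nrm ?g) * t\<^sup>2"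
      using K(1) by (simp only: nrm_scale norm_of_real abs_mult abs_power2 abs_of_nonneg mult_ac)
    finally show "nrm (\<lambda>x. cis t * coh (cis (2 * t) * z) x - coh z x - of_real t * osc_coh_rate z x) \<le> (K * nrm ?g) * t\<^sup>2" .
  qed
qed

text \<open>The orbit runs backwards in time, hence the sign. Splitting off \<open>cis (- s)\<close>
  and moving the rotation by \<open>- 2 * s\<close> into the parameter turns the difference quotient
  at \<open>s\<close> into one at time 0, which \<open>coh_rate_L2\<close> controls.\<close>

lemma ip_coh_orbit_deriv:
  assumes f: "f \<in> SQ"
  shows "((\<lambda>s. ip f (\<lambda>x. cis (- s) * coh (cis (- (2 * s)) * z) x)) has_vector_derivative
     - ip f (\<lambda>x. cis (- s) * osc_coh_rate (cis (- (2 * s)) * z) x)) (at s)"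
proof -
  let ?w = "cis (- (2 * s)) * z"
  let ?q = "\<lambda>s. ip f (\<lambda>x. cis (- s) * coh (cis (- (2 * s)) * z) x)"
  let ?d = "- ip f (\<lambda>x. cis (- s) * osc_coh_rate ?w x)"
  obtain B where B: "\<And>t. \<bar>t\<bar> \<le> 1 \<Longrightarrow>
    nrm (\<lambda>x. cis t * coh (cis (2 * t) * ?w) x - coh ?w x - of_real t * osc_coh_rate ?w x) \<le> B * t\<^sup>2"
    by (rule coh_rate_L2[where z = ?w]) blast
  have bound: "norm (?q (s + t) - ?q s - t *\<^sub>R ?d) \<le> nrm f * (B * t\<^sup>2)" if t: "\<bar>t\<bar> \<le> 1" for t
  proof -
    let ?r = "\<lambda>x. cis (- t) * coh (cis (2 * - t) * ?w) x - coh ?w x - of_real (- t) * osc_coh_rate ?w x"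
    have r: "?r \<in> SQ" by (intro L2_diff L2_scale coh_L2 osc_coh_rate_L2)
    have 1: "(\<lambda>x. cis (- (s + t)) * coh (cis (- (2 * (s + t))) * z) x) = (\<lambda>x. cis (- s) * (cis (- t) * coh (cis (2 * - t) * ?w) x))"
    proof -
      have "cis (- (s + t)) = cis (- s) * cis (- t)" "cis (- (2 * (s + t))) = cis (2 * - t) * cis (- (2 * s))"
        by (simp_all add: cis_mult algebra_simps)
      then show ?thesis by (simp only: mult.assoc)
    qed
    have e: "?q (s + t) - ?q s - t *\<^sub>R ?d = ip f (\<lambda>x. cis (- s) * ?r x)"
      unfolding 1 ip_scale_right using f
      by (simp only: ip_diff_right ip_scale_right L2_diff L2_scale coh_L2 osc_coh_rate_L2)
         (simp add: scaleR_conv_of_real algebra_simps)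
    have n1: "norm (ip f (\<lambda>x. cis (- s) * ?r x)) \<le> nrm f * nrm (\<lambda>x. cis (- s) * ?r x)"
      using f r by (intro norm_ip_le L2_scale)
    have n2: "nrm (\<lambda>x. cis (- s) * ?r x) = nrm ?r" by (simp only: nrm_scale norm_cis mult_1)
    have n3: "nrm f * nrm ?r \<le> nrm f * (B * t\<^sup>2)"
    proof (rule mult_left_mono)
      show "nrm ?r \<le> B * t\<^sup>2" using B[of "- t"] t by (simp only: abs_minus_cancel power2_minus)
    qed simp
    show ?thesis unfolding e using n1[unfolded n2] n3 by (rule order_trans)
  qed
  have "(?q has_derivative (\<lambda>h. h *\<^sub>R ?d)) (at s)"
    unfolding has_derivative_at
  proof (intro conjI)
    show "bounded_linear (\<lambda>h. h *\<^sub>R ?d)" by (rule bounded_linear_scaleR_left)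
    show "(\<lambda>h. norm (?q (s + h) - ?q s - h *\<^sub>R ?d) / norm h) \<midarrow>0\<rightarrow> 0"
    proof (rule Lim_null_comparison)
      show "\<forall>\<^sub>F h in at 0. norm (norm (?q (s + h) - ?q s - h *\<^sub>R ?d) / norm h) \<le> nrm f * B * \<bar>h\<bar>"
        unfolding eventually_at
      proof (intro exI[of _ 1] conjI ballI impI)
        fix h :: real assume h: "h \<noteq> 0 \<and> dist h 0 < 1"
        then have "norm (?q (s + h) - ?q s - h *\<^sub>R ?d) \<le> nrm f * B * \<bar>h\<bar> * \<bar>h\<bar>"
          using bound[of h] by (simp add: power2_eq_square mult.assoc)
        then show "norm (norm (?q (s + h) - ?q s - h *\<^sub>R ?d) / norm h) \<le> nrm f * B * \<bar>h\<bar>"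
          using h by (simp add: divide_le_eq del: scaleR_minus_right)
      qed simp
      have "((\<lambda>h. nrm f * B * \<bar>h\<bar>) \<longlongrightarrow> nrm f * B * \<bar>0\<bar>) (at 0)" by (intro tendsto_intros)
      then show "((\<lambda>h. nrm f * B * \<bar>h\<bar>) \<longlongrightarrow> 0) (at 0)" by simp
    qed
  qed
  then show ?thesis by (simp only: has_vector_derivative_def)
qed


section \<open>Coherent states as Schwartz functions\<close>

lemma poly_coh_deriv:
  "((\<lambda>x. poly p (of_real x) * coh z x) has_vector_derivative
     poly (pderiv p + [:2 * z, -1:] * p) (of_real x) * coh z x) (at x)"
proof -
  have "((\<lambda>w. poly p w * exp (- w\<^sup>2 / 2 + 2 * w * z - z\<^sup>2)) has_field_derivative
     poly (pderiv p + [:2 * z, -1:] * p) (of_real x) * exp (- (of_real x)\<^sup>2 / 2 + 2 * of_real x * z - z\<^sup>2)) (at (of_real x))"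
    by (auto intro!: derivative_eq_intros poly_DERIV simp: algebra_simps)
  from has_vector_derivative_real_field[OF this] show ?thesis by (simp only: coh_def)
qed

lemma vderiv_eqI: "(\<And>x. (f has_vector_derivative f' x) (at x)) \<Longrightarrow> vderiv f = f'"
  unfolding vderiv_def by (auto simp: fun_eq_iff vector_derivative_at)

text \<open>The polynomial factors of the derivatives of \<open>coh z\<close>: the recursion is the
  product rule, with \<open>2 * z - x\<close> the logarithmic derivative of
  \<open>coh z\<close>.\<close>

fun coh_poly :: "complex \<Rightarrow> nat \<Rightarrow> complex poly" where
  "coh_poly z 0 = 1"
| "coh_poly z (Suc n) = pderiv (coh_poly z n) + [:2 * z, -1:] * coh_poly z n"

lemma vderiv_coh: "(vderiv ^^ n) (coh z) = (\<lambda>x. poly (coh_poly z n) (of_real x) * coh z x)"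
proof (induction n)
  case (Suc n)
  show ?case
    unfolding funpow.simps comp_def Suc coh_poly.simps by (rule vderiv_eqI) (rule poly_coh_deriv)
qed simp

lemma harmonic_oscillator_coh:
  "harmonic_oscillator (coh z) x = (1 + 4 * of_real x * z - 4 * z\<^sup>2) * coh z x"
  using vderiv_coh[of 2 z]
  by (simp add: harmonic_oscillator_def fun_eq_iff numeral_2_eq_2 pderiv_pCons one_pCons
      scaleR_conv_of_real algebra_simps power2_eq_square)

lemma osc_coh_rate_eq: "osc_coh_rate z x = \<i> * harmonic_oscillator (coh z) x"
  by (simp add: osc_coh_rate_def harmonic_oscillator_coh)

lemma norm_poly_le_exp:
  "\<exists>K m. 0 \<le> K \<and> 0 \<le> m \<and> (\<forall>x::real. norm (poly p (complex_of_real x)) \<le> K * exp (m * \<bar>x\<bar>))"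
proof (induction p)
  case 0
  show ?case by (intro exI[of _ 0]) auto
next
  case (pCons a p)
  then obtain K m where K: "0 \<le> K" "0 \<le> m" "\<And>x::real. norm (poly p (complex_of_real x)) \<le> K * exp (m * \<bar>x\<bar>)"
    by blast
  show ?case
  proof (rule exI[of _ "norm a + K"], rule exI[of _ "m + 1"], intro conjI allI)
    fix x :: real
    have "norm (poly (pCons a p) (complex_of_real x)) \<le> norm a + \<bar>x\<bar> * norm (poly p (complex_of_real x))"
      by (simp add: order_trans[OF norm_triangle_ineq] norm_mult)
    also have "\<dots> \<le> norm a * exp ((m + 1) * \<bar>x\<bar>) + exp \<bar>x\<bar> * (K * exp (m * \<bar>x\<bar>))"
    proof (intro add_mono mult_mono K)
      show "norm a \<le> norm a * exp ((m + 1) * \<bar>x\<bar>)"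
        using K by (simp add: mult_le_cancel_left1)
      show "\<bar>x\<bar> \<le> exp \<bar>x\<bar>" using one_plus_le_exp[of x] by linarith
    qed auto
    also have "exp \<bar>x\<bar> * (K * exp (m * \<bar>x\<bar>)) = K * exp ((m + 1) * \<bar>x\<bar>)"
      by (simp add: mult_exp_exp algebra_simps)
    finally show "norm (poly (pCons a p) (complex_of_real x)) \<le> (norm a + K) * exp ((m + 1) * \<bar>x\<bar>)"
      by (simp add: algebra_simps)
  qed (use K in auto)
qed

lemma schwartz_coh: "schwartz (coh z)"
  unfolding schwartz_def
proof (intro conjI allI)
  fix n :: nat and x :: real
  show "((vderiv ^^ n) (coh z)) differentiable at x"
    unfolding vderiv_coh by (rule differentiableI_vector) (rule poly_coh_deriv)
next
  fix n k :: nat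
  define q where "q = monom 1 k * coh_poly z n"
  have q: "(x ^ k) *\<^sub>R (vderiv ^^ n) (coh z) x = poly q (of_real x) * coh z x" for x
    unfolding vderiv_coh by (simp add: q_def poly_monom scaleR_conv_of_real)
  obtain K m where K: "0 \<le> K" "0 \<le> m" "\<And>x::real. norm (poly q (complex_of_real x)) \<le> K * exp (m * \<bar>x\<bar>)"
    using norm_poly_le_exp[of q] by blast
  define M where "M = m + 2 * norm z"
  have "norm (poly q (of_real x) * coh z x) \<le> K * exp ((norm z)\<^sup>2) * exp (M\<^sup>2 / 2)" for x
  proof -
    have "norm (poly q (of_real x) * coh z x) \<le> K * exp (m * \<bar>x\<bar>) * (exp ((norm z)\<^sup>2) * exp (- x\<^sup>2 / 2 + 2 * norm z * \<bar>x\<bar>))"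
      unfolding norm_mult using K by (intro mult_mono norm_coh_le) auto
    also have "\<dots> = K * exp ((norm z)\<^sup>2) * exp (M * \<bar>x\<bar> - x\<^sup>2 / 2)"
      by (simp add: mult_exp_exp M_def algebra_simps)
    also have "\<dots> \<le> K * exp ((norm z)\<^sup>2) * exp (M\<^sup>2 / 2)"
    proof -
      have "M * \<bar>x\<bar> - x\<^sup>2 / 2 \<le> M\<^sup>2 / 2"
        using zero_le_power2[of "M - \<bar>x\<bar>"] by (simp add: power2_diff)
      then show ?thesis using K by (intro mult_left_mono) auto
    qed
    finally show ?thesis .
  qed
  then show "bounded (range (\<lambda>x. (x ^ k) *\<^sub>R (vderiv ^^ n) (coh z) x))"
    unfolding q by (intro boundedI[of _ "K * exp ((norm z)\<^sup>2) * exp (M\<^sup>2 / 2)"]) auto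
qed

section \<open>Decay of Schwartz functions and symmetry of the oscillator\<close>

lemma schwartz_deriv:
  assumes "schwartz f"
  shows "((vderiv ^^ n) f has_vector_derivative (vderiv ^^ Suc n) f x) (at x)"
  using assms unfolding schwartz_def funpow.simps comp_def vderiv_def[of "(vderiv ^^ n) f"]
  by (simp add: vector_derivative_works[symmetric])

lemma schwartz_continuous: "schwartz f \<Longrightarrow> isCont ((vderiv ^^ n) f) x"
  using has_vector_derivative_continuous[OF schwartz_deriv] by blast

text \<open>Boundedness against the powers \<open>k\<close> and \<open>k + 2\<close> combines into
  quadratic decay, which serves both for square integrability and for boundary terms at
  infinity.\<close>

lemma schwartz_decay:
  assumes "schwartz f"
  obtains C where "0 \<le> C" "\<And>x. (1 + x\<^sup>2) * norm ((x ^ k) *\<^sub>R (vderiv ^^ n) f x) \<le> C"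
proof -
  have "\<exists>B. \<forall>x. norm ((x ^ j) *\<^sub>R (vderiv ^^ n) f x) \<le> B" for j
    using assms unfolding schwartz_def bounded_iff by blast
  then obtain B where B: "\<And>j x. norm ((x ^ j) *\<^sub>R (vderiv ^^ n) f x) \<le> B j"
    by metis
  show ?thesis
  proof (rule that[of "B k + B (k + 2)"])
    show "0 \<le> B k + B (k + 2)" using B[of 0 k] B[of 0 "k + 2"] norm_ge_zero order_trans add_nonneg_nonneg by metis
    show "(1 + x\<^sup>2) * norm ((x ^ k) *\<^sub>R (vderiv ^^ n) f x) \<le> B k + B (k + 2)" for x
      using B[of x k] B[of x "k + 2"] by (simp add: power_add abs_mult power_abs[symmetric] algebra_simps power2_eq_square)
  qed
qed

lemma integrable_inverse_1_plus_square_real: "integrable lborel (\<lambda>x::real. inverse (1 + x\<^sup>2))"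
  using integrable_inverse_1_plus_square by (simp add: set_integrable_def)

lemma L2_decay:
  assumes [measurable]: "f \<in> borel_measurable borel" and le: "\<And>x. (1 + x\<^sup>2) * norm (f x) \<le> C"
  shows "f \<in> SQ"
proof -
  have C: "norm (f x) \<le> C * inverse (1 + x\<^sup>2)" for x
    using le[of x] by (simp add: field_simps add_pos_nonneg)
  have "integrable lborel (\<lambda>x. (norm (f x))\<^sup>2)"
  proof (rule Bochner_Integration.integrable_bound)
    show "integrable lborel (\<lambda>x. C\<^sup>2 * inverse (1 + x\<^sup>2))"
      by (intro integrable_mult_right integrable_inverse_1_plus_square_real)
    show "AE x in lborel. norm ((norm (f x))\<^sup>2) \<le> norm (C\<^sup>2 * inverse (1 + x\<^sup>2))"
    proof (rule AE_I2)
      fix x :: real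
      have "(norm (f x))\<^sup>2 \<le> (C * inverse (1 + x\<^sup>2))\<^sup>2" by (intro power_mono C) simp
      also have "\<dots> = C\<^sup>2 * inverse (1 + x\<^sup>2) * inverse (1 + x\<^sup>2)" by (simp add: power2_eq_square)
      also have "\<dots> \<le> C\<^sup>2 * inverse (1 + x\<^sup>2) * 1"
        by (intro mult_left_mono) (auto simp: inverse_le_1_iff add_pos_nonneg intro!: mult_nonneg_nonneg)
      finally show "norm ((norm (f x))\<^sup>2) \<le> norm (C\<^sup>2 * inverse (1 + x\<^sup>2))" by simp
    qed
  qed measurable
  then show ?thesis by (simp add: L2_iff)
qed

lemma schwartz_vderiv_measurable: "schwartz f \<Longrightarrow> (vderiv ^^ n) f \<in> borel_measurable borel"
  by (intro borel_measurable_continuous_onI) (auto simp: continuous_on_eq_continuous_at schwartz_continuous)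

lemma schwartz_L2: "schwartz f \<Longrightarrow> (\<lambda>x. (x ^ k) *\<^sub>R (vderiv ^^ n) f x) \<in> SQ"
proof -
  assume f: "schwartz f"
  obtain C where "\<And>x. (1 + x\<^sup>2) * norm ((x ^ k) *\<^sub>R (vderiv ^^ n) f x) \<le> C"
    using schwartz_decay[OF f] by metis
  moreover have "(\<lambda>x. (x ^ k) *\<^sub>R (vderiv ^^ n) f x) \<in> borel_measurable borel"
    using schwartz_vderiv_measurable[OF f] by measurable
  ultimately show ?thesis by (intro L2_decay)
qed

lemma schwartz_in_L2: "schwartz f \<Longrightarrow> f \<in> SQ"
  using schwartz_L2[of f 0 0] by simp

lemma harmonic_oscillator_eq:
  "harmonic_oscillator f = (\<lambda>x. (x ^ 2) *\<^sub>R (vderiv ^^ 0) f x - (x ^ 0) *\<^sub>R (vderiv ^^ 2) f x)"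
  by (simp add: harmonic_oscillator_def numeral_2_eq_2)

lemma harmonic_oscillator_L2: "schwartz f \<Longrightarrow> harmonic_oscillator f \<in> SQ"
  unfolding harmonic_oscillator_eq by (intro L2_diff schwartz_L2)

lemma tendsto_0_decay:
  fixes f :: "real \<Rightarrow> complex"
  assumes le: "\<And>x. (1 + x\<^sup>2) * norm (f x) \<le> C"
  shows "(f \<longlongrightarrow> 0) at_top" "(f \<longlongrightarrow> 0) at_bot"
proof -
  have C: "norm (f x) \<le> C * inverse (1 + x\<^sup>2)" for x
    using le[of x] by (simp add: field_simps add_pos_nonneg)
  have *: "(f \<longlongrightarrow> 0) F" if "filterlim (\<lambda>x::real. 1 + x\<^sup>2) at_top F" for F
  proof (rule Lim_null_comparison)
    show "\<forall>\<^sub>F x in F. norm (f x) \<le> C * inverse (1 + x\<^sup>2)" by (intro always_eventually allI C)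
    show "((\<lambda>x. C * inverse (1 + x\<^sup>2)) \<longlongrightarrow> 0) F"
      by (intro tendsto_mult_right_zero tendsto_inverse_0_at_top that)
  qed
  have "filterlim (\<lambda>x::real. 1 + x\<^sup>2) at_top at_top" "filterlim (\<lambda>x::real. 1 + x\<^sup>2) at_top at_bot"
    by (intro filterlim_tendsto_add_at_top[OF tendsto_const]
        filterlim_pow_at_top filterlim_pow_at_bot_even filterlim_ident; simp)+
  from this[THEN *] show "(f \<longlongrightarrow> 0) at_top" "(f \<longlongrightarrow> 0) at_bot" .
qed

text \<open>The potential terms cancel. What is left of the difference of the integrands is the
  derivative of the Wronskian \<open>k\<close>, which vanishes at both ends of the line.\<close>

lemma harmonic_oscillator_symmetric:
  assumes f: "schwartz f" and g: "schwartz g"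
  shows "ip (harmonic_oscillator f) g = ip f (harmonic_oscillator g)"
proof -
  define F where "F n = (vderiv ^^ n) f" for n
  define G where "G n = (vderiv ^^ n) g" for n
  have F: "(F n has_vector_derivative F (Suc n) x) (at x)" for n x
    unfolding F_def by (rule schwartz_deriv[OF f])
  have G: "(G n has_vector_derivative G (Suc n) x) (at x)" for n x
    unfolding G_def by (rule schwartz_deriv[OF g])
  have FG: "F 0 = f" "G 0 = g" by (simp_all add: F_def G_def)
  define k where "k x = F 0 x * cnj (G 1 x) - F 1 x * cnj (G 0 x)" for x
  define k' where "k' x = F 0 x * cnj (G 2 x) - F 2 x * cnj (G 0 x)" for x
  have H: "harmonic_oscillator f = (\<lambda>x. (x\<^sup>2) *\<^sub>R F 0 x - F 2 x)" "harmonic_oscillator g = (\<lambda>x. (x\<^sup>2) *\<^sub>R G 0 x - G 2 x)"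
    unfolding harmonic_oscillator_eq F_def G_def by simp_all
  have k': "harmonic_oscillator f x * cnj (g x) - f x * cnj (harmonic_oscillator g x) = k' x" for x
    unfolding H k'_def FG by (simp add: algebra_simps scaleR_conv_of_real)
  note L2s = schwartz_in_L2[OF f] schwartz_in_L2[OF g] harmonic_oscillator_L2[OF f] harmonic_oscillator_L2[OF g]
  have int: "integrable lborel k'"
    unfolding k'[symmetric] using L2s by (intro Bochner_Integration.integrable_diff ip_integrable)
  have dk: "(k has_vector_derivative k' x) (at x)" for x
  proof -
    have "((\<lambda>x. F 0 x * cnj (G 1 x) - F 1 x * cnj (G 0 x)) has_vector_derivative
       (F 0 x * cnj (G (Suc 1) x) + F (Suc 0) x * cnj (G 1 x)) - (F 1 x * cnj (G (Suc 0) x) + F (Suc 1) x * cnj (G 0 x))) (at x)"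
      by (intro has_vector_derivative_diff has_vector_derivative_mult has_vector_derivative_cnj F G)
    then show ?thesis unfolding k_def[abs_def] k'_def by (simp add: numeral_2_eq_2)
  qed
  obtain C0 where C0: "0 \<le> C0" "\<And>x. (1 + x\<^sup>2) * norm (F 0 x) \<le> C0" using schwartz_decay[OF f, of 0 0] by (auto simp: F_def)
  obtain C1 where C1: "0 \<le> C1" "\<And>x. (1 + x\<^sup>2) * norm (F 1 x) \<le> C1" using schwartz_decay[OF f, of 0 1] by (auto simp: F_def)
  have bG: "\<exists>B\<ge>0. \<forall>x. norm (G n x) \<le> B" for n
  proof -
    obtain C where "0 \<le> C" "\<And>x. (1 + x\<^sup>2) * norm (G n x) \<le> C" using schwartz_decay[OF g, of 0 n] by (auto simp: G_def)
    moreover have "norm (G n x) \<le> (1 + x\<^sup>2) * norm (G n x)" for x by (simp add: algebra_simps)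
    ultimately show ?thesis by (meson order_trans)
  qed
  obtain B0 where B0: "0 \<le> B0" "\<And>x. norm (G 0 x) \<le> B0" using bG by blast
  obtain B1 where B1: "0 \<le> B1" "\<And>x. norm (G 1 x) \<le> B1" using bG by blast
  have dec: "(1 + x\<^sup>2) * norm (k x) \<le> C0 * B1 + C1 * B0" for x
  proof -
    have "(1 + x\<^sup>2) * norm (k x) \<le> (1 + x\<^sup>2) * (norm (F 0 x) * norm (G 1 x) + norm (F 1 x) * norm (G 0 x))"
      unfolding k_def by (intro mult_left_mono order_trans[OF norm_triangle_ineq4]) (auto simp: norm_mult)
    also have "\<dots> = ((1 + x\<^sup>2) * norm (F 0 x)) * norm (G 1 x) + ((1 + x\<^sup>2) * norm (F 1 x)) * norm (G 0 x)"
      by (simp add: algebra_simps)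
    also have "\<dots> \<le> C0 * B1 + C1 * B0"
      using C0 C1 B0 B1 by (intro add_mono mult_mono) auto
    finally show ?thesis .
  qed
  have cont: "isCont k' x" for x
    unfolding k'_def using schwartz_continuous[OF f] schwartz_continuous[OF g]
    by (intro continuous_intros) (simp_all only: F_def G_def)
  have "(LBINT x=-\<infinity>..\<infinity>. k' x) = 0 - 0"
    by (rule interval_integral_FTC_integrable[where F = k])
       (use dk cont int tendsto_0_decay[OF dec] in \<open>auto simp: set_integrable_def ereal_tendsto_simps\<close>)
  then have "(LINT x|lborel. k' x) = 0"
    by (simp add: interval_lebesgue_integral_def set_lebesgue_integral_def)
  then show ?thesis
    unfolding k'[symmetric] ip_def using L2s
    by (subst (asm) Bochner_Integration.integral_diff) auto
qed

text \<open>Unitarity moves the flow onto the coherent state, whose orbit is differentiated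
  explicitly, and symmetry moves the oscillator back onto \<open>f\<close>. Differentiability of the
  orbit of \<open>f\<close> itself is thus obtained weakly, from that of coherent states.\<close>

lemma ip_osc_comb_deriv:
  assumes f: "schwartz f"
  defines "h \<equiv> \<lambda>x. \<i> * harmonic_oscillator f x"
  shows "((\<lambda>s. ip (osc s f) (comb cs 1)) has_vector_derivative ip (osc s h) (comb cs 1)) (at s)"
proof -
  note L [simp] = schwartz_in_L2[OF f] harmonic_oscillator_L2[OF f]
  have h [simp]: "h \<in> SQ" unfolding h_def by simp
  have coh: "((\<lambda>s. ip (osc s f) (coh z)) has_vector_derivative ip (osc s h) (coh z)) (at s)" for z
  proof -
    let ?w = "cis (- (2 * s)) * z"
    have "ip f (osc_coh_rate ?w) = - \<i> * ip f (harmonic_oscillator (coh ?w))"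
      unfolding osc_coh_rate_eq[abs_def] ip_scale_right by simp
    then have "- ip f (\<lambda>x. cis (- s) * osc_coh_rate ?w x) = \<i> * ip f (harmonic_oscillator (coh ?w)) * cis s"
      unfolding ip_scale_right by (simp add: cis_cnj)
    also have "ip f (harmonic_oscillator (coh ?w)) = ip (harmonic_oscillator f) (coh ?w)"
      by (rule harmonic_oscillator_symmetric[symmetric, OF f schwartz_coh])
    also have "\<i> * ip (harmonic_oscillator f) (coh ?w) * cis s = ip (osc s h) (coh z)"
      unfolding ip_osc_coh[OF h] ip_scale_right by (simp add: h_def ip_scale_left cis_cnj)
    finally show ?thesis
      using ip_coh_orbit_deriv[of f z s] by (simp add: ip_osc_coh)
  qed
  show ?thesis
  proof (induction cs)
    case (Cons c cs)
    obtain a z where c: "c = (a, z)" by (cases c)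
    have "((\<lambda>s. cnj a * ip (osc s f) (coh z) + ip (osc s f) (comb cs 1)) has_vector_derivative
        cnj a * ip (osc s h) (coh z) + ip (osc s h) (comb cs 1)) (at s)"
      by (intro has_vector_derivative_add has_vector_derivative_mult_right coh Cons)
    then show ?case by (simp add: c ip_add_right ip_scale_right)
  qed simp
qed

text \<open>Duhamel's formula, tested against the dense span of the coherent states.\<close>

lemma osc_generator_bound:
  assumes f: "schwartz f"
  defines "h \<equiv> \<lambda>x. \<i> * harmonic_oscillator f x"
  assumes B: "\<And>s. \<bar>s\<bar> \<le> \<bar>t\<bar> \<Longrightarrow> nrm (\<lambda>x. osc s h x - h x) \<le> B"
  shows "nrm (\<lambda>x. osc t f x - f x - of_real t * h x) \<le> B * \<bar>t\<bar>"
proof (rule nrm_le_dual)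
  note L [simp] = schwartz_in_L2[OF f] harmonic_oscillator_L2[OF f]
  have h [simp]: "h \<in> SQ" unfolding h_def by simp
  have B0: "0 \<le> B" using order_trans[OF nrm_nonneg B[of 0]] by simp
  then show "0 \<le> B * \<bar>t\<bar>" by simp
  show "(\<lambda>x. osc t f x - f x - of_real t * h x) \<in> SQ" by simp
  fix cs
  let ?d = "comb cs 1"
  let ?Q = "\<lambda>s. ip (osc s f) ?d - s *\<^sub>R ip h ?d"
  \<comment> \<open>The derivative of \<open>?Q\<close> at \<open>s\<close> is the pairing of
    \<open>osc s h - h\<close>, of norm at most \<open>B\<close>, with the test function; the mean
    value inequality integrates this bound.\<close>
  have "norm (?Q t - ?Q 0) \<le> (B * nrm ?d) * norm (t - 0)"
  proof (rule differentiable_bound)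
    show "convex (cball (0::real) \<bar>t\<bar>)" by (rule convex_cball)
    fix s :: real assume s: "s \<in> cball 0 \<bar>t\<bar>"
    have "((\<lambda>s. s *\<^sub>R ip h ?d) has_vector_derivative ip h ?d) (at s)"
      by (simp add: has_vector_derivative_def bounded_linear_imp_has_derivative bounded_linear_scaleR_left)
    then have "(?Q has_vector_derivative ip (osc s h) ?d - ip h ?d) (at s)"
      unfolding h_def by (intro has_vector_derivative_diff ip_osc_comb_deriv[OF f])
    then show "(?Q has_derivative (\<lambda>x. x *\<^sub>R (ip (osc s h) ?d - ip h ?d))) (at s within cball 0 \<bar>t\<bar>)"
      by (simp add: has_vector_derivative_def has_derivative_at_withinI)
    have "ip (osc s h) ?d - ip h ?d = ip (\<lambda>x. osc s h x - h x) ?d" by (simp add: ip_diff_left)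
    also have "norm \<dots> \<le> nrm (\<lambda>x. osc s h x - h x) * nrm ?d" by (rule norm_ip_le) auto
    also have "\<dots> \<le> B * nrm ?d" using s by (intro mult_right_mono B) (auto simp: dist_norm)
    finally have "norm (ip (osc s h) ?d - ip h ?d) \<le> B * nrm ?d" .
    then show "onorm (\<lambda>x. x *\<^sub>R (ip (osc s h) ?d - ip h ?d)) \<le> B * nrm ?d"
      by (intro onorm_le) (auto simp: mult.commute intro: mult_left_mono)
  qed (auto simp: dist_norm)
  also have "?Q t - ?Q 0 = ip (\<lambda>x. osc t f x - f x - of_real t * h x) ?d"
  proof -
    have "ip (osc 0 f) ?d = ip f ?d"
      using osc_0[of f] by (intro ip_cong_AE) (auto intro: L2_measurable)
    then show ?thesis by (simp add: ip_diff_left ip_scale_left scaleR_conv_of_real)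
  qed
  finally show "norm (ip (\<lambda>x. osc t f x - f x - of_real t * h x) ?d) \<le> B * \<bar>t\<bar> * nrm ?d"
    by (simp add: mult_ac)
qed

text \<open>Strong continuity of the group at the function \<open>\<i> H f\<close> makes the
  constant of \<open>osc_generator_bound\<close> as small as desired.\<close>

lemma osc_generator:
  assumes f: "schwartz f"
  shows "((\<lambda>t. nrm (\<lambda>x. (osc t f x - f x) / of_real t - \<i> * harmonic_oscillator f x)) \<longlongrightarrow> 0) (at 0)"
proof (rule tendstoI)
  fix e :: real assume e: "0 < e"
  let ?h = "\<lambda>x. \<i> * harmonic_oscillator f x"
  have h: "?h \<in> SQ" using harmonic_oscillator_L2[OF f] by simp
  have "\<forall>\<^sub>F s in at 0. dist (nrm (\<lambda>x. osc s ?h x - ?h x)) 0 < e / 2"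
    by (rule tendstoD[OF osc_tendsto[OF h]]) (use e in simp)
  then obtain d where d: "d > 0" "\<And>s. s \<noteq> 0 \<Longrightarrow> \<bar>s\<bar> < d \<Longrightarrow> nrm (\<lambda>x. osc s ?h x - ?h x) < e / 2"
    unfolding eventually_at by (auto simp: dist_norm)
  have z: "nrm (\<lambda>x. osc 0 ?h x - ?h x) = 0"
    using osc_0[OF h] h by (subst nrm_diff_eq_0_iff) auto
  show "\<forall>\<^sub>F t in at 0. dist (nrm (\<lambda>x. (osc t f x - f x) / of_real t - ?h x)) 0 < e"
    unfolding eventually_at
  proof (intro exI[of _ d] conjI ballI impI d)
    fix t :: real assume t: "t \<noteq> 0 \<and> dist t 0 < d"
    have le: "nrm (\<lambda>x. osc t f x - f x - of_real t * ?h x) \<le> (e / 2) * \<bar>t\<bar>"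
    proof (rule osc_generator_bound[OF f])
      fix s assume "\<bar>s\<bar> \<le> \<bar>t\<bar>"
      then show "nrm (\<lambda>x. osc s ?h x - ?h x) \<le> e / 2"
        using d(2)[of s] z e t by (cases "s = 0") (auto simp: dist_norm intro: less_imp_le)
    qed
    have "(\<lambda>x. (osc t f x - f x) / of_real t - ?h x) = (\<lambda>x. (1 / of_real t) * (osc t f x - f x - of_real t * ?h x))"
      using t by (simp add: fun_eq_iff field_simps)
    then have "nrm (\<lambda>x. (osc t f x - f x) / of_real t - ?h x) = (1 / \<bar>t\<bar>) * nrm (\<lambda>x. osc t f x - f x - of_real t * ?h x)"
      by (simp only: nrm_scale norm_divide norm_one norm_of_real)
    also have "\<dots> \<le> (1 / \<bar>t\<bar>) * ((e / 2) * \<bar>t\<bar>)" by (rule mult_left_mono[OF le]) simp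
    also have "\<dots> = e / 2" using t by simp
    finally show "dist (nrm (\<lambda>x. (osc t f x - f x) / of_real t - ?h x)) 0 < e"
      using e by (simp add: dist_norm)
  qed
qed

lemma L2_divide [simp, intro]: "f \<in> SQ \<Longrightarrow> (\<lambda>x. f x / c) \<in> SQ"
  using L2_scale[of f "1 / c"] by simp

lemma propagator_osc: "is_propagator osc"
  unfolding is_propagator_def
proof (intro conjI allI impI unitary_group_osc)
  fix f assume f: "schwartz f"
  have "(\<lambda>x. (osc r f x - f x) / complex_of_real r) \<in> SQ" for r
    using schwartz_in_L2[OF f] by (intro L2_divide L2_diff osc_L2)
  moreover have "(\<lambda>x. \<i> * harmonic_oscillator f x) \<in> SQ"
    using harmonic_oscillator_L2[OF f] by (rule L2_scale)
  ultimately show "L2_tendsto (\<lambda>t x. (osc t f x - f x) / complex_of_real t) (\<lambda>x. \<i> * harmonic_oscillator f x) (at 0)"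
    by (subst L2_tendsto_iff) (auto intro!: osc_generator[OF f])
qed

text \<open>\<open>ip (osc t (coh z)) (U t g)\<close> has derivative zero in \<open>t\<close>.\<close>

lemma propagator_unique:
  assumes U: "is_propagator U" and g: "g \<in> SQ"
  shows "AE x in lborel. U t g x = osc t g x"
proof -
  have U_L2: "U t f \<in> SQ" and U_nrm: "nrm (U t f) = nrm f" if "f \<in> SQ" for t f
    using U that unfolding is_propagator_def unitary_group_def L2_eq Lp_norm_2_eq by blast+
  have U_lin: "AE x in lborel. U t (\<lambda>y. a * f y + b * k y) x = a * U t f x + b * U t k x"
    if "f \<in> SQ" "k \<in> SQ" for t a b f k
    using U that unfolding is_propagator_def unitary_group_def L2_eq Lp_norm_2_eq by blast
  have U_0: "AE x in lborel. U 0 f x = f x" if "f \<in> SQ" for f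
    using U that unfolding is_propagator_def unitary_group_def L2_eq Lp_norm_2_eq by blast
  have U_add: "AE x in lborel. U (s + t) f x = U s (U t f) x" if "f \<in> SQ" for s t f
    using U that unfolding is_propagator_def unitary_group_def L2_eq Lp_norm_2_eq by blast
  have U_gen: "L2_tendsto (\<lambda>t x. (U t f x - f x) / complex_of_real t) (\<lambda>x. \<i> * harmonic_oscillator f x) (at 0)"
    if "schwartz f" for f
    using U that unfolding is_propagator_def by blast
  have U_ip: "ip (U t f) (U t k) = ip f k" if "f \<in> SQ" "k \<in> SQ" for t f k
    using that by (intro isometry_ip U_L2 U_nrm U_lin)
  define \<phi> where "\<phi> z t = ip (osc t (coh z)) (U t g)" for z t
  have deriv: "(\<phi> z has_vector_derivative 0) (at t)" for z t
  proof -
    define w where "w = cis (2 * t) * z"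
    define v where "v = U t g"
    have v [simp]: "v \<in> SQ" unfolding v_def using g by (rule U_L2)
    note [simp] = U_L2
    have step: "\<phi> z (t + h) = cis t * ip (osc h (coh w)) (U h v)" for h
    proof -
      have 1: "AE x in lborel. osc (t + h) (coh z) x = cis t * osc h (coh w) x"
      proof -
        have "AE x in lborel. osc (h + t) (coh z) x = osc h (osc t (coh z)) x" by (rule osc_add) simp
        moreover have "AE x in lborel. osc h (osc t (coh z)) x = osc h (\<lambda>x. cis t * coh w x) x"
          using osc_coh[of t z] by (intro osc_cong) (auto simp: w_def)
        moreover have "AE x in lborel. osc h (\<lambda>x. cis t * coh w x) x = cis t * osc h (coh w) x"
          using osc_lin[of "coh w" "\<lambda>x. 0" h "cis t" 0] by simp
        ultimately show ?thesis by eventually_elim (simp add: add.commute)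
      qed
      have 2: "AE x in lborel. U (t + h) g x = U h v x"
        using U_add[OF g, of h t] by (simp add: v_def add.commute)
      have "\<phi> z (t + h) = ip (\<lambda>x. cis t * osc h (coh w) x) (U h v)"
        unfolding \<phi>_def using g by (intro ip_cong_AE 1 2 L2_measurable) auto
      then show ?thesis by (simp add: ip_scale_left)
    qed
    \<comment> \<open>Unitarity of \<open>U h\<close> brings the value at \<open>t\<close> to the
      same second argument \<open>U h v\<close> as the value at \<open>t + h\<close>. The difference
      then pairs \<open>U h v\<close> with \<open>osc h (coh w) - U h (coh w)\<close>, where both
      orbits start at \<open>coh w\<close> with the same velocity.\<close>
    have base: "\<phi> z t = cis t * ip (U h (coh w)) (U h v)" for h
    proof -
      have "\<phi> z t = ip (\<lambda>x. cis t * coh w x) v"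
        unfolding \<phi>_def v_def[symmetric] using osc_coh[of t z]
        by (intro ip_cong_AE L2_measurable) (auto simp: w_def)
      then show ?thesis by (simp add: ip_scale_left U_ip)
    qed
    let ?h = "\<lambda>x. \<i> * harmonic_oscillator (coh w) x"
    have hh [simp]: "?h \<in> SQ" using harmonic_oscillator_L2[OF schwartz_coh] by simp
    let ?a = "\<lambda>h. nrm (\<lambda>x. (osc h (coh w) x - coh w x) / of_real h - ?h x)"
    let ?b = "\<lambda>h. nrm (\<lambda>x. (U h (coh w) x - coh w x) / of_real h - ?h x)"
    have bound: "norm (\<phi> z (t + h) - \<phi> z t) / norm h \<le> (?a h + ?b h) * nrm v" if h: "h \<noteq> 0" for h
    proof -
      have "\<phi> z (t + h) - \<phi> z t = cis t * ip (\<lambda>x. osc h (coh w) x - U h (coh w) x) (U h v)"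
        unfolding step base[of h] by (simp add: ip_diff_left algebra_simps)
      then have "norm (\<phi> z (t + h) - \<phi> z t) \<le> nrm (\<lambda>x. osc h (coh w) x - U h (coh w) x) * nrm v"
        using norm_ip_le[of "\<lambda>x. osc h (coh w) x - U h (coh w) x" "U h v"] by (simp add: norm_mult U_nrm)
      also have "(\<lambda>x. osc h (coh w) x - U h (coh w) x) =
        (\<lambda>x. of_real h * (((osc h (coh w) x - coh w x) / of_real h - ?h x) - ((U h (coh w) x - coh w x) / of_real h - ?h x)))"
        using h by (simp add: fun_eq_iff field_simps)
      also have "nrm \<dots> = \<bar>h\<bar> * nrm (\<lambda>x. ((osc h (coh w) x - coh w x) / of_real h - ?h x) - ((U h (coh w) x - coh w x) / of_real h - ?h x))"
        by (simp only: nrm_scale norm_of_real)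
      also have "nrm (\<lambda>x. ((osc h (coh w) x - coh w x) / of_real h - ?h x) - ((U h (coh w) x - coh w x) / of_real h - ?h x)) \<le> ?a h + ?b h"
        by (intro nrm_diff_le L2_diff L2_divide hh U_L2 osc_L2 coh_L2)
      finally have "norm (\<phi> z (t + h) - \<phi> z t) \<le> \<bar>h\<bar> * (?a h + ?b h) * nrm v"
        by (simp add: mult_left_mono mult_right_mono)
      then show ?thesis using h by (simp add: divide_le_eq mult_ac)
    qed
    have "((\<lambda>h. (?a h + ?b h) * nrm v) \<longlongrightarrow> (0 + 0) * nrm v) (at 0)"
    proof (intro tendsto_intros)
      show "(?a \<longlongrightarrow> 0) (at 0)" by (rule osc_generator[OF schwartz_coh])
      show "(?b \<longlongrightarrow> 0) (at 0)"
        using U_gen[OF schwartz_coh, of w] by (subst (asm) L2_tendsto_iff) auto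
    qed
    then have lim: "((\<lambda>h. (?a h + ?b h) * nrm v) \<longlongrightarrow> 0) (at 0)" by simp
    have "(\<lambda>h. norm (\<phi> z (t + h) - \<phi> z t) / norm h) \<midarrow>0\<rightarrow> 0"
    proof (rule Lim_null_comparison[OF _ lim])
      show "\<forall>\<^sub>F h in at 0. norm (norm (\<phi> z (t + h) - \<phi> z t) / norm h) \<le> (?a h + ?b h) * nrm v"
        unfolding eventually_at using bound by (intro exI[of _ 1]) auto
    qed
    then show ?thesis
      unfolding has_vector_derivative_def has_derivative_at by (simp add: bounded_linear_zero)
  qed
  have const: "\<phi> z t = ip (coh z) g" for z t
  proof -
    have "\<phi> z t = \<phi> z 0"
    proof (rule has_vector_derivative_zero_constant[of UNIV "\<phi> z"])
      show "convex (UNIV :: real set)" by simp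
      show "(\<phi> z has_vector_derivative 0) (at x within UNIV)" for x using deriv by simp
    qed (metis UNIV_I)
    also have "\<phi> z 0 = ip (coh z) g"
      unfolding \<phi>_def using osc_0[of "coh z"] U_0[OF g] g by (intro ip_cong_AE L2_measurable) (auto simp: U_L2)
    finally show ?thesis .
  qed
  let ?r = "\<lambda>x. U t g x - osc t g x"
  have r: "?r \<in> SQ" using g by (intro L2_diff U_L2 osc_L2)
  have "ip ?r (coh \<zeta>) = 0" for \<zeta>
  proof -
    define z where "z = cis (- (2 * t)) * \<zeta>"
    have \<zeta>: "cis (2 * t) * z = \<zeta>" by (simp add: z_def mult.assoc[symmetric] cis_mult)
    have "ip (osc t (coh z)) ?r = \<phi> z t - ip (osc t (coh z)) (osc t g)"
      unfolding \<phi>_def using g by (intro ip_diff_right U_L2 osc_L2) auto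
    also have "\<dots> = 0" using g by (simp add: const ip_osc)
    finally have "ip (\<lambda>x. cis t * coh \<zeta> x) ?r = 0"
      using osc_coh[of t z] r by (subst ip_cong_AE[of _ "osc t (coh z)" _ ?r]) (auto simp: \<zeta> intro: L2_measurable)
    then have "ip (coh \<zeta>) ?r = 0" by (simp add: ip_scale_left)
    then show ?thesis using ip_cnj[of "coh \<zeta>" ?r] by simp
  qed
  from L2_orth_coh_AE[OF r this] show ?thesis by simp
qed

text \<open>\<open>propagator_osc\<close> shows that the choice defining \<open>expitH\<close> has a
  witness, and uniqueness identifies it. The exceptional set depends on \<open>t\<close> and
  \<open>g\<close>.\<close>

lemma expitH_AE: "g \<in> SQ \<Longrightarrow> AE x in lborel. expitH t g x = osc t g x"
  by (rule propagator_unique) (auto simp: expitH_def intro: someI[of is_propagator] propagator_osc)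

lemma expitH_L2: "g \<in> SQ \<Longrightarrow> expitH t g \<in> SQ"
proof -
  have "is_propagator expitH" unfolding expitH_def by (rule someI[of is_propagator]) (rule propagator_osc)
  then show "g \<in> SQ \<Longrightarrow> expitH t g \<in> SQ"
    unfolding is_propagator_def unitary_group_def L2_eq by blast
qed

section \<open>The Fourier transform as a rotation of coherent states\<close>

text \<open>The Fourier integral over the whole line, to be applied to truncated functions, for
  which it converges.\<close>

definition fhat :: "(real \<Rightarrow> complex) \<Rightarrow> real \<Rightarrow> complex" where
  "fhat f \<xi> = complex_of_real ((2 * pi) powr (- 1 / 2)) *
     (LINT x|lborel. exp (- (\<i> * complex_of_real (x * \<xi>))) * f x)"

lemma powr_minus_half_2pi: "(2 * pi) powr (- 1 / 2) = 1 / sqrt (2 * pi)"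
  by (simp add: powr_minus_divide powr_half_sqrt)

lemma inverse_fourier_coh:
  "has_bochner_integral lborel (\<lambda>\<xi>. exp (\<i> * complex_of_real (x * \<xi>)) * coh z \<xi>)
     (complex_of_real (sqrt (2 * pi)) * coh (\<i> * z) x)"
proof -
  have eq: "exp (\<i> * complex_of_real (x * \<xi>)) * coh z \<xi> =
      exp (- z\<^sup>2) * exp (complex_of_real (- ((1/2) * \<xi>\<^sup>2)) + 2 * of_real \<xi> * (z + \<i> * of_real x / 2))" for \<xi>
    by (simp add: coh_def mult_exp_exp algebra_simps)
  have "exp (- z\<^sup>2) * exp ((z + \<i> * of_real x / 2)\<^sup>2 / of_real (1/2)) = coh (\<i> * z) x"
    unfolding coh_def mult_exp_exp by (simp add: power2_sum power_mult_distrib power_divide algebra_simps)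
  then have v: "exp (- z\<^sup>2) * (complex_of_real (sqrt (pi / (1/2))) * exp ((z + \<i> * of_real x / 2)\<^sup>2 / of_real (1/2))) =
      complex_of_real (sqrt (2 * pi)) * coh (\<i> * z) x"
    by (simp add: mult.left_commute[of "exp (- _)"] mult.commute[of pi])
  have "has_bochner_integral lborel (\<lambda>\<xi>. exp (- z\<^sup>2) * exp (complex_of_real (- ((1/2) * \<xi>\<^sup>2)) + 2 * of_real \<xi> * (z + \<i> * of_real x / 2)))
    (exp (- z\<^sup>2) * (complex_of_real (sqrt (pi / (1/2))) * exp ((z + \<i> * of_real x / 2)\<^sup>2 / of_real (1/2))))"
    by (intro has_bochner_integral_mult_right gaussian_complex) simp
  then show ?thesis unfolding eq v .
qed

lemma coh_integrable: "integrable lborel (coh z)"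
  using inverse_fourier_coh[of 0 z] by (simp add: has_bochner_integral_iff)

lemma fhat_measurable [measurable]:
  assumes [measurable]: "f \<in> borel_measurable borel"
  shows "fhat f \<in> borel_measurable borel"
  unfolding fhat_def by measurable

lemma norm_exp_minus_i: "norm (exp (- (\<i> * complex_of_real t))) = 1"
  using norm_exp_i_times[of "- t"] by simp

text \<open>Both sides have the same pairings with coherent states: Fubini moves the exponential
  kernel onto \<open>coh z\<close> and produces \<open>coh (\<i> * z)\<close>, as
  \<open>ip_phi_coh\<close> does. The left side is only known to be bounded at this point, hence the
  appeal to \<open>orth_coh_AE\<close>.\<close>

lemma fhat_AE_phi:
  assumes f: "f \<in> SQ" and i: "integrable lborel f"
  shows "AE x in lborel. fhat f x = phi (- \<i>) f x"
proof -
  have [measurable]: "f \<in> borel_measurable borel" using f by auto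
  have p [simp]: "phi (- \<i>) f \<in> SQ" by (rule phi_L2[OF f]) simp
  have [measurable]: "phi (- \<i>) f \<in> borel_measurable borel" by (rule L2_measurable[OF p])
  let ?c = "complex_of_real ((2 * pi) powr (- 1 / 2))"
  have bnd: "norm (fhat f \<xi>) \<le> norm ?c * (LINT x|lborel. norm (f x))" for \<xi>
  proof -
    have "norm (LINT x|lborel. exp (- (\<i> * complex_of_real (x * \<xi>))) * f x) \<le> (LINT x|lborel. norm (f x))"
      using integral_norm_bound[of lborel "\<lambda>x. exp (- (\<i> * complex_of_real (x * \<xi>))) * f x"]
      by (simp only: norm_mult norm_exp_minus_i mult_1)
    then show ?thesis unfolding fhat_def norm_mult by (intro mult_left_mono) auto
  qed
  have i1: "integrable lborel (\<lambda>\<xi>. fhat f \<xi> * cnj (coh z \<xi>))" for z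
  proof (rule Bochner_Integration.integrable_bound)
    show "integrable lborel (\<lambda>\<xi>. (norm ?c * (LINT x|lborel. norm (f x))) * norm (coh z \<xi>))"
      by (intro integrable_mult_right integrable_norm coh_integrable)
    show "AE \<xi> in lborel. norm (fhat f \<xi> * cnj (coh z \<xi>)) \<le> norm ((norm ?c * (LINT x|lborel. norm (f x))) * norm (coh z \<xi>))"
    proof (rule AE_I2)
      fix \<xi>
      have "norm (fhat f \<xi> * cnj (coh z \<xi>)) \<le> (norm ?c * (LINT x|lborel. norm (f x))) * norm (coh z \<xi>)"
        unfolding norm_mult complex_mod_cnj by (intro mult_right_mono order_trans[OF bnd]) auto
      also have "\<dots> \<le> norm ((norm ?c * (LINT x|lborel. norm (f x))) * norm (coh z \<xi>))" by simp
      finally show "norm (fhat f \<xi> * cnj (coh z \<xi>)) \<le> norm ((norm ?c * (LINT x|lborel. norm (f x))) * norm (coh z \<xi>))" .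
    qed
  qed measurable
  have v: "(LINT \<xi>|lborel. fhat f \<xi> * cnj (coh z \<xi>)) = ip f (coh (\<i> * z))" for z
  proof -
    let ?k = "\<lambda>x \<xi>. f x * cnj (exp (\<i> * complex_of_real (x * \<xi>)) * coh z \<xi>)"
    have nk: "norm (?k x \<xi>) = norm (f x) * norm (coh z \<xi>)" for x \<xi>
      by (simp add: norm_mult del: of_real_mult complex_cnj_mult)
    have int: "integrable (lborel \<Otimes>\<^sub>M lborel) (\<lambda>(x, \<xi>). ?k x \<xi>)"
    proof (rule lborel_pair.Fubini_integrable)
      show "(\<lambda>(x, \<xi>). ?k x \<xi>) \<in> borel_measurable (lborel \<Otimes>\<^sub>M lborel)" by measurable
      show "integrable lborel (\<lambda>x. LINT y|lborel. norm (case (x, y) of (x, \<xi>) \<Rightarrow> ?k x \<xi>))"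
        unfolding prod.case nk integral_mult_right_zero by (intro integrable_mult_left integrable_norm i)
      show "AE x in lborel. integrable lborel (\<lambda>y. case (x, y) of (x, \<xi>) \<Rightarrow> ?k x \<xi>)"
        unfolding prod.case using inverse_fourier_coh
        by (intro AE_I2 integrable_mult_right integrable_cnj) (simp add: has_bochner_integral_iff)
    qed
    have "fhat f \<xi> * cnj (coh z \<xi>) = ?c * (LINT x|lborel. ?k x \<xi>)" for \<xi>
    proof -
      have "?k x \<xi> = (exp (- (\<i> * complex_of_real (x * \<xi>))) * f x) * cnj (coh z \<xi>)" for x
        by (simp add: exp_cnj mult_ac)
      then have "(LINT x|lborel. ?k x \<xi>) = (LINT x|lborel. exp (- (\<i> * complex_of_real (x * \<xi>))) * f x) * cnj (coh z \<xi>)"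
        by (simp only: integral_mult_left_zero)
      then show ?thesis unfolding fhat_def by (simp only: mult.assoc)
    qed
    then have "(LINT \<xi>|lborel. fhat f \<xi> * cnj (coh z \<xi>)) = ?c * (LINT \<xi>|lborel. LINT x|lborel. ?k x \<xi>)"
      by (simp only: integral_mult_right_zero)
    also have "(LINT \<xi>|lborel. LINT x|lborel. ?k x \<xi>) = (LINT x|lborel. LINT \<xi>|lborel. ?k x \<xi>)"
      by (rule lborel_pair.Fubini_integral[OF int])
    finally have S: "(LINT \<xi>|lborel. fhat f \<xi> * cnj (coh z \<xi>)) = ?c * (LINT x|lborel. LINT \<xi>|lborel. ?k x \<xi>)" .
    have "(LINT \<xi>|lborel. ?k x \<xi>) = complex_of_real (sqrt (2 * pi)) * (f x * cnj (coh (\<i> * z) x))" for x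
      using inverse_fourier_coh[of x z]
      by (simp only: integral_mult_right_zero Bochner_Integration.integral_cnj has_bochner_integral_iff) simp
    then show ?thesis
      unfolding S by (simp only: integral_mult_right_zero powr_minus_half_2pi ip_def[symmetric]) simp
  qed
  have "AE x in lborel. fhat f x - phi (- \<i>) f x = 0"
  proof (rule orth_coh_AE)
    fix z
    have i2: "integrable lborel (\<lambda>x. phi (- \<i>) f x * cnj (coh z x))" by (intro ip_integrable p coh_L2)
    show "integrable lborel (\<lambda>x. (fhat f x - phi (- \<i>) f x) * cnj (coh z x))"
      unfolding left_diff_distrib by (intro Bochner_Integration.integrable_diff i1 i2)
    have "(LINT x|lborel. (fhat f x - phi (- \<i>) f x) * cnj (coh z x)) = ip f (coh (\<i> * z)) - ip (phi (- \<i>) f) (coh z)"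
      unfolding left_diff_distrib Bochner_Integration.integral_diff[OF i1 i2] v ip_def ..
    also have "\<dots> = 0" using f by (simp add: ip_phi_coh)
    finally show "(LINT x|lborel. (fhat f x - phi (- \<i>) f x) * cnj (coh z x)) = 0" .
  qed measurable
  then show ?thesis by eventually_elim simp
qed

lemma truncated_fourier_eq:
  "truncated_fourier f R = fhat (\<lambda>x. indicator {-R..R} x *\<^sub>R f x)"
  unfolding truncated_fourier_def fhat_def set_lebesgue_integral_def by (simp add: fun_eq_iff)

lemma indicator_L2:
  assumes f: "f \<in> SQ" shows "(\<lambda>x. indicator {-R..R::real} x *\<^sub>R f x) \<in> SQ"
    "integrable lborel (\<lambda>x. indicator {-R..R} x *\<^sub>R f x)"
proof -
  have [measurable]: "f \<in> borel_measurable borel" using f by auto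
  show "(\<lambda>x. indicator {-R..R::real} x *\<^sub>R f x) \<in> SQ"
    by (rule L2_dominated(1)[OF f]) (auto simp: indicator_def)
  have I: "(\<lambda>x. complex_of_real (indicator {-R..R} x)) \<in> SQ"
  proof -
    have "(\<lambda>x. (norm (complex_of_real (indicator {-R..R} x)))\<^sup>2) = (indicator {-R..R} :: real \<Rightarrow> real)"
      by (auto simp: fun_eq_iff indicator_def)
    moreover have "integrable lborel (indicator {-R..R} :: real \<Rightarrow> real)" by (simp add: emeasure_lborel_Icc_eq)
    ultimately show ?thesis by (simp add: L2_iff)
  qed
  show "integrable lborel (\<lambda>x. indicator {-R..R} x *\<^sub>R f x)"
    using L2_mult_integrable[OF I f] by (simp add: scaleR_conv_of_real)
qed

lemma nrm_truncate_tendsto: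
  assumes f: "f \<in> SQ"
  shows "((\<lambda>R. nrm (\<lambda>x. indicator {-R..R} x *\<^sub>R f x - f x)) \<longlongrightarrow> 0) at_top"
proof -
  have [measurable]: "f \<in> borel_measurable borel" using f by auto
  have "((\<lambda>R. LINT x|lborel. (norm (indicator {-R..R} x *\<^sub>R f x - f x))\<^sup>2) \<longlongrightarrow> (LINT x|(lborel :: real measure). (0::real))) at_top"
  proof (rule integral_dominated_convergence_at_top[where s = "\<lambda>R x. (norm (indicator {-R..R} x *\<^sub>R f x - f x))\<^sup>2" and f = "\<lambda>x. 0"])
    show "integrable lborel (\<lambda>x. (norm (f x))\<^sup>2)" by (rule L2_integrable[OF f])
    show "\<forall>\<^sub>F R in at_top. AE x in lborel. norm ((norm (indicator {-R..R} x *\<^sub>R f x - f x))\<^sup>2) \<le> (norm (f x))\<^sup>2"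
      by (intro always_eventually allI AE_I2) (auto simp: indicator_def)
    show "AE x in lborel. ((\<lambda>R. (norm (indicator {-R..R} x *\<^sub>R f x - f x))\<^sup>2) \<longlongrightarrow> 0) at_top"
    proof (intro AE_I2 tendsto_eventually)
      fix x :: real
      show "\<forall>\<^sub>F R in at_top. (norm (indicator {-R..R} x *\<^sub>R f x - f x))\<^sup>2 = 0"
        using eventually_ge_at_top[of "\<bar>x\<bar>"] by eventually_elim (auto simp: indicator_def abs_le_iff)
    qed
  qed measurable
  from tendsto_real_sqrt[OF this] show ?thesis by (simp add: nrm_eq)
qed

text \<open>Each truncated transform is \<open>phi (- \<i>)\<close> of a truncation, so by isometry
  these transforms converge to \<open>phi (- \<i>) f\<close>. This limit witnesses the choice in
  \<open>fourier\<close>, and limits in \<open>L2\<close> are unique up to null sets.\<close>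

lemma fourier_AE_phi:
  assumes f: "f \<in> SQ"
  shows "fourier f \<in> SQ" "AE x in lborel. fourier f x = phi (- \<i>) f x"
proof -
  let ?g = "\<lambda>R x. indicator {-R..R} x *\<^sub>R f x"
  have p: "phi (- \<i>) f \<in> SQ" by (rule phi_L2[OF f]) simp
  have pg: "phi (- \<i>) (?g R) \<in> SQ" for R by (rule phi_L2[OF indicator_L2(1)[OF f]]) simp
  have ae: "AE x in lborel. truncated_fourier f R x = phi (- \<i>) (?g R) x" for R
    unfolding truncated_fourier_eq by (intro fhat_AE_phi indicator_L2 f)
  have m: "truncated_fourier f R \<in> borel_measurable borel" for R
    unfolding truncated_fourier_eq by (intro fhat_measurable L2_measurable indicator_L2 f)
  have t: "truncated_fourier f R \<in> SQ" for R
    by (rule L2_cong_AE[OF pg m ae])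
  have n: "nrm (\<lambda>x. truncated_fourier f R x - phi (- \<i>) f x) = nrm (\<lambda>x. ?g R x - f x)" for R
  proof -
    have "AE x in lborel. phi (- \<i>) (\<lambda>y. 1 * ?g R y + (-1) * f y) x = 1 * phi (- \<i>) (?g R) x + (-1) * phi (- \<i>) f x"
      by (rule phi_lin[OF indicator_L2(1)[OF f] f]) simp
    with ae[of R] have "AE x in lborel. truncated_fourier f R x - phi (- \<i>) f x = phi (- \<i>) (\<lambda>y. ?g R y - f y) x"
      by eventually_elim simp
    then have "nrm (\<lambda>x. truncated_fourier f R x - phi (- \<i>) f x) = nrm (phi (- \<i>) (\<lambda>y. ?g R y - f y))"
      by (intro nrm_cong_AE L2_measurable L2_diff t p phi_L2 indicator_L2 f) auto
    also have "\<dots> = nrm (\<lambda>y. ?g R y - f y)" by (intro phi_nrm L2_diff indicator_L2 f) simp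
    finally show ?thesis .
  qed
  have lim: "L2_tendsto (truncated_fourier f) (phi (- \<i>) f) at_top"
    using nrm_truncate_tendsto[OF f] by (simp only: L2_tendsto_iff[OF t p] n)
  have "\<exists>F. F \<in> L2 \<and> L2_tendsto (truncated_fourier f) F at_top"
    unfolding L2_eq using p lim by blast
  from someI_ex[OF this] have F: "fourier f \<in> SQ" "L2_tendsto (truncated_fourier f) (fourier f) at_top"
    unfolding fourier_def L2_eq by auto
  show "fourier f \<in> SQ" by fact
  have l1: "((\<lambda>R. nrm (\<lambda>x. truncated_fourier f R x - fourier f x)) \<longlongrightarrow> 0) at_top"
    using F(2) by (simp only: L2_tendsto_iff[OF t F(1)])
  have "((\<lambda>R. nrm (\<lambda>x. truncated_fourier f R x - phi (- \<i>) f x)) \<longlongrightarrow> nrm (\<lambda>x. fourier f x - phi (- \<i>) f x)) at_top"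
    by (rule nrm_tendsto[OF t F(1) p l1])
  moreover have "((\<lambda>R. nrm (\<lambda>x. truncated_fourier f R x - phi (- \<i>) f x)) \<longlongrightarrow> 0) at_top"
    using lim by (simp only: L2_tendsto_iff[OF t p])
  ultimately have "nrm (\<lambda>x. fourier f x - phi (- \<i>) f x) = 0"
    using tendsto_unique trivial_limit_at_top_linorder by blast
  then show "AE x in lborel. fourier f x = phi (- \<i>) f x"
    by (simp add: nrm_diff_eq_0_iff F p)
qed

section \<open>Sextic forms\<close>

text \<open>Slots 0 to 2 of a sextic form are linear and slots 3 to 5 conjugate linear; one indexed
  operation lets all six be treated alike.\<close>

definition slot :: "nat \<Rightarrow> complex \<Rightarrow> complex" where
  "slot i c = (if i < 3 then c else cnj c)"

lemma slot_simps [simp]: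
  "slot i (a + b) = slot i a + slot i b" "slot i (a * b) = slot i a * slot i b"
  "norm (slot i a) = norm a" "slot i 0 = 0"
  by (simp_all add: slot_def)

lemma slot_measurable [measurable]: "f \<in> borel_measurable M \<Longrightarrow> (\<lambda>x. slot i (f x)) \<in> borel_measurable M"
  unfolding slot_def by (cases "i < 3") auto

definition hexalinear :: "(real \<Rightarrow> complex) set \<Rightarrow> ((nat \<Rightarrow> real \<Rightarrow> complex) \<Rightarrow> complex) \<Rightarrow> bool" where
  "hexalinear S Q \<longleftrightarrow> (\<forall>f. (\<forall>i<6. f i \<in> S) \<longrightarrow> (\<forall>j<6. \<forall>g\<in>S. \<forall>h\<in>S. \<forall>a b.
     Q (f(j := \<lambda>x. a * g x + b * h x)) = slot j a * Q (f(j := g)) + slot j b * Q (f(j := h))))"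

lemma hexalinearD:
  assumes "hexalinear S Q" "\<And>i. i < 6 \<Longrightarrow> f i \<in> S" "j < 6" "g \<in> S" "h \<in> S"
  shows "Q (f(j := \<lambda>x. a * g x + b * h x)) = slot j a * Q (f(j := g)) + slot j b * Q (f(j := h))"
  using assms unfolding hexalinear_def by blast

lemma cspan_add: "f \<in> cspan \<Longrightarrow> g \<in> cspan \<Longrightarrow> (\<lambda>x. f x + g x) \<in> cspan"
proof -
  assume "f \<in> cspan" "g \<in> cspan"
  then obtain cs ds where "f = comb cs 1" "g = comb ds 1" by (auto simp: cspan_def)
  then have "(\<lambda>x. f x + g x) = comb (cs @ ds) 1" by simp
  then show ?thesis by (simp only: comb_cspan)
qed

lemma cspan_scale: "f \<in> cspan \<Longrightarrow> (\<lambda>x. c * f x) \<in> cspan"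
proof -
  assume "f \<in> cspan"
  then obtain cs where "f = comb cs 1" by (auto simp: cspan_def)
  then have "(\<lambda>x. c * f x) = comb (map (\<lambda>(a, z). (c * a, z)) cs) 1" by (simp add: comb_scale)
  then show ?thesis by (simp only: comb_cspan)
qed

text \<open>The slots are released one at a time: at stage \<open>j\<close> the first
  \<open>j\<close> arguments are arbitrary and the remaining ones are still coherent states.\<close>

lemma hexalinear_eq_cspan:
  assumes Q: "hexalinear cspan Q" and R: "hexalinear cspan R"
    and coh: "\<And>z. Q (\<lambda>i. coh (z i)) = R (\<lambda>i. coh (z i))"
    and cong: "\<And>f g. (\<And>i. i < 6 \<Longrightarrow> f i = g i) \<Longrightarrow> Q f = Q g" "\<And>f g. (\<And>i. i < 6 \<Longrightarrow> f i = g i) \<Longrightarrow> R f = R g"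
    and f: "\<And>i. i < 6 \<Longrightarrow> f i \<in> cspan"
  shows "Q f = R f"
proof -
  have "j \<le> 6 \<Longrightarrow> (\<And>i. i < 6 \<Longrightarrow> f i \<in> cspan) \<Longrightarrow> (\<And>i. j \<le> i \<Longrightarrow> i < 6 \<Longrightarrow> f i \<in> range coh) \<Longrightarrow> Q f = R f" for j f
  proof (induction j arbitrary: f)
    case 0
    then obtain z where z: "\<And>i. i < 6 \<Longrightarrow> f i = coh (z i)" by (auto simp: image_iff) metis
    show ?case using coh[of z] cong(1)[OF z] cong(2)[OF z] by simp
  next
    case (Suc j)
    let ?D = "\<lambda>g. Q (f(j := g)) - R (f(j := g))"
    have lin: "?D (\<lambda>x. a * g x + b * h x) = slot j a * ?D g + slot j b * ?D h" if "g \<in> cspan" "h \<in> cspan" for a b g h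
      using hexalinearD[OF Q, of f j g h a b] hexalinearD[OF R, of f j g h a b] Suc.prems that
      by (simp add: algebra_simps)
    have "?D (f j) = 0"
    proof (rule cspan_functional_zero[where D = ?D and h = "slot j"])
      show "?D (\<lambda>x. g x + h x) = ?D g + ?D h" if "g \<in> cspan" "h \<in> cspan" for g h
        using lin[OF that, of 1 1] by (simp add: slot_def)
      show "?D (\<lambda>x. c * g x) = slot j c * ?D g" if "g \<in> cspan" for c g
        using lin[OF that coh_cspan, of c 0] by simp
      show "?D (coh z) = 0" for z
      proof -
        have "Q (f(j := coh z)) = R (f(j := coh z))"
          using Suc.prems by (intro Suc.IH) auto
        then show ?thesis by simp
      qed
    qed (use Suc.prems in auto)
    then show ?case by simp
  qed
  from this[of 6 f] f show ?thesis by simp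
qed

text \<open>The same exchange of slots, with continuity in each single slot carrying the equality
  from the span to its completion.\<close>

lemma hexalinear_eq_L2:
  assumes Q: "hexalinear SQ Q" and R: "hexalinear SQ R"
    and coh: "\<And>z. Q (\<lambda>i. coh (z i)) = R (\<lambda>i. coh (z i))"
    and cong: "\<And>f g. (\<And>i. i < 6 \<Longrightarrow> f i = g i) \<Longrightarrow> Q f = Q g" "\<And>f g. (\<And>i. i < 6 \<Longrightarrow> f i = g i) \<Longrightarrow> R f = R g"
    and bQ: "\<And>f j. (\<And>i. i < 6 \<Longrightarrow> f i \<in> SQ) \<Longrightarrow> j < 6 \<Longrightarrow> \<exists>K. \<forall>g\<in>SQ. norm (Q (f(j := g))) \<le> K * nrm g"
    and bR: "\<And>f j. (\<And>i. i < 6 \<Longrightarrow> f i \<in> SQ) \<Longrightarrow> j < 6 \<Longrightarrow> \<exists>K. \<forall>g\<in>SQ. norm (R (f(j := g))) \<le> K * nrm g"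
    and f: "\<And>i. i < 6 \<Longrightarrow> f i \<in> SQ"
  shows "Q f = R f"
proof -
  have "j \<le> 6 \<Longrightarrow> (\<And>i. i < 6 \<Longrightarrow> f i \<in> SQ) \<Longrightarrow> (\<And>i. j \<le> i \<Longrightarrow> i < 6 \<Longrightarrow> f i \<in> range coh) \<Longrightarrow> Q f = R f" for j f
  proof (induction j arbitrary: f)
    case 0
    then obtain z where z: "\<And>i. i < 6 \<Longrightarrow> f i = coh (z i)" by (auto simp: image_iff) metis
    show ?case using coh[of z] cong(1)[OF z] cong(2)[OF z] by simp
  next
    case (Suc j)
    let ?D = "\<lambda>g. Q (f(j := g)) - R (f(j := g))"
    have lin: "?D (\<lambda>x. a * g x + b * h x) = slot j a * ?D g + slot j b * ?D h" if "g \<in> SQ" "h \<in> SQ" for a b g h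
      using hexalinearD[OF Q, of f j g h a b] hexalinearD[OF R, of f j g h a b] Suc.prems that
      by (simp add: algebra_simps)
    obtain K where K: "\<And>g. g \<in> SQ \<Longrightarrow> norm (Q (f(j := g))) \<le> K * nrm g" using bQ[of f j] Suc.prems by auto
    obtain L where L: "\<And>g. g \<in> SQ \<Longrightarrow> norm (R (f(j := g))) \<le> L * nrm g" using bR[of f j] Suc.prems by auto
    have "?D (f j) = 0"
    proof (rule L2_functional_zero[where D = ?D and h = "slot j" and K = "K + L"])
      show "?D (\<lambda>x. g x + h x) = ?D g + ?D h" if "g \<in> SQ" "h \<in> SQ" for g h
        using lin[OF that, of 1 1] by (simp add: slot_def)
      show "?D (\<lambda>x. c * g x) = slot j c * ?D g" if "g \<in> SQ" for c g
        using lin[OF that coh_L2, of c 0] by simp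
      show "norm (?D g) \<le> (K + L) * nrm g" if "g \<in> SQ" for g
        using K[OF that] L[OF that] by (intro order_trans[OF norm_triangle_ineq4]) (simp add: algebra_simps)
      show "?D (coh z) = 0" for z
      proof -
        have "Q (f(j := coh z)) = R (f(j := coh z))"
          using Suc.prems by (intro Suc.IH) auto
        then show ?thesis by simp
      qed
    qed (use Suc.prems in auto)
    then show ?case by simp
  qed
  from this[of 6 f] f show ?thesis by simp
qed

text \<open>Rescaling by any \<open>r\<close> above \<open>nrm g\<close>, and letting
  \<open>r\<close> decrease afterwards, avoids a separate treatment of functions of norm
  zero.\<close>

lemma homogeneous_bound:
  fixes D :: "(real \<Rightarrow> complex) \<Rightarrow> complex"
  assumes hom: "\<And>g c. g \<in> SQ \<Longrightarrow> norm (D (\<lambda>x. c * g x)) = norm c * norm (D g)"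
    and b: "\<And>g. g \<in> SQ \<Longrightarrow> nrm g \<le> 1 \<Longrightarrow> norm (D g) \<le> K" and g: "g \<in> SQ"
  shows "norm (D g) \<le> K * nrm g"
proof -
  have K: "0 \<le> K" using order_trans[OF norm_ge_zero b[OF L2_zero]] by simp
  have *: "norm (D g) \<le> K * r" if r: "nrm g < r" for r
  proof -
    have r0: "r > 0" using r nrm_nonneg[of g] by linarith
    have "norm (D (\<lambda>x. of_real (1 / r) * g x)) \<le> K"
    proof (intro b L2_scale g)
      show "nrm (\<lambda>x. of_real (1 / r) * g x) \<le> 1" using r r0 by (simp only: nrm_scale norm_of_real) (simp add: field_simps)
    qed
    moreover have "norm (D (\<lambda>x. of_real (1 / r) * g x)) = (1 / r) * norm (D g)"
      using r0 by (subst hom[OF g]) (simp add: norm_divide)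
    ultimately have "(1 / r) * norm (D g) \<le> K" by simp
    then show ?thesis using r0 by (simp add: field_simps)
  qed
  show ?thesis
  proof (rule field_le_epsilon)
    fix e :: real assume e: "0 < e"
    have "norm (D g) \<le> K * (nrm g + e / (K + 1))" using K e by (intro *) auto
    also have "\<dots> = K * nrm g + e * (K / (K + 1))" by (simp add: algebra_simps)
    also have "\<dots> \<le> K * nrm g + e * 1"
      using K e by (intro add_left_mono mult_left_mono) auto
    finally show "norm (D g) \<le> K * nrm g + e" by simp
  qed
qed

text \<open>Three instances follow: the average over rotations on \<open>L2\<close>
  (\<open>A\<close>), the space-time form on the span (\<open>C\<close>) and the same form on
  \<open>L2\<close> (\<open>T\<close>). The set \<open>S\<close> is a parameter because finiteness
  of the space-time form on \<open>L2\<close> is a later result.\<close>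

locale sextic =
  fixes M :: "'w measure" and W :: "'w \<Rightarrow> real" and A :: "nat \<Rightarrow> (real \<Rightarrow> complex) \<Rightarrow> 'w \<Rightarrow> complex"
    and S :: "(real \<Rightarrow> complex) set"
  assumes W [measurable]: "W \<in> borel_measurable M" and W0: "\<And>w. 0 \<le> W w"
    and Am: "\<And>i f. i < 6 \<Longrightarrow> f \<in> S \<Longrightarrow> A i f \<in> borel_measurable M"
    and Alin: "\<And>i f g a b. f \<in> S \<Longrightarrow> g \<in> S \<Longrightarrow>
        AE w in M. A i (\<lambda>x. a * f x + b * g x) w = a * A i f w + b * A i g w"
    and Slin: "\<And>f g a b. f \<in> S \<Longrightarrow> g \<in> S \<Longrightarrow> (\<lambda>x. a * f x + b * g x) \<in> S"
    and fin: "\<And>f. (\<And>i. i < 6 \<Longrightarrow> f i \<in> S) \<Longrightarrow> (\<integral>\<^sup>+w. ennreal (W w * (\<Prod>i<6. norm (A i (f i) w))) \<partial>M) < \<infinity>"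
begin

definition form :: "(nat \<Rightarrow> real \<Rightarrow> complex) \<Rightarrow> complex" where
  "form f = (LINT w|M. W w *\<^sub>R (\<Prod>i<6. slot i (A i (f i) w)))"

lemma form_cong: "(\<And>i. i < 6 \<Longrightarrow> f i = g i) \<Longrightarrow> form f = form g"
  unfolding form_def by (intro Bochner_Integration.integral_cong refl arg_cong2[where f = scaleR] prod.cong) auto

lemma form_integrable:
  assumes f: "\<And>i. i < 6 \<Longrightarrow> f i \<in> S"
  shows "integrable M (\<lambda>w. W w *\<^sub>R (\<Prod>i<6. slot i (A i (f i) w)))"
proof (rule integrableI_bounded)
  have "(\<lambda>w. \<Prod>i<6. slot i (A i (f i) w)) \<in> borel_measurable M"
    by (intro borel_measurable_prod slot_measurable Am f) auto
  then show "(\<lambda>w. W w *\<^sub>R (\<Prod>i<6. slot i (A i (f i) w))) \<in> borel_measurable M" by measurable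
  show "(\<integral>\<^sup>+w. ennreal (norm (W w *\<^sub>R (\<Prod>i<6. slot i (A i (f i) w)))) \<partial>M) < \<infinity>"
    using fin[OF f] by (simp add: prod_norm[symmetric] W0)
qed

lemma norm_form_le:
  assumes f: "\<And>i. i < 6 \<Longrightarrow> f i \<in> S"
  shows "ennreal (norm (form f)) \<le> (\<integral>\<^sup>+w. ennreal (W w * (\<Prod>i<6. norm (A i (f i) w))) \<partial>M)"
  using integral_norm_bound_ennreal[OF form_integrable[OF f]] unfolding form_def
  by (simp add: prod_norm[symmetric] W0)

lemma hexalinear_form: "hexalinear S form"
  unfolding hexalinear_def
proof (intro allI impI ballI)
  fix f :: "nat \<Rightarrow> real \<Rightarrow> complex" and j g h and a b :: complex
  assume f: "\<forall>i<6. f i \<in> S" and j: "j < (6::nat)" and g: "g \<in> S" and h: "h \<in> S"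
  let ?P = "\<lambda>w. \<Prod>i\<in>{..<6} - {j}. slot i (A i (f i) w)"
  have split: "(\<Prod>i<6. slot i (A i ((f(j := k)) i) w)) = slot j (A j k w) * ?P w" for k w
    using j by (subst prod.remove[of _ j]) (auto intro!: prod.cong)
  let ?gh = "\<lambda>x. a * g x + b * h x"
  have i: "integrable M (\<lambda>w. W w *\<^sub>R (slot j (A j k w) * ?P w))" if "k \<in> S" for k
    unfolding split[symmetric] using f that by (intro form_integrable) auto
  have "form (f(j := ?gh)) = (LINT w|M. W w *\<^sub>R (slot j (A j ?gh w) * ?P w))"
    unfolding form_def split ..
  also have "\<dots> = (LINT w|M. slot j a * (W w *\<^sub>R (slot j (A j g w) * ?P w)) + slot j b * (W w *\<^sub>R (slot j (A j h w) * ?P w)))"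
  proof (rule integral_cong_AE)
    show "AE w in M. W w *\<^sub>R (slot j (A j ?gh w) * ?P w) =
        slot j a * (W w *\<^sub>R (slot j (A j g w) * ?P w)) + slot j b * (W w *\<^sub>R (slot j (A j h w) * ?P w))"
      using Alin[OF g h, of j a b] by eventually_elim (simp add: scaleR_conv_of_real algebra_simps)
  qed (intro borel_measurable_integrable Bochner_Integration.integrable_add integrable_mult_right i Slin g h)+
  also have "\<dots> = slot j a * (LINT w|M. W w *\<^sub>R (slot j (A j g w) * ?P w)) + slot j b * (LINT w|M. W w *\<^sub>R (slot j (A j h w) * ?P w))"
    by (simp only: Bochner_Integration.integral_add integrable_mult_right i g h integral_mult_right_zero)
  also have "\<dots> = slot j a * form (f(j := g)) + slot j b * form (f(j := h))"
    unfolding form_def split ..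
  finally show "form (f(j := ?gh)) = slot j a * form (f(j := g)) + slot j b * form (f(j := h))" .
qed

end

section \<open>Averaging over the rotations about the diagonal\<close>

text \<open>The matrix of the rotation by \<open>\<theta>\<close> about the axis
  \<open>(1, 1, 1)\<close> is circulant, so one row, with the entries \<open>ra\<close>,
  \<open>rb\<close>, \<open>rc\<close>, determines it.\<close>

definition ra :: "real \<Rightarrow> real" where "ra \<theta> = (1 + 2 * cos \<theta>) / 3"
definition rb :: "real \<Rightarrow> real" where "rb \<theta> = (1 - cos \<theta> + sqrt 3 * sin \<theta>) / 3"
definition rc :: "real \<Rightarrow> real" where "rc \<theta> = (1 - cos \<theta> - sqrt 3 * sin \<theta>) / 3"

lemma rot_measurable [measurable]:
  "ra \<in> borel_measurable borel" "rb \<in> borel_measurable borel" "rc \<in> borel_measurable borel"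
  unfolding ra_def[abs_def] rb_def[abs_def] rc_def[abs_def] by measurable

lemma rot_sum: "ra \<theta> + rb \<theta> + rc \<theta> = 1"
  by (simp add: ra_def rb_def rc_def field_simps)

lemma rot_sq: "(ra \<theta>)\<^sup>2 + (rb \<theta>)\<^sup>2 + (rc \<theta>)\<^sup>2 = 1"
proof -
  have "9 * ((ra \<theta>)\<^sup>2 + (rb \<theta>)\<^sup>2 + (rc \<theta>)\<^sup>2) = 3 + 6 * (cos \<theta>)\<^sup>2 + 2 * ((sqrt 3)\<^sup>2 * (sin \<theta>)\<^sup>2)"
    unfolding ra_def rb_def rc_def by (simp add: power2_eq_square field_simps)
  also have "\<dots> = 3 + 6 * ((sin \<theta>)\<^sup>2 + (cos \<theta>)\<^sup>2)" by (simp del: sin_cos_squared_add)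
  also have "\<dots> = 9" by simp
  finally show ?thesis by simp
qed

text \<open>A rotation matrix equals its own cofactor matrix; for a circulant one these are the
  three equations. The assumptions force \<open>a * b + b * c + a * c = 0\<close>, from which they
  follow.\<close>

lemma rot_cofactor:
  fixes a b c :: real
  assumes 1: "a + b + c = 1" and 2: "a\<^sup>2 + b\<^sup>2 + c\<^sup>2 = 1"
  shows "a\<^sup>2 - b * c = a" "b\<^sup>2 - a * c = b" "c\<^sup>2 - a * b = c"
proof -
  have "(a + b + c)\<^sup>2 = a\<^sup>2 + b\<^sup>2 + c\<^sup>2 + 2 * (a * b + b * c + a * c)"
    by (simp add: power2_eq_square algebra_simps)
  then have 0: "a * b + b * c + a * c = 0" using 1 2 by simp
  have "a\<^sup>2 - b * c = a * (a + b + c) - (a * b + b * c + a * c)" by (simp add: power2_eq_square algebra_simps)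
  then show "a\<^sup>2 - b * c = a" unfolding 0 1 by simp
  have "b\<^sup>2 - a * c = b * (a + b + c) - (a * b + b * c + a * c)" by (simp add: power2_eq_square algebra_simps)
  then show "b\<^sup>2 - a * c = b" unfolding 0 1 by simp
  have "c\<^sup>2 - a * b = c * (a + b + c) - (a * b + b * c + a * c)" by (simp add: power2_eq_square algebra_simps)
  then show "c\<^sup>2 - a * b = c" unfolding 0 1 by simp
qed

lemmas rot_cofactors = rot_cofactor[OF rot_sum rot_sq]

text \<open>\<open>ra \<theta>\<close> is the first pivot when the rotation is inverted by
  elimination; it vanishes only at the two angles of the window whose cosine is
  \<open>-1/2\<close>.\<close>

lemma ra_nonzero_AE: "AE \<theta> in lborel. \<theta> \<in> {-pi..pi} \<longrightarrow> ra \<theta> \<noteq> 0"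
proof -
  define p :: real where "p = arccos (-1/2)"
  let ?s = "{p, - p}"
  have zero: "\<theta> \<in> ?s" if "\<theta> \<in> {-pi..pi}" "ra \<theta> = 0" for \<theta>
  proof -
    have c: "cos \<theta> = -1/2" using that by (simp add: ra_def)
    show ?thesis
    proof (cases "0 \<le> \<theta>")
      case True
      then have "\<theta> = p" unfolding p_def c[symmetric] using arccos_cos[of \<theta>] that by simp
      then show ?thesis by simp
    next
      case False
      have "p = arccos (cos (- \<theta>))" unfolding p_def using c by simp
      also have "\<dots> = - \<theta>" using False that by (intro arccos_cos) auto
      finally show ?thesis by simp
    qed
  qed
  have "AE \<theta> in lborel. \<theta> \<notin> ?s"
    by (intro AE_not_in finite_imp_null_set_lborel) simp
  then show ?thesis
    by eventually_elim (use zero in blast)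
qed

section \<open>Invariance of the triple integral under rotation\<close>

lemma nn_affine:
  fixes f :: "real \<Rightarrow> ennreal"
  assumes "f \<in> borel_measurable borel" "c \<noteq> 0"
  shows "ennreal \<bar>c\<bar> * (\<integral>\<^sup>+x. f (t + c * x) \<partial>lborel) = (\<integral>\<^sup>+x. f x \<partial>lborel)"
  using nn_integral_real_affine[OF assms, of t] by simp

text \<open>Gaussian elimination reduces the change of variables to one-dimensional ones; by
  \<open>a\<^sup>2 - b * c = a\<close> the second pivot is \<open>1\<close>.\<close>

lemma rot_nn_integral:
  fixes K :: "real \<times> real \<times> real \<Rightarrow> ennreal"
  assumes [measurable]: "K \<in> borel_measurable (borel \<Otimes>\<^sub>M borel \<Otimes>\<^sub>M borel)"
    and sum: "a + b + c = 1" and sq: "a\<^sup>2 + b\<^sup>2 + c\<^sup>2 = 1" and a: "a \<noteq> 0"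
  shows "(\<integral>\<^sup>+x3. \<integral>\<^sup>+x2. \<integral>\<^sup>+x1. K (a * x1 + b * x2 + c * x3, c * x1 + a * x2 + b * x3, b * x1 + c * x2 + a * x3)
      \<partial>lborel \<partial>lborel \<partial>lborel) = (\<integral>\<^sup>+z. \<integral>\<^sup>+y. \<integral>\<^sup>+x. K (x, y, z) \<partial>lborel \<partial>lborel \<partial>lborel)"
    (is "?L = ?R")
proof -
  note cof = rot_cofactor[OF sum sq]
  let ?m = "c / a" and ?n = "b / a"
  have 1: "ennreal \<bar>a\<bar> * (\<integral>\<^sup>+x1. K (a * x1 + b * x2 + c * x3, c * x1 + a * x2 + b * x3, b * x1 + c * x2 + a * x3) \<partial>lborel) =
      (\<integral>\<^sup>+u. K (u, ?m * u + x2 - ?m * x3, ?n * u - ?n * x2 + x3) \<partial>lborel)" for x2 x3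
  proof -
    have e2: "?m * (b * x2 + c * x3 + a * x1) + x2 - ?m * x3 = c * x1 + a * x2 + b * x3" for x1
    proof -
      have "?m * (b * x2 + c * x3 + a * x1) + x2 - ?m * x3 = c * x1 + (b * c + a) / a * x2 + (c\<^sup>2 - c) / a * x3"
        using a by (simp add: field_simps power2_eq_square)
      also have "b * c + a = a * a" using cof(1) by (simp add: power2_eq_square)
      also have "c\<^sup>2 - c = a * b" using cof(3) by simp
      finally show ?thesis using a by simp
    qed
    have e3: "?n * (b * x2 + c * x3 + a * x1) - ?n * x2 + x3 = b * x1 + c * x2 + a * x3" for x1
    proof -
      have "?n * (b * x2 + c * x3 + a * x1) - ?n * x2 + x3 = b * x1 + (b\<^sup>2 - b) / a * x2 + (b * c + a) / a * x3"
        using a by (simp add: field_simps power2_eq_square)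
      also have "b * c + a = a * a" using cof(1) by (simp add: power2_eq_square)
      also have "b\<^sup>2 - b = a * c" using cof(2) by simp
      finally show ?thesis using a by simp
    qed
    have e1: "b * x2 + c * x3 + a * x1 = a * x1 + b * x2 + c * x3" for x1 by simp
    have m: "(\<lambda>u. K (u, ?m * u + x2 - ?m * x3, ?n * u - ?n * x2 + x3)) \<in> borel_measurable borel"
      by measurable
    show ?thesis
      using nn_affine[OF m a, of "b * x2 + c * x3"] by (simp only: e2 e3) (simp only: e1)
  qed
  have 2: "(\<integral>\<^sup>+x2. K (u, ?m * u + x2 - ?m * x3, ?n * u - ?n * x2 + x3) \<partial>lborel) =
      (\<integral>\<^sup>+v. K (u, v, ?n * u - ?n * (v - ?m * u + ?m * x3) + x3) \<partial>lborel)" for u x3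
    using nn_affine[of "\<lambda>v. K (u, v, ?n * u - ?n * (v - ?m * u + ?m * x3) + x3)" 1 "?m * u - ?m * x3"]
    by (simp add: algebra_simps)
  \<comment> \<open>The third pivot is \<open>1 / a\<close>; its Jacobian cancels that of the first
    substitution, so the total is 1.\<close>
  have 3: "(\<integral>\<^sup>+x3. K (u, v, ?n * u - ?n * (v - ?m * u + ?m * x3) + x3) \<partial>lborel) =
      ennreal \<bar>a\<bar> * (\<integral>\<^sup>+w. K (u, v, w) \<partial>lborel)" for u v
  proof -
    have e: "?n * u - ?n * (v - ?m * u + ?m * x3) + x3 = (?n * u - ?n * (v - ?m * u)) + (1 / a) * x3" for x3
    proof -
      have "1 - ?n * ?m = (a\<^sup>2 - b * c) / a\<^sup>2" using a by (simp add: field_simps power2_eq_square)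
      also have "\<dots> = 1 / a" unfolding cof(1) using a by (simp add: power2_eq_square)
      finally have "(1 - ?n * ?m) * x3 = (1 / a) * x3" by (rule arg_cong)
      then show ?thesis by (simp add: algebra_simps)
    qed
    have eq: "ennreal \<bar>1 / a\<bar> * (\<integral>\<^sup>+x3. K (u, v, ?n * u - ?n * (v - ?m * u + ?m * x3) + x3) \<partial>lborel) = (\<integral>\<^sup>+w. K (u, v, w) \<partial>lborel)"
      unfolding e using a by (intro nn_affine) auto
    have one: "ennreal \<bar>a\<bar> * ennreal \<bar>1 / a\<bar> = 1"
      by (subst ennreal_mult[symmetric]) (use a in auto)
    show ?thesis unfolding eq[symmetric] mult.assoc[symmetric] one by simp
  qed
  have "ennreal \<bar>a\<bar> * ?L = (\<integral>\<^sup>+x3. \<integral>\<^sup>+x2. \<integral>\<^sup>+u. K (u, ?m * u + x2 - ?m * x3, ?n * u - ?n * x2 + x3) \<partial>lborel \<partial>lborel \<partial>lborel)"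
    unfolding 1[symmetric] by (simp add: nn_integral_cmult)
  also have "\<dots> = (\<integral>\<^sup>+x3. \<integral>\<^sup>+u. \<integral>\<^sup>+x2. K (u, ?m * u + x2 - ?m * x3, ?n * u - ?n * x2 + x3) \<partial>lborel \<partial>lborel \<partial>lborel)"
    by (intro nn_integral_cong lborel_pair.Fubini') measurable
  also have "\<dots> = (\<integral>\<^sup>+x3. \<integral>\<^sup>+u. \<integral>\<^sup>+v. K (u, v, ?n * u - ?n * (v - ?m * u + ?m * x3) + x3) \<partial>lborel \<partial>lborel \<partial>lborel)"
    by (simp only: 2)
  also have "\<dots> = (\<integral>\<^sup>+u. \<integral>\<^sup>+x3. \<integral>\<^sup>+v. K (u, v, ?n * u - ?n * (v - ?m * u + ?m * x3) + x3) \<partial>lborel \<partial>lborel \<partial>lborel)"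
    by (intro lborel_pair.Fubini') measurable
  also have "\<dots> = (\<integral>\<^sup>+u. \<integral>\<^sup>+v. \<integral>\<^sup>+x3. K (u, v, ?n * u - ?n * (v - ?m * u + ?m * x3) + x3) \<partial>lborel \<partial>lborel \<partial>lborel)"
    by (intro nn_integral_cong lborel_pair.Fubini') measurable
  also have "\<dots> = ennreal \<bar>a\<bar> * (\<integral>\<^sup>+u. \<integral>\<^sup>+v. \<integral>\<^sup>+w. K (u, v, w) \<partial>lborel \<partial>lborel \<partial>lborel)"
    by (simp only: 3) (simp add: nn_integral_cmult)
  also have "(\<integral>\<^sup>+u. \<integral>\<^sup>+v. \<integral>\<^sup>+w. K (u, v, w) \<partial>lborel \<partial>lborel \<partial>lborel) = (\<integral>\<^sup>+u. \<integral>\<^sup>+w. \<integral>\<^sup>+v. K (u, v, w) \<partial>lborel \<partial>lborel \<partial>lborel)"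
    by (intro nn_integral_cong lborel_pair.Fubini') measurable
  also have "\<dots> = (\<integral>\<^sup>+w. \<integral>\<^sup>+u. \<integral>\<^sup>+v. K (u, v, w) \<partial>lborel \<partial>lborel \<partial>lborel)"
    by (intro lborel_pair.Fubini') measurable
  also have "\<dots> = ?R"
    by (intro nn_integral_cong lborel_pair.Fubini') measurable
  finally have "ennreal \<bar>a\<bar> * ?L = ennreal \<bar>a\<bar> * ?R" .
  then show ?thesis using a by (simp add: ennreal_mult_cancel_left)
qed

text \<open>A point \<open>(x3, \<theta>, x1, x2)\<close> carries the six evaluation points: the rotated vector followed by the
  original one. The output variable comes first.\<close>

fun evp :: "nat \<Rightarrow> real \<times> real \<times> real \<times> real \<Rightarrow> real" where
  "evp i (x3, \<theta>, x1, x2) = [ra \<theta> * x1 + rb \<theta> * x2 + rc \<theta> * x3, rc \<theta> * x1 + ra \<theta> * x2 + rb \<theta> * x3,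
     rb \<theta> * x1 + rc \<theta> * x2 + ra \<theta> * x3, x1, x2, x3] ! i"

lemma less_6_cases: "i < 6 \<Longrightarrow> i = 0 \<or> i = Suc 0 \<or> i = 2 \<or> i = 3 \<or> i = 4 \<or> i = (5::nat)"
  by auto

lemma evp_measurable [measurable]:
  assumes "i < 6" shows "evp i \<in> borel_measurable borel"
proof -
  have eq: "evp i = (\<lambda>p. evp i (fst p, fst (snd p), fst (snd (snd p)), snd (snd (snd p))))" by auto
  have "evp i \<in> borel_measurable (borel \<Otimes>\<^sub>M borel \<Otimes>\<^sub>M borel \<Otimes>\<^sub>M borel)"
    by (subst eq, unfold evp.simps) (use less_6_cases[OF assms] in \<open>elim disjE; simp; measurable\<close>)
  then show ?thesis by (simp only: borel_prod)
qed

definition window :: "real \<Rightarrow> real" where "window \<theta> = indicator {-pi..pi} \<theta>"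

lemma window_measurable [measurable]: "window \<in> borel_measurable borel"
  unfolding window_def[abs_def] by measurable

lemma window_nonneg [simp]: "0 \<le> window \<theta>" and window_idem [simp]: "window \<theta> * window \<theta> = window \<theta>"
  by (auto simp: window_def indicator_def)

lemma window_nn_integral: "(\<integral>\<^sup>+\<theta>. ennreal (window \<theta>) \<partial>lborel) = ennreal (2 * pi)"
  unfolding window_def ennreal_indicator by simp

section \<open>The positive average and its \<open>L2\<close> bound\<close>

lemma nn_lborel3:
  fixes f :: "real \<times> real \<times> real \<Rightarrow> ennreal"
  assumes [measurable]: "f \<in> borel_measurable borel"
  shows "(\<integral>\<^sup>+w. f w \<partial>lborel) = (\<integral>\<^sup>+\<theta>. \<integral>\<^sup>+x1. \<integral>\<^sup>+x2. f (\<theta>, x1, x2) \<partial>lborel \<partial>lborel \<partial>lborel)"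
proof -
  have [measurable]: "f \<in> borel_measurable (lborel \<Otimes>\<^sub>M lborel)" by (simp add: lborel_prod)
  have "(\<integral>\<^sup>+w. f w \<partial>lborel) = (\<integral>\<^sup>+\<theta>. \<integral>\<^sup>+q. f (\<theta>, q) \<partial>lborel \<partial>lborel)"
    by (subst lborel_prod[symmetric], subst lborel.nn_integral_fst[symmetric]) auto
  moreover have "(\<integral>\<^sup>+q. f (\<theta>, q) \<partial>lborel) = (\<integral>\<^sup>+x1. \<integral>\<^sup>+x2. f (\<theta>, x1, x2) \<partial>lborel \<partial>lborel)" for \<theta>
  proof -
    have "(\<lambda>q. f (\<theta>, q)) \<in> borel_measurable borel"
      by (rule measurable_compose[OF _ assms]) (intro borel_measurable_continuous_onI continuous_intros)
    then have "(\<lambda>q. f (\<theta>, q)) \<in> borel_measurable (lborel \<Otimes>\<^sub>M lborel)" by (simp add: lborel_prod)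
    then show ?thesis by (subst lborel_prod[symmetric], subst lborel.nn_integral_fst[symmetric]) auto
  qed
  ultimately show ?thesis by simp
qed

text \<open>The output \<open>x\<close> is the third original coordinate; the angle and the other
  two coordinates are integrated. Values in \<open>ennreal\<close> allow arbitrary nonnegative
  measurable arguments.\<close>

definition avg :: "(nat \<Rightarrow> real \<Rightarrow> real) \<Rightarrow> real \<Rightarrow> ennreal" where
  "avg F x = (\<integral>\<^sup>+w. ennreal (window (fst w) * (\<Prod>i<5. F i (evp i (x, w)))) \<partial>lborel)"

lemma prod_lessThan_5: "(\<Prod>i<5. f i) = f 0 * f (Suc 0) * f 2 * f 3 * (f 4 :: 'a :: comm_monoid_mult)"
  and prod_lessThan_3: "(\<Prod>i<3. f i) = f 0 * f (Suc 0) * f 2"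
  and prod_lessThan_6: "(\<Prod>i<6. f i) = (\<Prod>i<5. f i) * f 5"
  by (simp_all add: eval_nat_numeral lessThan_Suc mult_ac)

lemma evp_pair_measurable [measurable]:
  assumes "i < 6" shows "(\<lambda>w. evp i (x, w)) \<in> borel_measurable borel"
  using evp_measurable[OF assms]
  by (intro measurable_compose[of "\<lambda>w. (x, w)" _ borel "evp i"])
     (auto intro!: continuous_intros borel_measurable_continuous_onI)

lemma window_fst_measurable:
  "(\<lambda>w :: real \<times> real \<times> real. window (fst w)) \<in> borel_measurable borel"
  by (rule measurable_compose[OF _ window_measurable]) (intro borel_measurable_continuous_onI continuous_intros)

lemma window_snd_measurable:
  "(\<lambda>p :: real \<times> real \<times> real \<times> real. window (fst (snd p))) \<in> borel_measurable borel"
  by (rule measurable_compose[OF _ window_measurable]) (intro borel_measurable_continuous_onI continuous_intros)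

lemma avg_measurable [measurable]:
  assumes F: "\<And>i. i < 5 \<Longrightarrow> F i \<in> borel_measurable borel"
  shows "avg F \<in> borel_measurable borel"
proof -
  have "(\<lambda>p. ennreal (window (fst (snd p)) * (\<Prod>i<5. F i (evp i p)))) \<in> borel_measurable borel"
    by (intro measurable_compose[OF _ measurable_ennreal] borel_measurable_times borel_measurable_prod measurable_compose[OF evp_measurable F]
        window_snd_measurable) auto
  then have "(\<lambda>(x, w). ennreal (window (fst w) * (\<Prod>i<5. F i (evp i (x, w))))) \<in> borel_measurable (lborel \<Otimes>\<^sub>M lborel)"
    by (simp add: lborel_prod case_prod_beta')
  from lborel.borel_measurable_nn_integral[OF this] show ?thesis
    by (simp add: avg_def[abs_def])
qed

text \<open>Cauchy--Schwarz at fixed \<open>x\<close> separates the rotated factors 0 to 2 from the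
  unrotated factors 3 and 4. The integral of the latter is bounded uniformly in \<open>x\<close>;
  that of the former is bounded after integrating over \<open>x\<close>, by rotation invariance.
  Each contributes one factor \<open>2 * pi\<close> from the angle.\<close>

lemma avg_L2:
  assumes F: "\<And>i. i < 5 \<Longrightarrow> F i \<in> borel_measurable borel" and F0: "\<And>i x. i < 5 \<Longrightarrow> 0 \<le> F i x"
    and n: "\<And>i. i < 5 \<Longrightarrow> (\<integral>\<^sup>+x. (ennreal (F i x))\<^sup>2 \<partial>lborel) \<le> ennreal ((n i)\<^sup>2)"
  shows "(\<integral>\<^sup>+x. (avg F x)\<^sup>2 \<partial>lborel) \<le> ennreal ((2 * pi * (\<Prod>i<5. n i))\<^sup>2)"
proof -
  note [measurable] = F
  have Fs [measurable]: "F 0 \<in> borel_measurable borel" "F (Suc 0) \<in> borel_measurable borel" "F 2 \<in> borel_measurable borel"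
    "F 3 \<in> borel_measurable borel" "F 4 \<in> borel_measurable borel" using F by auto
  have Fe: "(\<lambda>w. F i (evp i (x, w))) \<in> borel_measurable borel" if "i < 5" for i x
    using that by (intro measurable_compose[OF evp_pair_measurable F]) auto
  let ?U = "\<lambda>x w. ennreal (window (fst w) * (\<Prod>i<3. F i (evp i (x, w))))"
  let ?V = "\<lambda>x w. ennreal (window (fst w) * (F 3 (evp 3 (x, w)) * F 4 (evp 4 (x, w))))"
  have Um: "?U x \<in> borel_measurable borel" for x
    by (intro measurable_compose[OF _ measurable_ennreal] borel_measurable_times borel_measurable_prod Fe window_fst_measurable) auto
  have Vm: "?V x \<in> borel_measurable borel" for x
    by (intro measurable_compose[OF _ measurable_ennreal] borel_measurable_times Fe window_fst_measurable) auto
  \<comment> \<open>The window is its own square, so both halves of the product can carry a copy of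
    it.\<close>
  have UV: "avg F x = (\<integral>\<^sup>+w. ?U x w * ?V x w \<partial>lborel)" for x
  proof -
    have "ennreal (window (fst w) * (\<Prod>i<5. F i (evp i (x, w)))) = ?U x w * ?V x w" for w
    proof -
      have "?U x w * ?V x w = ennreal ((window (fst w) * (\<Prod>i<3. F i (evp i (x, w)))) * (window (fst w) * (F 3 (evp 3 (x, w)) * F 4 (evp 4 (x, w)))))"
        by (rule ennreal_mult[symmetric]) (auto intro!: mult_nonneg_nonneg prod_nonneg F0)
      also have "(window (fst w) * (\<Prod>i<3. F i (evp i (x, w)))) * (window (fst w) * (F 3 (evp 3 (x, w)) * F 4 (evp 4 (x, w)))) =
          (window (fst w) * window (fst w)) * (\<Prod>i<5. F i (evp i (x, w)))"
        by (simp add: prod_lessThan_5 prod_lessThan_3 mult_ac del: window_idem evp.simps)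
      finally show ?thesis by simp
    qed
    then show ?thesis by (simp add: avg_def)
  qed
  define g where "g i x = (ennreal (F i x))\<^sup>2" for i x
  have gm [measurable]: "i < 5 \<Longrightarrow> g i \<in> borel_measurable borel" for i unfolding g_def by measurable
  have gs [measurable]: "g 0 \<in> borel_measurable borel" "g (Suc 0) \<in> borel_measurable borel" "g 2 \<in> borel_measurable borel"
    "g 3 \<in> borel_measurable borel" "g 4 \<in> borel_measurable borel" using gm by auto
  have V2: "(\<integral>\<^sup>+w. (?V x w)\<^sup>2 \<partial>lborel) \<le> ennreal (2 * pi * ((n 3)\<^sup>2 * (n 4)\<^sup>2))" for x
  proof -
    have "(?V x (\<theta>, x1, x2))\<^sup>2 = ennreal (window \<theta>) * (g 3 x1 * g 4 x2)" for \<theta> x1 x2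
    proof -
      have "(?V x (\<theta>, x1, x2))\<^sup>2 = (ennreal (window \<theta>) * ennreal (window \<theta>)) * (g 3 x1 * g 4 x2)"
        by (simp add: g_def ennreal_mult F0 power2_eq_square mult_ac)
      also have "ennreal (window \<theta>) * ennreal (window \<theta>) = ennreal (window \<theta>)" by (simp flip: ennreal_mult)
      finally show ?thesis .
    qed
    then have "(\<integral>\<^sup>+w. (?V x w)\<^sup>2 \<partial>lborel) = (\<integral>\<^sup>+\<theta>. \<integral>\<^sup>+x1. \<integral>\<^sup>+x2. ennreal (window \<theta>) * (g 3 x1 * g 4 x2) \<partial>lborel \<partial>lborel \<partial>lborel)"
      by (subst nn_lborel3[OF borel_measurable_power_ennreal[OF Vm[of x]]]) simp
    also have "\<dots> = ennreal (2 * pi) * ((\<integral>\<^sup>+x. g 3 x \<partial>lborel) * (\<integral>\<^sup>+x. g 4 x \<partial>lborel))"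
      by (simp add: nn_integral_cmult nn_integral_multc window_nn_integral)
    also have "\<dots> \<le> ennreal (2 * pi) * (ennreal ((n 3)\<^sup>2) * ennreal ((n 4)\<^sup>2))"
      using n[of 3] n[of 4] by (intro mult_mono) (auto simp: g_def)
    finally show ?thesis by (simp flip: ennreal_mult)
  qed
  have U2: "(\<integral>\<^sup>+x. \<integral>\<^sup>+w. (?U x w)\<^sup>2 \<partial>lborel \<partial>lborel) \<le> ennreal (2 * pi * ((n 0)\<^sup>2 * (n 1)\<^sup>2 * (n 2)\<^sup>2))"
  proof -
    define K where "K = (\<lambda>(y1, y2, y3). g 0 y1 * (g (Suc 0) y2 * g 2 y3))"
    have [measurable]: "K \<in> borel_measurable (borel \<Otimes>\<^sub>M borel \<Otimes>\<^sub>M borel)" unfolding K_def by measurable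
    let ?Y = "\<lambda>\<theta> x1 x2 x3. (ra \<theta> * x1 + rb \<theta> * x2 + rc \<theta> * x3, rc \<theta> * x1 + ra \<theta> * x2 + rb \<theta> * x3,
     rb \<theta> * x1 + rc \<theta> * x2 + ra \<theta> * x3)"
    have "(?U x (\<theta>, x1, x2))\<^sup>2 = ennreal (window \<theta>) * K (?Y \<theta> x1 x2 x)" for x \<theta> x1 x2
    proof -
      have "(?U x (\<theta>, x1, x2))\<^sup>2 = (ennreal (window \<theta>) * ennreal (window \<theta>)) * K (?Y \<theta> x1 x2 x)"
        by (simp add: K_def g_def prod_lessThan_3 ennreal_mult F0 power2_eq_square mult_ac)
      also have "ennreal (window \<theta>) * ennreal (window \<theta>) = ennreal (window \<theta>)" by (simp flip: ennreal_mult)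
      finally show ?thesis .
    qed
    then have "(\<integral>\<^sup>+x. \<integral>\<^sup>+w. (?U x w)\<^sup>2 \<partial>lborel \<partial>lborel) =
        (\<integral>\<^sup>+x. \<integral>\<^sup>+\<theta>. \<integral>\<^sup>+x1. \<integral>\<^sup>+x2. ennreal (window \<theta>) * K (?Y \<theta> x1 x2 x) \<partial>lborel \<partial>lborel \<partial>lborel \<partial>lborel)"
      by (subst nn_lborel3[OF borel_measurable_power_ennreal[OF Um]]) simp
    also have "\<dots> = (\<integral>\<^sup>+\<theta>. \<integral>\<^sup>+x. \<integral>\<^sup>+x1. \<integral>\<^sup>+x2. ennreal (window \<theta>) * K (?Y \<theta> x1 x2 x) \<partial>lborel \<partial>lborel \<partial>lborel \<partial>lborel)"
      by (intro lborel_pair.Fubini') measurable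
    also have "\<dots> = (\<integral>\<^sup>+\<theta>. \<integral>\<^sup>+x. \<integral>\<^sup>+x2. \<integral>\<^sup>+x1. ennreal (window \<theta>) * K (?Y \<theta> x1 x2 x) \<partial>lborel \<partial>lborel \<partial>lborel \<partial>lborel)"
      by (intro nn_integral_cong lborel_pair.Fubini') measurable
    also have "\<dots> = (\<integral>\<^sup>+\<theta>. ennreal (window \<theta>) * (\<integral>\<^sup>+x. \<integral>\<^sup>+x2. \<integral>\<^sup>+x1. K (?Y \<theta> x1 x2 x) \<partial>lborel \<partial>lborel \<partial>lborel) \<partial>lborel)"
      by (simp add: nn_integral_cmult)
    also have "\<dots> = (\<integral>\<^sup>+\<theta>. ennreal (window \<theta>) * (\<integral>\<^sup>+z. \<integral>\<^sup>+y. \<integral>\<^sup>+x. K (x, y, z) \<partial>lborel \<partial>lborel \<partial>lborel) \<partial>lborel)"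
    proof (rule nn_integral_cong_AE)
      show "AE \<theta> in lborel. ennreal (window \<theta>) * (\<integral>\<^sup>+x. \<integral>\<^sup>+x2. \<integral>\<^sup>+x1. K (?Y \<theta> x1 x2 x) \<partial>lborel \<partial>lborel \<partial>lborel) =
          ennreal (window \<theta>) * (\<integral>\<^sup>+z. \<integral>\<^sup>+y. \<integral>\<^sup>+x. K (x, y, z) \<partial>lborel \<partial>lborel \<partial>lborel)"
        using ra_nonzero_AE
      proof eventually_elim
        case (elim \<theta>)
        show ?case
        proof (cases "\<theta> \<in> {-pi..pi}")
          case True
          then show ?thesis using elim by (subst rot_nn_integral) (auto simp: rot_sum rot_sq)
        next
          case False
          then show ?thesis by (simp add: window_def)
        qed
      qed
    qed
    also have "\<dots> = ennreal (2 * pi) * ((\<integral>\<^sup>+x. g 0 x \<partial>lborel) * ((\<integral>\<^sup>+x. g (Suc 0) x \<partial>lborel) * (\<integral>\<^sup>+x. g 2 x \<partial>lborel)))"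
      unfolding K_def by (simp add: nn_integral_cmult nn_integral_multc window_nn_integral)
    also have "\<dots> \<le> ennreal (2 * pi) * (ennreal ((n 0)\<^sup>2) * (ennreal ((n 1)\<^sup>2) * ennreal ((n 2)\<^sup>2)))"
      using n[of 0] n[of 1] n[of 2] by (intro mult_mono) (auto simp: g_def)
    finally show ?thesis by (simp add: mult_ac flip: ennreal_mult)
  qed
  have "(\<integral>\<^sup>+x. (avg F x)\<^sup>2 \<partial>lborel) \<le> (\<integral>\<^sup>+x. (\<integral>\<^sup>+w. (?U x w)\<^sup>2 \<partial>lborel) * ennreal (2 * pi * ((n 3)\<^sup>2 * (n 4)\<^sup>2)) \<partial>lborel)"
  proof (rule nn_integral_mono)
    fix x
    have "(avg F x)\<^sup>2 \<le> (\<integral>\<^sup>+w. (?U x w)\<^sup>2 \<partial>lborel) * (\<integral>\<^sup>+w. (?V x w)\<^sup>2 \<partial>lborel)"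
      unfolding UV using Um Vm by (intro Cauchy_Schwarz_nn_integral) auto
    also have "\<dots> \<le> (\<integral>\<^sup>+w. (?U x w)\<^sup>2 \<partial>lborel) * ennreal (2 * pi * ((n 3)\<^sup>2 * (n 4)\<^sup>2))"
      by (intro mult_left_mono V2) auto
    finally show "(avg F x)\<^sup>2 \<le> (\<integral>\<^sup>+w. (?U x w)\<^sup>2 \<partial>lborel) * ennreal (2 * pi * ((n 3)\<^sup>2 * (n 4)\<^sup>2))" .
  qed
  also have "\<dots> = (\<integral>\<^sup>+x. (\<integral>\<^sup>+w. (?U x w)\<^sup>2 \<partial>lborel) \<partial>lborel) * ennreal (2 * pi * ((n 3)\<^sup>2 * (n 4)\<^sup>2))"
  proof (rule nn_integral_multc)
    have "(\<lambda>p. (ennreal (window (fst (snd p)) * (\<Prod>i<3. F i (evp i p))))\<^sup>2) \<in> borel_measurable borel"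
      by (intro borel_measurable_power_ennreal measurable_compose[OF _ measurable_ennreal] borel_measurable_times borel_measurable_prod measurable_compose[OF evp_measurable F]
          window_snd_measurable) auto
    then have "(\<lambda>(x, w). (?U x w)\<^sup>2) \<in> borel_measurable (lborel \<Otimes>\<^sub>M lborel)"
      by (simp add: lborel_prod case_prod_beta')
    from lborel.borel_measurable_nn_integral[OF this]
    show "(\<lambda>x. \<integral>\<^sup>+w. (?U x w)\<^sup>2 \<partial>lborel) \<in> borel_measurable lborel" by simp
  qed
  also have "\<dots> \<le> ennreal (2 * pi * ((n 0)\<^sup>2 * (n 1)\<^sup>2 * (n 2)\<^sup>2)) * ennreal (2 * pi * ((n 3)\<^sup>2 * (n 4)\<^sup>2))"
    by (intro mult_right_mono U2) auto
  also have "\<dots> = ennreal (2 * pi * ((n 0)\<^sup>2 * (n 1)\<^sup>2 * (n 2)\<^sup>2) * (2 * pi * ((n 3)\<^sup>2 * (n 4)\<^sup>2)))"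
    by (rule ennreal_mult[symmetric]; intro mult_nonneg_nonneg zero_le_power2; simp)
  also have "2 * pi * ((n 0)\<^sup>2 * (n 1)\<^sup>2 * (n 2)\<^sup>2) * (2 * pi * ((n 3)\<^sup>2 * (n 4)\<^sup>2)) = (2 * pi * (\<Prod>i<5. n i))\<^sup>2"
    by (simp add: prod_lessThan_5 power2_eq_square mult_ac)
  finally show ?thesis .
qed

lemma avg_pairing:
  assumes f: "\<And>i. i < 6 \<Longrightarrow> f i \<in> SQ"
  shows "(\<integral>\<^sup>+p. ennreal (window (fst (snd p)) * (\<Prod>i<6. norm (f i (evp i p)))) \<partial>lborel)
     \<le> ennreal (2 * pi * (\<Prod>i<6. nrm (f i)))"
proof -
  let ?F = "\<lambda>i x. norm (f i x)"
  have m: "?F i \<in> borel_measurable borel" if "i < 6" for i using f[OF that] by measurable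
  have m5: "?F 5 \<in> borel_measurable borel" by (rule m) simp
  have pm: "(\<lambda>p. ennreal (window (fst (snd p)) * (\<Prod>i<6. ?F i (evp i p)))) \<in> borel_measurable borel"
    by (intro measurable_compose[OF _ measurable_ennreal] borel_measurable_times borel_measurable_prod
        measurable_compose[OF evp_measurable m] window_snd_measurable) auto
  have am: "avg ?F \<in> borel_measurable borel" by (rule avg_measurable) (use m in auto)
  have "(\<integral>\<^sup>+p. ennreal (window (fst (snd p)) * (\<Prod>i<6. ?F i (evp i p))) \<partial>lborel) =
      (\<integral>\<^sup>+x. \<integral>\<^sup>+w. ennreal (window (fst w) * (\<Prod>i<6. ?F i (evp i (x, w)))) \<partial>lborel \<partial>lborel)"
    using pm by (subst lborel_prod[symmetric], subst lborel.nn_integral_fst[symmetric]) (auto simp: lborel_prod)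
  also have "\<dots> = (\<integral>\<^sup>+x. avg ?F x * ennreal (?F 5 x) \<partial>lborel)"
  proof (rule nn_integral_cong)
    fix x
    have "(\<integral>\<^sup>+w. ennreal (window (fst w) * (\<Prod>i<6. ?F i (evp i (x, w)))) \<partial>lborel) =
        (\<integral>\<^sup>+w. ennreal (window (fst w) * (\<Prod>i<5. ?F i (evp i (x, w)))) * ennreal (?F 5 x) \<partial>lborel)"
    proof (rule nn_integral_cong)
      fix w :: "real \<times> real \<times> real"
      have "evp 5 (x, w) = x" by (cases w) simp
      then have e: "window (fst w) * (\<Prod>i<6. ?F i (evp i (x, w))) = (window (fst w) * (\<Prod>i<5. ?F i (evp i (x, w)))) * ?F 5 x"
        unfolding prod_lessThan_6 by (simp only: mult.assoc)
      show "ennreal (window (fst w) * (\<Prod>i<6. ?F i (evp i (x, w)))) = ennreal (window (fst w) * (\<Prod>i<5. ?F i (evp i (x, w)))) * ennreal (?F 5 x)"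
        unfolding e by (rule ennreal_mult) (auto intro!: mult_nonneg_nonneg prod_nonneg)
    qed
    also have "\<dots> = avg ?F x * ennreal (?F 5 x)"
      unfolding avg_def
    proof (rule nn_integral_multc)
      have "(\<lambda>w :: real \<times> real \<times> real. window (fst w)) \<in> borel_measurable borel"
        by (rule window_fst_measurable)
      then have "(\<lambda>w. ennreal (window (fst w) * (\<Prod>i<5. ?F i (evp i (x, w))))) \<in> borel_measurable borel"
        by (intro measurable_compose[OF _ measurable_ennreal] borel_measurable_times borel_measurable_prod
          measurable_compose[OF evp_pair_measurable m]) auto
      then show "(\<lambda>w. ennreal (window (fst w) * (\<Prod>i<5. ?F i (evp i (x, w))))) \<in> borel_measurable lborel" by simp
    qed
    finally show "(\<integral>\<^sup>+w. ennreal (window (fst w) * (\<Prod>i<6. ?F i (evp i (x, w)))) \<partial>lborel) = avg ?F x * ennreal (?F 5 x)" .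
  qed
  also have "\<dots> \<le> ennreal ((2 * pi * (\<Prod>i<5. nrm (f i))) * nrm (f 5))"
  proof (rule cauchy_schwarz_nn_real)
    show "avg ?F \<in> borel_measurable lborel" using am by simp
    show "(\<lambda>x. ennreal (?F 5 x)) \<in> borel_measurable lborel" using m5 by simp
    show "(\<integral>\<^sup>+x. (avg ?F x)\<^sup>2 \<partial>lborel) \<le> ennreal ((2 * pi * (\<Prod>i<5. nrm (f i)))\<^sup>2)"
      by (rule avg_L2) (use f m in \<open>auto simp: nn_integral_nrm\<close>)
    show "(\<integral>\<^sup>+x. (ennreal (?F 5 x))\<^sup>2 \<partial>lborel) \<le> ennreal ((nrm (f 5))\<^sup>2)"
      using f[of 5] by (simp add: nn_integral_nrm)
  qed (auto intro!: mult_nonneg_nonneg prod_nonneg)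
  also have "(2 * pi * (\<Prod>i<5. nrm (f i))) * nrm (f 5) = 2 * pi * (\<Prod>i<6. nrm (f i))"
    by (simp add: prod_lessThan_6)
  finally show ?thesis .
qed

text \<open>Fixed by agreement on coherent states. There \<open>12 / pi\<close>, the factor
  \<open>1 / 4\<close> from rescaling time to a full period and the Gaussian integral
  \<open>sqrt (pi / 3)\<close> must match \<open>pi * sqrt pi\<close> from three Gaussian integrals.
  Times the angular mass \<open>2 * pi\<close> it becomes the \<open>L2\<close> constant
  \<open>2 * sqrt 3 / pi\<close>.\<close>

definition avg_const :: real where "avg_const = sqrt 3 / pi\<^sup>2"

lemma avg_const_pos: "0 < avg_const" by (simp add: avg_const_def)

definition avg_weight :: "real \<times> real \<times> real \<times> real \<Rightarrow> real" where
  "avg_weight p = avg_const * window (fst (snd p))"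

lemma avg_weight_measurable [measurable]: "avg_weight \<in> borel_measurable borel"
  unfolding avg_weight_def[abs_def] by (intro borel_measurable_times window_snd_measurable) simp

lemma avg_form_bound:
  assumes f: "\<And>i. i < 6 \<Longrightarrow> f i \<in> SQ"
  shows "(\<integral>\<^sup>+p. ennreal (avg_weight p * (\<Prod>i<6. norm (f i (evp i p)))) \<partial>lborel)
     \<le> ennreal (2 * sqrt 3 / pi * (\<Prod>i<6. nrm (f i)))"
proof -
  have m: "f i \<in> borel_measurable borel" if "i < 6" for i using f[OF that] by (rule L2_measurable)
  have nm: "(\<lambda>p. norm (f i (evp i p))) \<in> borel_measurable borel" if "i < 6" for i
    by (rule measurable_compose[OF measurable_compose[OF evp_measurable[OF that] m[OF that]] borel_measurable_norm])
  have pm: "(\<lambda>p. ennreal (window (fst (snd p)) * (\<Prod>i<6. norm (f i (evp i p))))) \<in> borel_measurable borel"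
    by (intro measurable_compose[OF _ measurable_ennreal] borel_measurable_times borel_measurable_prod
        nm window_snd_measurable) auto
  have "(\<integral>\<^sup>+p. ennreal (avg_weight p * (\<Prod>i<6. norm (f i (evp i p)))) \<partial>lborel) =
      (\<integral>\<^sup>+p. ennreal avg_const * ennreal (window (fst (snd p)) * (\<Prod>i<6. norm (f i (evp i p)))) \<partial>lborel)"
  proof (rule nn_integral_cong)
    fix p :: "real \<times> real \<times> real \<times> real"
    have e: "avg_weight p * (\<Prod>i<6. norm (f i (evp i p))) = avg_const * (window (fst (snd p)) * (\<Prod>i<6. norm (f i (evp i p))))"
      by (simp only: avg_weight_def mult.assoc)
    show "ennreal (avg_weight p * (\<Prod>i<6. norm (f i (evp i p)))) = ennreal avg_const * ennreal (window (fst (snd p)) * (\<Prod>i<6. norm (f i (evp i p))))"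
      unfolding e using avg_const_pos by (intro ennreal_mult) (auto intro!: mult_nonneg_nonneg prod_nonneg)
  qed
  also have "\<dots> = ennreal avg_const * (\<integral>\<^sup>+p. ennreal (window (fst (snd p)) * (\<Prod>i<6. norm (f i (evp i p)))) \<partial>lborel)"
    using pm by (intro nn_integral_cmult) simp
  also have "\<dots> \<le> ennreal avg_const * ennreal (2 * pi * (\<Prod>i<6. nrm (f i)))"
    by (intro mult_left_mono avg_pairing f) auto
  also have "\<dots> = ennreal (avg_const * (2 * pi * (\<Prod>i<6. nrm (f i))))"
    using avg_const_pos by (intro ennreal_mult[symmetric]) (auto intro!: mult_nonneg_nonneg prod_nonneg)
  also have "avg_const * (2 * pi * (\<Prod>i<6. nrm (f i))) = 2 * sqrt 3 / pi * (\<Prod>i<6. nrm (f i))"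
    by (simp add: avg_const_def power2_eq_square)
  finally show ?thesis .
qed

interpretation A: sextic lborel avg_weight "\<lambda>i f p. f (evp i p)" SQ
proof
  show "avg_weight \<in> borel_measurable lborel" by simp
  show "0 \<le> avg_weight w" for w using avg_const_pos by (simp add: avg_weight_def)
  show "(\<lambda>p. f (evp i p)) \<in> borel_measurable lborel" if "i < 6" "f \<in> SQ" for i f
    using measurable_compose[OF evp_measurable[OF that(1)] L2_measurable[OF that(2)]] by simp
  show "(\<integral>\<^sup>+w. ennreal (avg_weight w * (\<Prod>i<6. norm (f i (evp i w)))) \<partial>lborel) < \<infinity>"
    if "\<And>i. i < 6 \<Longrightarrow> f i \<in> SQ" for f
    unfolding infinity_ennreal_def by (rule le_less_trans[OF avg_form_bound[of f, OF that] ennreal_less_top])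
qed auto

lemma norm_avg_form_le:
  assumes f: "\<And>i. i < 6 \<Longrightarrow> f i \<in> SQ"
  shows "norm (A.form f) \<le> 2 * sqrt 3 / pi * (\<Prod>i<6. nrm (f i))"
proof -
  have "ennreal (norm (A.form f)) \<le> ennreal (2 * sqrt 3 / pi * (\<Prod>i<6. nrm (f i)))"
    using A.norm_form_le[OF f] avg_form_bound[of f, OF f] by (rule order_trans)
  moreover have "0 \<le> 2 * sqrt 3 / pi * (\<Prod>i<6. nrm (f i))"
    by (intro mult_nonneg_nonneg prod_nonneg) auto
  ultimately show ?thesis by (simp only: ennreal_le_iff)
qed

lemma avg_form_slot_bound:
  assumes f: "\<And>i. i < 6 \<Longrightarrow> f i \<in> SQ" and j: "j < 6"
  shows "\<exists>K. \<forall>g\<in>SQ. norm (A.form (f(j := g))) \<le> K * nrm g"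
proof (intro exI ballI)
  fix g assume g: "g \<in> SQ"
  have "norm (A.form (f(j := g))) \<le> 2 * sqrt 3 / pi * (\<Prod>i<6. nrm ((f(j := g)) i))"
    using f g by (intro norm_avg_form_le) auto
  also have "(\<Prod>i<6. nrm ((f(j := g)) i)) = nrm g * (\<Prod>i\<in>{..<6} - {j}. nrm (f i))"
    using j by (subst prod.remove[of _ j]) (auto intro!: prod.cong)
  finally show "norm (A.form (f(j := g))) \<le> (2 * sqrt 3 / pi * (\<Prod>i\<in>{..<6} - {j}. nrm (f i))) * nrm g"
    by (simp only: mult_ac)
qed

text \<open>The operator that represents the averaged form by duality in the last slot
  (\<open>ip_avg_op\<close>); it gives an explicit formula for \<open>T6\<close> almost
  everywhere.\<close>

definition avg_op :: "(nat \<Rightarrow> real \<Rightarrow> complex) \<Rightarrow> real \<Rightarrow> complex" where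
  "avg_op f x = (LINT w|lborel. avg_weight (x, w) *\<^sub>R (\<Prod>i<5. slot i (f i (evp i (x, w)))))"

lemma avg_op_measurable:
  assumes f: "\<And>i. i < 5 \<Longrightarrow> f i \<in> borel_measurable borel"
  shows "avg_op f \<in> borel_measurable borel"
proof -
  have "(\<lambda>p. avg_weight p *\<^sub>R (\<Prod>i<5. slot i (f i (evp i p)))) \<in> borel_measurable borel"
    by (intro borel_measurable_scaleR borel_measurable_prod slot_measurable avg_weight_measurable
        measurable_compose[OF evp_measurable f]) auto
  then have "(\<lambda>(x, w). avg_weight (x, w) *\<^sub>R (\<Prod>i<5. slot i (f i (evp i (x, w))))) \<in> borel_measurable (lborel \<Otimes>\<^sub>M lborel)"
    by (simp add: lborel_prod case_prod_beta')
  from lborel.borel_measurable_lebesgue_integral[OF this] show ?thesis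
    by (simp add: avg_op_def[abs_def])
qed

lemma norm_avg_op_le:
  assumes f: "\<And>i. i < 5 \<Longrightarrow> f i \<in> borel_measurable borel"
  shows "ennreal (norm (avg_op f x)) \<le> ennreal avg_const * avg (\<lambda>i x. norm (f i x)) x"
proof -
  let ?g = "\<lambda>w. avg_weight (x, w) *\<^sub>R (\<Prod>i<5. slot i (f i (evp i (x, w))))"
  have "ennreal (norm (avg_op f x)) \<le> (\<integral>\<^sup>+w. ennreal (norm (?g w)) \<partial>lborel)"
  proof (cases "integrable lborel ?g")
    case True
    then show ?thesis unfolding avg_op_def by (rule integral_norm_bound_ennreal)
  next
    \<comment> \<open>The integral is 0 by convention here, so the bound holds at every point and
      not just almost everywhere.\<close>
    case False
    then show ?thesis by (simp add: avg_op_def not_integrable_integral_eq)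
  qed
  also have "\<dots> = (\<integral>\<^sup>+w. ennreal avg_const * ennreal (window (fst w) * (\<Prod>i<5. norm (f i (evp i (x, w))))) \<partial>lborel)"
  proof (rule nn_integral_cong)
    fix w
    have "norm (?g w) = avg_const * (window (fst w) * (\<Prod>i<5. norm (f i (evp i (x, w)))))"
      using avg_const_pos by (simp add: prod_norm[symmetric] avg_weight_def mult.assoc del: evp.simps)
    then show "ennreal (norm (?g w)) = ennreal avg_const * ennreal (window (fst w) * (\<Prod>i<5. norm (f i (evp i (x, w)))))"
      using avg_const_pos by (simp only: ennreal_mult less_imp_le mult_nonneg_nonneg window_nonneg prod_nonneg norm_ge_zero ballI)
  qed
  also have "\<dots> = ennreal avg_const * avg (\<lambda>i x. norm (f i x)) x"
    unfolding avg_def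
  proof (rule nn_integral_cmult)
    have nm: "(\<lambda>w. norm (f i (evp i (x, w)))) \<in> borel_measurable borel" if "i < 5" for i
      using that by (intro measurable_compose[OF measurable_compose[OF evp_pair_measurable f] borel_measurable_norm]) auto
    have "(\<lambda>w :: real \<times> real \<times> real. window (fst w)) \<in> borel_measurable borel"
      by (rule window_fst_measurable)
    then have "(\<lambda>w. ennreal (window (fst w) * (\<Prod>i<5. norm (f i (evp i (x, w)))))) \<in> borel_measurable borel"
      by (intro measurable_compose[OF _ measurable_ennreal] borel_measurable_times borel_measurable_prod nm) auto
    then show "(\<lambda>w. ennreal (window (fst w) * (\<Prod>i<5. norm (f i (evp i (x, w)))))) \<in> borel_measurable lborel" by simp
  qed
  finally show ?thesis .
qed

lemma avg_op_L2:
  assumes f: "\<And>i. i < 5 \<Longrightarrow> f i \<in> SQ"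
  shows "avg_op f \<in> SQ" "nrm (avg_op f) \<le> 2 * sqrt 3 / pi * (\<Prod>i<5. nrm (f i))"
proof -
  have m: "f i \<in> borel_measurable borel" if "i < 5" for i using f[OF that] by (rule L2_measurable)
  have am: "avg (\<lambda>i x. norm (f i x)) \<in> borel_measurable borel" by (rule avg_measurable) (use m in auto)
  have "(\<integral>\<^sup>+x. (ennreal (norm (avg_op f x)))\<^sup>2 \<partial>lborel) \<le> (\<integral>\<^sup>+x. (ennreal avg_const)\<^sup>2 * (avg (\<lambda>i x. norm (f i x)) x)\<^sup>2 \<partial>lborel)"
    unfolding power_mult_distrib[symmetric] by (intro nn_integral_mono power_mono norm_avg_op_le m) auto
  also have "\<dots> = (ennreal avg_const)\<^sup>2 * (\<integral>\<^sup>+x. (avg (\<lambda>i x. norm (f i x)) x)\<^sup>2 \<partial>lborel)"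
    using borel_measurable_power_ennreal[OF am] by (intro nn_integral_cmult) simp
  also have "\<dots> \<le> (ennreal avg_const)\<^sup>2 * ennreal ((2 * pi * (\<Prod>i<5. nrm (f i)))\<^sup>2)"
    by (intro mult_left_mono avg_L2) (use f m in \<open>auto simp: nn_integral_nrm\<close>)
  also have "\<dots> = ennreal (avg_const\<^sup>2) * ennreal ((2 * pi * (\<Prod>i<5. nrm (f i)))\<^sup>2)"
    using avg_const_pos by (simp add: ennreal_power)
  also have "\<dots> = ennreal (avg_const\<^sup>2 * (2 * pi * (\<Prod>i<5. nrm (f i)))\<^sup>2)"
    by (rule ennreal_mult[symmetric]) auto
  also have "avg_const\<^sup>2 * (2 * pi * (\<Prod>i<5. nrm (f i)))\<^sup>2 = (2 * sqrt 3 / pi * (\<Prod>i<5. nrm (f i)))\<^sup>2"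
    by (simp add: avg_const_def power2_eq_square)
  finally have le: "(\<integral>\<^sup>+x. (ennreal (norm (avg_op f x)))\<^sup>2 \<partial>lborel) \<le> ennreal ((2 * sqrt 3 / pi * (\<Prod>i<5. nrm (f i)))\<^sup>2)" .
  have n: "0 \<le> 2 * sqrt 3 / pi * (\<Prod>i<5. nrm (f i))" by (intro mult_nonneg_nonneg prod_nonneg) auto
  show "avg_op f \<in> SQ" "nrm (avg_op f) \<le> 2 * sqrt 3 / pi * (\<Prod>i<5. nrm (f i))"
    using L2_I_nn[OF avg_op_measurable[OF m] le n] by auto
qed

lemma ip_avg_op:
  assumes f: "\<And>i. i < 6 \<Longrightarrow> f i \<in> SQ"
  shows "ip (avg_op f) (f 5) = A.form f"
proof -
  let ?G = "\<lambda>p. avg_weight p *\<^sub>R (\<Prod>i<6. slot i (f i (evp i p)))"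
  have int: "integrable (lborel \<Otimes>\<^sub>M lborel) ?G"
    using A.form_integrable[OF f] by (simp add: lborel_prod)
  have "A.form f = integral\<^sup>L (lborel \<Otimes>\<^sub>M lborel) ?G"
    unfolding A.form_def by (simp add: lborel_prod)
  also have "\<dots> = (LINT x|lborel. LINT w|lborel. ?G (x, w))"
    by (rule lborel_pair.integral_fst'[OF int, symmetric])
  also have "\<dots> = (LINT x|lborel. avg_op f x * cnj (f 5 x))"
  proof (rule Bochner_Integration.integral_cong[OF refl])
    fix x
    have "?G (x, w) = (avg_weight (x, w) *\<^sub>R (\<Prod>i<5. slot i (f i (evp i (x, w))))) * cnj (f 5 x)" for w
    proof -
      have "evp 5 (x, w) = x" by (cases w) simp
      then show ?thesis unfolding prod_lessThan_6 by (simp add: slot_def[of 5])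
    qed
    then show "(LINT w|lborel. ?G (x, w)) = avg_op f x * cnj (f 5 x)"
      unfolding avg_op_def by (simp only: integral_mult_left_zero)
  qed
  finally show ?thesis by (simp add: ip_def)
qed

text \<open>This is \<open>2 * pi\<close> times the modified Bessel function of order 0 at twice a
  square root of \<open>p * q\<close>.\<close>

definition bess :: "complex \<Rightarrow> complex \<Rightarrow> complex" where
  "bess p q = (LINT \<alpha>|lborel. window \<alpha> *\<^sub>R exp (p * cis \<alpha> + q * cis (- \<alpha>)))"

lemma window_integrable: "integrable lborel window"
  unfolding window_def[abs_def] by (rule integrable_real_indicator) (auto simp: emeasure_lborel_Icc_eq)

lemma window_cis:
  fixes m :: int
  shows "(LINT \<alpha>|lborel. window \<alpha> *\<^sub>R cis (real_of_int m * \<alpha>)) = (if m = 0 then 2 * pi else 0)"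
proof (cases "m = 0")
  case True
  have "(LINT \<alpha>|lborel. window \<alpha> *\<^sub>R (1::complex)) = (LINT \<alpha>|lborel. window \<alpha>) *\<^sub>R 1"
    using window_integrable by (intro integral_scaleR_left) auto
  also have "(LINT \<alpha>|lborel. window \<alpha>) = 2 * pi"
    unfolding window_def by simp
  finally show ?thesis using True by (simp add: scaleR_conv_of_real)
next
  case False
  let ?F = "\<lambda>\<alpha>. cis (real_of_int m * \<alpha>) / (\<i> * of_int m)"
  have "(LINT \<alpha>|lborel. indicator {-pi..pi} \<alpha> *\<^sub>R cis (real_of_int m * \<alpha>)) = ?F pi - ?F (- pi)"
  proof (rule integral_FTC_Icc)
    show "(?F has_vector_derivative cis (real_of_int m * x)) (at x within {-pi..pi})" for x
    proof -
      have "((\<lambda>w. exp (\<i> * of_int m * w) / (\<i> * of_int m)) has_field_derivative exp (\<i> * of_int m * of_real x)) (at (of_real x))"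
        using False by (auto intro!: derivative_eq_intros)
      from has_vector_derivative_real_field[OF this] have "(?F has_vector_derivative cis (real_of_int m * x)) (at x)"
        by (simp add: cis_conv_exp mult.assoc)
      then show ?thesis by (rule has_vector_derivative_at_within)
    qed
    show "continuous_on {-pi..pi} (\<lambda>\<alpha>. cis (real_of_int m * \<alpha>))" by (intro continuous_intros)
  qed simp
  also have "cis (real_of_int m * pi) = cis (real_of_int m * - pi)"
    using sin_times_pi_eq_0[of "real_of_int m"] by (simp add: complex_eq_iff)
  finally show ?thesis using False by (simp add: window_def)
qed

text \<open>By orthogonality of the characters on a full period, only the balanced term of the
  binomial expansion survives.\<close>

lemma bess_moment:
  fixes p q :: complex
  shows "(LINT \<alpha>|lborel. window \<alpha> *\<^sub>R (p * cis \<alpha> + q * cis (- \<alpha>)) ^ k) =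
     (\<Sum>j\<le>k. of_nat (k choose j) * (if 2 * j = k then 2 * pi * (p * q) ^ j else 0))"
proof -
  have int: "integrable lborel (\<lambda>\<alpha>. window \<alpha> *\<^sub>R cis (real_of_int m * \<alpha>))" for m :: int
  proof (rule Bochner_Integration.integrable_bound[OF window_integrable])
    have [measurable]: "(\<lambda>\<alpha>. cis (real_of_int m * \<alpha>)) \<in> borel_measurable borel"
      by (intro borel_measurable_continuous_onI continuous_intros)
    show "(\<lambda>\<alpha>. window \<alpha> *\<^sub>R cis (real_of_int m * \<alpha>)) \<in> borel_measurable lborel" by measurable
  qed simp
  have eq: "window \<alpha> *\<^sub>R (p * cis \<alpha> + q * cis (- \<alpha>)) ^ k =
      (\<Sum>j\<le>k. (of_nat (k choose j) * (p ^ j * q ^ (k - j))) * (window \<alpha> *\<^sub>R cis (of_int (2 * int j - int k) * \<alpha>)))" for \<alpha>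
  proof -
    have "(p * cis \<alpha>) ^ j * (q * cis (- \<alpha>)) ^ (k - j) = (p ^ j * q ^ (k - j)) * cis (of_int (2 * int j - int k) * \<alpha>)" if "j \<le> k" for j
    proof -
      have e: "real j * \<alpha> + real (k - j) * - \<alpha> = of_int (2 * int j - int k) * \<alpha>"
        using that by (simp add: of_nat_diff algebra_simps)
      have "cis \<alpha> ^ j * cis (- \<alpha>) ^ (k - j) = cis (of_int (2 * int j - int k) * \<alpha>)"
        by (simp only: Complex.DeMoivre cis_mult e)
      then show ?thesis by (simp only: power_mult_distrib mult_ac)
    qed
    then show ?thesis
      by (simp add: binomial_ring scaleR_sum_right mult_ac)
  qed
  have "(LINT \<alpha>|lborel. window \<alpha> *\<^sub>R (p * cis \<alpha> + q * cis (- \<alpha>)) ^ k) =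
     (\<Sum>j\<le>k. (of_nat (k choose j) * (p ^ j * q ^ (k - j))) * (LINT \<alpha>|lborel. window \<alpha> *\<^sub>R cis (of_int (2 * int j - int k) * \<alpha>)))"
    unfolding eq using int by (simp only: Bochner_Integration.integral_sum integrable_mult_right integral_mult_right_zero)
  also have "\<dots> = (\<Sum>j\<le>k. of_nat (k choose j) * (if 2 * j = k then 2 * pi * (p * q) ^ j else 0))"
    unfolding window_cis
    by (intro sum.cong refl) (auto simp: power_mult_distrib)
  finally show ?thesis .
qed

text \<open>Expanding the exponential reduces \<open>bess\<close> to moments, and
  \<open>bess_moment\<close> shows that each moment involves \<open>p\<close> and \<open>q\<close>
  only through their product.\<close>

lemma bess_eq:
  assumes "p * q = p' * q'" shows "bess p q = bess p' q'"
proof -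
  have sums: "bess p q = (\<Sum>k. (1 / fact k) * (LINT \<alpha>|lborel. window \<alpha> *\<^sub>R (p * cis \<alpha> + q * cis (- \<alpha>)) ^ k))" for p q
  proof -
    let ?v = "\<lambda>\<alpha>. p * cis \<alpha> + q * cis (- \<alpha>)"
    let ?c = "norm p + norm q"
    let ?f = "\<lambda>k \<alpha>. (1 / fact k) * (window \<alpha> *\<^sub>R ?v \<alpha> ^ k)"
    have v: "norm (?v \<alpha>) \<le> ?c" for \<alpha>
      by (rule order_trans[OF norm_triangle_ineq]) (simp add: norm_mult)
    have meas: "(\<lambda>\<alpha>. ?v \<alpha> ^ k) \<in> borel_measurable borel" for k
      by (intro borel_measurable_continuous_onI continuous_intros)
    have nf: "norm (?f k \<alpha>) \<le> window \<alpha> * (?c ^ k / fact k)" for k \<alpha>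
    proof -
      have "norm (?f k \<alpha>) = window \<alpha> * (norm (?v \<alpha>) ^ k / fact k)"
        by (simp add: norm_mult norm_divide norm_power)
      also have "\<dots> \<le> window \<alpha> * (?c ^ k / fact k)"
        by (intro mult_left_mono divide_right_mono power_mono v) auto
      finally show ?thesis .
    qed
    have int: "integrable lborel (?f k)" for k
    proof (rule Bochner_Integration.integrable_bound)
      show "integrable lborel (\<lambda>\<alpha>. window \<alpha> * (?c ^ k / fact k))"
        by (intro integrable_mult_left window_integrable)
      show "AE \<alpha> in lborel. norm (?f k \<alpha>) \<le> norm (window \<alpha> * (?c ^ k / fact k))"
        using order_trans[OF nf abs_ge_self] by (intro AE_I2) (simp only: real_norm_def)
      show "?f k \<in> borel_measurable lborel" using meas by measurable
    qed
    have se: "summable (\<lambda>k. ?c ^ k / fact k)"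
      using summable_exp_generic[of "?c"] by (simp add: divide_inverse mult.commute)
    have "bess p q = (LINT \<alpha>|lborel. (\<Sum>k. ?f k \<alpha>))"
    proof -
      have "window \<alpha> *\<^sub>R exp (?v \<alpha>) = (\<Sum>k. ?f k \<alpha>)" for \<alpha>
      proof -
        have "(\<lambda>k. window \<alpha> *\<^sub>R (?v \<alpha> ^ k /\<^sub>R fact k)) sums (window \<alpha> *\<^sub>R exp (?v \<alpha>))"
          by (intro sums_scaleR_right exp_converges)
        then have "(\<lambda>k. ?f k \<alpha>) sums (window \<alpha> *\<^sub>R exp (?v \<alpha>))"
          by (simp add: scaleR_conv_of_real divide_inverse mult_ac)
        then show ?thesis by (rule sums_unique)
      qed
      then show ?thesis by (simp add: bess_def)
    qed
    also have "\<dots> = (\<Sum>k. LINT \<alpha>|lborel. ?f k \<alpha>)"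
    proof (rule integral_suminf)
      show "AE \<alpha> in lborel. summable (\<lambda>k. norm (?f k \<alpha>))"
      proof (rule AE_I2)
        fix \<alpha>
        show "summable (\<lambda>k. norm (?f k \<alpha>))"
          by (rule summable_comparison_test'[OF summable_mult[OF se, of "window \<alpha>"], of 0]) (use nf in simp)
      qed
      show "summable (\<lambda>k. LINT \<alpha>|lborel. norm (?f k \<alpha>))"
      proof (rule summable_comparison_test'[OF summable_mult[OF se, of "integral\<^sup>L lborel window"], of 0])
        fix k
        have "(LINT \<alpha>|lborel. norm (?f k \<alpha>)) \<le> (LINT \<alpha>|lborel. window \<alpha> * (?c ^ k / fact k))"
          by (intro integral_mono integrable_norm int integrable_mult_left window_integrable nf)
        then show "norm (LINT \<alpha>|lborel. norm (?f k \<alpha>)) \<le> integral\<^sup>L lborel window * (?c ^ k / fact k)"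
          by simp
      qed
    qed (rule int)
    finally show ?thesis by (simp only: integral_mult_right_zero)
  qed
  show ?thesis unfolding sums bess_moment assms ..
qed

section \<open>The averaged form on coherent states\<close>

lemma rot_cross:
  fixes a b c :: real
  assumes "a + b + c = 1" "a\<^sup>2 + b\<^sup>2 + c\<^sup>2 = 1"
  shows "a * b + b * c + a * c = 0"
proof -
  have "(a + b + c)\<^sup>2 = a\<^sup>2 + b\<^sup>2 + c\<^sup>2 + 2 * (a * b + b * c + a * c)"
    by (simp add: power2_eq_square algebra_simps)
  then show ?thesis using assms by simp
qed

lemma rot_norm:
  fixes a b c x1 x2 x3 :: real
  assumes "a + b + c = 1" "a\<^sup>2 + b\<^sup>2 + c\<^sup>2 = 1"
  shows "(a * x1 + b * x2 + c * x3)\<^sup>2 + (c * x1 + a * x2 + b * x3)\<^sup>2 + (b * x1 + c * x2 + a * x3)\<^sup>2 = x1\<^sup>2 + x2\<^sup>2 + x3\<^sup>2"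
proof -
  note 0 = rot_cross[OF assms]
  have "(a * x1 + b * x2 + c * x3)\<^sup>2 + (c * x1 + a * x2 + b * x3)\<^sup>2 + (b * x1 + c * x2 + a * x3)\<^sup>2 =
     (a\<^sup>2 + b\<^sup>2 + c\<^sup>2) * (x1\<^sup>2 + x2\<^sup>2 + x3\<^sup>2) + 2 * (a * b + b * c + a * c) * (x1 * x2 + x2 * x3 + x1 * x3)"
    by (simp add: power2_eq_square algebra_simps)
  then show ?thesis unfolding 0 assms by simp
qed

lemma integral_product:
  fixes f g :: "real \<Rightarrow> complex"
  assumes f: "integrable lborel f" and g: "integrable lborel g"
  shows "(LINT q|lborel. f (fst q) * g (snd q)) = integral\<^sup>L lborel f * integral\<^sup>L lborel g"
proof -
  note [measurable] = borel_measurable_integrable[OF f] borel_measurable_integrable[OF g]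
  have int: "integrable (lborel \<Otimes>\<^sub>M lborel) (\<lambda>q. f (fst q) * g (snd q))"
  proof (rule lborel_pair.Fubini_integrable)
    show "integrable lborel (\<lambda>x. LINT y|lborel. norm (f (fst (x, y)) * g (snd (x, y))))"
      unfolding fst_conv snd_conv norm_mult integral_mult_right_zero
      by (intro integrable_mult_left integrable_norm f)
    show "AE x in lborel. integrable lborel (\<lambda>y. f (fst (x, y)) * g (snd (x, y)))"
      using g by simp
  qed measurable
  have "(LINT q|lborel. f (fst q) * g (snd q)) = (LINT x|lborel. LINT y|lborel. f x * g y)"
    using lborel_pair.integral_fst'[OF int] by (simp add: lborel_prod)
  then show ?thesis by simp
qed

text \<open>The factor 1 keeps the exponent in the shape of \<open>gaussian_complex\<close> with
  \<open>a = 1\<close>.\<close>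

definition gau :: "complex \<Rightarrow> real \<Rightarrow> complex" where
  "gau u x = exp (complex_of_real (- (1 * x\<^sup>2)) + 2 * of_real x * u)"

lemma gau_integral: "integrable lborel (gau u)" "integral\<^sup>L lborel (gau u) = of_real (sqrt pi) * exp (u\<^sup>2)"
  using gaussian_complex[of 1 u] unfolding gau_def[abs_def] has_bochner_integral_iff by simp_all

lemma prod_6: "(\<Prod>i<6::nat. f i) = f 0 * f 1 * f 2 * f 3 * f 4 * (f 5 :: 'a :: comm_monoid_mult)"
  by (simp add: prod_lessThan_6 prod_lessThan_5)

text \<open>Since rotation preserves the norm, the quadratic terms at the rotated and at the
  original point merge. The linear terms move to the original point through the transposed matrix,
  so the integrand factors in \<open>x1\<close>, \<open>x2\<close>, \<open>x3\<close>.\<close>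

lemma coh_rot_prod:
  fixes z :: "nat \<Rightarrow> complex" and \<theta> :: real
  defines "a \<equiv> complex_of_real (ra \<theta>)" and "b \<equiv> complex_of_real (rb \<theta>)" and "c \<equiv> complex_of_real (rc \<theta>)"
  defines "u1 \<equiv> a * z 0 + c * z 1 + b * z 2 + cnj (z 3)" and "u2 \<equiv> b * z 0 + a * z 1 + c * z 2 + cnj (z 4)"
    and "u3 \<equiv> c * z 0 + b * z 1 + a * z 2 + cnj (z 5)"
    and "Q \<equiv> (z 0)\<^sup>2 + (z 1)\<^sup>2 + (z 2)\<^sup>2 + (cnj (z 3))\<^sup>2 + (cnj (z 4))\<^sup>2 + (cnj (z 5))\<^sup>2"
  shows "(\<Prod>i<6. slot i (coh (z i) (evp i (x3, \<theta>, x1, x2)))) = exp (- Q) * (gau u1 x1 * gau u2 x2 * gau u3 x3)"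
proof -
  define y1 where "y1 = ra \<theta> * x1 + rb \<theta> * x2 + rc \<theta> * x3"
  define y2 where "y2 = rc \<theta> * x1 + ra \<theta> * x2 + rb \<theta> * x3"
  define y3 where "y3 = rb \<theta> * x1 + rc \<theta> * x2 + ra \<theta> * x3"
  have "y1\<^sup>2 + y2\<^sup>2 + y3\<^sup>2 = x1\<^sup>2 + x2\<^sup>2 + x3\<^sup>2"
    unfolding y1_def y2_def y3_def by (rule rot_norm[OF rot_sum rot_sq])
  then have "complex_of_real (y1\<^sup>2 + y2\<^sup>2 + y3\<^sup>2) = complex_of_real (x1\<^sup>2 + x2\<^sup>2 + x3\<^sup>2)" by simp
  then have sq: "(complex_of_real y1)\<^sup>2 + (of_real y2)\<^sup>2 + (of_real y3)\<^sup>2 = (of_real x1)\<^sup>2 + (of_real x2)\<^sup>2 + (of_real x3)\<^sup>2"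
    by simp
  have lin: "of_real y1 * z 0 + of_real y2 * z 1 + of_real y3 * z 2 + of_real x1 * cnj (z 3) + of_real x2 * cnj (z 4) + of_real x3 * cnj (z 5)
      = of_real x1 * u1 + of_real x2 * u2 + of_real x3 * u3"
    unfolding y1_def y2_def y3_def u1_def u2_def u3_def a_def b_def c_def by (simp add: algebra_simps)
  have "(\<Prod>i<6. slot i (coh (z i) (evp i (x3, \<theta>, x1, x2)))) =
     coh (z 0) y1 * coh (z 1) y2 * coh (z 2) y3 * cnj (coh (z 3) x1) * cnj (coh (z 4) x2) * cnj (coh (z 5) x3)"
    unfolding prod_6 by (simp add: slot_def y1_def y2_def y3_def)
  also have "\<dots> = exp (- Q - ((of_real y1)\<^sup>2 + (of_real y2)\<^sup>2 + (of_real y3)\<^sup>2) / 2 - ((of_real x1)\<^sup>2 + (of_real x2)\<^sup>2 + (of_real x3)\<^sup>2) / 2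
      + 2 * (of_real y1 * z 0 + of_real y2 * z 1 + of_real y3 * z 2 + of_real x1 * cnj (z 3) + of_real x2 * cnj (z 4) + of_real x3 * cnj (z 5)))"
    unfolding coh_def exp_cnj mult_exp_exp by (rule arg_cong[of _ _ exp]) (simp add: Q_def algebra_simps add_divide_distrib)
  also have "\<dots> = exp (- Q - ((of_real x1)\<^sup>2 + (of_real x2)\<^sup>2 + (of_real x3)\<^sup>2) + 2 * (of_real x1 * u1 + of_real x2 * u2 + of_real x3 * u3))"
    unfolding sq lin by (rule arg_cong[of _ _ exp]) (simp add: field_simps)
  also have "\<dots> = exp (- Q) * (gau u1 x1 * gau u2 x2 * gau u3 x3)"
    unfolding gau_def mult_exp_exp by (rule arg_cong[of _ _ exp]) (simp add: algebra_simps)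
  finally show ?thesis .
qed

text \<open>After the three Gaussian integrals, the terms quadratic in the first three parameters
  alone, or in the last three alone, cancel by orthogonality of the matrix. The mixed terms are
  affine in \<open>cos \<theta>\<close> and \<open>sin \<theta>\<close>, with coefficients given by
  \<open>P - Z * Y / 3\<close> and by the triple product \<open>S\<close> with the diagonal.\<close>

lemma A_form_coh:
  fixes z :: "nat \<Rightarrow> complex"
  defines "Z \<equiv> z 0 + z 1 + z 2" and "Y \<equiv> cnj (z 3) + cnj (z 4) + cnj (z 5)"
    and "P \<equiv> z 0 * cnj (z 3) + z 1 * cnj (z 4) + z 2 * cnj (z 5)"
    and "S \<equiv> z 0 * (cnj (z 4) - cnj (z 5)) + z 1 * (cnj (z 5) - cnj (z 3)) + z 2 * (cnj (z 3) - cnj (z 4))"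
  shows "A.form (\<lambda>i. coh (z i)) = of_real (avg_const * (pi * sqrt pi)) * exp (2 * Z * Y / 3) *
     bess (P - Z * Y / 3 - \<i> * S / of_real (sqrt 3)) (P - Z * Y / 3 + \<i> * S / of_real (sqrt 3))"
proof -
  define u1 where "u1 \<theta> = of_real (ra \<theta>) * z 0 + of_real (rc \<theta>) * z 1 + of_real (rb \<theta>) * z 2 + cnj (z 3)" for \<theta>
  define u2 where "u2 \<theta> = of_real (rb \<theta>) * z 0 + of_real (ra \<theta>) * z 1 + of_real (rc \<theta>) * z 2 + cnj (z 4)" for \<theta>
  define u3 where "u3 \<theta> = of_real (rc \<theta>) * z 0 + of_real (rb \<theta>) * z 1 + of_real (ra \<theta>) * z 2 + cnj (z 5)" for \<theta>
  define Q where "Q = (z 0)\<^sup>2 + (z 1)\<^sup>2 + (z 2)\<^sup>2 + (cnj (z 3))\<^sup>2 + (cnj (z 4))\<^sup>2 + (cnj (z 5))\<^sup>2"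
  let ?p = "P - Z * Y / 3 - \<i> * S / of_real (sqrt 3)" and ?q = "P - Z * Y / 3 + \<i> * S / of_real (sqrt 3)"
  let ?G = "\<lambda>p. avg_weight p *\<^sub>R (\<Prod>i<6. slot i (coh (z i) (evp i p)))"
  have G: "?G (x3, \<theta>, x1, x2) = (avg_const * window \<theta>) *\<^sub>R (exp (- Q) * (gau (u1 \<theta>) x1 * gau (u2 \<theta>) x2 * gau (u3 \<theta>) x3))" for x1 x2 x3 \<theta>
    unfolding coh_rot_prod by (simp add: avg_weight_def u1_def u2_def u3_def Q_def)
  have int: "integrable (lborel \<Otimes>\<^sub>M lborel) ?G"
    using A.form_integrable[of "\<lambda>i. coh (z i)"] by (simp add: lborel_prod)
  have eta: "(\<lambda>(x, w). ?G (x, w)) = ?G" by (rule case_prod_eta)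
  have int': "integrable (lborel \<Otimes>\<^sub>M lborel) (\<lambda>(x, w). ?G (x, w))" unfolding eta by (rule int)
  have inner: "(LINT x|lborel. ?G (x, \<theta>, x1, x2)) = (avg_const * window \<theta>) *\<^sub>R (exp (- Q) * (gau (u1 \<theta>) x1 * gau (u2 \<theta>) x2 * (of_real (sqrt pi) * exp ((u3 \<theta>)\<^sup>2))))" for \<theta> x1 x2
    unfolding G using gau_integral[of "u3 \<theta>"] by simp
  let ?H = "\<lambda>w. LINT x|lborel. ?G (x, w)"
  have intH: "integrable (lborel \<Otimes>\<^sub>M lborel) ?H"
    using lborel_pair.integrable_snd[OF int'] by (simp add: lborel_prod)
  have "A.form (\<lambda>i. coh (z i)) = integral\<^sup>L (lborel \<Otimes>\<^sub>M lborel) (\<lambda>(x, w). ?G (x, w))"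
    unfolding A.form_def eta by (simp add: lborel_prod)
  also have "\<dots> = (LINT w|lborel. ?H w)" by (rule lborel_pair.integral_snd[OF int', symmetric])
  also have "\<dots> = (LINT \<theta>|lborel. LINT q|lborel. ?H (\<theta>, q))"
    using lborel_pair.integral_fst'[OF intH] by (simp add: lborel_prod)
  also have "\<dots> = (LINT \<theta>|lborel. of_real (avg_const * (pi * sqrt pi)) * exp (2 * Z * Y / 3) * (window \<theta> *\<^sub>R exp (?p * cis \<theta> + ?q * cis (- \<theta>))))"
  proof (rule Bochner_Integration.integral_cong[OF refl])
    fix \<theta>
    have "?H (\<theta>, q) = ((avg_const * window \<theta>) *\<^sub>R (exp (- Q) * (of_real (sqrt pi) * exp ((u3 \<theta>)\<^sup>2)))) * (gau (u1 \<theta>) (fst q) * gau (u2 \<theta>) (snd q))" for q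
      by (cases q) (simp only: inner fst_conv snd_conv, simp only: scaleR_conv_of_real mult_ac)
    then have "(LINT q|lborel. ?H (\<theta>, q)) = ((avg_const * window \<theta>) *\<^sub>R (exp (- Q) * (of_real (sqrt pi) * exp ((u3 \<theta>)\<^sup>2)))) *
        ((of_real (sqrt pi) * exp ((u1 \<theta>)\<^sup>2)) * (of_real (sqrt pi) * exp ((u2 \<theta>)\<^sup>2)))"
      by (simp only: integral_mult_right_zero integral_product gau_integral)
    also have "\<dots> = of_real (avg_const * (pi * sqrt pi)) * (window \<theta> *\<^sub>R (exp (- Q) * exp ((u1 \<theta>)\<^sup>2) * exp ((u2 \<theta>)\<^sup>2) * exp ((u3 \<theta>)\<^sup>2)))"
    proof -
      have "complex_of_real (sqrt pi) * complex_of_real (sqrt pi) = complex_of_real pi"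
        by (simp flip: of_real_mult)
      then show ?thesis by (simp add: scaleR_conv_of_real mult_ac)
    qed
    also have "exp (- Q) * exp ((u1 \<theta>)\<^sup>2) * exp ((u2 \<theta>)\<^sup>2) * exp ((u3 \<theta>)\<^sup>2) = exp (2 * Z * Y / 3) * exp (?p * cis \<theta> + ?q * cis (- \<theta>))"
      unfolding mult_exp_exp
    proof (rule arg_cong[of _ _ exp])
      define a b c where "a = complex_of_real (ra \<theta>)" and "b = complex_of_real (rb \<theta>)" and "c = complex_of_real (rc \<theta>)"
      have s1: "a + b + c = 1" using arg_cong[OF rot_sum[of \<theta>], of complex_of_real] by (simp add: a_def b_def c_def)
      have s2: "a\<^sup>2 + b\<^sup>2 + c\<^sup>2 = 1" using arg_cong[OF rot_sq[of \<theta>], of complex_of_real] by (simp add: a_def b_def c_def)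
      have s0: "a * b + b * c + a * c = 0"
        using arg_cong[OF rot_cross[OF rot_sum rot_sq, of \<theta>], of complex_of_real] by (simp add: a_def b_def c_def)
      have "- Q + (u1 \<theta>)\<^sup>2 + (u2 \<theta>)\<^sup>2 + (u3 \<theta>)\<^sup>2 =
        (a\<^sup>2 + b\<^sup>2 + c\<^sup>2 - 1) * ((z 0)\<^sup>2 + (z 1)\<^sup>2 + (z 2)\<^sup>2) + 2 * (a * b + b * c + a * c) * (z 0 * z 1 + z 1 * z 2 + z 0 * z 2)
        + 2 * (a * P + b * (z 0 * cnj (z 4) + z 1 * cnj (z 5) + z 2 * cnj (z 3)) + c * (z 0 * cnj (z 5) + z 1 * cnj (z 3) + z 2 * cnj (z 4)))"
        unfolding Q_def u1_def u2_def u3_def P_def a_def[symmetric] b_def[symmetric] c_def[symmetric]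
        by (simp add: power2_eq_square algebra_simps)
      also have "\<dots> = 2 * (a * P + b * (z 0 * cnj (z 4) + z 1 * cnj (z 5) + z 2 * cnj (z 3)) + c * (z 0 * cnj (z 5) + z 1 * cnj (z 3) + z 2 * cnj (z 4)))"
        unfolding s2 s0 by simp
      also have "\<dots> = 2 * Z * Y / 3 + 2 * (P - Z * Y / 3) * of_real (cos \<theta>) + 2 * (of_real (sqrt 3) * S / 3) * of_real (sin \<theta>)"
        unfolding a_def b_def c_def ra_def rb_def rc_def P_def Z_def Y_def S_def
        by (simp add: field_simps)
      also have "of_real (sqrt 3) * S / 3 = S / of_real (sqrt 3)"
      proof -
        have "complex_of_real (sqrt 3) * complex_of_real (sqrt 3) = 3" by (simp flip: of_real_mult)
        then show ?thesis by (simp add: field_simps)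
      qed
      also have "2 * Z * Y / 3 + 2 * (P - Z * Y / 3) * of_real (cos \<theta>) + 2 * (S / of_real (sqrt 3)) * of_real (sin \<theta>) =
         2 * Z * Y / 3 + (?p * cis \<theta> + ?q * cis (- \<theta>))"
      proof -
        have c: "cis \<theta> = of_real (cos \<theta>) + \<i> * of_real (sin \<theta>)" "cis (- \<theta>) = of_real (cos \<theta>) - \<i> * of_real (sin \<theta>)"
          by (simp_all add: complex_eq_iff)
        have g: "2 * D * C + 2 * T * s = (D - \<i> * T) * (C + \<i> * s) + (D + \<i> * T) * (C - \<i> * s)" for D T C s :: complex
          by (simp add: algebra_simps)
        show ?thesis unfolding c using g[of "P - Z * Y / 3" "of_real (cos \<theta>)" "S / of_real (sqrt 3)" "of_real (sin \<theta>)"] by (simp add: add.assoc)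
      qed
      finally show "- Q + (u1 \<theta>)\<^sup>2 + (u2 \<theta>)\<^sup>2 + (u3 \<theta>)\<^sup>2 = 2 * Z * Y / 3 + (?p * cis \<theta> + ?q * cis (- \<theta>))" .
    qed
    finally show "(LINT q|lborel. ?H (\<theta>, q)) = of_real (avg_const * (pi * sqrt pi)) * exp (2 * Z * Y / 3) * (window \<theta> *\<^sub>R exp (?p * cis \<theta> + ?q * cis (- \<theta>)))"
      by (simp only: scaleR_conv_of_real mult_ac)
  qed
  finally show ?thesis by (simp only: integral_mult_right_zero bess_def)
qed

section \<open>The space-time form\<close>

definition osc_weight :: "real \<times> real \<Rightarrow> real" where
  "osc_weight p = 12 / pi * indicator {-(pi/4)..pi/4} (fst p)"

lemma osc_weight_measurable [measurable]: "osc_weight \<in> borel_measurable borel"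
  unfolding osc_weight_def[abs_def] by (simp add: borel_prod[symmetric])

lemma osc_weight_nonneg: "0 \<le> osc_weight p"
  by (simp add: osc_weight_def)

text \<open>Joint measurability comes from \<open>phi\<close> being a pointwise limit of functions
  continuous in both variables; it is what makes Fubini available.\<close>

lemma osc_pair_measurable: "(\<lambda>p. osc (fst p) f (snd p)) \<in> borel_measurable borel"
proof -
  have 1: "(\<lambda>p :: real \<times> real. (cis (2 * fst p), snd p)) \<in> borel_measurable borel"
    by (intro borel_measurable_continuous_onI continuous_intros)
  have "(\<lambda>p. phi (fst p) f (snd p)) \<in> borel_measurable borel"
    using phi_measurable_pair by (simp add: borel_prod)
  from measurable_compose[OF 1 this] have 2: "(\<lambda>p :: real \<times> real. phi (cis (2 * fst p)) f (snd p)) \<in> borel_measurable borel"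
    by simp
  have 3: "(\<lambda>p :: real \<times> real. cis (fst p)) \<in> borel_measurable borel"
    by (intro borel_measurable_continuous_onI continuous_intros)
  show ?thesis unfolding osc_def by (intro borel_measurable_times 2 3)
qed

lemma AE_lborel_pairI:
  fixes F G :: "real \<times> real \<Rightarrow> complex"
  assumes [measurable]: "F \<in> borel_measurable borel" "G \<in> borel_measurable borel"
    and ae: "\<And>t. AE x in lborel. F (t, x) = G (t, x)"
  shows "AE p in lborel. F p = G p"
proof -
  have "AE p in lborel \<Otimes>\<^sub>M lborel. F p = G p"
  proof (rule lborel_pair.AE_pair_measure)
    have "{p \<in> space borel. F p = G p} \<in> sets borel" by measurable
    then show "{p \<in> space (lborel \<Otimes>\<^sub>M lborel). F p = G p} \<in> sets (lborel \<Otimes>\<^sub>M lborel)"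
      by (simp only: lborel_prod space_lborel sets_lborel space_borel)
  qed (use ae in simp)
  then show ?thesis unfolding lborel_prod .
qed

lemma nn_lborel2:
  fixes f :: "'a :: euclidean_space \<times> 'b :: euclidean_space \<Rightarrow> ennreal"
  assumes "f \<in> borel_measurable borel"
  shows "(\<integral>\<^sup>+p. f p \<partial>lborel) = (\<integral>\<^sup>+t. \<integral>\<^sup>+x. f (t, x) \<partial>lborel \<partial>lborel)"
  using assms by (subst lborel_prod[symmetric], subst lborel.nn_integral_fst[symmetric]) (auto simp: lborel_prod)

lemma comb_bounded: "\<exists>B\<ge>0. \<forall>u x. norm u = 1 \<longrightarrow> norm (comb cs u x) \<le> B"
proof (induction cs)
  case (Cons c cs)
  obtain a z where c: "c = (a, z)" by (cases c)
  obtain B where B: "0 \<le> B" "\<And>u x. norm u = 1 \<Longrightarrow> norm (comb cs u x) \<le> B" using Cons by blast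
  have coh: "norm (coh (u * z) x) \<le> exp ((norm z)\<^sup>2) * exp (2 * (norm z)\<^sup>2)" if "norm u = 1" for u x
  proof -
    have "- x\<^sup>2 / 2 + 2 * norm z * \<bar>x\<bar> \<le> 2 * (norm z)\<^sup>2"
      using zero_le_power2[of "\<bar>x\<bar> - 2 * norm z"] by (simp add: power2_diff power_mult_distrib algebra_simps)
    then have "exp ((norm z)\<^sup>2) * exp (- x\<^sup>2 / 2 + 2 * norm z * \<bar>x\<bar>) \<le> exp ((norm z)\<^sup>2) * exp (2 * (norm z)\<^sup>2)"
      by (intro mult_left_mono) auto
    moreover have "norm (u * z) = norm z" using that by (simp add: norm_mult)
    ultimately show ?thesis using norm_coh_le[of "u * z" x] by (simp only: order_trans)
  qed
  show ?case
  proof (intro exI conjI allI impI)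
    fix u :: complex and x assume u: "norm u = 1"
    have "norm (comb (c # cs) u x) \<le> norm (a * coh (u * z) x) + norm (comb cs u x)"
      by (simp add: c norm_triangle_ineq)
    also have "\<dots> \<le> norm a * (exp ((norm z)\<^sup>2) * exp (2 * (norm z)\<^sup>2)) + B"
      unfolding norm_mult by (intro add_mono mult_left_mono coh B u) auto
    finally show "norm (comb (c # cs) u x) \<le> norm a * (exp ((norm z)\<^sup>2) * exp (2 * (norm z)\<^sup>2)) + B" .
  qed (use B in auto)
qed (auto intro: exI[of _ 0])

lemma osc_comb: "AE x in lborel. osc t (comb cs 1) x = cis t * comb cs (cis (2 * t)) x"
  using phi_comb[of "cis (2 * t)" cs 1] by (simp add: osc_def) (auto elim: eventually_mono)

lemma osc_cspan_bounded:
  assumes "f \<in> cspan" shows "\<exists>B\<ge>0. \<forall>t. AE x in lborel. norm (osc t f x) \<le> B"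
proof -
  obtain cs where f: "f = comb cs 1" using assms by (auto simp: cspan_def)
  obtain B where B: "0 \<le> B" "\<And>u x. norm u = 1 \<Longrightarrow> norm (comb cs u x) \<le> B"
    using comb_bounded by blast
  have "AE x in lborel. norm (osc t f x) \<le> B" for t
    using osc_comb[of t cs] unfolding f by eventually_elim (simp add: norm_mult B)
  then show ?thesis using B by blast
qed

lemma osc_form_integrand_measurable:
  fixes f :: "nat \<Rightarrow> real \<Rightarrow> complex"
  shows "(\<lambda>p. ennreal (osc_weight p * (\<Prod>i<6. norm (osc (fst p) (f i) (snd p))))) \<in> borel_measurable borel"
proof -
  have "(\<lambda>p. norm (osc (fst p) (f i) (snd p))) \<in> borel_measurable borel" for i
    by (rule measurable_compose[OF osc_pair_measurable borel_measurable_norm])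
  then show ?thesis
    by (intro measurable_compose[OF _ measurable_ennreal] borel_measurable_times borel_measurable_prod osc_weight_measurable)
qed

text \<open>At each time four factors are bounded uniformly and the other two are paired by
  Cauchy--Schwarz; the time window has finite length.\<close>

lemma osc_form_cspan_finite:
  fixes f :: "nat \<Rightarrow> real \<Rightarrow> complex"
  assumes f: "\<And>i. i < 6 \<Longrightarrow> f i \<in> cspan"
  shows "(\<integral>\<^sup>+p. ennreal (osc_weight p * (\<Prod>i<6. norm (osc (fst p) (f i) (snd p)))) \<partial>lborel) < \<infinity>"
proof -
  have "\<exists>B. \<forall>i<6::nat. 0 \<le> B i \<and> (\<forall>t. AE x in lborel. norm (osc t (f i) x) \<le> B i)"
    using osc_cspan_bounded[OF f] by metis
  then obtain B where B: "\<And>i. i < 6 \<Longrightarrow> 0 \<le> B i" "\<And>i t. i < 6 \<Longrightarrow> AE x in lborel. norm (osc t (f i) x) \<le> B i"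
    by blast
  define C where "C = B 2 * B 3 * B 4 * B 5"
  have C: "0 \<le> C" unfolding C_def by (intro mult_nonneg_nonneg B) auto
  have L: "f 0 \<in> SQ" "f 1 \<in> SQ" using f by (auto intro: cspan_L2)
  have inner: "(\<integral>\<^sup>+x. ennreal (osc_weight (t, x) * (\<Prod>i<6. norm (osc t (f i) x))) \<partial>lborel)
      \<le> ennreal (12 / pi * C * (nrm (f 0) * nrm (f 1))) * indicator {-(pi/4)..pi/4} t" for t
  proof -
    have "(\<integral>\<^sup>+x. ennreal (osc_weight (t, x) * (\<Prod>i<6. norm (osc t (f i) x))) \<partial>lborel) \<le>
        (\<integral>\<^sup>+x. ennreal (12 / pi * C * indicator {-(pi/4)..pi/4} t) * ennreal (norm (osc t (f 0) x * osc t (f 1) x)) \<partial>lborel)"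
    proof (rule nn_integral_mono_AE)
      have "AE x in lborel. norm (osc t (f 2) x) \<le> B 2" "AE x in lborel. norm (osc t (f 3) x) \<le> B 3"
        "AE x in lborel. norm (osc t (f 4) x) \<le> B 4" "AE x in lborel. norm (osc t (f 5) x) \<le> B 5"
        by (auto intro!: B)
      then show "AE x in lborel. ennreal (osc_weight (t, x) * (\<Prod>i<6. norm (osc t (f i) x))) \<le>
          ennreal (12 / pi * C * indicator {-(pi/4)..pi/4} t) * ennreal (norm (osc t (f 0) x * osc t (f 1) x))"
      proof eventually_elim
        case (elim x)
        have "(\<Prod>i<6. norm (osc t (f i) x)) = norm (osc t (f 0) x * osc t (f 1) x) *
            (norm (osc t (f 2) x) * norm (osc t (f 3) x) * norm (osc t (f 4) x) * norm (osc t (f 5) x))"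
          by (simp add: prod_6 norm_mult)
        also have "\<dots> \<le> norm (osc t (f 0) x * osc t (f 1) x) * C"
          unfolding C_def using elim B(1) by (intro mult_left_mono mult_mono mult_nonneg_nonneg) auto
        finally have "osc_weight (t, x) * (\<Prod>i<6. norm (osc t (f i) x)) \<le> osc_weight (t, x) * (norm (osc t (f 0) x * osc t (f 1) x) * C)"
          by (rule mult_left_mono[OF _ osc_weight_nonneg])
        also have "\<dots> = (12 / pi * C * indicator {-(pi/4)..pi/4} t) * norm (osc t (f 0) x * osc t (f 1) x)"
          by (simp add: osc_weight_def)
        finally have "ennreal (osc_weight (t, x) * (\<Prod>i<6. norm (osc t (f i) x))) \<le>
            ennreal ((12 / pi * C * indicator {-(pi/4)..pi/4} t) * norm (osc t (f 0) x * osc t (f 1) x))" by (rule ennreal_leI)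
        also have "\<dots> = ennreal (12 / pi * C * indicator {-(pi/4)..pi/4} t) * ennreal (norm (osc t (f 0) x * osc t (f 1) x))"
          using C by (intro ennreal_mult) auto
        finally show ?case .
      qed
    qed
    also have "\<dots> = ennreal (12 / pi * C * indicator {-(pi/4)..pi/4} t) * (\<integral>\<^sup>+x. ennreal (norm (osc t (f 0) x * osc t (f 1) x)) \<partial>lborel)"
    proof (rule nn_integral_cmult)
      have [measurable]: "osc t (f 0) \<in> borel_measurable borel" "osc t (f 1) \<in> borel_measurable borel"
        using L by (auto intro: L2_measurable)
      show "(\<lambda>x. ennreal (norm (osc t (f 0) x * osc t (f 1) x))) \<in> borel_measurable lborel" by measurable
    qed
    also have "\<dots> \<le> ennreal (12 / pi * C * indicator {-(pi/4)..pi/4} t) * ennreal (nrm (f 0) * nrm (f 1))"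
      using L2_mult_nn[of "osc t (f 0)" "osc t (f 1)"] L by (intro mult_left_mono) (auto simp: osc_nrm)
    also have "\<dots> = ennreal (12 / pi * C * (nrm (f 0) * nrm (f 1))) * indicator {-(pi/4)..pi/4} t"
      using C by (auto simp: indicator_def ennreal_mult[symmetric])
    finally show ?thesis .
  qed
  have "(\<integral>\<^sup>+p. ennreal (osc_weight p * (\<Prod>i<6. norm (osc (fst p) (f i) (snd p)))) \<partial>lborel) =
      (\<integral>\<^sup>+t. \<integral>\<^sup>+x. ennreal (osc_weight (t, x) * (\<Prod>i<6. norm (osc t (f i) x))) \<partial>lborel \<partial>lborel)"
    by (subst nn_lborel2[OF osc_form_integrand_measurable]) simp
  also have "\<dots> \<le> (\<integral>\<^sup>+t. ennreal (12 / pi * C * (nrm (f 0) * nrm (f 1))) * indicator {-(pi/4)..pi/4} t \<partial>lborel)"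
    by (intro nn_integral_mono inner)
  also have "\<dots> = ennreal (12 / pi * C * (nrm (f 0) * nrm (f 1))) * emeasure lborel {-(pi/4)..pi/4}"
    by (rule nn_integral_cmult_indicator) simp
  also have "\<dots> < \<infinity>"
    by (auto simp: ennreal_mult_less_top emeasure_lborel_Icc_eq)
  finally show ?thesis .
qed

lemma osc_pair_lin:
  assumes f: "f \<in> SQ" and g: "g \<in> SQ"
  shows "AE p in lborel. osc (fst p) (\<lambda>x. a * f x + b * g x) (snd p) = a * osc (fst p) f (snd p) + b * osc (fst p) g (snd p)"
proof (rule AE_lborel_pairI)
  show "(\<lambda>p. osc (fst p) (\<lambda>x. a * f x + b * g x) (snd p)) \<in> borel_measurable borel" by (rule osc_pair_measurable)
  show "(\<lambda>p. a * osc (fst p) f (snd p) + b * osc (fst p) g (snd p)) \<in> borel_measurable borel"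
    by (intro borel_measurable_add borel_measurable_times osc_pair_measurable borel_measurable_const)
  show "AE x in lborel. osc (fst (t, x)) (\<lambda>x. a * f x + b * g x) (snd (t, x)) =
      a * osc (fst (t, x)) f (snd (t, x)) + b * osc (fst (t, x)) g (snd (t, x))" for t
    using osc_lin[OF f g] by simp
qed

interpretation C: sextic lborel osc_weight "\<lambda>i f p. osc (fst p) f (snd p)" cspan
proof
  show "osc_weight \<in> borel_measurable lborel" by simp
  show "0 \<le> osc_weight p" for p by (rule osc_weight_nonneg)
  show "(\<lambda>p. osc (fst p) f (snd p)) \<in> borel_measurable lborel" for f using osc_pair_measurable by simp
  show "AE p in lborel. osc (fst p) (\<lambda>x. a * f x + b * g x) (snd p) = a * osc (fst p) f (snd p) + b * osc (fst p) g (snd p)"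
    if "f \<in> cspan" "g \<in> cspan" for f g a b using that by (intro osc_pair_lin cspan_L2)
  show "(\<lambda>x. a * f x + b * g x) \<in> cspan" if "f \<in> cspan" "g \<in> cspan" for f g a b
    using that by (intro cspan_add cspan_scale)
  show "(\<integral>\<^sup>+p. ennreal (osc_weight p * (\<Prod>i<6. norm (osc (fst p) (f i) (snd p)))) \<partial>lborel) < \<infinity>"
    if "\<And>i. i < 6 \<Longrightarrow> f i \<in> cspan" for f :: "nat \<Rightarrow> real \<Rightarrow> complex"
    using that by (rule osc_form_cspan_finite)
qed

text \<open>Three ground state phases cancel against three conjugate ones, and the product of the
  six Gaussians is a single one with \<open>a = 3\<close>. In the completed square the cross term
  has \<open>u * v = 1\<close> and is constant in time; the rest oscillates as
  \<open>cis (4 * t)\<close> and \<open>cis (- (4 * t))\<close>.\<close>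

lemma osc_coh_prod_integral:
  fixes z :: "nat \<Rightarrow> complex"
  defines "Z \<equiv> z 0 + z 1 + z 2" and "Y \<equiv> cnj (z 3) + cnj (z 4) + cnj (z 5)"
    and "q1 \<equiv> (z 0)\<^sup>2 + (z 1)\<^sup>2 + (z 2)\<^sup>2" and "q2 \<equiv> (cnj (z 3))\<^sup>2 + (cnj (z 4))\<^sup>2 + (cnj (z 5))\<^sup>2"
  shows "(LINT x|lborel. (\<Prod>i<6. slot i (osc t (coh (z i)) x))) =
     of_real (sqrt (pi / 3)) * exp (2 * Z * Y / 3) * exp ((Z\<^sup>2 / 3 - q1) * cis (4 * t) + (Y\<^sup>2 / 3 - q2) * cis (- (4 * t)))"
proof -
  define u v where "u = cis (2 * t)" and "v = cis (- (2 * t))"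
  have uv: "u * v = 1" "u\<^sup>2 = cis (4 * t)" "v\<^sup>2 = cis (- (4 * t))" "cnj u = v"
    by (simp_all add: u_def v_def cis_mult power2_eq_square cis_cnj)
  have tt: "cis t * cis (- t) = 1" by (simp add: cis_mult)
  have ae: "AE x in lborel. \<forall>i\<in>{..<6::nat}. osc t (coh (z i)) x = cis t * coh (u * z i) x"
    unfolding u_def by (intro AE_finite_allI osc_coh) simp
  have pt: "(\<Prod>i<6. slot i (cis t * coh (u * z i) x)) =
      exp (- (u\<^sup>2 * q1 + v\<^sup>2 * q2)) * exp (complex_of_real (- (3 * x\<^sup>2)) + 2 * of_real x * (u * Z + v * Y))" for x
  proof -
    have "(\<Prod>i<6. slot i (cis t * coh (u * z i) x)) = (cis t * cis (- t)) ^ 3 *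
       (coh (u * z 0) x * coh (u * z 1) x * coh (u * z 2) x * cnj (coh (u * z 3) x) * cnj (coh (u * z 4) x) * cnj (coh (u * z 5) x))"
      unfolding prod_6 by (simp add: slot_def cis_cnj power3_eq_cube mult_ac)
    also have "\<dots> = exp (- (u\<^sup>2 * q1 + v\<^sup>2 * q2) + (complex_of_real (- (3 * x\<^sup>2)) + 2 * of_real x * (u * Z + v * Y)))"
      unfolding tt coh_def exp_cnj power_one mult_1 mult_exp_exp
      by (rule arg_cong[of _ _ exp]) (simp add: uv(4) Z_def Y_def q1_def q2_def power_mult_distrib algebra_simps)
    finally show ?thesis by (simp only: mult_exp_exp)
  qed
  have "(LINT x|lborel. (\<Prod>i<6. slot i (osc t (coh (z i)) x))) = (LINT x|lborel. (\<Prod>i<6. slot i (cis t * coh (u * z i) x)))"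
  proof (rule integral_cong_AE)
    show "AE x in lborel. (\<Prod>i<6. slot i (osc t (coh (z i)) x)) = (\<Prod>i<6. slot i (cis t * coh (u * z i) x))"
      using ae by eventually_elim (auto intro!: prod.cong)
    have "(\<lambda>x. \<Prod>i<6. slot i (osc t (coh (z i)) x)) \<in> borel_measurable borel"
      by (intro borel_measurable_prod slot_measurable L2_measurable osc_L2 coh_L2)
    then show "(\<lambda>x. \<Prod>i<6. slot i (osc t (coh (z i)) x)) \<in> borel_measurable lborel" by simp
    have "(\<lambda>x. \<Prod>i<6. slot i (cis t * coh (u * z i) x)) \<in> borel_measurable borel"
      by (intro borel_measurable_prod slot_measurable borel_measurable_times coh_measurable borel_measurable_const)
    then show "(\<lambda>x. \<Prod>i<6. slot i (cis t * coh (u * z i) x)) \<in> borel_measurable lborel" by simp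
  qed
  also have "\<dots> = exp (- (u\<^sup>2 * q1 + v\<^sup>2 * q2)) * (of_real (sqrt (pi / 3)) * exp ((u * Z + v * Y)\<^sup>2 / of_real 3))"
    unfolding pt integral_mult_right_zero
    using gaussian_complex[of 3 "u * Z + v * Y"] by (simp only: has_bochner_integral_iff)
  also have "\<dots> = of_real (sqrt (pi / 3)) * exp (- (u\<^sup>2 * q1 + v\<^sup>2 * q2) + (u * Z + v * Y)\<^sup>2 / of_real 3)"
    by (simp only: mult_exp_exp mult.left_commute[of "exp (- _)"])
  also have "- (u\<^sup>2 * q1 + v\<^sup>2 * q2) + (u * Z + v * Y)\<^sup>2 / of_real 3 =
      2 * Z * Y / 3 + ((Z\<^sup>2 / 3 - q1) * cis (4 * t) + (Y\<^sup>2 / 3 - q2) * cis (- (4 * t)))"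
  proof -
    have "(u * Z + v * Y)\<^sup>2 = u\<^sup>2 * Z\<^sup>2 + 2 * (u * v) * Z * Y + v\<^sup>2 * Y\<^sup>2"
      by (simp add: power2_eq_square algebra_simps)
    then show ?thesis unfolding uv by (simp add: field_simps)
  qed
  finally show ?thesis by (simp only: exp_add mult.assoc)
qed

text \<open>The variable \<open>\<alpha> = 4 * t\<close> stretches the time window to a full period,
  which turns the time integral into \<open>bess\<close>.\<close>

lemma C_form_coh:
  fixes z :: "nat \<Rightarrow> complex"
  defines "Z \<equiv> z 0 + z 1 + z 2" and "Y \<equiv> cnj (z 3) + cnj (z 4) + cnj (z 5)"
    and "q1 \<equiv> (z 0)\<^sup>2 + (z 1)\<^sup>2 + (z 2)\<^sup>2" and "q2 \<equiv> (cnj (z 3))\<^sup>2 + (cnj (z 4))\<^sup>2 + (cnj (z 5))\<^sup>2"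
  shows "C.form (\<lambda>i. coh (z i)) = of_real (avg_const * (pi * sqrt pi)) * exp (2 * Z * Y / 3) * bess (Z\<^sup>2 / 3 - q1) (Y\<^sup>2 / 3 - q2)"
proof -
  let ?G = "\<lambda>p. osc_weight p *\<^sub>R (\<Prod>i<6. slot i (osc (fst p) (coh (z i)) (snd p)))"
  let ?k = "\<lambda>\<alpha>. window \<alpha> *\<^sub>R exp ((Z\<^sup>2 / 3 - q1) * cis \<alpha> + (Y\<^sup>2 / 3 - q2) * cis (- \<alpha>))"
  have int: "integrable (lborel \<Otimes>\<^sub>M lborel) ?G"
    using C.form_integrable[of "\<lambda>i. coh (z i)"] by (simp add: lborel_prod)
  have w: "indicator {-(pi/4)..pi/4} t = window (4 * t)" for t
    by (auto simp: window_def indicator_def)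
  have "C.form (\<lambda>i. coh (z i)) = (LINT t|lborel. LINT x|lborel. ?G (t, x))"
    unfolding C.form_def using lborel_pair.integral_fst'[OF int] by (simp add: lborel_prod)
  also have "\<dots> = (LINT t|lborel. (of_real (12 / pi * sqrt (pi / 3)) * exp (2 * Z * Y / 3)) * ?k (4 * t))"
  proof (rule Bochner_Integration.integral_cong[OF refl])
    fix t
    have "(LINT x|lborel. ?G (t, x)) = (12 / pi * window (4 * t)) *\<^sub>R (LINT x|lborel. (\<Prod>i<6. slot i (osc t (coh (z i)) x)))"
      by (simp add: osc_weight_def w)
    also have "\<dots> = (of_real (12 / pi * sqrt (pi / 3)) * exp (2 * Z * Y / 3)) * ?k (4 * t)"
      unfolding osc_coh_prod_integral Z_def Y_def q1_def q2_def by (simp add: scaleR_conv_of_real mult_ac)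
    finally show "(LINT x|lborel. ?G (t, x)) = (of_real (12 / pi * sqrt (pi / 3)) * exp (2 * Z * Y / 3)) * ?k (4 * t)" .
  qed
  also have "\<dots> = (of_real (12 / pi * sqrt (pi / 3)) * exp (2 * Z * Y / 3)) * (LINT t|lborel. ?k (4 * t))"
    by (rule integral_mult_right_zero)
  also have "(LINT t|lborel. ?k (4 * t)) = bess (Z\<^sup>2 / 3 - q1) (Y\<^sup>2 / 3 - q2) / 4"
    unfolding bess_def using lborel_integral_real_affine[of 4 ?k 0] by (simp add: scaleR_conv_of_real)
  also have "of_real (12 / pi * sqrt (pi / 3)) * exp (2 * Z * Y / 3) * (bess (Z\<^sup>2 / 3 - q1) (Y\<^sup>2 / 3 - q2) / 4) =
      of_real ((12 / pi * sqrt (pi / 3)) / 4) * exp (2 * Z * Y / 3) * bess (Z\<^sup>2 / 3 - q1) (Y\<^sup>2 / 3 - q2)"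
    by simp
  also have "(12 / pi * sqrt (pi / 3)) / 4 = avg_const * (pi * sqrt pi)"
  proof -
    have "sqrt (pi / 3) = sqrt pi * sqrt 3 / 3"
      by (simp add: real_sqrt_divide) (simp add: field_simps mult.commute)
    then show ?thesis unfolding avg_const_def by (simp add: power2_eq_square mult.commute)
  qed
  finally show ?thesis .
qed

text \<open>The prefactors already agree, so by \<open>bess_eq\<close> only the products of the two
  \<open>bess\<close> arguments have to be compared.\<close>

lemma C_form_eq_A_form_coh: "C.form (\<lambda>i. coh (z i)) = A.form (\<lambda>i. coh (z i))"
proof -
  define Z Y P S where "Z = z 0 + z 1 + z 2" and "Y = cnj (z 3) + cnj (z 4) + cnj (z 5)"
    and "P = z 0 * cnj (z 3) + z 1 * cnj (z 4) + z 2 * cnj (z 5)"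
    and "S = z 0 * (cnj (z 4) - cnj (z 5)) + z 1 * (cnj (z 5) - cnj (z 3)) + z 2 * (cnj (z 3) - cnj (z 4))"
  have s3: "complex_of_real (sqrt 3) * of_real (sqrt 3) = 3" by (simp flip: of_real_mult)
  have "(P - Z * Y / 3 - \<i> * S / of_real (sqrt 3)) * (P - Z * Y / 3 + \<i> * S / of_real (sqrt 3)) =
      (P - Z * Y / 3)\<^sup>2 + S\<^sup>2 / (of_real (sqrt 3) * of_real (sqrt 3))"
    by (simp add: power2_eq_square algebra_simps)
  also have "\<dots> = (P - Z * Y / 3)\<^sup>2 + S\<^sup>2 / 3" unfolding s3 ..
  also have "\<dots> = (Z\<^sup>2 / 3 - ((z 0)\<^sup>2 + (z 1)\<^sup>2 + (z 2)\<^sup>2)) * (Y\<^sup>2 / 3 - ((cnj (z 3))\<^sup>2 + (cnj (z 4))\<^sup>2 + (cnj (z 5))\<^sup>2))"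
  proof -
    \<comment> \<open>Lagrange's identity, multiplied by 9, for the projections of
      \<open>(a, b, c)\<close> and \<open>(d, e, f)\<close> onto the plane orthogonal to the
      diagonal: the squared dot product plus the squared diagonal component of the cross product is
      the product of the squared lengths, all taken bilinearly.\<close>
    have id: "(3 * (a * d + b * e + c * f) - (a + b + c) * (d + e + f))\<^sup>2 + 3 * (a * (e - f) + b * (f - d) + c * (d - e))\<^sup>2 =
        ((a + b + c)\<^sup>2 - 3 * (a\<^sup>2 + b\<^sup>2 + c\<^sup>2)) * ((d + e + f)\<^sup>2 - 3 * (d\<^sup>2 + e\<^sup>2 + f\<^sup>2))" for a b c d e f :: complex
      by algebra
    have "9 * ((P - Z * Y / 3)\<^sup>2 + S\<^sup>2 / 3) = (3 * P - Z * Y)\<^sup>2 + 3 * S\<^sup>2"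
      by (simp add: power2_eq_square field_simps)
    also have "\<dots> = (Z\<^sup>2 - 3 * ((z 0)\<^sup>2 + (z 1)\<^sup>2 + (z 2)\<^sup>2)) * (Y\<^sup>2 - 3 * ((cnj (z 3))\<^sup>2 + (cnj (z 4))\<^sup>2 + (cnj (z 5))\<^sup>2))"
      unfolding P_def S_def Z_def Y_def by (rule id)
    also have "\<dots> = 9 * ((Z\<^sup>2 / 3 - ((z 0)\<^sup>2 + (z 1)\<^sup>2 + (z 2)\<^sup>2)) * (Y\<^sup>2 / 3 - ((cnj (z 3))\<^sup>2 + (cnj (z 4))\<^sup>2 + (cnj (z 5))\<^sup>2)))"
      by (simp add: field_simps)
    finally show ?thesis by (simp only: mult_cancel_left) simp
  qed
  finally show ?thesis
    unfolding C_form_coh A_form_coh Z_def[symmetric] Y_def[symmetric] P_def[symmetric] S_def[symmetric]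
    by (subst bess_eq) (auto simp only: refl)
qed

section \<open>The Strichartz bound and the extension to \<open>L2\<close>\<close>

lemma hexalinear_subset: "hexalinear S Q \<Longrightarrow> R \<subseteq> S \<Longrightarrow> hexalinear R Q"
  unfolding hexalinear_def by blast

lemma C_form_eq_A_form_cspan:
  assumes "\<And>i. i < 6 \<Longrightarrow> f i \<in> cspan" shows "C.form f = A.form f"
proof (rule hexalinear_eq_cspan[OF C.hexalinear_form])
  show "hexalinear cspan A.form" by (rule hexalinear_subset[OF A.hexalinear_form]) (auto intro: cspan_L2)
qed (use assms C_form_eq_A_form_coh in \<open>auto intro: C.form_cong A.form_cong\<close>)

lemma prod_slot_diag: "(\<Prod>i<6. slot i v) = of_real (norm v ^ 6)"
proof -
  have "(\<Prod>i<6. slot i v) = (v * cnj v) ^ 3" by (simp add: prod_6 slot_def power3_eq_cube mult_ac)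
  also have "\<dots> = of_real (norm v ^ 6)"
    by (simp add: complex_norm_square[symmetric] power_mult[symmetric])
  finally show ?thesis .
qed

lemma osc_L6_measurable:
  "(\<lambda>p. ennreal (osc_weight p * norm (osc (fst p) f (snd p)) ^ 6)) \<in> borel_measurable borel"
  by (intro measurable_compose[OF _ measurable_ennreal] borel_measurable_times borel_measurable_power
      measurable_compose[OF osc_pair_measurable borel_measurable_norm] osc_weight_measurable)

text \<open>With six equal arguments the integrand is a nonnegative sixth power, so no absolute
  value is lost when the form is evaluated through \<open>A.form\<close>.\<close>

lemma osc_L6_cspan:
  assumes f: "f \<in> cspan"
  shows "(\<integral>\<^sup>+p. ennreal (osc_weight p * norm (osc (fst p) f (snd p)) ^ 6) \<partial>lborel) \<le> ennreal (2 * sqrt 3 / pi * nrm f ^ 6)"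
proof -
  let ?u = "\<lambda>p. osc_weight p * norm (osc (fst p) f (snd p)) ^ 6"
  have eq: "osc_weight p *\<^sub>R (\<Prod>i<6. slot i (osc (fst p) f (snd p))) = complex_of_real (?u p)" for p
    by (simp add: prod_slot_diag scaleR_conv_of_real)
  have int: "integrable lborel ?u"
    using C.form_integrable[of "\<lambda>_. f", OF f] unfolding eq complex_of_real_integrable_eq .
  have "C.form (\<lambda>_. f) = complex_of_real (integral\<^sup>L lborel ?u)"
    unfolding C.form_def eq by (rule integral_complex_of_real)
  then have "integral\<^sup>L lborel ?u \<le> norm (A.form (\<lambda>_. f))"
    using C_form_eq_A_form_cspan[of "\<lambda>_. f"] f by simp
  also have "\<dots> \<le> 2 * sqrt 3 / pi * (\<Prod>i<6::nat. nrm f)"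
    using f by (intro norm_avg_form_le cspan_L2)
  finally have "integral\<^sup>L lborel ?u \<le> 2 * sqrt 3 / pi * nrm f ^ 6" by simp
  moreover have "(\<integral>\<^sup>+p. ennreal (?u p) \<partial>lborel) = ennreal (integral\<^sup>L lborel ?u)"
    using int by (intro nn_integral_eq_integral) (auto simp: osc_weight_nonneg)
  ultimately show ?thesis by (simp only: ennreal_leI)
qed

text \<open>Fatou's lemma along the approximants \<open>apx f n\<close>, whose norms are at most
  \<open>nrm f + 1\<close>. Only finiteness is at stake; the sharp constant comes from
  \<open>A.form\<close>.\<close>

lemma osc_L6:
  assumes f: "f \<in> SQ"
  shows "(\<integral>\<^sup>+p. ennreal (osc_weight p * norm (osc (fst p) f (snd p)) ^ 6) \<partial>lborel) \<le> ennreal (2 * sqrt 3 / pi * (nrm f + 1) ^ 6)"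
proof -
  let ?g = "\<lambda>n. comb (apx f n) 1"
  let ?J = "\<lambda>n t. \<integral>\<^sup>+x. ennreal (osc_weight (t, x) * norm (osc t (?g n) x) ^ 6) \<partial>lborel"
  have Jm: "?J n \<in> borel_measurable lborel" for n
  proof -
    have "(\<lambda>(t, x). ennreal (osc_weight (t, x) * norm (osc t (?g n) x) ^ 6)) \<in> borel_measurable (lborel \<Otimes>\<^sub>M lborel)"
      using osc_L6_measurable[of "?g n"] by (simp add: lborel_prod case_prod_beta')
    then show ?thesis by (rule lborel.borel_measurable_nn_integral)
  qed
  have xm: "(\<lambda>x. ennreal (osc_weight (t, x) * norm (osc t k x) ^ 6)) \<in> borel_measurable lborel" for t k
  proof -
    have "(\<lambda>x :: real. (t, x)) \<in> borel_measurable borel"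
      by (intro borel_measurable_continuous_onI continuous_intros)
    from measurable_compose[OF this osc_L6_measurable[of k]] show ?thesis by simp
  qed
  \<comment> \<open>The approximants converge almost everywhere in \<open>x\<close> at each fixed
    time, so Fatou's lemma is applied first in \<open>x\<close> and afterwards once more in
    \<open>t\<close>.\<close>
  have inner: "(\<integral>\<^sup>+x. ennreal (osc_weight (t, x) * norm (osc t f x) ^ 6) \<partial>lborel) \<le> liminf (\<lambda>n. ?J n t)" for t
  proof -
    have "AE x in lborel. \<forall>n. osc t (?g n) x = cis t * comb (apx f n) (cis (2 * t)) x"
      by (intro AE_all_countable[THEN iffD2] allI osc_comb)
    moreover have "AE x in lborel. (\<lambda>n. comb (apx f n) (cis (2 * t)) x) \<longlonglongrightarrow> phi (cis (2 * t)) f x"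
      using f by (intro phi_AE_lim) auto
    ultimately have "AE x in lborel. ennreal (osc_weight (t, x) * norm (osc t f x) ^ 6) =
        liminf (\<lambda>n. ennreal (osc_weight (t, x) * norm (osc t (?g n) x) ^ 6))"
    proof eventually_elim
      case (elim x)
      have "(\<lambda>n. ennreal (osc_weight (t, x) * norm (osc t (?g n) x) ^ 6)) \<longlonglongrightarrow> ennreal (osc_weight (t, x) * norm (osc t f x) ^ 6)"
        using elim unfolding osc_def[of t f] by (intro tendsto_ennrealI tendsto_intros) (simp add: tendsto_mult_left)
      then show ?case by (simp add: lim_imp_Liminf[symmetric])
    qed
    then have "(\<integral>\<^sup>+x. ennreal (osc_weight (t, x) * norm (osc t f x) ^ 6) \<partial>lborel) =
        (\<integral>\<^sup>+x. liminf (\<lambda>n. ennreal (osc_weight (t, x) * norm (osc t (?g n) x) ^ 6)) \<partial>lborel)"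
      by (rule nn_integral_cong_AE)
    also have "\<dots> \<le> liminf (\<lambda>n. ?J n t)" by (rule nn_integral_liminf) (rule xm)
    finally show ?thesis .
  qed
  have bound: "(\<integral>\<^sup>+t. ?J n t \<partial>lborel) \<le> ennreal (2 * sqrt 3 / pi * (nrm f + 1) ^ 6)" for n
  proof -
    have "(\<integral>\<^sup>+t. ?J n t \<partial>lborel) = (\<integral>\<^sup>+p. ennreal (osc_weight p * norm (osc (fst p) (?g n) (snd p)) ^ 6) \<partial>lborel)"
      by (subst nn_lborel2[OF osc_L6_measurable]) simp
    also have "\<dots> \<le> ennreal (2 * sqrt 3 / pi * nrm (?g n) ^ 6)" by (intro osc_L6_cspan comb_cspan)
    also have "\<dots> \<le> ennreal (2 * sqrt 3 / pi * (nrm f + 1) ^ 6)"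
    proof (intro ennreal_leI mult_left_mono power_mono)
      have "nrm (\<lambda>x. f x - ?g n x) \<le> 1"
        using apx[OF f, of n] by (rule order_trans) simp
      then show "nrm (?g n) \<le> nrm f + 1" using nrm_diff_abs[of f "?g n"] f by simp
    qed auto
    finally show ?thesis .
  qed
  have "(\<integral>\<^sup>+p. ennreal (osc_weight p * norm (osc (fst p) f (snd p)) ^ 6) \<partial>lborel) =
      (\<integral>\<^sup>+t. \<integral>\<^sup>+x. ennreal (osc_weight (t, x) * norm (osc t f x) ^ 6) \<partial>lborel \<partial>lborel)"
    by (subst nn_lborel2[OF osc_L6_measurable]) simp
  also have "\<dots> \<le> (\<integral>\<^sup>+t. liminf (\<lambda>n. ?J n t) \<partial>lborel)" by (intro nn_integral_mono inner)
  also have "\<dots> \<le> liminf (\<lambda>n. \<integral>\<^sup>+t. ?J n t \<partial>lborel)" by (rule nn_integral_liminf) (rule Jm)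
  also have "\<dots> \<le> liminf (\<lambda>n. ennreal (2 * sqrt 3 / pi * (nrm f + 1) ^ 6))"
    by (intro Liminf_mono always_eventually allI bound)
  also have "\<dots> = ennreal (2 * sqrt 3 / pi * (nrm f + 1) ^ 6)" by (simp add: Liminf_const)
  finally show ?thesis .
qed

text \<open>The product is at most the sixth power of its largest factor. This crude bound takes the
  place of Hoelder's inequality for six functions and is enough for finiteness.\<close>

lemma prod_6_le_sum:
  fixes a :: "nat \<Rightarrow> real"
  assumes a: "\<And>i. 0 \<le> a i" shows "(\<Prod>i<6. a i) \<le> (\<Sum>i<6. a i ^ 6)"
proof -
  define m where "m = Max (a ` {..<6})"
  have "m \<in> a ` {..<6}" unfolding m_def by (rule Max_in) (auto simp: lessThan_empty_iff)
  then obtain j where j: "j < 6" "m = a j" by auto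
  have "a i \<le> m" if "i < 6" for i unfolding m_def using that by (intro Max_ge) auto
  then have "(\<Prod>i<6. a i) \<le> (\<Prod>i<(6::nat). m)" using a by (intro prod_mono) auto
  also have "\<dots> = a j ^ 6" by (simp add: j)
  also have "\<dots> \<le> (\<Sum>i<6. a i ^ 6)" using j a by (intro member_le_sum) auto
  finally show ?thesis .
qed

lemma osc_form_bound:
  fixes f :: "nat \<Rightarrow> real \<Rightarrow> complex"
  assumes f: "\<And>i. i < 6 \<Longrightarrow> f i \<in> SQ"
  shows "(\<integral>\<^sup>+p. ennreal (osc_weight p * (\<Prod>i<6. norm (osc (fst p) (f i) (snd p)))) \<partial>lborel)
     \<le> ennreal (\<Sum>i<6. 2 * sqrt 3 / pi * (nrm (f i) + 1) ^ 6)"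
proof -
  have "(\<integral>\<^sup>+p. ennreal (osc_weight p * (\<Prod>i<6. norm (osc (fst p) (f i) (snd p)))) \<partial>lborel) \<le>
      (\<integral>\<^sup>+p. (\<Sum>i<6. ennreal (osc_weight p * norm (osc (fst p) (f i) (snd p)) ^ 6)) \<partial>lborel)"
  proof (rule nn_integral_mono)
    fix p
    have "osc_weight p * (\<Prod>i<6. norm (osc (fst p) (f i) (snd p))) \<le> osc_weight p * (\<Sum>i<6. norm (osc (fst p) (f i) (snd p)) ^ 6)"
      by (intro mult_left_mono prod_6_le_sum osc_weight_nonneg) simp
    also have "\<dots> = (\<Sum>i<6. osc_weight p * norm (osc (fst p) (f i) (snd p)) ^ 6)" by (rule sum_distrib_left)
    finally have "ennreal (osc_weight p * (\<Prod>i<6. norm (osc (fst p) (f i) (snd p)))) \<le> ennreal (\<Sum>i<6. osc_weight p * norm (osc (fst p) (f i) (snd p)) ^ 6)"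
      by (rule ennreal_leI)
    also have "\<dots> = (\<Sum>i<6. ennreal (osc_weight p * norm (osc (fst p) (f i) (snd p)) ^ 6))"
      by (rule sum_ennreal[symmetric]) (auto simp: osc_weight_nonneg)
    finally show "ennreal (osc_weight p * (\<Prod>i<6. norm (osc (fst p) (f i) (snd p)))) \<le>
        (\<Sum>i<6. ennreal (osc_weight p * norm (osc (fst p) (f i) (snd p)) ^ 6))" .
  qed
  also have "\<dots> = (\<Sum>i<6. \<integral>\<^sup>+p. ennreal (osc_weight p * norm (osc (fst p) (f i) (snd p)) ^ 6) \<partial>lborel)"
    using osc_L6_measurable by (intro nn_integral_sum) simp
  also have "\<dots> \<le> (\<Sum>i<6. ennreal (2 * sqrt 3 / pi * (nrm (f i) + 1) ^ 6))"
    using f by (intro sum_mono osc_L6) auto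
  also have "\<dots> = ennreal (\<Sum>i<6. 2 * sqrt 3 / pi * (nrm (f i) + 1) ^ 6)"
    by (rule sum_ennreal) auto
  finally show ?thesis .
qed

interpretation T: sextic lborel osc_weight "\<lambda>i f p. osc (fst p) f (snd p)" SQ
proof
  show "osc_weight \<in> borel_measurable lborel" by simp
  show "0 \<le> osc_weight p" for p by (rule osc_weight_nonneg)
  show "(\<lambda>p. osc (fst p) f (snd p)) \<in> borel_measurable lborel" for f using osc_pair_measurable by simp
  show "AE p in lborel. osc (fst p) (\<lambda>x. a * f x + b * g x) (snd p) = a * osc (fst p) f (snd p) + b * osc (fst p) g (snd p)"
    if "f \<in> SQ" "g \<in> SQ" for f g a b using that by (rule osc_pair_lin)
  show "(\<lambda>x. a * f x + b * g x) \<in> SQ" if "f \<in> SQ" "g \<in> SQ" for f g a b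
    using that by (intro L2_add L2_scale)
  show "(\<integral>\<^sup>+p. ennreal (osc_weight p * (\<Prod>i<6. norm (osc (fst p) (f i) (snd p)))) \<partial>lborel) < \<infinity>"
    if "\<And>i. i < 6 \<Longrightarrow> f i \<in> SQ" for f :: "nat \<Rightarrow> real \<Rightarrow> complex"
    unfolding infinity_ennreal_def by (rule le_less_trans[OF osc_form_bound[of f, OF that] ennreal_less_top])
qed

lemma norm_T_form_le:
  fixes f :: "nat \<Rightarrow> real \<Rightarrow> complex"
  assumes f: "\<And>i. i < 6 \<Longrightarrow> f i \<in> SQ"
  shows "norm (T.form f) \<le> (\<Sum>i<6. 2 * sqrt 3 / pi * (nrm (f i) + 1) ^ 6)"
proof -
  have "ennreal (norm (T.form f)) \<le> ennreal (\<Sum>i<6. 2 * sqrt 3 / pi * (nrm (f i) + 1) ^ 6)"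
    using T.norm_form_le[OF f] osc_form_bound[of f, OF f] by (rule order_trans)
  moreover have "0 \<le> (\<Sum>i<6. 2 * sqrt 3 / pi * (nrm (f i) + 1) ^ 6)"
    by (intro sum_nonneg mult_nonneg_nonneg) auto
  ultimately show ?thesis by (simp only: ennreal_le_iff)
qed

text \<open>The bound \<open>norm_T_form_le\<close> is not homogeneous. It is constant on the unit
  ball of a single slot, and homogeneity in that slot turns it into a linear bound.\<close>

lemma T_form_slot_bound:
  fixes f :: "nat \<Rightarrow> real \<Rightarrow> complex"
  assumes f: "\<And>i. i < 6 \<Longrightarrow> f i \<in> SQ" and j: "j < 6"
  shows "\<exists>K. \<forall>g\<in>SQ. norm (T.form (f(j := g))) \<le> K * nrm g"
proof (intro exI ballI)
  fix g assume g: "g \<in> SQ"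
  \<comment> \<open>The 2 accounts for slot \<open>j\<close>, where a function of norm at most 1
    contributes at most \<open>1 + 1\<close>.\<close>
  let ?K = "\<Sum>i<6. 2 * sqrt 3 / pi * (nrm (f i) + 2) ^ 6"
  show "norm (T.form (f(j := g))) \<le> ?K * nrm g"
  proof (rule homogeneous_bound[OF _ _ g])
    fix h c assume h: "h \<in> SQ"
    have "T.form (f(j := \<lambda>x. c * h x + 0 * h x)) = slot j c * T.form (f(j := h)) + slot j 0 * T.form (f(j := h))"
      by (rule hexalinearD[OF T.hexalinear_form f j h h])
    then show "norm (T.form (f(j := \<lambda>x. c * h x))) = norm c * norm (T.form (f(j := h)))"
      by (simp add: norm_mult)
  next
    fix h assume h: "h \<in> SQ" "nrm h \<le> 1"
    have "norm (T.form (f(j := h))) \<le> (\<Sum>i<6. 2 * sqrt 3 / pi * (nrm ((f(j := h)) i) + 1) ^ 6)"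
      using f h by (intro norm_T_form_le) auto
    also have "\<dots> \<le> ?K"
    proof (intro sum_mono mult_left_mono power_mono)
      show "nrm ((f(j := h)) i) + 1 \<le> nrm (f i) + 2" for i
        using h by (cases "i = j") (simp_all add: add_increasing2)
    qed auto
    finally show "norm (T.form (f(j := h))) \<le> ?K" .
  qed
qed

lemma T_form_eq_A_form:
  assumes "\<And>i. i < 6 \<Longrightarrow> f i \<in> SQ" shows "T.form f = A.form f"
proof (rule hexalinear_eq_L2[OF T.hexalinear_form A.hexalinear_form])
  show "T.form (\<lambda>i. coh (z i)) = A.form (\<lambda>i. coh (z i))" for z by (rule C_form_eq_A_form_coh)
qed (use assms in \<open>auto intro: T.form_cong A.form_cong T_form_slot_bound avg_form_slot_bound\<close>)

text \<open>At each fixed time \<open>expitH\<close> and \<open>osc\<close> agree almost everywhere,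
  so the inner integral over \<open>x\<close> is literally the same. The exchange happens inside the
  iterated integral, and joint measurability is required of \<open>osc\<close> alone.\<close>

lemma T6_form_eq:
  assumes f: "f1 \<in> SQ" "f2 \<in> SQ" "f3 \<in> SQ" "f4 \<in> SQ" "f5 \<in> SQ" and g: "g \<in> SQ"
  shows "T6_form f1 f2 f3 f4 f5 g = A.form ((!) [f1, f2, f3, f4, f5, g])"
proof -
  let ?f = "(!) [f1, f2, f3, f4, f5, g]"
  have L: "?f i \<in> SQ" if "i < 6" for i using less_6_cases[OF that] f g by auto
  let ?G = "\<lambda>p. osc_weight p *\<^sub>R (\<Prod>i<6. slot i (osc (fst p) (?f i) (snd p)))"
  have int: "integrable (lborel \<Otimes>\<^sub>M lborel) ?G"
    using T.form_integrable[of ?f, OF L] by (simp only: lborel_prod)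
  have "A.form ?f = T.form ?f" using L by (rule T_form_eq_A_form[symmetric])
  also have "\<dots> = (LINT t|lborel. LINT x|lborel. ?G (t, x))"
    unfolding T.form_def using lborel_pair.integral_fst'[OF int] by (simp only: lborel_prod)
  also have "\<dots> = (LINT t|lborel. of_real (12 / pi) * (indicator {-(pi/4)..pi/4} t *\<^sub>R (LINT x|lborel.
        expitH t f1 x * expitH t f2 x * expitH t f3 x * cnj (expitH t f4 x * expitH t f5 x * expitH t g x))))"
  proof (rule Bochner_Integration.integral_cong[OF refl])
    fix t
    have "(LINT x|lborel. ?G (t, x)) = osc_weight (t, 0) *\<^sub>R (LINT x|lborel. (\<Prod>i<6. slot i (osc t (?f i) x)))"
      by (simp add: osc_weight_def)
    also have "(LINT x|lborel. (\<Prod>i<6. slot i (osc t (?f i) x))) = (LINT x|lborel. (\<Prod>i<6. slot i (expitH t (?f i) x)))"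
    proof (rule integral_cong_AE)
      have "AE x in lborel. \<forall>i\<in>{..<6::nat}. expitH t (?f i) x = osc t (?f i) x"
        using L by (intro AE_finite_allI expitH_AE) auto
      then show "AE x in lborel. (\<Prod>i<6. slot i (osc t (?f i) x)) = (\<Prod>i<6. slot i (expitH t (?f i) x))"
        by eventually_elim (intro prod.cong, auto)
      have "osc t (?f i) \<in> borel_measurable borel" "expitH t (?f i) \<in> borel_measurable borel" if "i < 6" for i
        using L[OF that] by (intro L2_measurable osc_L2 expitH_L2; simp)+
      then have "(\<lambda>x. \<Prod>i<6. slot i (osc t (?f i) x)) \<in> borel_measurable borel" "(\<lambda>x. \<Prod>i<6. slot i (expitH t (?f i) x)) \<in> borel_measurable borel"
        by (intro borel_measurable_prod slot_measurable; simp)+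
      then show "(\<lambda>x. \<Prod>i<6. slot i (osc t (?f i) x)) \<in> borel_measurable lborel" "(\<lambda>x. \<Prod>i<6. slot i (expitH t (?f i) x)) \<in> borel_measurable lborel"
        by simp_all
    qed
    also have "(LINT x|lborel. (\<Prod>i<6. slot i (expitH t (?f i) x))) = (LINT x|lborel.
        expitH t f1 x * expitH t f2 x * expitH t f3 x * cnj (expitH t f4 x * expitH t f5 x * expitH t g x))"
      unfolding prod_6 by (simp add: slot_def mult.assoc)
    finally show "(LINT x|lborel. ?G (t, x)) = of_real (12 / pi) * (indicator {-(pi/4)..pi/4} t *\<^sub>R (LINT x|lborel.
        expitH t f1 x * expitH t f2 x * expitH t f3 x * cnj (expitH t f4 x * expitH t f5 x * expitH t g x)))"
      by (simp add: osc_weight_def scaleR_conv_of_real)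
  qed
  also have "\<dots> = T6_form f1 f2 f3 f4 f5 g"
    unfolding T6_form_def set_lebesgue_integral_def by (rule integral_mult_right_zero)
  finally show ?thesis ..
qed

section \<open>Identification of the quintic operator\<close>

lemma avg_op_cong: "(\<And>i. i < 5 \<Longrightarrow> f i = g i) \<Longrightarrow> avg_op f = avg_op g"
  unfolding avg_op_def fun_eq_iff
  by (intro allI Bochner_Integration.integral_cong refl arg_cong2[where f = scaleR] prod.cong) auto

text \<open>\<open>avg_op\<close> shows that the property by which \<open>T6\<close> is chosen can
  be satisfied, and two functions with equal pairings against all of \<open>L2\<close> agree almost
  everywhere.\<close>

lemma T6_AE:
  assumes f: "f1 \<in> SQ" "f2 \<in> SQ" "f3 \<in> SQ" "f4 \<in> SQ" "f5 \<in> SQ"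
  shows "T6 f1 f2 f3 f4 f5 \<in> SQ" "AE x in lborel. T6 f1 f2 f3 f4 f5 x = avg_op ((!) [f1, f2, f3, f4, f5]) x"
proof -
  let ?F = "(!) [f1, f2, f3, f4, f5]"
  have F: "?F i \<in> SQ" if "i < 5" for i
    using that less_6_cases[of i] f by auto
  have h: "avg_op ?F \<in> SQ" by (rule avg_op_L2) (rule F)
  have rep: "ip (avg_op ?F) g = T6_form f1 f2 f3 f4 f5 g" if g: "g \<in> SQ" for g
  proof -
    let ?f = "(!) [f1, f2, f3, f4, f5, g]"
    have L: "?f i \<in> SQ" if "i < 6" for i using less_6_cases[OF that] f g by auto
    have "?F i = ?f i" if "i < 5" for i using that less_6_cases[of i] by auto
    then have "avg_op ?F = avg_op ?f" by (rule avg_op_cong)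
    then have "ip (avg_op ?F) g = ip (avg_op ?f) (?f 5)" by simp
    also have "\<dots> = A.form ?f" using L by (rule ip_avg_op)
    finally show ?thesis using T6_form_eq[OF f g] by simp
  qed
  have "\<exists>h. h \<in> L2 \<and> (\<forall>g\<in>L2. (LINT x|lborel. h x * cnj (g x)) = T6_form f1 f2 f3 f4 f5 g)"
    unfolding L2_eq ip_def[symmetric] using h rep by blast
  from someI_ex[OF this] have T: "T6 f1 f2 f3 f4 f5 \<in> SQ" "\<And>g. g \<in> SQ \<Longrightarrow> ip (T6 f1 f2 f3 f4 f5) g = T6_form f1 f2 f3 f4 f5 g"
    unfolding T6_def L2_eq ip_def[symmetric] by blast+
  show "T6 f1 f2 f3 f4 f5 \<in> SQ" by (rule T(1))
  show "AE x in lborel. T6 f1 f2 f3 f4 f5 x = avg_op ?F x"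
    by (rule ip_eq_AE[OF T(1) h]) (simp only: T(2) rep)
qed

section \<open>Weighted and Sobolev bounds\<close>

abbreviation jb :: "real \<Rightarrow> real" where "jb \<equiv> japanese_bracket"

lemma jb_ge_1: "1 \<le> jb x"
  by (simp add: japanese_bracket_def)

lemma jb_pos: "0 < jb x"
  using jb_ge_1[of x] by simp

lemma jb_sq: "(jb x)\<^sup>2 = 1 + x\<^sup>2"
  by (simp add: japanese_bracket_def add_nonneg_nonneg)

lemma jb_measurable [measurable]: "jb \<in> borel_measurable borel"
  unfolding japanese_bracket_def[abs_def] by measurable

lemma norm_weight: "norm (weight s f x) = jb x powr s * norm (f x)"
  by (simp add: weight_def)

lemma weight_measurable [measurable]:
  "f \<in> borel_measurable borel \<Longrightarrow> weight s f \<in> borel_measurable borel"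
  unfolding weight_def by measurable

lemma weight_inverse: "(\<lambda>x. (jb x powr (- s)) *\<^sub>R weight s f x) = f"
  using jb_pos by (simp add: weight_def fun_eq_iff powr_add[symmetric] less_imp_neq[symmetric])

lemma weight_measurableD: "weight s f \<in> borel_measurable borel \<Longrightarrow> f \<in> borel_measurable borel"
proof -
  assume [measurable]: "weight s f \<in> borel_measurable borel"
  have "(\<lambda>x. (jb x powr (- s)) *\<^sub>R weight s f x) \<in> borel_measurable borel" by measurable
  then show ?thesis by (simp only: weight_inverse)
qed

lemma weight_L2D:
  assumes w: "weight s f \<in> SQ" and s: "0 \<le> s"
  shows "f \<in> SQ" "nrm f \<le> nrm (weight s f)"
proof -
  have m: "f \<in> borel_measurable borel" by (rule weight_measurableD[OF L2_measurable[OF w]])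
  have "norm (f x) \<le> norm (weight s f x)" for x
  proof -
    have "1 * norm (f x) \<le> jb x powr s * norm (f x)"
      using s jb_ge_1[of x] by (intro mult_right_mono ge_one_powr_ge_zero) auto
    then show ?thesis by (simp add: norm_weight)
  qed
  then have ae: "AE x in lborel. norm (f x) \<le> norm (weight s f x)" by simp
  show "f \<in> SQ" "nrm f \<le> nrm (weight s f)"
    using L2_dominated[OF w m ae] by auto
qed

lemma weight_cong_AE: "AE x in lborel. f x = g x \<Longrightarrow> AE x in lborel. weight s f x = weight s g x"
  by (auto simp: weight_def)

lemma evp_sq_le: "x\<^sup>2 \<le> (evp 0 (x, w))\<^sup>2 + (evp (Suc 0) (x, w))\<^sup>2 + (evp 2 (x, w))\<^sup>2"
proof -
  obtain \<theta> x1 x2 where w: "w = (\<theta>, x1, x2)" by (cases w)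
  have "(evp 0 (x, w))\<^sup>2 + (evp (Suc 0) (x, w))\<^sup>2 + (evp 2 (x, w))\<^sup>2 = x1\<^sup>2 + x2\<^sup>2 + x\<^sup>2"
    unfolding w evp.simps using rot_norm[OF rot_sum rot_sq, of \<theta> x1 x2 x] by simp
  then show ?thesis by simp
qed

text \<open>Expanding the product of the three factors \<open>1 + y\<^sup>2\<close> gives 1, the
  squared norm of the rotated vector and nonnegative terms; the squared norm already dominates
  \<open>x\<^sup>2\<close>.\<close>

lemma jb_evp_le: "jb x \<le> jb (evp 0 (x, w)) * jb (evp (Suc 0) (x, w)) * jb (evp 2 (x, w))"
proof (rule power2_le_imp_le)
  let ?a = "(evp 0 (x, w))\<^sup>2" and ?b = "(evp (Suc 0) (x, w))\<^sup>2" and ?c = "(evp 2 (x, w))\<^sup>2"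
  have "(1 + ?a) * (1 + ?b) * (1 + ?c) = 1 + ?a + ?b + ?c + (?a * ?b + ?b * ?c + ?a * ?c + ?a * ?b * ?c)"
    by (simp add: algebra_simps del: evp.simps)
  moreover have "0 \<le> ?a * ?b + ?b * ?c + ?a * ?c + ?a * ?b * ?c"
    by (intro add_nonneg_nonneg mult_nonneg_nonneg zero_le_power2)
  ultimately show "(jb x)\<^sup>2 \<le> (jb (evp 0 (x, w)) * jb (evp (Suc 0) (x, w)) * jb (evp 2 (x, w)))\<^sup>2"
    unfolding power_mult_distrib jb_sq using evp_sq_le[of x w] by linarith
qed (intro mult_nonneg_nonneg less_imp_le jb_pos)

text \<open>Domination by an average is all that is used of \<open>g\<close>, so the bound applies
  to \<open>weight \<sigma> (avg_op f)\<close>, which is not itself of the form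
  \<open>avg_op\<close>.\<close>

lemma L2_of_avg:
  assumes F: "\<And>i. i < 5 \<Longrightarrow> F i \<in> SQ" and [measurable]: "g \<in> borel_measurable borel"
    and le: "\<And>x. ennreal (norm (g x)) \<le> ennreal avg_const * avg (\<lambda>i x. norm (F i x)) x"
  shows "g \<in> SQ" "nrm g \<le> 2 * sqrt 3 / pi * (\<Prod>i<5. nrm (F i))"
proof -
  have m: "F i \<in> borel_measurable borel" if "i < 5" for i using F[OF that] by (rule L2_measurable)
  have am: "avg (\<lambda>i x. norm (F i x)) \<in> borel_measurable borel" by (rule avg_measurable) (use m in auto)
  have "(\<integral>\<^sup>+x. (ennreal (norm (g x)))\<^sup>2 \<partial>lborel) \<le> (\<integral>\<^sup>+x. (ennreal avg_const)\<^sup>2 * (avg (\<lambda>i x. norm (F i x)) x)\<^sup>2 \<partial>lborel)"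
    unfolding power_mult_distrib[symmetric] by (intro nn_integral_mono power_mono le) auto
  also have "\<dots> = (ennreal avg_const)\<^sup>2 * (\<integral>\<^sup>+x. (avg (\<lambda>i x. norm (F i x)) x)\<^sup>2 \<partial>lborel)"
    using borel_measurable_power_ennreal[OF am] by (intro nn_integral_cmult) simp
  also have "\<dots> \<le> (ennreal avg_const)\<^sup>2 * ennreal ((2 * pi * (\<Prod>i<5. nrm (F i)))\<^sup>2)"
    by (intro mult_left_mono avg_L2) (use F m in \<open>auto simp: nn_integral_nrm\<close>)
  also have "\<dots> = ennreal (avg_const\<^sup>2) * ennreal ((2 * pi * (\<Prod>i<5. nrm (F i)))\<^sup>2)"
    using avg_const_pos by (simp add: ennreal_power)
  also have "\<dots> = ennreal (avg_const\<^sup>2 * (2 * pi * (\<Prod>i<5. nrm (F i)))\<^sup>2)"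
    by (rule ennreal_mult[symmetric]) auto
  also have "avg_const\<^sup>2 * (2 * pi * (\<Prod>i<5. nrm (F i)))\<^sup>2 = (2 * sqrt 3 / pi * (\<Prod>i<5. nrm (F i)))\<^sup>2"
    by (simp add: avg_const_def power2_eq_square)
  finally have le2: "(\<integral>\<^sup>+x. (ennreal (norm (g x)))\<^sup>2 \<partial>lborel) \<le> ennreal ((2 * sqrt 3 / pi * (\<Prod>i<5. nrm (F i)))\<^sup>2)" .
  have n: "0 \<le> 2 * sqrt 3 / pi * (\<Prod>i<5. nrm (F i))" by (intro mult_nonneg_nonneg prod_nonneg) auto
  show "g \<in> SQ" "nrm g \<le> 2 * sqrt 3 / pi * (\<Prod>i<5. nrm (F i))"
    using L2_I_nn[OF assms(2) le2 n] by auto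
qed

lemma avg_integrand_measurable:
  assumes F: "\<And>i. i < 5 \<Longrightarrow> F i \<in> borel_measurable borel"
  shows "(\<lambda>w. ennreal (window (fst w) * (\<Prod>i<5. F i (evp i (x, w))))) \<in> borel_measurable borel"
proof -
  have Fm: "(\<lambda>w. F i (evp i (x, w))) \<in> borel_measurable borel" if "i < 5" for i
    using that by (intro measurable_compose[OF evp_pair_measurable F]) auto
  show ?thesis
    by (intro measurable_compose[OF _ measurable_ennreal] borel_measurable_times borel_measurable_prod Fm window_fst_measurable) auto
qed

lemma weighted_avg_op_L2:
  assumes f: "\<And>i. i < 5 \<Longrightarrow> weight \<sigma> (f i) \<in> SQ" and \<sigma>: "0 \<le> \<sigma>"
  shows "weight \<sigma> (avg_op f) \<in> SQ"
    "nrm (weight \<sigma> (avg_op f)) \<le> 2 * sqrt 3 / pi * (\<Prod>i<5. nrm (weight \<sigma> (f i)))"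
proof -
  have fL: "f i \<in> SQ" if "i < 5" for i using weight_L2D[OF f[OF that] \<sigma>] by simp
  have m: "f i \<in> borel_measurable borel" if "i < 5" for i using fL[OF that] by (rule L2_measurable)
  have wm: "weight \<sigma> (avg_op f) \<in> borel_measurable borel" by (intro weight_measurable avg_op_measurable m)
  have le: "ennreal (norm (weight \<sigma> (avg_op f) x)) \<le> ennreal avg_const * avg (\<lambda>i x. norm (weight \<sigma> (f i) x)) x" for x
  proof -
    have "ennreal (norm (weight \<sigma> (avg_op f) x)) = ennreal (jb x powr \<sigma>) * ennreal (norm (avg_op f x))"
      unfolding norm_weight by (rule ennreal_mult) auto
    also have "\<dots> \<le> ennreal (jb x powr \<sigma>) * (ennreal avg_const * avg (\<lambda>i x. norm (f i x)) x)"
      by (intro mult_left_mono norm_avg_op_le m) auto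
    also have "\<dots> = ennreal avg_const * (ennreal (jb x powr \<sigma>) * avg (\<lambda>i x. norm (f i x)) x)"
      by (simp only: mult_ac)
    also have "\<dots> \<le> ennreal avg_const * avg (\<lambda>i x. norm (weight \<sigma> (f i) x)) x"
    proof (rule mult_left_mono)
      have "ennreal (jb x powr \<sigma>) * avg (\<lambda>i x. norm (f i x)) x =
          (\<integral>\<^sup>+w. ennreal (jb x powr \<sigma>) * ennreal (window (fst w) * (\<Prod>i<5. norm (f i (evp i (x, w))))) \<partial>lborel)"
        unfolding avg_def using avg_integrand_measurable[of "\<lambda>i x. norm (f i x)" x] m
        by (intro nn_integral_cmult[symmetric]) auto
      also have "\<dots> \<le> avg (\<lambda>i x. norm (weight \<sigma> (f i) x)) x"
        unfolding avg_def
      proof (rule nn_integral_mono)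
        fix w
        let ?p = "\<lambda>i. jb (evp i (x, w)) powr \<sigma>"
        have "jb x powr \<sigma> \<le> (jb (evp 0 (x, w)) * jb (evp (Suc 0) (x, w)) * jb (evp 2 (x, w))) powr \<sigma>"
          using \<sigma> jb_pos[of x] by (intro powr_mono2 jb_evp_le) auto
        also have "\<dots> = ?p 0 * ?p (Suc 0) * ?p 2"
          using jb_pos by (simp add: powr_mult less_imp_le del: evp.simps)
        \<comment> \<open>The two unrotated slots also receive a weight, which is at least 1, so
          that all five functions end up measured in the same norm.\<close>
        also have "\<dots> = ?p 0 * ?p (Suc 0) * ?p 2 * 1 * 1" by simp
        also have "\<dots> \<le> ?p 0 * ?p (Suc 0) * ?p 2 * ?p 3 * ?p 4"
          using \<sigma> jb_ge_1 by (intro mult_mono order_refl ge_one_powr_ge_zero mult_nonneg_nonneg) auto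
        also have "\<dots> = (\<Prod>i<5. ?p i)" by (simp only: prod_lessThan_5)
        finally have "jb x powr \<sigma> \<le> (\<Prod>i<5. ?p i)" .
        then have "jb x powr \<sigma> * (window (fst w) * (\<Prod>i<5. norm (f i (evp i (x, w))))) \<le>
            (\<Prod>i<5. ?p i) * (window (fst w) * (\<Prod>i<5. norm (f i (evp i (x, w)))))"
          by (intro mult_right_mono mult_nonneg_nonneg prod_nonneg) auto
        also have "\<dots> = window (fst w) * (\<Prod>i<5. norm (weight \<sigma> (f i) (evp i (x, w))))"
          by (simp only: norm_weight prod.distrib mult_ac)
        finally show "ennreal (jb x powr \<sigma>) * ennreal (window (fst w) * (\<Prod>i<5. norm (f i (evp i (x, w))))) \<le>
            ennreal (window (fst w) * (\<Prod>i<5. norm (weight \<sigma> (f i) (evp i (x, w)))))"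
          by (subst ennreal_mult[symmetric]) (auto intro!: ennreal_leI mult_nonneg_nonneg prod_nonneg simp del: evp.simps)
      qed
      finally show "ennreal (jb x powr \<sigma>) * avg (\<lambda>i x. norm (f i x)) x \<le> avg (\<lambda>i x. norm (weight \<sigma> (f i) x)) x" .
    qed simp
    finally show ?thesis .
  qed
  show "weight \<sigma> (avg_op f) \<in> SQ" "nrm (weight \<sigma> (avg_op f)) \<le> 2 * sqrt 3 / pi * (\<Prod>i<5. nrm (weight \<sigma> (f i)))"
    using L2_of_avg[of "\<lambda>i. weight \<sigma> (f i)", OF f wm le] by auto
qed

lemma less_5_cases: "i < 5 \<Longrightarrow> i = 0 \<or> i = Suc 0 \<or> i = 2 \<or> i = 3 \<or> i = (4::nat)"
  by auto

lemma T6_bounded_L2: "T6_bounded_by L2 (Lp_norm 2) (2 * sqrt 3 / pi)"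
  unfolding T6_bounded_by_def L2_eq Lp_norm_2_eq
proof (intro ballI conjI)
  fix f1 f2 f3 f4 f5 assume f: "f1 \<in> SQ" "f2 \<in> SQ" "f3 \<in> SQ" "f4 \<in> SQ" "f5 \<in> SQ"
  let ?F = "(!) [f1, f2, f3, f4, f5]"
  have F: "?F i \<in> SQ" if "i < 5" for i using less_5_cases[OF that] f by auto
  show "T6 f1 f2 f3 f4 f5 \<in> SQ" by (rule T6_AE(1)[OF f])
  have h: "avg_op ?F \<in> SQ" by (rule avg_op_L2) (rule F)
  have "nrm (T6 f1 f2 f3 f4 f5) = nrm (avg_op ?F)"
    by (rule nrm_cong_AE[OF L2_measurable L2_measurable T6_AE(2)[OF f]]) (use T6_AE(1)[OF f] h in auto)
  also have "\<dots> \<le> 2 * sqrt 3 / pi * (\<Prod>i<5. nrm (?F i))" by (rule avg_op_L2) (rule F)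
  also have "(\<Prod>i<5. nrm (?F i)) = nrm f1 * nrm f2 * nrm f3 * nrm f4 * nrm f5" by (simp add: prod_lessThan_5)
  finally show "nrm (T6 f1 f2 f3 f4 f5) \<le> 2 * sqrt 3 / pi * (nrm f1 * nrm f2 * nrm f3 * nrm f4 * nrm f5)" .
qed

lemma T6_bounded_weighted_L2:
  assumes \<sigma>: "0 \<le> \<sigma>" shows "T6_bounded_by (Lps 2 \<sigma>) (Lps_norm 2 \<sigma>) (2 * sqrt 3 / pi)"
  unfolding T6_bounded_by_def Lps_def Lps_norm_def L2_eq Lp_norm_2_eq mem_Collect_eq
proof (intro ballI conjI)
  fix f1 f2 f3 f4 f5
  assume "f1 \<in> {f. weight \<sigma> f \<in> SQ}" "f2 \<in> {f. weight \<sigma> f \<in> SQ}" "f3 \<in> {f. weight \<sigma> f \<in> SQ}"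
    "f4 \<in> {f. weight \<sigma> f \<in> SQ}" "f5 \<in> {f. weight \<sigma> f \<in> SQ}"
  then have w: "weight \<sigma> f1 \<in> SQ" "weight \<sigma> f2 \<in> SQ" "weight \<sigma> f3 \<in> SQ" "weight \<sigma> f4 \<in> SQ" "weight \<sigma> f5 \<in> SQ" by auto
  note f = w[THEN weight_L2D(1), OF \<sigma>]
  let ?F = "(!) [f1, f2, f3, f4, f5]"
  have F: "weight \<sigma> (?F i) \<in> SQ" if "i < 5" for i using less_5_cases[OF that] w by auto
  note h = weighted_avg_op_L2[of \<sigma> ?F, OF F \<sigma>]
  have Tm: "weight \<sigma> (T6 f1 f2 f3 f4 f5) \<in> borel_measurable borel"
    using T6_AE(1)[OF f] by (intro weight_measurable L2_measurable)
  note ae = weight_cong_AE[OF T6_AE(2)[OF f], of \<sigma>]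
  show "weight \<sigma> (T6 f1 f2 f3 f4 f5) \<in> SQ" by (rule L2_cong_AE[OF h(1) Tm ae])
  have "nrm (weight \<sigma> (T6 f1 f2 f3 f4 f5)) = nrm (weight \<sigma> (avg_op ?F))"
    by (rule nrm_cong_AE[OF Tm L2_measurable[OF h(1)] ae])
  also note h(2)
  also have "(\<Prod>i<5. nrm (weight \<sigma> (?F i))) = nrm (weight \<sigma> f1) * nrm (weight \<sigma> f2) * nrm (weight \<sigma> f3) * nrm (weight \<sigma> f4) * nrm (weight \<sigma> f5)"
    by (simp add: prod_lessThan_5)
  finally show "nrm (weight \<sigma> (T6 f1 f2 f3 f4 f5)) \<le> 2 * sqrt 3 / pi * (nrm (weight \<sigma> f1) * nrm (weight \<sigma> f2) * nrm (weight \<sigma> f3) * nrm (weight \<sigma> f4) * nrm (weight \<sigma> f5))" .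
qed

text \<open>A difference that vanishes almost everywhere has norm zero, and the slot bound kills it.
  This replaces the check that preimages of null sets under \<open>evp\<close> are null.\<close>

lemma A_form_cong_slot:
  assumes F: "\<And>i. i < 6 \<Longrightarrow> F i \<in> SQ" and j: "j < 6" and g: "g \<in> SQ" "h \<in> SQ" "AE x in lborel. g x = h x"
  shows "A.form (F(j := g)) = A.form (F(j := h))"
proof -
  obtain K where K: "\<And>k. k \<in> SQ \<Longrightarrow> norm (A.form (F(j := k))) \<le> K * nrm k"
    using avg_form_slot_bound[of F j] F j by auto
  have "A.form (F(j := \<lambda>x. 1 * g x + (-1) * h x)) = slot j 1 * A.form (F(j := g)) + slot j (-1) * A.form (F(j := h))"
    by (rule hexalinearD[OF A.hexalinear_form F j g(1,2)])
  moreover have "nrm (\<lambda>x. g x - h x) = 0" using g by (simp add: nrm_diff_eq_0_iff)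
  then have "A.form (F(j := \<lambda>x. 1 * g x + (-1) * h x)) = 0"
    using K[of "\<lambda>x. g x - h x"] g by simp
  ultimately show ?thesis by (simp add: slot_def split: if_splits)
qed

text \<open>The arguments are exchanged one slot at a time; at stage \<open>j\<close> the slots
  below \<open>j\<close> already carry \<open>g\<close>.\<close>

lemma A_form_cong_AE:
  assumes f: "\<And>i. i < 6 \<Longrightarrow> f i \<in> SQ" "\<And>i. i < 6 \<Longrightarrow> g i \<in> SQ" "\<And>i. i < 6 \<Longrightarrow> AE x in lborel. f i x = g i x"
  shows "A.form f = A.form g"
proof -
  have "j \<le> 6 \<Longrightarrow> A.form (\<lambda>i. if i < j then g i else f i) = A.form f" for j
  proof (induction j)
    case (Suc j)
    let ?H = "\<lambda>i. if i < j then g i else f i"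
    have j: "j < 6" using Suc by simp
    have "(\<lambda>i. if i < Suc j then g i else f i) = ?H(j := g j)" by (auto simp: fun_eq_iff less_Suc_eq)
    then have "A.form (\<lambda>i. if i < Suc j then g i else f i) = A.form (?H(j := g j))" by (rule arg_cong)
    also have "\<dots> = A.form (?H(j := f j))"
    proof (rule A_form_cong_slot[OF _ j])
      show "AE x in lborel. g j x = f j x" using f(3)[OF j] by eventually_elim simp
    qed (use f j in auto)
    also have "?H(j := f j) = ?H" by auto
    finally show ?case using Suc by simp
  qed simp
  from this[of 6] have "A.form f = A.form (\<lambda>i. if i < 6 then g i else f i)" by simp
  also have "\<dots> = A.form g" by (rule A.form_cong) simp
  finally show ?thesis .
qed

lemma avg_op_cong_AE:
  assumes f: "\<And>i. i < 5 \<Longrightarrow> f i \<in> SQ" "\<And>i. i < 5 \<Longrightarrow> g i \<in> SQ" "\<And>i. i < 5 \<Longrightarrow> AE x in lborel. f i x = g i x"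
  shows "AE x in lborel. avg_op f x = avg_op g x"
proof (rule ip_eq_AE)
  show "avg_op f \<in> SQ" "avg_op g \<in> SQ" by (intro avg_op_L2(1) f; simp)+
  fix h assume h: "h \<in> SQ"
  have "ip (avg_op f) h = ip (avg_op (f(5 := h))) ((f(5 := h)) 5)"
    by (simp add: avg_op_cong[of f "f(5 := h)"])
  also have "\<dots> = A.form (f(5 := h))" using f h by (intro ip_avg_op) auto
  also have "\<dots> = A.form (g(5 := h))" using f h by (intro A_form_cong_AE) auto
  also have "\<dots> = ip (avg_op (g(5 := h))) ((g(5 := h)) 5)" using f h by (intro ip_avg_op[symmetric]) auto
  also have "\<dots> = ip (avg_op g) h" by (simp add: avg_op_cong[of g "g(5 := h)"])
  finally show "ip (avg_op f) h = ip (avg_op g) h" .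
qed

section \<open>The Fourier transform and the averaged form\<close>

lemma fourier_L2: "f \<in> SQ \<Longrightarrow> fourier f \<in> SQ"
  by (rule fourier_AE_phi)

lemma fourier_lin:
  assumes f: "f \<in> SQ" "g \<in> SQ"
  shows "AE x in lborel. fourier (\<lambda>x. a * f x + b * g x) x = a * fourier f x + b * fourier g x"
proof -
  have fg: "(\<lambda>x. a * f x + b * g x) \<in> SQ" using f by auto
  have "norm (- \<i>) = 1" by simp
  from phi_lin[OF f this, of a b] fourier_AE_phi(2)[OF fg] fourier_AE_phi(2)[OF f(1)] fourier_AE_phi(2)[OF f(2)]
  show ?thesis by eventually_elim simp
qed

lemma fourier_nrm: "f \<in> SQ \<Longrightarrow> nrm (fourier f) = nrm f"
  using nrm_cong_AE[OF L2_measurable L2_measurable fourier_AE_phi(2)] fourier_L2[of f] phi_L2[of f "- \<i>"] phi_nrm[of f "- \<i>"]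
  by simp

lemma ip_fourier: "f \<in> SQ \<Longrightarrow> g \<in> SQ \<Longrightarrow> ip (fourier f) (fourier g) = ip f g"
  by (rule isometry_ip) (auto simp: fourier_L2 fourier_nrm intro!: fourier_lin)

lemma fourier_surj:
  assumes h: "h \<in> SQ" obtains g where "g \<in> SQ" "AE x in lborel. fourier g x = h x"
proof
  show p: "phi \<i> h \<in> SQ" by (rule phi_L2[OF h]) simp
  have "AE x in lborel. phi (- \<i>) (phi \<i> h) x = phi (- \<i> * \<i>) h x" by (rule phi_phi[OF h]) auto
  with fourier_AE_phi(2)[OF p] phi_one[OF h] show "AE x in lborel. fourier (phi \<i> h) x = h x"
    by eventually_elim simp
qed

text \<open>The formula \<open>A_form_coh\<close> involves the parameters only through products of
  one of the first three with a conjugate of one of the last three, and a common unimodular factor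
  drops out of these.\<close>

lemma A_form_coh_rotate: "A.form (\<lambda>i. coh (- \<i> * z i)) = A.form (\<lambda>i. coh (z i))"
proof -
  have 1: "(- \<i> * a) * cnj (- \<i> * b) = a * cnj b" for a b by (simp add: complex_eq_iff)
  have P: "- \<i> * z 0 * cnj (- \<i> * z 3) + - \<i> * z 1 * cnj (- \<i> * z 4) + - \<i> * z 2 * cnj (- \<i> * z 5) =
      z 0 * cnj (z 3) + z 1 * cnj (z 4) + z 2 * cnj (z 5)" by (simp only: 1)
  have Z: "(- \<i> * z 0 + - \<i> * z 1 + - \<i> * z 2) * (cnj (- \<i> * z 3) + cnj (- \<i> * z 4) + cnj (- \<i> * z 5)) =
      (z 0 + z 1 + z 2) * (cnj (z 3) + cnj (z 4) + cnj (z 5))"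
    by (simp only: distrib_left distrib_right 1)
  have S: "- \<i> * z 0 * (cnj (- \<i> * z 4) - cnj (- \<i> * z 5)) + - \<i> * z 1 * (cnj (- \<i> * z 5) - cnj (- \<i> * z 3)) + - \<i> * z 2 * (cnj (- \<i> * z 3) - cnj (- \<i> * z 4)) =
     z 0 * (cnj (z 4) - cnj (z 5)) + z 1 * (cnj (z 5) - cnj (z 3)) + z 2 * (cnj (z 3) - cnj (z 4))"
    by (simp only: right_diff_distrib 1)
  show ?thesis unfolding A_form_coh mult.assoc[of 2] P Z S ..
qed

text \<open>The averaged form commutes with the Fourier transform, as both are rotations of the coherent
  states.\<close>

lemma A_form_fourier:
  assumes f: "\<And>i. i < 6 \<Longrightarrow> f i \<in> SQ"
  shows "A.form (\<lambda>i. fourier (f i)) = A.form f"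
proof (rule hexalinear_eq_L2[of "\<lambda>f. A.form (\<lambda>i. fourier (f i))" A.form])
  have upd: "(\<lambda>i. fourier ((f(j := k)) i)) = (\<lambda>i. fourier (f i))(j := fourier k)" for f :: "nat \<Rightarrow> real \<Rightarrow> complex" and j k
    by auto
  show "hexalinear SQ (\<lambda>f. A.form (\<lambda>i. fourier (f i)))"
    unfolding hexalinear_def
  proof (intro allI impI ballI)
    fix f :: "nat \<Rightarrow> real \<Rightarrow> complex" and j g h and a b :: complex
    assume f: "\<forall>i<6. f i \<in> SQ" and j: "j < (6::nat)" and g: "g \<in> SQ" and h: "h \<in> SQ"
    have "A.form ((\<lambda>i. fourier (f i))(j := fourier (\<lambda>x. a * g x + b * h x))) = A.form ((\<lambda>i. fourier (f i))(j := \<lambda>x. a * fourier g x + b * fourier h x))"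
      using f j g h by (intro A_form_cong_slot fourier_lin) (auto intro!: fourier_L2)
    also have "\<dots> = slot j a * A.form ((\<lambda>i. fourier (f i))(j := fourier g)) + slot j b * A.form ((\<lambda>i. fourier (f i))(j := fourier h))"
      using f j g h by (intro hexalinearD[OF A.hexalinear_form]) (auto intro!: fourier_L2)
    finally show "A.form (\<lambda>i. fourier ((f(j := \<lambda>x. a * g x + b * h x)) i)) =
        slot j a * A.form (\<lambda>i. fourier ((f(j := g)) i)) + slot j b * A.form (\<lambda>i. fourier ((f(j := h)) i))"
      unfolding upd .
  qed
  show "A.form (\<lambda>i. fourier (coh (z i))) = A.form (\<lambda>i. coh (z i))" for z
  proof -
    have "A.form (\<lambda>i. fourier (coh (z i))) = A.form (\<lambda>i. coh (- \<i> * z i))"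
    proof (rule A_form_cong_AE)
      fix i
      have "norm (- \<i>) = 1" by simp
      from phi_coh[OF this, of "z i"] fourier_AE_phi(2)[OF coh_L2, of "z i"]
      show "AE x in lborel. fourier (coh (z i)) x = coh (- \<i> * z i) x" by eventually_elim simp
    qed (auto intro: fourier_L2)
    then show ?thesis by (simp only: A_form_coh_rotate)
  qed
  show "\<exists>K. \<forall>g\<in>SQ. norm (A.form (\<lambda>i. fourier ((f(j := g)) i))) \<le> K * nrm g"
    if F: "\<And>i. i < 6 \<Longrightarrow> f i \<in> SQ" and j: "j < 6" for f :: "nat \<Rightarrow> real \<Rightarrow> complex" and j
  proof -
    obtain K where K: "\<And>k. k \<in> SQ \<Longrightarrow> norm (A.form ((\<lambda>i. fourier (f i))(j := k))) \<le> K * nrm k"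
      using avg_form_slot_bound[of "\<lambda>i. fourier (f i)" j] fourier_L2[OF F] j by blast
    have "norm (A.form (\<lambda>i. fourier ((f(j := g)) i))) \<le> K * nrm g" if "g \<in> SQ" for g
      using K[OF fourier_L2[OF that]] that by (simp only: upd fourier_nrm)
    then show ?thesis by blast
  qed
qed (use f A.hexalinear_form in \<open>auto intro: A.form_cong avg_form_slot_bound\<close>)

text \<open>Up to null sets every test function is \<open>fourier g\<close>. Against it, Plancherel
  reduces the left side to the averaged form, and \<open>A_form_fourier\<close> does the same for
  the right side.\<close>

lemma fourier_avg_op:
  assumes f: "\<And>i. i < 5 \<Longrightarrow> f i \<in> SQ"
  shows "AE x in lborel. fourier (avg_op f) x = avg_op (\<lambda>i. fourier (f i)) x"
proof (rule ip_eq_AE)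
  have a: "avg_op f \<in> SQ" by (intro avg_op_L2(1) f)
  show b: "fourier (avg_op f) \<in> SQ" by (rule fourier_L2[OF a])
  show c: "avg_op (\<lambda>i. fourier (f i)) \<in> SQ" by (intro avg_op_L2(1) fourier_L2 f)
  fix h assume h: "h \<in> SQ"
  obtain g where g: "g \<in> SQ" and gh: "AE x in lborel. fourier g x = h x" using fourier_surj[OF h] .
  let ?f = "f(5 := g)"
  have f6: "?f i \<in> SQ" if "i < 6" for i using f g that by auto
  have "ip (fourier (avg_op f)) h = ip (fourier (avg_op f)) (fourier g)"
    using gh b g h fourier_L2[OF g] by (intro ip_cong_AE L2_measurable) auto
  also have "\<dots> = ip (avg_op f) g" by (rule ip_fourier[OF a g])
  also have "\<dots> = ip (avg_op ?f) (?f 5)" by (simp add: avg_op_cong[of f ?f])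
  also have "\<dots> = A.form ?f" by (rule ip_avg_op) (rule f6)
  also have "\<dots> = A.form (\<lambda>i. fourier (?f i))" by (rule A_form_fourier[symmetric]) (rule f6)
  also have "\<dots> = ip (avg_op (\<lambda>i. fourier (?f i))) (fourier (?f 5))"
    by (rule ip_avg_op[symmetric]) (rule fourier_L2[OF f6])
  also have "avg_op (\<lambda>i. fourier (?f i)) = avg_op (\<lambda>i. fourier (f i))" by (rule avg_op_cong) auto
  also have "ip (avg_op (\<lambda>i. fourier (f i))) (fourier (?f 5)) = ip (avg_op (\<lambda>i. fourier (f i))) h"
    using gh c g h by (intro ip_cong_AE L2_measurable) (auto intro: fourier_L2)
  finally show "ip (fourier (avg_op f)) h = ip (avg_op (\<lambda>i. fourier (f i))) h" .
qed

lemma fourier_cong_AE: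
  assumes "f \<in> SQ" "g \<in> SQ" "AE x in lborel. f x = g x"
  shows "AE x in lborel. fourier f x = fourier g x"
proof -
  have "norm (- \<i>) = 1" by simp
  from phi_cong[OF assms this] fourier_AE_phi(2)[OF assms(1)] fourier_AE_phi(2)[OF assms(2)]
  show ?thesis by eventually_elim simp
qed

lemma T6_bounded_Sobolev:
  assumes \<sigma>: "0 \<le> \<sigma>" shows "T6_bounded_by (Sobolev \<sigma>) (Sobolev_norm \<sigma>) (2 * sqrt 3 / pi)"
  unfolding T6_bounded_by_def Sobolev_def Sobolev_norm_def L2_eq Lp_norm_2_eq
proof (intro ballI conjI)
  let ?X = "{f \<in> SQ. weight \<sigma> (fourier f) \<in> SQ}"
  fix f1 f2 f3 f4 f5 assume X: "f1 \<in> ?X" "f2 \<in> ?X" "f3 \<in> ?X" "f4 \<in> ?X" "f5 \<in> ?X"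
  then have f: "f1 \<in> SQ" "f2 \<in> SQ" "f3 \<in> SQ" "f4 \<in> SQ" "f5 \<in> SQ" by auto
  let ?F = "(!) [f1, f2, f3, f4, f5]"
  let ?T = "T6 f1 f2 f3 f4 f5"
  have F: "?F i \<in> SQ" "weight \<sigma> (fourier (?F i)) \<in> SQ" if "i < 5" for i using less_5_cases[OF that] X by auto
  note h = weighted_avg_op_L2[of \<sigma> "\<lambda>i. fourier (?F i)", OF F(2) \<sigma>]
  have T: "?T \<in> SQ" by (rule T6_AE(1)[OF f])
  have a: "avg_op ?F \<in> SQ" by (intro avg_op_L2(1) F)
  have Tm: "weight \<sigma> (fourier ?T) \<in> borel_measurable borel"
    by (intro weight_measurable L2_measurable fourier_L2 T)
  have four: "AE x in lborel. fourier (avg_op ?F) x = avg_op (\<lambda>i. fourier (?F i)) x"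
    by (rule fourier_avg_op) (rule F(1))
  have "AE x in lborel. fourier ?T x = avg_op (\<lambda>i. fourier (?F i)) x"
    using fourier_cong_AE[OF T a T6_AE(2)[OF f]] four by eventually_elim simp
  note ae = weight_cong_AE[OF this, of \<sigma>]
  have "weight \<sigma> (fourier ?T) \<in> SQ" by (rule L2_cong_AE[OF h(1) Tm ae])
  then show "?T \<in> ?X" using T by simp
  have "nrm (weight \<sigma> (fourier ?T)) = nrm (weight \<sigma> (avg_op (\<lambda>i. fourier (?F i))))"
    by (rule nrm_cong_AE[OF Tm L2_measurable[OF h(1)] ae])
  also note h(2)
  also have "(\<Prod>i<5. nrm (weight \<sigma> (fourier (?F i)))) = nrm (weight \<sigma> (fourier f1)) * nrm (weight \<sigma> (fourier f2)) *
      nrm (weight \<sigma> (fourier f3)) * nrm (weight \<sigma> (fourier f4)) * nrm (weight \<sigma> (fourier f5))"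
    by (simp add: prod_lessThan_5)
  finally show "nrm (weight \<sigma> (fourier ?T)) \<le> 2 * sqrt 3 / pi * (nrm (weight \<sigma> (fourier f1)) * nrm (weight \<sigma> (fourier f2)) *
      nrm (weight \<sigma> (fourier f3)) * nrm (weight \<sigma> (fourier f4)) * nrm (weight \<sigma> (fourier f5)))" .
qed

section \<open>Weighted Lebesgue bounds\<close>

lemma nn_tail:
  assumes r: "1 < r"
  shows "(\<integral>\<^sup>+x. ennreal (if x \<in> {1..} then x powr (- r) else 0) \<partial>lborel) < \<infinity>"
proof -
  have "((\<lambda>x. if x \<in> {1..} then x powr (- r) else 0) has_integral - (1 powr (- r + 1)) / (- r + 1)) UNIV"
    using has_integral_powr_to_inf[of "- r" 1] r by (subst has_integral_restrict_UNIV) simp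
  then show ?thesis
    by (subst nn_integral_has_integral_lborel) auto
qed

lemma jb_powr_integral:
  assumes r: "1 < r" shows "(\<integral>\<^sup>+x. ennreal (jb x powr (- r)) \<partial>lborel) < \<infinity>"
proof -
  let ?t = "\<lambda>x::real. if x \<in> {1..} then x powr (- r) else 0"
  have le: "ennreal (jb x powr (- r)) \<le> indicator {-1..1} x + (ennreal (?t x) + ennreal (?t (- x)))" for x
  proof (cases "x \<in> {-1..1}")
    case True
    have "jb x powr (- r) \<le> 1"
      using r jb_ge_1[of x] powr_mono[of "- r" 0 "jb x"] by simp
    then have "ennreal (jb x powr (- r)) \<le> 1" by (simp add: ennreal_le_1)
    moreover have "indicator {-1..1} x = (1 :: ennreal)" using True by simp
    moreover have "(1 :: ennreal) \<le> 1 + y" for y by (rule add_increasing2) auto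
    ultimately show ?thesis by (metis order_trans)
  next
    case False
    then have x: "1 < \<bar>x\<bar>" by auto
    have "\<bar>x\<bar> \<le> jb x" unfolding japanese_bracket_def by (rule real_le_rsqrt) simp
    then have "jb x powr (- r) \<le> \<bar>x\<bar> powr (- r)" using r x by (intro powr_mono2') auto
    also have "\<dots> \<le> ?t x + ?t (- x)" using x by (auto simp: abs_if split: if_splits)
    finally have "ennreal (jb x powr (- r)) \<le> ennreal (?t x + ?t (- x))" by (rule ennreal_leI)
    also have "\<dots> = ennreal (?t x) + ennreal (?t (- x))" by (rule ennreal_plus) auto
    finally show ?thesis using False by simp
  qed
  have "(\<integral>\<^sup>+x. ennreal (jb x powr (- r)) \<partial>lborel) \<le> (\<integral>\<^sup>+x. indicator {-1..1} x + (ennreal (?t x) + ennreal (?t (- x))) \<partial>lborel)"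
    by (intro nn_integral_mono le)
  also have "\<dots> = 2 + ((\<integral>\<^sup>+x. ennreal (?t x) \<partial>lborel) + (\<integral>\<^sup>+x. ennreal (?t (- x)) \<partial>lborel))"
    by (subst nn_integral_add; simp)+
  also have "(\<integral>\<^sup>+x. ennreal (?t (- x)) \<partial>lborel) = (\<integral>\<^sup>+x. ennreal (?t x) \<partial>lborel)"
  proof -
    have e: "0 + (- 1 :: real) * x = - x" for x by simp
    show ?thesis using nn_affine[of "\<lambda>x. ennreal (?t x)" "-1" 0] unfolding e by simp
  qed
  finally show ?thesis using nn_tail[OF r] by (simp add: less_top[symmetric]) (auto simp: top_unique)
qed

text \<open>\<open>sinc\<close> is continuous without zeros on this compact interval, hence bounded
  away from 0. The bound \<open>5 * pi / 6\<close> is half of \<open>pi + 2 * pi / 3\<close>, the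
  largest distance from an angle in the window to a zero of a matrix entry.\<close>

lemma sin_lower_bound: "\<exists>c>0. \<forall>x. \<bar>x\<bar> \<le> 5 * pi / 6 \<longrightarrow> c * \<bar>x\<bar> \<le> \<bar>sin x\<bar>"
proof -
  let ?I = "{- (5 * pi / 6)..5 * pi / 6}"
  have "continuous_on ?I (\<lambda>x. \<bar>sinc x\<bar>)" by (intro continuous_intros)
  then obtain x0 where x0: "x0 \<in> ?I" "\<And>y. y \<in> ?I \<Longrightarrow> \<bar>sinc x0\<bar> \<le> \<bar>sinc y\<bar>"
    using continuous_attains_inf[of ?I "\<lambda>x. \<bar>sinc x\<bar>"] by (auto simp: less_imp_le)
  have "sinc x0 \<noteq> 0"
    using x0(1) sin_eq_0_pi[of x0] pi_gt_zero by (auto simp: field_simps)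
  then have "0 < \<bar>sinc x0\<bar>" by simp
  moreover have "\<bar>sinc x0\<bar> * \<bar>x\<bar> \<le> \<bar>sin x\<bar>" if "\<bar>x\<bar> \<le> 5 * pi / 6" for x
  proof (cases "x = 0")
    case False
    have "\<bar>sinc x0\<bar> * \<bar>x\<bar> \<le> \<bar>sinc x\<bar> * \<bar>x\<bar>" using that by (intro mult_right_mono x0) auto
    also have "\<dots> = \<bar>sin x\<bar>" using False by simp
    finally show ?thesis .
  qed simp
  ultimately show ?thesis by blast
qed

text \<open>The half angle factorization exhibits the two simple zeros of each entry, taken from 0
  and plus or minus \<open>2 * pi / 3\<close>. Writing \<open>\<theta> - 0\<close> matches the shape
  expected by \<open>inverse_sqrt_det_integral\<close>.\<close>

lemma rot_sin:
  "\<bar>ra \<theta>\<bar> = 4 / 3 * (\<bar>sin ((\<theta> + 2 * pi / 3) / 2)\<bar> * \<bar>sin ((\<theta> - 2 * pi / 3) / 2)\<bar>)"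
  "\<bar>rb \<theta>\<bar> = 4 / 3 * (\<bar>sin ((\<theta> - 0) / 2)\<bar> * \<bar>sin ((\<theta> + 2 * pi / 3) / 2)\<bar>)"
  "\<bar>rc \<theta>\<bar> = 4 / 3 * (\<bar>sin ((\<theta> - 0) / 2)\<bar> * \<bar>sin ((\<theta> - 2 * pi / 3) / 2)\<bar>)"
proof -
  define S C where "S = sin (\<theta> / 2)" and "C = cos (\<theta> / 2)"
  have SC: "C\<^sup>2 = 1 - S\<^sup>2" by (simp add: S_def C_def cos_squared_eq)
  have d: "cos \<theta> = 1 - 2 * S\<^sup>2" "sin \<theta> = 2 * S * C"
    using cos_double_sin[of "\<theta> / 2"] sin_double[of "\<theta> / 2"] by (simp_all add: S_def C_def)
  have p: "sin ((\<theta> + 2 * pi / 3) / 2) = S / 2 + C * (sqrt 3 / 2)"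
    using sin_add[of "\<theta> / 2" "pi / 3"] by (simp add: add_divide_distrib S_def C_def sin_60 cos_60)
  have m: "sin ((\<theta> - 2 * pi / 3) / 2) = S / 2 - C * (sqrt 3 / 2)"
    using sin_diff[of "\<theta> / 2" "pi / 3"] by (simp add: diff_divide_distrib S_def C_def sin_60 cos_60)
  have s3: "sqrt 3 * sqrt 3 = (3::real)" by simp
  have "ra \<theta> = - (4 / 3 * ((S / 2 + C * (sqrt 3 / 2)) * (S / 2 - C * (sqrt 3 / 2))))"
  proof -
    have "(S / 2 + C * (sqrt 3 / 2)) * (S / 2 - C * (sqrt 3 / 2)) = S\<^sup>2 / 4 - C\<^sup>2 * (sqrt 3 * sqrt 3) / 4"
      by (simp add: power2_eq_square field_simps)
    then show ?thesis unfolding s3 SC ra_def d by (simp add: field_simps)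
  qed
  then show "\<bar>ra \<theta>\<bar> = 4 / 3 * (\<bar>sin ((\<theta> + 2 * pi / 3) / 2)\<bar> * \<bar>sin ((\<theta> - 2 * pi / 3) / 2)\<bar>)"
    unfolding p m by (simp only: abs_minus_cancel abs_mult)
  have "rb \<theta> = 4 / 3 * (S * (S / 2 + C * (sqrt 3 / 2)))"
    unfolding rb_def d by (simp add: power2_eq_square field_simps)
  then show "\<bar>rb \<theta>\<bar> = 4 / 3 * (\<bar>sin ((\<theta> - 0) / 2)\<bar> * \<bar>sin ((\<theta> + 2 * pi / 3) / 2)\<bar>)"
    unfolding p by (simp only: abs_mult, (simp add: S_def)?)
  have "rc \<theta> = 4 / 3 * (S * (S / 2 - C * (sqrt 3 / 2)))"
    unfolding rc_def d by (simp add: power2_eq_square field_simps)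
  then show "\<bar>rc \<theta>\<bar> = 4 / 3 * (\<bar>sin ((\<theta> - 0) / 2)\<bar> * \<bar>sin ((\<theta> - 2 * pi / 3) / 2)\<bar>)"
    unfolding m by (simp only: abs_mult, (simp add: S_def)?)
qed

lemma inverse_sqrt_shift_integral:
  assumes \<phi>: "\<bar>\<phi>\<bar> \<le> 2 * pi / 3"
  shows "(\<integral>\<^sup>+\<theta>. ennreal (window \<theta> * (1 / sqrt \<bar>\<theta> - \<phi>\<bar>)) \<partial>lborel) < \<infinity>"
proof -
  let ?t = "\<lambda>x::real. if x \<in> {0..2 * pi} then x powr (- 1 / 2) else 0"
  have ht: "(?t has_integral ((2 * pi) powr (- 1 / 2 + 1) / (- 1 / 2 + 1))) UNIV"
    using has_integral_powr_from_0[of "- 1 / 2" "2 * pi"] by (subst has_integral_restrict_UNIV) simp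
  have tfin: "(\<integral>\<^sup>+x. ennreal (?t x) \<partial>lborel) < \<infinity>"
    by (subst nn_integral_has_integral_lborel[OF _ _ ht]) auto
  have le: "ennreal (window \<theta> * (1 / sqrt \<bar>\<theta> - \<phi>\<bar>)) \<le> ennreal (?t (- \<phi> + 1 * \<theta>)) + ennreal (?t (\<phi> + (-1) * \<theta>))" for \<theta>
  proof (cases "\<theta> \<in> {-pi..pi}")
    case True
    have pw: "1 / sqrt y = y powr (- 1 / 2)" if "0 \<le> y" for y :: real
      using that by (cases "y = 0") (simp_all add: powr_minus_divide powr_half_sqrt)
    have "window \<theta> * (1 / sqrt \<bar>\<theta> - \<phi>\<bar>) = \<bar>\<theta> - \<phi>\<bar> powr (- 1 / 2)"
      using True by (simp add: window_def pw)
    also have "\<dots> \<le> ?t (- \<phi> + 1 * \<theta>) + ?t (\<phi> + (-1) * \<theta>)"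
    proof -
      have "\<bar>\<theta>\<bar> \<le> pi" using True by (auto simp: abs_le_iff)
      then have "\<bar>\<theta> - \<phi>\<bar> \<le> 2 * pi"
        using abs_triangle_ineq4[of \<theta> \<phi>] \<phi> pi_gt_zero by linarith
      then show ?thesis by (auto simp: abs_if split: if_splits)
    qed
    finally have "ennreal (window \<theta> * (1 / sqrt \<bar>\<theta> - \<phi>\<bar>)) \<le> ennreal (?t (- \<phi> + 1 * \<theta>) + ?t (\<phi> + (-1) * \<theta>))"
      by (rule ennreal_leI)
    also have "\<dots> = ennreal (?t (- \<phi> + 1 * \<theta>)) + ennreal (?t (\<phi> + (-1) * \<theta>))"
      by (rule ennreal_plus) auto
    finally show ?thesis .
  qed (simp add: window_def)
  have "(\<integral>\<^sup>+\<theta>. ennreal (window \<theta> * (1 / sqrt \<bar>\<theta> - \<phi>\<bar>)) \<partial>lborel) \<le>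
      (\<integral>\<^sup>+\<theta>. ennreal (?t (- \<phi> + 1 * \<theta>)) + ennreal (?t (\<phi> + (-1) * \<theta>)) \<partial>lborel)"
    by (intro nn_integral_mono le)
  also have "\<dots> = (\<integral>\<^sup>+\<theta>. ennreal (?t (- \<phi> + 1 * \<theta>)) \<partial>lborel) + (\<integral>\<^sup>+\<theta>. ennreal (?t (\<phi> + (-1) * \<theta>)) \<partial>lborel)"
    by (rule nn_integral_add) measurable
  also have "(\<integral>\<^sup>+\<theta>. ennreal (?t (- \<phi> + 1 * \<theta>)) \<partial>lborel) = (\<integral>\<^sup>+x. ennreal (?t x) \<partial>lborel)"
    using nn_affine[of "\<lambda>x. ennreal (?t x)" 1 "- \<phi>"] by simp
  also have "(\<integral>\<^sup>+\<theta>. ennreal (?t (\<phi> + (-1) * \<theta>)) \<partial>lborel) = (\<integral>\<^sup>+x. ennreal (?t x) \<partial>lborel)"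
    using nn_affine[of "\<lambda>x. ennreal (?t x)" "-1" "\<phi>"] by simp
  finally show ?thesis using tfin by (auto simp: less_top[symmetric] top_unique)
qed

text \<open>The two zeros of \<open>D\<close> are simple and separated, so at every angle at most one of the factors is small.\<close>

lemma inverse_sqrt_det_integral:
  assumes D [measurable]: "D \<in> borel_measurable borel"
    and eq: "\<And>\<theta>. \<bar>D \<theta>\<bar> = 4 / 3 * (\<bar>sin ((\<theta> - \<phi>) / 2)\<bar> * \<bar>sin ((\<theta> - \<psi>) / 2)\<bar>)"
    and \<phi>: "\<bar>\<phi>\<bar> \<le> 2 * pi / 3" and \<psi>: "\<bar>\<psi>\<bar> \<le> 2 * pi / 3" and sep: "2 \<le> \<bar>\<phi> - \<psi>\<bar>"
  shows "(\<integral>\<^sup>+\<theta>. ennreal (window \<theta> * (1 / sqrt \<bar>D \<theta>\<bar>)) \<partial>lborel) < \<infinity>"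
    "AE \<theta> in lborel. \<theta> \<in> {-pi..pi} \<longrightarrow> D \<theta> \<noteq> 0"
proof -
  obtain c where c: "0 < c" "\<And>x. \<bar>x\<bar> \<le> 5 * pi / 6 \<Longrightarrow> c * \<bar>x\<bar> \<le> \<bar>sin x\<bar>" using sin_lower_bound by blast
  \<comment> \<open>The factor \<open>4 / 3\<close> times \<open>(c / 2)\<^sup>2\<close>, one half
    from each of the two half angles.\<close>
  define K where "K = c\<^sup>2 / 3"
  have K: "0 < K" using c by (simp add: K_def)
  have low: "K * (\<bar>\<theta> - \<phi>\<bar> * \<bar>\<theta> - \<psi>\<bar>) \<le> \<bar>D \<theta>\<bar>" if "\<theta> \<in> {-pi..pi}" for \<theta>
  proof -
    have "\<bar>\<theta>\<bar> \<le> pi" using that by (auto simp: abs_le_iff)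
    then have "\<bar>\<theta> - \<phi>\<bar> \<le> 5 * pi / 3" "\<bar>\<theta> - \<psi>\<bar> \<le> 5 * pi / 3"
      using abs_triangle_ineq4[of \<theta> \<phi>] abs_triangle_ineq4[of \<theta> \<psi>] \<phi> \<psi> by linarith+
    then have "\<bar>(\<theta> - \<phi>) / 2\<bar> \<le> 5 * pi / 6" "\<bar>(\<theta> - \<psi>) / 2\<bar> \<le> 5 * pi / 6" by simp_all
    then have "(c * \<bar>(\<theta> - \<phi>) / 2\<bar>) * (c * \<bar>(\<theta> - \<psi>) / 2\<bar>) \<le> \<bar>sin ((\<theta> - \<phi>) / 2)\<bar> * \<bar>sin ((\<theta> - \<psi>) / 2)\<bar>"
      using c(1) by (intro mult_mono c(2)) auto
    then show ?thesis unfolding eq K_def by (simp add: power2_eq_square abs_mult mult_ac)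
  qed
  show "AE \<theta> in lborel. \<theta> \<in> {-pi..pi} \<longrightarrow> D \<theta> \<noteq> 0"
  proof -
    have "AE \<theta> in lborel. \<theta> \<notin> {\<phi>, \<psi>}" by (intro AE_not_in finite_imp_null_set_lborel) simp
    then show ?thesis
    proof eventually_elim
      case (elim \<theta>)
      show ?case
      proof
        assume "\<theta> \<in> {-pi..pi}"
        moreover have "0 < K * (\<bar>\<theta> - \<phi>\<bar> * \<bar>\<theta> - \<psi>\<bar>)" using elim K by simp
        ultimately show "D \<theta> \<noteq> 0" using low[of \<theta>] by auto
      qed
    qed
  qed
  have le: "window \<theta> * (1 / sqrt \<bar>D \<theta>\<bar>) \<le> (1 / sqrt K) * (window \<theta> * (1 / sqrt \<bar>\<theta> - \<phi>\<bar>) + window \<theta> * (1 / sqrt \<bar>\<theta> - \<psi>\<bar>))" for \<theta>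
  proof (cases "\<theta> \<in> {-pi..pi} \<and> \<theta> \<noteq> \<phi> \<and> \<theta> \<noteq> \<psi>")
    case True
    define u v where "u = \<bar>\<theta> - \<phi>\<bar>" and "v = \<bar>\<theta> - \<psi>\<bar>"
    have uv: "u > 0" "v > 0" using True by (auto simp: u_def v_def)
    have "1 \<le> u \<or> 1 \<le> v" using sep by (auto simp: u_def v_def)
    then have "(1 / sqrt u) * (1 / sqrt v) \<le> 1 / sqrt u + 1 / sqrt v"
    proof
      assume "1 \<le> u"
      then have "1 / sqrt u \<le> 1" by simp
      then have "(1 / sqrt u) * (1 / sqrt v) \<le> 1 * (1 / sqrt v)" using uv by (intro mult_right_mono) auto
      moreover have "0 \<le> 1 / sqrt u" using uv by simp
      ultimately show ?thesis by linarith
    next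
      assume "1 \<le> v"
      then have "1 / sqrt v \<le> 1" by simp
      then have "(1 / sqrt u) * (1 / sqrt v) \<le> (1 / sqrt u) * 1" using uv by (intro mult_left_mono) auto
      moreover have "0 \<le> 1 / sqrt v" using uv by simp
      ultimately show ?thesis by linarith
    qed
    then have 1: "(1 / sqrt K) * ((1 / sqrt u) * (1 / sqrt v)) \<le> (1 / sqrt K) * (1 / sqrt u + 1 / sqrt v)"
      using K by (intro mult_left_mono) auto
    have "sqrt (K * (u * v)) \<le> sqrt \<bar>D \<theta>\<bar>" using low[of \<theta>] True by (simp add: u_def v_def)
    then have "1 / sqrt \<bar>D \<theta>\<bar> \<le> 1 / sqrt (K * (u * v))" using K uv by (intro frac_le) auto
    also have "\<dots> = (1 / sqrt K) * ((1 / sqrt u) * (1 / sqrt v))" by (simp add: real_sqrt_mult)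
    finally have "1 / sqrt \<bar>D \<theta>\<bar> \<le> (1 / sqrt K) * (1 / sqrt u + 1 / sqrt v)" using 1 by linarith
    then show ?thesis using True by (simp add: window_def u_def v_def)
  next
    \<comment> \<open>At a zero of \<open>D\<close> the convention \<open>1 / 0 = 0\<close> makes
      the left side vanish, as it does outside the window.\<close>
    case False
    then have "window \<theta> * (1 / sqrt \<bar>D \<theta>\<bar>) = 0" using eq[of \<theta>] by (auto simp: window_def)
    also have "0 \<le> (1 / sqrt K) * (window \<theta> * (1 / sqrt \<bar>\<theta> - \<phi>\<bar>) + window \<theta> * (1 / sqrt \<bar>\<theta> - \<psi>\<bar>))"
      using K by (intro mult_nonneg_nonneg add_nonneg_nonneg) auto
    finally show ?thesis .
  qed
  have "(\<integral>\<^sup>+\<theta>. ennreal (window \<theta> * (1 / sqrt \<bar>D \<theta>\<bar>)) \<partial>lborel) \<le>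
      (\<integral>\<^sup>+\<theta>. ennreal (1 / sqrt K) * (ennreal (window \<theta> * (1 / sqrt \<bar>\<theta> - \<phi>\<bar>)) + ennreal (window \<theta> * (1 / sqrt \<bar>\<theta> - \<psi>\<bar>))) \<partial>lborel)"
  proof (rule nn_integral_mono)
    fix \<theta>
    have "ennreal (window \<theta> * (1 / sqrt \<bar>D \<theta>\<bar>)) \<le> ennreal ((1 / sqrt K) * (window \<theta> * (1 / sqrt \<bar>\<theta> - \<phi>\<bar>) + window \<theta> * (1 / sqrt \<bar>\<theta> - \<psi>\<bar>)))"
      by (rule ennreal_leI[OF le])
    also have "\<dots> = ennreal (1 / sqrt K) * ennreal (window \<theta> * (1 / sqrt \<bar>\<theta> - \<phi>\<bar>) + window \<theta> * (1 / sqrt \<bar>\<theta> - \<psi>\<bar>))"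
      using K by (intro ennreal_mult) auto
    also have "ennreal (window \<theta> * (1 / sqrt \<bar>\<theta> - \<phi>\<bar>) + window \<theta> * (1 / sqrt \<bar>\<theta> - \<psi>\<bar>)) =
        ennreal (window \<theta> * (1 / sqrt \<bar>\<theta> - \<phi>\<bar>)) + ennreal (window \<theta> * (1 / sqrt \<bar>\<theta> - \<psi>\<bar>))"
      by (rule ennreal_plus) auto
    finally show "ennreal (window \<theta> * (1 / sqrt \<bar>D \<theta>\<bar>)) \<le> ennreal (1 / sqrt K) * (ennreal (window \<theta> * (1 / sqrt \<bar>\<theta> - \<phi>\<bar>)) + ennreal (window \<theta> * (1 / sqrt \<bar>\<theta> - \<psi>\<bar>)))" .
  qed
  also have "\<dots> = ennreal (1 / sqrt K) * ((\<integral>\<^sup>+\<theta>. ennreal (window \<theta> * (1 / sqrt \<bar>\<theta> - \<phi>\<bar>)) \<partial>lborel) + (\<integral>\<^sup>+\<theta>. ennreal (window \<theta> * (1 / sqrt \<bar>\<theta> - \<psi>\<bar>)) \<partial>lborel))"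
  proof -
    have 1: "(\<lambda>\<theta>. ennreal (window \<theta> * (1 / sqrt \<bar>\<theta> - \<phi>\<bar>))) \<in> borel_measurable lborel"
      and 2: "(\<lambda>\<theta>. ennreal (window \<theta> * (1 / sqrt \<bar>\<theta> - \<psi>\<bar>))) \<in> borel_measurable lborel" by measurable
    show ?thesis unfolding nn_integral_cmult[OF borel_measurable_add[OF 1 2]] nn_integral_add[OF 1 2] ..
  qed
  also have "\<dots> < \<infinity>"
    using inverse_sqrt_shift_integral[OF \<phi>] inverse_sqrt_shift_integral[OF \<psi>] by (simp add: ennreal_mult_eq_top_iff less_top[symmetric])
  finally show "(\<integral>\<^sup>+\<theta>. ennreal (window \<theta> * (1 / sqrt \<bar>D \<theta>\<bar>)) \<partial>lborel) < \<infinity>" .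
qed

text \<open>Two elimination steps: the first replaces \<open>x1\<close> by the first linear form,
  with Jacobian \<open>p\<close>, and the second rescales \<open>x2\<close> by
  \<open>(p * q' - q * p') / p\<close>. Translations by \<open>r\<close> and \<open>r'\<close> have
  no effect on the integral.\<close>

lemma pair_affine:
  fixes W :: "real \<Rightarrow> ennreal"
  assumes W [measurable]: "W \<in> borel_measurable borel" and p: "p \<noteq> 0" and D: "p * q' - q * p' \<noteq> 0"
  shows "ennreal \<bar>p * q' - q * p'\<bar> * (\<integral>\<^sup>+x1. \<integral>\<^sup>+x2. W (p * x1 + q * x2 + r) * W (p' * x1 + q' * x2 + r') \<partial>lborel \<partial>lborel) =
     (\<integral>\<^sup>+x. W x \<partial>lborel)\<^sup>2"
proof -
  let ?D = "p * q' - q * p'"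
  let ?e = "\<lambda>u. p' / p * u + (r' - p' / p * r)"
  have 1: "ennreal \<bar>p\<bar> * (\<integral>\<^sup>+x1. W (p * x1 + q * x2 + r) * W (p' * x1 + q' * x2 + r') \<partial>lborel) =
      (\<integral>\<^sup>+u. W u * W (?e u + ?D / p * x2) \<partial>lborel)" for x2
  proof -
    have e1: "?e (q * x2 + r + p * x1) + ?D / p * x2 = p' * x1 + q' * x2 + r'" for x1
      using p by (simp add: field_simps)
    have e2: "q * x2 + r + p * x1 = p * x1 + q * x2 + r" for x1 by simp
    have m: "(\<lambda>u. W u * W (?e u + ?D / p * x2)) \<in> borel_measurable borel" by measurable
    show ?thesis using nn_affine[OF m p, of "q * x2 + r"] by (simp only: e1) (simp only: e2)
  qed
  have Dp: "?D / p \<noteq> 0" using D p by simp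
  have 2: "ennreal \<bar>?D / p\<bar> * (\<integral>\<^sup>+x2. W (k + ?D / p * x2) \<partial>lborel) = (\<integral>\<^sup>+x. W x \<partial>lborel)" for k
    by (rule nn_affine[OF W Dp])
  have "ennreal \<bar>?D\<bar> = ennreal \<bar>?D / p\<bar> * ennreal \<bar>p\<bar>"
    using p by (subst ennreal_mult[symmetric]) (auto simp: abs_divide)
  then have "ennreal \<bar>?D\<bar> * (\<integral>\<^sup>+x1. \<integral>\<^sup>+x2. W (p * x1 + q * x2 + r) * W (p' * x1 + q' * x2 + r') \<partial>lborel \<partial>lborel) =
      ennreal \<bar>?D / p\<bar> * (ennreal \<bar>p\<bar> * (\<integral>\<^sup>+x2. \<integral>\<^sup>+x1. W (p * x1 + q * x2 + r) * W (p' * x1 + q' * x2 + r') \<partial>lborel \<partial>lborel))"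
    by (subst lborel_pair.Fubini') (measurable, simp only: mult.assoc)
  also have "ennreal \<bar>p\<bar> * (\<integral>\<^sup>+x2. \<integral>\<^sup>+x1. W (p * x1 + q * x2 + r) * W (p' * x1 + q' * x2 + r') \<partial>lborel \<partial>lborel) =
      (\<integral>\<^sup>+x2. \<integral>\<^sup>+u. W u * W (?e u + ?D / p * x2) \<partial>lborel \<partial>lborel)"
    unfolding 1[symmetric] by (intro nn_integral_cmult[symmetric]) measurable
  also have "\<dots> = (\<integral>\<^sup>+u. \<integral>\<^sup>+x2. W u * W (?e u + ?D / p * x2) \<partial>lborel \<partial>lborel)"
    by (intro lborel_pair.Fubini') measurable
  also have "ennreal \<bar>?D / p\<bar> * \<dots> = (\<integral>\<^sup>+u. ennreal \<bar>?D / p\<bar> * (\<integral>\<^sup>+x2. W u * W (?e u + ?D / p * x2) \<partial>lborel) \<partial>lborel)"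
    by (intro nn_integral_cmult[symmetric]) measurable
  also have "\<dots> = (\<integral>\<^sup>+u. W u * (\<integral>\<^sup>+x. W x \<partial>lborel) \<partial>lborel)"
  proof (rule nn_integral_cong)
    fix u
    have "(\<integral>\<^sup>+x2. W u * W (?e u + ?D / p * x2) \<partial>lborel) = W u * (\<integral>\<^sup>+x2. W (?e u + ?D / p * x2) \<partial>lborel)"
      by (intro nn_integral_cmult) measurable
    then show "ennreal \<bar>?D / p\<bar> * (\<integral>\<^sup>+x2. W u * W (?e u + ?D / p * x2) \<partial>lborel) = W u * (\<integral>\<^sup>+x. W x \<partial>lborel)"
      by (simp only: mult.left_commute[of _ "W u"] 2)
  qed
  also have "\<dots> = (\<integral>\<^sup>+x. W x \<partial>lborel)\<^sup>2" by (simp add: nn_integral_multc power2_eq_square)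
  finally show ?thesis .
qed

text \<open>Cauchy--Schwarz pairs the two rotated variables against the two original ones; only the square
  root of the Jacobian is lost, which keeps its zeros integrable in the angle.\<close>

lemma pair_bound:
  fixes w :: "real \<Rightarrow> real"
  assumes w [measurable]: "w \<in> borel_measurable borel" and w0: "\<And>x. 0 \<le> w x"
    and I: "(\<integral>\<^sup>+x. (ennreal (w x))\<^sup>2 \<partial>lborel) \<le> ennreal (I\<^sup>2)" "0 \<le> I"
    and p: "p \<noteq> 0" and D: "p * q' - q * p' = D" "D \<noteq> 0"
  shows "(\<integral>\<^sup>+x1. \<integral>\<^sup>+x2. ennreal (w (p * x1 + q * x2 + r) * w (p' * x1 + q' * x2 + r') * (w x1 * w x2)) \<partial>lborel \<partial>lborel)
     \<le> ennreal (I ^ 4 * (1 / sqrt \<bar>D\<bar>))"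
proof -
  let ?u = "\<lambda>x1 x2. ennreal (w (p * x1 + q * x2 + r) * w (p' * x1 + q' * x2 + r'))"
  let ?v = "\<lambda>x1 x2. ennreal (w x1 * w x2)"
  let ?W = "\<lambda>x. (ennreal (w x))\<^sup>2"
  have um: "(\<lambda>z. ?u (fst z) (snd z)) \<in> borel_measurable (lborel \<Otimes>\<^sub>M lborel)"
    and vm: "(\<lambda>z. ?v (fst z) (snd z)) \<in> borel_measurable (lborel \<Otimes>\<^sub>M lborel)" by measurable
  have "(\<integral>\<^sup>+x1. \<integral>\<^sup>+x2. ennreal (w (p * x1 + q * x2 + r) * w (p' * x1 + q' * x2 + r') * (w x1 * w x2)) \<partial>lborel \<partial>lborel) =
      (\<integral>\<^sup>+z. ?u (fst z) (snd z) * ?v (fst z) (snd z) \<partial>(lborel \<Otimes>\<^sub>M lborel))"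
  proof (subst lborel.nn_integral_fst[symmetric])
    show "(\<lambda>z. ?u (fst z) (snd z) * ?v (fst z) (snd z)) \<in> borel_measurable (lborel \<Otimes>\<^sub>M lborel)" by measurable
  qed (simp add: ennreal_mult w0 mult.assoc)
  also have "\<dots> \<le> ennreal ((I\<^sup>2 * (1 / sqrt \<bar>D\<bar>)) * I\<^sup>2)"
  proof (rule cauchy_schwarz_nn_real[OF um vm])
    have "(\<integral>\<^sup>+z. (?u (fst z) (snd z))\<^sup>2 \<partial>(lborel \<Otimes>\<^sub>M lborel)) =
        (\<integral>\<^sup>+x1. \<integral>\<^sup>+x2. ?W (p * x1 + q * x2 + r) * ?W (p' * x1 + q' * x2 + r') \<partial>lborel \<partial>lborel)"
      using um by (subst lborel.nn_integral_fst[symmetric]) (auto simp: ennreal_mult w0 power_mult_distrib intro!: borel_measurable_power_ennreal)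
    also have "\<dots> \<le> ennreal ((I\<^sup>2 * (1 / sqrt \<bar>D\<bar>))\<^sup>2)" (is "?L \<le> _")
    proof -
      have "ennreal \<bar>D\<bar> * ?L = (\<integral>\<^sup>+x. ?W x \<partial>lborel)\<^sup>2"
        unfolding D(1)[symmetric] using p D by (intro pair_affine) auto
      also have "\<dots> \<le> (ennreal (I\<^sup>2))\<^sup>2" by (intro power_mono I) simp
      finally have le: "ennreal \<bar>D\<bar> * ?L \<le> (ennreal (I\<^sup>2))\<^sup>2" .
      have "?L = ennreal (1 / \<bar>D\<bar>) * (ennreal \<bar>D\<bar> * ?L)"
      proof -
        have "ennreal (1 / \<bar>D\<bar>) * ennreal \<bar>D\<bar> = 1"
          using D(2) by (subst ennreal_mult[symmetric]) auto
        then show ?thesis by (simp only: mult.assoc[symmetric] mult_1)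
      qed
      also have "\<dots> \<le> ennreal (1 / \<bar>D\<bar>) * (ennreal (I\<^sup>2))\<^sup>2" by (intro mult_left_mono le) simp
      also have "\<dots> = ennreal (1 / \<bar>D\<bar> * (I\<^sup>2)\<^sup>2)"
        by (subst ennreal_mult) (auto simp: ennreal_power)
      also have "1 / \<bar>D\<bar> * (I\<^sup>2)\<^sup>2 = (I\<^sup>2 * (1 / sqrt \<bar>D\<bar>))\<^sup>2" by (simp add: power_mult_distrib power_divide)
      finally show ?thesis .
    qed
    finally show "(\<integral>\<^sup>+z. (?u (fst z) (snd z))\<^sup>2 \<partial>(lborel \<Otimes>\<^sub>M lborel)) \<le> ennreal ((I\<^sup>2 * (1 / sqrt \<bar>D\<bar>))\<^sup>2)" .
    have "(\<integral>\<^sup>+z. (?v (fst z) (snd z))\<^sup>2 \<partial>(lborel \<Otimes>\<^sub>M lborel)) = (\<integral>\<^sup>+x1. \<integral>\<^sup>+x2. ?W x1 * ?W x2 \<partial>lborel \<partial>lborel)"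
      using vm by (subst lborel.nn_integral_fst[symmetric]) (auto simp: ennreal_mult w0 power_mult_distrib intro!: borel_measurable_power_ennreal)
    also have "\<dots> = (\<integral>\<^sup>+x. ?W x \<partial>lborel) * (\<integral>\<^sup>+x. ?W x \<partial>lborel)"
      by (simp add: nn_integral_cmult nn_integral_multc)
    also have "\<dots> \<le> ennreal (I\<^sup>2) * ennreal (I\<^sup>2)" by (intro mult_mono I) auto
    also have "\<dots> = ennreal ((I\<^sup>2)\<^sup>2)" by (subst ennreal_mult[symmetric]) (auto simp: power2_eq_square)
    finally show "(\<integral>\<^sup>+z. (?v (fst z) (snd z))\<^sup>2 \<partial>(lborel \<Otimes>\<^sub>M lborel)) \<le> ennreal ((I\<^sup>2)\<^sup>2)" .
  qed auto
  also have "(I\<^sup>2 * (1 / sqrt \<bar>D\<bar>)) * I\<^sup>2 = I ^ 4 * (1 / sqrt \<bar>D\<bar>)" by (simp add: power2_eq_square power4_eq_xxxx)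
  finally show ?thesis .
qed


text \<open>\<open>pair_bound\<close> at almost every angle, then integrated. \<open>D\<close>
  enters through its absolute value, so a minor of the rotation can be replaced by the matrix entry
  that equals it up to sign.\<close>

lemma evp_pair_bound:
  fixes w D p q p' q' :: "real \<Rightarrow> real"
  assumes w: "w \<in> borel_measurable borel" and w0: "\<And>x. 0 \<le> w x"
    and I: "(\<integral>\<^sup>+x. (ennreal (w x))\<^sup>2 \<partial>lborel) \<le> ennreal (I\<^sup>2)" "0 \<le> I"
    and ij: "i < 5" "j < 5"
      "\<And>\<theta> x1 x2. evp i (x, \<theta>, x1, x2) = p \<theta> * x1 + q \<theta> * x2 + r \<theta>"
      "\<And>\<theta> x1 x2. evp j (x, \<theta>, x1, x2) = p' \<theta> * x1 + q' \<theta> * x2 + r' \<theta>"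
    and D: "D \<in> borel_measurable borel" "\<And>\<theta>. \<bar>p \<theta> * q' \<theta> - q \<theta> * p' \<theta>\<bar> = \<bar>D \<theta>\<bar>"
    and ne: "AE \<theta> in lborel. \<theta> \<in> {-pi..pi} \<longrightarrow> p \<theta> \<noteq> 0" "AE \<theta> in lborel. \<theta> \<in> {-pi..pi} \<longrightarrow> D \<theta> \<noteq> 0"
  shows "(\<integral>\<^sup>+z. ennreal (window (fst z) * (w (evp i (x, z)) * w (evp j (x, z)) * (w (evp 3 (x, z)) * w (evp 4 (x, z))))) \<partial>lborel)
     \<le> ennreal (I ^ 4) * (\<integral>\<^sup>+\<theta>. ennreal (window \<theta> * (1 / sqrt \<bar>D \<theta>\<bar>)) \<partial>lborel)"
proof -
  note [measurable] = w D(1)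
  have em: "(\<lambda>z. w (evp k (x, z))) \<in> borel_measurable borel" if "k < 5" for k
    using that by (intro measurable_compose[OF evp_pair_measurable w]) auto
  have "(\<integral>\<^sup>+z. ennreal (window (fst z) * (w (evp i (x, z)) * w (evp j (x, z)) * (w (evp 3 (x, z)) * w (evp 4 (x, z))))) \<partial>lborel) =
     (\<integral>\<^sup>+\<theta>. \<integral>\<^sup>+x1. \<integral>\<^sup>+x2. ennreal (window (fst (\<theta>, x1, x2)) * (w (evp i (x, \<theta>, x1, x2)) * w (evp j (x, \<theta>, x1, x2)) *
       (w (evp 3 (x, \<theta>, x1, x2)) * w (evp 4 (x, \<theta>, x1, x2))))) \<partial>lborel \<partial>lborel \<partial>lborel)"
    by (intro nn_lborel3 measurable_compose[OF _ measurable_ennreal] borel_measurable_times em window_fst_measurable ij) auto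
  also have "\<dots> \<le> (\<integral>\<^sup>+\<theta>. ennreal (I ^ 4) * ennreal (window \<theta> * (1 / sqrt \<bar>D \<theta>\<bar>)) \<partial>lborel)"
  proof (rule nn_integral_mono_AE)
    show "AE \<theta> in lborel. (\<integral>\<^sup>+x1. \<integral>\<^sup>+x2. ennreal (window (fst (\<theta>, x1, x2)) * (w (evp i (x, \<theta>, x1, x2)) * w (evp j (x, \<theta>, x1, x2)) *
       (w (evp 3 (x, \<theta>, x1, x2)) * w (evp 4 (x, \<theta>, x1, x2))))) \<partial>lborel \<partial>lborel) \<le> ennreal (I ^ 4) * ennreal (window \<theta> * (1 / sqrt \<bar>D \<theta>\<bar>))"
      using ne
    proof eventually_elim
      case (elim \<theta>)
      show ?case
      proof (cases "\<theta> \<in> {-pi..pi}")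
        case True
        then have wi: "window \<theta> = 1" by (simp add: window_def)
        have ne': "p \<theta> \<noteq> 0" "p \<theta> * q' \<theta> - q \<theta> * p' \<theta> \<noteq> 0" using elim True D(2)[of \<theta>] by auto
        have e34: "evp 3 (x, \<theta>, x1, x2) = x1" "evp 4 (x, \<theta>, x1, x2) = x2" for x1 x2 by simp_all
        show ?thesis unfolding ij e34 fst_conv wi mult_1
          using pair_bound[OF w w0 I ne'(1) refl ne'(2), of "r \<theta>" "r' \<theta>"] I(2)
          by (simp add: D(2) ennreal_mult[symmetric])
      qed (simp add: window_def)
    qed
  qed
  also have "\<dots> = ennreal (I ^ 4) * (\<integral>\<^sup>+\<theta>. ennreal (window \<theta> * (1 / sqrt \<bar>D \<theta>\<bar>)) \<partial>lborel)"
    by (rule nn_integral_cmult) measurable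
  finally show ?thesis .
qed

lemma rot_inverse_sqrt_integral:
  "(\<integral>\<^sup>+\<theta>. ennreal (window \<theta> * (1 / sqrt \<bar>ra \<theta>\<bar>)) \<partial>lborel) < \<infinity>" (is ?A)
  "(\<integral>\<^sup>+\<theta>. ennreal (window \<theta> * (1 / sqrt \<bar>rb \<theta>\<bar>)) \<partial>lborel) < \<infinity>" (is ?B)
  "(\<integral>\<^sup>+\<theta>. ennreal (window \<theta> * (1 / sqrt \<bar>rc \<theta>\<bar>)) \<partial>lborel) < \<infinity>" (is ?C)
  "AE \<theta> in lborel. \<theta> \<in> {-pi..pi} \<longrightarrow> ra \<theta> \<noteq> 0" (is ?A')
  "AE \<theta> in lborel. \<theta> \<in> {-pi..pi} \<longrightarrow> rb \<theta> \<noteq> 0" (is ?B')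
  "AE \<theta> in lborel. \<theta> \<in> {-pi..pi} \<longrightarrow> rc \<theta> \<noteq> 0" (is ?C')
proof -
  have m: "\<theta> + 2 * pi / 3 = \<theta> - (- (2 * pi / 3))" for \<theta> by simp
  have pi: "3 < pi" by (rule pi_gt3)
  note e = rot_sin[unfolded m]
  have a: "?A \<and> ?A'"
    using pi by (intro conjI inverse_sqrt_det_integral[OF rot_measurable(1) e(1)]) auto
  have b: "?B \<and> ?B'"
    using pi by (intro conjI inverse_sqrt_det_integral[OF rot_measurable(2) e(2)]) auto
  have c: "?C \<and> ?C'"
    using pi by (intro conjI inverse_sqrt_det_integral[OF rot_measurable(3) e(3)]) auto
  show ?A ?B ?C ?A' ?B' ?C' using a b c by blast+
qed

text \<open>On the sphere one of the three rotated variables carries the weight of \<open>x\<close>, so the weight can be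
  traded for one of the five factors.\<close>

lemma jb_weight_trade:
  fixes s :: real
  assumes s: "0 \<le> s"
  shows "jb x powr s * (\<Prod>i<5. jb (evp i (x, z)) powr (- s)) \<le> 3 powr s *
    ((jb (evp 0 (x, z)) powr (- s) * jb (evp (Suc 0) (x, z)) powr (- s) +
      jb (evp 0 (x, z)) powr (- s) * jb (evp 2 (x, z)) powr (- s) +
      jb (evp (Suc 0) (x, z)) powr (- s) * jb (evp 2 (x, z)) powr (- s)) *
     (jb (evp 3 (x, z)) powr (- s) * jb (evp 4 (x, z)) powr (- s)))"
proof -
  define y0 y1 y2 where y: "y0 = evp 0 (x, z)" "y1 = evp (Suc 0) (x, z)" "y2 = evp 2 (x, z)"
  have sq: "(jb x)\<^sup>2 \<le> (jb y0 + jb y1 + jb y2)\<^sup>2"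
  proof -
    have "(jb x)\<^sup>2 \<le> (jb y0)\<^sup>2 + (jb y1)\<^sup>2 + (jb y2)\<^sup>2"
      unfolding jb_sq y using evp_sq_le[of x z] by linarith
    also have "\<dots> \<le> (jb y0 + jb y1 + jb y2)\<^sup>2"
    proof -
      have "0 \<le> jb y0 * jb y1 + jb y1 * jb y2 + jb y0 * jb y2"
        by (intro add_nonneg_nonneg mult_nonneg_nonneg less_imp_le[OF jb_pos])
      then show ?thesis by (simp add: power2_eq_square algebra_simps)
    qed
    finally show ?thesis .
  qed
  have "jb x \<le> jb y0 + jb y1 + jb y2"
    using jb_pos[of y0] jb_pos[of y1] jb_pos[of y2] by (intro power2_le_imp_le[OF sq]) linarith
  \<comment> \<open>Among three summands one reaches a third of the total; this is where
    \<open>3 powr s\<close> comes from.\<close>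
  then have "jb x \<le> 3 * jb y0 \<or> jb x \<le> 3 * jb y1 \<or> jb x \<le> 3 * jb y2" by linarith
  have one: "jb x powr s * jb y powr (- s) \<le> 3 powr s" if "jb x \<le> 3 * jb y" for y
  proof -
    have "jb x powr s \<le> (3 * jb y) powr s" using that s jb_pos[of x] by (intro powr_mono2) auto
    also have "\<dots> = 3 powr s * jb y powr s" by (rule powr_mult)
    finally have "jb x powr s * jb y powr (- s) \<le> 3 powr s * jb y powr s * jb y powr (- s)"
      by (rule mult_right_mono) simp
    also have "\<dots> = 3 powr s" using jb_pos[of y] by (simp add: mult.assoc powr_add[symmetric])
    finally show ?thesis .
  qed
  define u0 u1 u2 X where u: "u0 = jb y0 powr (- s)" "u1 = jb y1 powr (- s)" "u2 = jb y2 powr (- s)" "X = jb x powr s"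
  have u0: "0 \<le> u0" "0 \<le> u1" "0 \<le> u2" "0 \<le> X" by (simp_all add: u)
  have "X * u0 \<le> 3 powr s \<or> X * u1 \<le> 3 powr s \<or> X * u2 \<le> 3 powr s"
    using \<open>jb x \<le> 3 * jb y0 \<or> _\<close> one unfolding u by blast
  then have main: "X * (u0 * u1 * u2) \<le> 3 powr s * (u0 * u1 + u0 * u2 + u1 * u2)"
  proof (elim disjE)
    assume "X * u0 \<le> 3 powr s"
    then have "X * u0 * (u1 * u2) \<le> 3 powr s * (u1 * u2)" using u0 by (intro mult_right_mono) auto
    also have "\<dots> \<le> 3 powr s * (u0 * u1 + u0 * u2 + u1 * u2)" using u0 by (intro mult_left_mono) auto
    finally show ?thesis by (simp add: mult_ac)
  next
    assume "X * u1 \<le> 3 powr s"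
    then have "X * u1 * (u0 * u2) \<le> 3 powr s * (u0 * u2)" using u0 by (intro mult_right_mono) auto
    also have "\<dots> \<le> 3 powr s * (u0 * u1 + u0 * u2 + u1 * u2)" using u0 by (intro mult_left_mono) auto
    finally show ?thesis by (simp add: mult_ac)
  next
    assume "X * u2 \<le> 3 powr s"
    then have "X * u2 * (u0 * u1) \<le> 3 powr s * (u0 * u1)" using u0 by (intro mult_right_mono) auto
    also have "\<dots> \<le> 3 powr s * (u0 * u1 + u0 * u2 + u1 * u2)" using u0 by (intro mult_left_mono) auto
    finally show ?thesis by (simp add: mult_ac)
  qed
  have v: "0 \<le> jb (evp 3 (x, z)) powr (- s) * jb (evp 4 (x, z)) powr (- s)" by simp
  show ?thesis
    using mult_right_mono[OF main v] unfolding u y prod_lessThan_5 by (simp only: mult.assoc)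
qed

lemma jb_powr_sq_integral:
  assumes s: "1 / 2 < s" shows "(\<integral>\<^sup>+x. (ennreal (jb x powr (- s)))\<^sup>2 \<partial>lborel) < \<infinity>"
proof -
  have "(ennreal (jb x powr (- s)))\<^sup>2 = ennreal (jb x powr (- (2 * s)))" for x
    unfolding power2_eq_square by (subst ennreal_mult[symmetric]) (auto simp: powr_add[symmetric])
  then show ?thesis using jb_powr_integral[of "2 * s"] s by simp
qed

text \<open>The powers \<open>jb y powr (- s)\<close> are the largest functions of weighted supremum
  norm 1, so this case decides the whole estimate. Trading the weight leaves one integral for each
  pair of rotated variables, whose minors in \<open>(x1, x2)\<close> are \<open>ra\<close>,
  \<open>- rb\<close> and \<open>rc\<close> by the cofactor identities.\<close>

lemma avg_jb_bound:
  assumes s: "1 / 2 < s"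
  shows "\<exists>C\<ge>0. \<forall>x. ennreal (jb x powr s) * avg (\<lambda>_ y. jb y powr (- s)) x \<le> ennreal C"
proof -
  define w where "w = (\<lambda>y. jb y powr (- s))"
  have wm: "w \<in> borel_measurable borel" unfolding w_def by measurable
  have w0: "0 \<le> w x" for x by (simp add: w_def)
  have fin: "(\<integral>\<^sup>+x. (ennreal (w x))\<^sup>2 \<partial>lborel) < \<infinity>"
    unfolding w_def by (rule jb_powr_sq_integral[OF s])
  define I where "I = sqrt (enn2real (\<integral>\<^sup>+x. (ennreal (w x))\<^sup>2 \<partial>lborel))"
  have I: "(\<integral>\<^sup>+x. (ennreal (w x))\<^sup>2 \<partial>lborel) \<le> ennreal (I\<^sup>2)" "0 \<le> I"
    using fin by (simp_all add: I_def less_top)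
  let ?J = "\<lambda>D. \<integral>\<^sup>+\<theta>. ennreal (window \<theta> * (1 / sqrt \<bar>D \<theta>\<bar>)) \<partial>lborel"
  let ?P = "\<lambda>i j x z. ennreal (window (fst z) * (w (evp i (x, z)) * w (evp j (x, z)) * (w (evp 3 (x, z)) * w (evp 4 (x, z)))))"
  define B where "B = ennreal (3 powr s) * (ennreal (I ^ 4) * ?J ra + ennreal (I ^ 4) * ?J rb + ennreal (I ^ 4) * ?J rc)"
  have B: "B < \<infinity>" unfolding B_def using rot_inverse_sqrt_integral(1-3) by (simp add: ennreal_mult_less_top)
  note cof = rot_cofactors
  have 1: "(\<integral>\<^sup>+z. ?P 0 (Suc 0) x z \<partial>lborel) \<le> ennreal (I ^ 4) * ?J ra" for x
    by (rule evp_pair_bound[OF wm w0 I, where p = ra and q = rb and p' = rc and q' = ra and r = "\<lambda>\<theta>. rc \<theta> * x" and r' = "\<lambda>\<theta>. rb \<theta> * x"])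
      (use cof(1) rot_inverse_sqrt_integral(4-6) in \<open>simp_all add: power2_eq_square\<close>)
  have 2: "(\<integral>\<^sup>+z. ?P 0 2 x z \<partial>lborel) \<le> ennreal (I ^ 4) * ?J rb" for x
  proof (rule evp_pair_bound[OF wm w0 I, where p = ra and q = rb and p' = rb and q' = rc and r = "\<lambda>\<theta>. rc \<theta> * x" and r' = "\<lambda>\<theta>. ra \<theta> * x"])
    show "\<bar>ra \<theta> * rc \<theta> - rb \<theta> * rb \<theta>\<bar> = \<bar>rb \<theta>\<bar>" for \<theta>
      using cof(2)[of \<theta>] by (simp add: power2_eq_square abs_minus_commute)
  qed (use rot_inverse_sqrt_integral(4-6) in simp_all)
  have 3: "(\<integral>\<^sup>+z. ?P (Suc 0) 2 x z \<partial>lborel) \<le> ennreal (I ^ 4) * ?J rc" for x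
  proof (rule evp_pair_bound[OF wm w0 I, where p = rc and q = ra and p' = rb and q' = rc and r = "\<lambda>\<theta>. rb \<theta> * x" and r' = "\<lambda>\<theta>. ra \<theta> * x"])
    show "\<bar>rc \<theta> * rc \<theta> - ra \<theta> * rb \<theta>\<bar> = \<bar>rc \<theta>\<bar>" for \<theta>
      using cof(3)[of \<theta>] by (simp add: power2_eq_square)
  qed (use rot_inverse_sqrt_integral(4-6) in simp_all)
  have em: "(\<lambda>z. w (evp k (x, z))) \<in> borel_measurable borel" if "k < 5" for k x
    using that by (intro measurable_compose[OF evp_pair_measurable wm]) auto
  have Pm: "(\<lambda>z. ?P i j x z) \<in> borel_measurable lborel" if "i < 5" "j < 5" for i j x
  proof -
    have "(\<lambda>z. ?P i j x z) \<in> borel_measurable borel"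
      by (intro measurable_compose[OF _ measurable_ennreal] borel_measurable_times em window_fst_measurable that) auto
    then show ?thesis by (simp del: evp.simps)
  qed
  have "ennreal (jb x powr s) * avg (\<lambda>_. w) x \<le> B" for x
  proof -
    have "ennreal (jb x powr s) * avg (\<lambda>_. w) x =
        (\<integral>\<^sup>+z. ennreal (jb x powr s) * ennreal (window (fst z) * (\<Prod>i<5. w (evp i (x, z)))) \<partial>lborel)"
      unfolding avg_def using avg_integrand_measurable[of "\<lambda>_. w" x] wm
      by (intro nn_integral_cmult[symmetric]) auto
    also have "\<dots> \<le> (\<integral>\<^sup>+z. ennreal (3 powr s) * (?P 0 (Suc 0) x z + ?P 0 2 x z + ?P (Suc 0) 2 x z) \<partial>lborel)"
    proof (rule nn_integral_mono)
      fix z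
      let ?w = "\<lambda>i. w (evp i (x, z))"
      have "window (fst z) * (jb x powr s * (\<Prod>i<5. ?w i)) \<le> window (fst z) * (3 powr s *
          ((?w 0 * ?w (Suc 0) + ?w 0 * ?w 2 + ?w (Suc 0) * ?w 2) * (?w 3 * ?w 4)))"
        using jb_weight_trade[of s x z] s unfolding w_def by (intro mult_left_mono) auto
      also have "\<dots> = 3 powr s * (window (fst z) * (?w 0 * ?w (Suc 0) * (?w 3 * ?w 4)) +
          window (fst z) * (?w 0 * ?w 2 * (?w 3 * ?w 4)) + window (fst z) * (?w (Suc 0) * ?w 2 * (?w 3 * ?w 4)))"
        by (simp only: ring_distribs mult_ac)
      finally have "ennreal (jb x powr s * (window (fst z) * (\<Prod>i<5. ?w i))) \<le> ennreal \<dots>"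
        by (intro ennreal_leI) (simp only: mult.left_commute)
      then show "ennreal (jb x powr s) * ennreal (window (fst z) * (\<Prod>i<5. ?w i)) \<le> ennreal (3 powr s) * (?P 0 (Suc 0) x z + ?P 0 2 x z + ?P (Suc 0) 2 x z)"
        by (simp add: ennreal_mult w0 prod_nonneg ennreal_plus del: evp.simps)
    qed
    also have "\<dots> = ennreal (3 powr s) * ((\<integral>\<^sup>+z. ?P 0 (Suc 0) x z \<partial>lborel) + (\<integral>\<^sup>+z. ?P 0 2 x z \<partial>lborel) + (\<integral>\<^sup>+z. ?P (Suc 0) 2 x z \<partial>lborel))"
      using Pm by (subst nn_integral_cmult, simp, subst nn_integral_add, simp, simp, subst nn_integral_add) auto
    also have "\<dots> \<le> B" unfolding B_def by (intro mult_left_mono add_mono 1 2 3) simp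
    finally show ?thesis .
  qed
  then have "\<And>x. ennreal (jb x powr s) * avg (\<lambda>_ y. jb y powr (- s)) x \<le> ennreal (enn2real B)"
    using B by (simp add: w_def less_top)
  then show ?thesis by (intro exI[of _ "enn2real B"]) simp
qed

lemma avg_mono_cmult:
  assumes H: "\<And>i. i < 5 \<Longrightarrow> H i \<in> borel_measurable borel"
    and le: "\<And>i y. i < 5 \<Longrightarrow> F i y \<le> N i * H i y" "\<And>i y. i < 5 \<Longrightarrow> 0 \<le> F i y"
    and N: "\<And>i. i < 5 \<Longrightarrow> 0 \<le> N i"
  shows "avg F x \<le> ennreal (\<Prod>i<5. N i) * avg H x"
proof -
  have N0: "0 \<le> (\<Prod>i<5. N i)" using N by (intro prod_nonneg) auto
  have "avg F x \<le> (\<integral>\<^sup>+w. ennreal (\<Prod>i<5. N i) * ennreal (window (fst w) * (\<Prod>i<5. H i (evp i (x, w)))) \<partial>lborel)"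
    unfolding avg_def
  proof (rule nn_integral_mono)
    fix w
    have "(\<Prod>i<5. F i (evp i (x, w))) \<le> (\<Prod>i<5. N i * H i (evp i (x, w)))"
      using le by (intro prod_mono) auto
    then have "window (fst w) * (\<Prod>i<5. F i (evp i (x, w))) \<le> window (fst w) * (\<Prod>i<5. N i * H i (evp i (x, w)))"
      by (rule mult_left_mono) simp
    then have "ennreal (window (fst w) * (\<Prod>i<5. F i (evp i (x, w)))) \<le> ennreal ((\<Prod>i<5. N i) * (window (fst w) * (\<Prod>i<5. H i (evp i (x, w)))))"
      by (intro ennreal_leI) (simp only: prod.distrib mult.left_commute)
    then show "ennreal (window (fst w) * (\<Prod>i<5. F i (evp i (x, w)))) \<le> ennreal (\<Prod>i<5. N i) * ennreal (window (fst w) * (\<Prod>i<5. H i (evp i (x, w))))"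
      by (simp only: ennreal_mult'[OF N0])
  qed
  also have "\<dots> = ennreal (\<Prod>i<5. N i) * avg H x"
    unfolding avg_def using avg_integrand_measurable[of H x] H by (intro nn_integral_cmult) auto
  finally show ?thesis .
qed

section \<open>The weighted space with exponent infinity\<close>

lemma Linfty_D:
  assumes g: "g \<in> Lp \<infinity>"
  shows "g \<in> borel_measurable borel" "AE x in lborel. norm (g x) \<le> Lp_norm \<infinity> g" "0 \<le> Lp_norm \<infinity> g"
    "ereal (Lp_norm \<infinity> g) = esssup lborel (\<lambda>x. ereal (norm (g x)))"
proof -
  let ?e = "esssup lborel (\<lambda>x. ereal (norm (g x)))"
  show m [measurable]: "g \<in> borel_measurable borel" using g by (simp add: Lp_def)
  have lt: "?e < \<infinity>" using g by (simp add: Lp_def)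
  have ge: "0 \<le> ?e"
  proof -
    have "esssup lborel (\<lambda>x::real. 0::ereal) \<le> ?e" by (intro esssup_mono) auto
    then show ?thesis by (simp add: esssup_const)
  qed
  show e: "ereal (Lp_norm \<infinity> g) = ?e" using lt ge by (simp add: Lp_norm_def ereal_real)
  show "0 \<le> Lp_norm \<infinity> g" using ge e by (metis ereal_less_eq(5))
  show "AE x in lborel. norm (g x) \<le> Lp_norm \<infinity> g"
    using esssup_AE[where M = lborel and f = "\<lambda>x. ereal (norm (g x))"] unfolding e[symmetric] by simp
qed

lemma Linfty_I:
  assumes g [measurable]: "g \<in> borel_measurable borel" and K: "AE x in lborel. norm (g x) \<le> K"
  shows "g \<in> Lp \<infinity>" "Lp_norm \<infinity> g \<le> K"
proof -
  have le: "esssup lborel (\<lambda>x. ereal (norm (g x))) \<le> ereal K" using K by (intro esssup_I) auto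
  then show *: "g \<in> Lp \<infinity>" by (auto simp: Lp_def intro: le_less_trans)
  show "Lp_norm \<infinity> g \<le> K" using le unfolding Linfty_D(4)[OF *, symmetric] by simp
qed

lemma jb_powr_SQ: "1 / 2 < s \<Longrightarrow> (\<lambda>x. complex_of_real (N * jb x powr (- s))) \<in> SQ"
proof -
  assume s: "1 / 2 < s"
  have "(\<lambda>x. complex_of_real (jb x powr (- s))) \<in> SQ"
  proof (rule L2_I_nn)
    show "(\<integral>\<^sup>+x. (ennreal (norm (complex_of_real (jb x powr (- s)))))\<^sup>2 \<partial>lborel) \<le>
        ennreal ((sqrt (enn2real (\<integral>\<^sup>+x. (ennreal (jb x powr (- s)))\<^sup>2 \<partial>lborel)))\<^sup>2)"
      using jb_powr_sq_integral[OF s] by (simp add: less_top)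
  qed auto
  then show ?thesis by (auto simp: L2_iff norm_mult power_mult_distrib)
qed

text \<open>For \<open>s > 1 / 2\<close> the function \<open>jb x powr (- s)\<close> is square
  integrable, so the space embeds into \<open>L2\<close>, where \<open>T6\<close> is
  characterized.\<close>

lemma weighted_Linfty_SQ:
  assumes w: "weight s f \<in> Lp \<infinity>" and s: "1 / 2 < s"
  shows "f \<in> SQ"
proof (rule L2_dominated(1)[OF jb_powr_SQ[OF s]])
  let ?N = "Lp_norm \<infinity> (weight s f)"
  show "f \<in> borel_measurable borel" using Linfty_D(1)[OF w] by (rule weight_measurableD)
  show "AE x in lborel. norm (f x) \<le> norm (complex_of_real (?N * jb x powr (- s)))"
    using Linfty_D(2)[OF w]
  proof eventually_elim
    case (elim x)
    have "norm (f x) = jb x powr (- s) * norm (weight s f x)"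
      using jb_pos[of x] by (simp add: norm_weight powr_minus field_simps)
    also have "\<dots> \<le> jb x powr (- s) * ?N" by (intro mult_left_mono elim) simp
    also have "\<dots> = norm (complex_of_real (?N * jb x powr (- s)))"
      using Linfty_D(3)[OF w] by (simp add: norm_mult mult.commute)
    finally show ?case .
  qed
qed

lemma T6_bounded_weighted_Linfty:
  assumes s: "1 / 2 < s" shows "\<exists>C. T6_bounded_by (Lps \<infinity> s) (Lps_norm \<infinity> s) C"
proof -
  obtain C where C: "0 \<le> C" "\<And>x. ennreal (jb x powr s) * avg (\<lambda>_ y. jb y powr (- s)) x \<le> ennreal C"
    using avg_jb_bound[OF s] by blast
  have "T6_bounded_by (Lps \<infinity> s) (Lps_norm \<infinity> s) (avg_const * C)"
    unfolding T6_bounded_by_def Lps_def Lps_norm_def mem_Collect_eq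
  proof (intro ballI)
    fix f1 f2 f3 f4 f5
    assume "f1 \<in> {f. weight s f \<in> Lp \<infinity>}" "f2 \<in> {f. weight s f \<in> Lp \<infinity>}" "f3 \<in> {f. weight s f \<in> Lp \<infinity>}"
      "f4 \<in> {f. weight s f \<in> Lp \<infinity>}" "f5 \<in> {f. weight s f \<in> Lp \<infinity>}"
    then have w: "weight s f1 \<in> Lp \<infinity>" "weight s f2 \<in> Lp \<infinity>" "weight s f3 \<in> Lp \<infinity>" "weight s f4 \<in> Lp \<infinity>" "weight s f5 \<in> Lp \<infinity>" by auto
    note f = w[THEN weighted_Linfty_SQ, OF s]
    let ?F = "(!) [f1, f2, f3, f4, f5]"
    have Fw: "weight s (?F i) \<in> Lp \<infinity>" if "i < 5" for i using less_5_cases[OF that] w by auto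
    have FL: "?F i \<in> SQ" if "i < 5" for i by (rule weighted_Linfty_SQ[OF Fw[OF that] s])
    define N where "N i = Lp_norm \<infinity> (weight s (?F i))" for i
    have N0: "0 \<le> N i" if "i < 5" for i unfolding N_def by (rule Linfty_D(3)[OF Fw[OF that]])
    \<comment> \<open>The essential supremum bounds the functions almost everywhere only, while the
      average evaluates them along rotated points. Setting them to 0 on the exceptional set makes
      the bound hold everywhere and changes the operator on a null set only.\<close>
    define G where "G i x = (if norm (weight s (?F i) x) \<le> N i then ?F i x else 0)" for i x
    have Gm: "G i \<in> borel_measurable borel" if "i < 5" for i
    proof -
      have [measurable]: "?F i \<in> borel_measurable borel" "weight s (?F i) \<in> borel_measurable borel"
        by (rule L2_measurable[OF FL[OF that]], rule Linfty_D(1)[OF Fw[OF that]])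
      show ?thesis unfolding G_def[abs_def] by measurable
    qed
    have Gae: "AE x in lborel. G i x = ?F i x" if "i < 5" for i
      using Linfty_D(2)[OF Fw[OF that]] by eventually_elim (simp add: G_def N_def)
    have GL: "G i \<in> SQ" if "i < 5" for i by (rule L2_cong_AE[OF FL Gm Gae]) (rule that)+
    have Gb: "norm (G i y) \<le> N i * jb y powr (- s)" if "i < 5" for i y
    proof (cases "norm (weight s (?F i) y) \<le> N i")
      case True
      have "norm (G i y) = jb y powr (- s) * norm (weight s (?F i) y)"
        using jb_pos[of y] True by (simp add: G_def norm_weight powr_minus field_simps)
      also have "\<dots> \<le> jb y powr (- s) * N i" by (intro mult_left_mono True) simp
      finally show ?thesis by (simp only: mult.commute)
    qed (use N0[OF that] in \<open>simp add: G_def\<close>)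
    have le: "norm (weight s (avg_op G) x) \<le> avg_const * C * (\<Prod>i<5. N i)" for x
    proof -
      have P: "0 \<le> (\<Prod>i<5. N i)" using N0 by (intro prod_nonneg) auto
      have "ennreal (norm (weight s (avg_op G) x)) = ennreal (jb x powr s) * ennreal (norm (avg_op G x))"
        unfolding norm_weight by (rule ennreal_mult) auto
      also have "\<dots> \<le> ennreal (jb x powr s) * (ennreal avg_const * avg (\<lambda>i x. norm (G i x)) x)"
        by (intro mult_left_mono norm_avg_op_le Gm) auto
      also have "\<dots> \<le> ennreal (jb x powr s) * (ennreal avg_const * (ennreal (\<Prod>i<5. N i) * avg (\<lambda>_ y. jb y powr (- s)) x))"
        by (intro mult_left_mono avg_mono_cmult Gb N0) auto
      also have "\<dots> = ennreal avg_const * (ennreal (\<Prod>i<5. N i) * (ennreal (jb x powr s) * avg (\<lambda>_ y. jb y powr (- s)) x))"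
        by (simp only: mult_ac)
      also have "\<dots> \<le> ennreal avg_const * (ennreal (\<Prod>i<5. N i) * ennreal C)"
        by (intro mult_left_mono C) auto
      also have "\<dots> = ennreal (avg_const * C * (\<Prod>i<5. N i))"
        using P C(1) avg_const_pos by (simp add: ennreal_mult mult_ac)
      finally show ?thesis using P C(1) avg_const_pos by (subst (asm) ennreal_le_iff) auto
    qed
    have GF: "AE x in lborel. avg_op G x = avg_op ?F x" by (rule avg_op_cong_AE) (rule GL FL Gae; assumption)+
    have "AE x in lborel. norm (weight s (T6 f1 f2 f3 f4 f5) x) \<le> avg_const * C * (\<Prod>i<5. N i)"
      using T6_AE(2)[OF f] GF
    proof eventually_elim
      case (elim x)
      then have "weight s (T6 f1 f2 f3 f4 f5) x = weight s (avg_op G) x" by (simp add: weight_def)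
      then show ?case using le[of x] by simp
    qed
    then show "weight s (T6 f1 f2 f3 f4 f5) \<in> Lp \<infinity> \<and> Lp_norm \<infinity> (weight s (T6 f1 f2 f3 f4 f5)) \<le> avg_const * C *
       (Lp_norm \<infinity> (weight s f1) * Lp_norm \<infinity> (weight s f2) * Lp_norm \<infinity> (weight s f3) * Lp_norm \<infinity> (weight s f4) * Lp_norm \<infinity> (weight s f5))"
      using Linfty_I[of "weight s (T6 f1 f2 f3 f4 f5)" "avg_const * C * (\<Prod>i<5. N i)"] T6_AE(1)[OF f]
      by (simp add: N_def prod_lessThan_5 weight_measurable L2_measurable)
  qed
  then show ?thesis ..
qed

text \<open>Young's inequality for the functions normalized by \<open>\<alpha>\<close> and
  \<open>\<beta>\<close>, integrated. If one of the bounds is 0 no normalization is possible, but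
  then the product vanishes almost everywhere.\<close>

lemma nn_holder:
  fixes A B :: "'a \<Rightarrow> real"
  assumes [measurable]: "A \<in> borel_measurable M" "B \<in> borel_measurable M"
    and nn: "\<And>x. 0 \<le> A x" "\<And>x. 0 \<le> B x"
    and e: "0 < l" "0 < m" "l + m = 1"
    and \<alpha>: "(\<integral>\<^sup>+x. ennreal (A x) \<partial>M) \<le> ennreal \<alpha>" "0 \<le> \<alpha>"
    and \<beta>: "(\<integral>\<^sup>+x. ennreal (B x) \<partial>M) \<le> ennreal \<beta>" "0 \<le> \<beta>"
  shows "(\<integral>\<^sup>+x. ennreal (A x powr l * B x powr m) \<partial>M) \<le> ennreal (\<alpha> powr l * \<beta> powr m)"
proof -
  have zero: "(\<integral>\<^sup>+x. ennreal (A x powr l * B x powr m) \<partial>M) = 0" if "D = A \<or> D = B" "(\<integral>\<^sup>+x. ennreal (D x) \<partial>M) = 0" for D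
  proof -
    have [measurable]: "D \<in> borel_measurable M" using that(1) by auto
    have "AE x in M. ennreal (D x) = 0" using that(2) by (subst (asm) nn_integral_0_iff_AE) auto
    then have "AE x in M. ennreal (A x powr l * B x powr m) = 0"
      by eventually_elim (use that(1) nn e in \<open>auto simp: ennreal_eq_0_iff antisym[OF _ nn(1)] antisym[OF _ nn(2)]\<close>)
    then show ?thesis by (subst nn_integral_0_iff_AE) auto
  qed
  consider "\<alpha> = 0" | "\<beta> = 0" | "0 < \<alpha>" "0 < \<beta>" using \<alpha>(2) \<beta>(2) by linarith
  then show ?thesis
  proof cases
    case 1
    then show ?thesis using \<alpha>(1) zero[of A] by auto
  next
    case 2
    then show ?thesis using \<beta>(1) zero[of B] by auto
  next
    case 3
    let ?K = "\<alpha> powr l * \<beta> powr m"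
    have K: "0 \<le> ?K" by simp
    have le: "A x powr l * B x powr m \<le> ?K * (l / \<alpha> * A x + m / \<beta> * B x)" for x
    proof (cases "A x = 0 \<or> B x = 0")
      case True
      have "0 \<le> ?K * (l / \<alpha> * A x + m / \<beta> * B x)"
        using e 3 nn by (intro mult_nonneg_nonneg add_nonneg_nonneg) auto
      then show ?thesis using True by auto
    next
      case False
      then have pos: "0 < A x" "0 < B x" using nn[of x] by linarith+
      have "A x powr l * B x powr m = ?K * ((A x / \<alpha>) powr l * (B x / \<beta>) powr m)"
        using pos 3 by (simp add: powr_divide)
      also have "\<dots> \<le> ?K * (l * (A x / \<alpha>) + m * (B x / \<beta>))"
        using pos 3 e by (intro mult_left_mono Youngs_inequality_0) auto
      finally show ?thesis by simp
    qed
    have ab: "0 \<le> l / \<alpha>" "0 \<le> m / \<beta>" using e 3 by auto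
    have "(\<integral>\<^sup>+x. ennreal (A x powr l * B x powr m) \<partial>M) \<le>
        (\<integral>\<^sup>+x. ennreal ?K * (ennreal (l / \<alpha>) * ennreal (A x) + ennreal (m / \<beta>) * ennreal (B x)) \<partial>M)"
    proof (rule nn_integral_mono)
      fix x
      have "ennreal (A x powr l * B x powr m) \<le> ennreal (?K * (l / \<alpha> * A x + m / \<beta> * B x))" by (rule ennreal_leI[OF le])
      also have "\<dots> = ennreal ?K * (ennreal (l / \<alpha>) * ennreal (A x) + ennreal (m / \<beta>) * ennreal (B x))"
        using ab nn by (simp only: ennreal_mult'[OF K] ennreal_plus[OF mult_nonneg_nonneg mult_nonneg_nonneg] ennreal_mult'[OF ab(1)] ennreal_mult'[OF ab(2)])
      finally show "ennreal (A x powr l * B x powr m) \<le> ennreal ?K * (ennreal (l / \<alpha>) * ennreal (A x) + ennreal (m / \<beta>) * ennreal (B x))" .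
    qed
    also have "\<dots> = ennreal ?K * (ennreal (l / \<alpha>) * (\<integral>\<^sup>+x. ennreal (A x) \<partial>M) + ennreal (m / \<beta>) * (\<integral>\<^sup>+x. ennreal (B x) \<partial>M))"
      by (simp add: nn_integral_cmult nn_integral_add)
    also have "\<dots> \<le> ennreal ?K * (ennreal (l / \<alpha>) * ennreal \<alpha> + ennreal (m / \<beta>) * ennreal \<beta>)"
      by (intro mult_left_mono add_mono \<alpha> \<beta>) auto
    also have "\<dots> = ennreal (?K * (l / \<alpha> * \<alpha> + m / \<beta> * \<beta>))"
      using ab 3 by (simp only: ennreal_mult'[OF K] ennreal_plus[OF mult_nonneg_nonneg mult_nonneg_nonneg] ennreal_mult'[OF ab(1)] ennreal_mult'[OF ab(2)] less_imp_le)
    also have "?K * (l / \<alpha> * \<alpha> + m / \<beta> * \<beta>) = ?K" using 3 e by simp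
    finally show ?thesis .
  qed
qed


section \<open>Weighted spaces with finite exponent\<close>

lemma Lp_D:
  assumes g: "g \<in> Lp (ereal p)" and p: "0 < p"
  shows "g \<in> borel_measurable borel" "0 \<le> Lp_norm (ereal p) g"
    "(\<integral>\<^sup>+x. ennreal (norm (g x) powr p) \<partial>lborel) = ennreal (Lp_norm (ereal p) g powr p)"
proof -
  show "g \<in> borel_measurable borel" using g by (simp add: Lp_def)
  show "0 \<le> Lp_norm (ereal p) g" by (simp add: Lp_norm_def)
  have i: "integrable lborel (\<lambda>x. norm (g x) powr p)" using g by (simp add: Lp_def)
  have "0 \<le> (LINT x|lborel. norm (g x) powr p)" by (intro Bochner_Integration.integral_nonneg) simp
  then have "Lp_norm (ereal p) g powr p = (LINT x|lborel. norm (g x) powr p)"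
    using p by (simp add: Lp_norm_def powr_powr)
  then show "(\<integral>\<^sup>+x. ennreal (norm (g x) powr p) \<partial>lborel) = ennreal (Lp_norm (ereal p) g powr p)"
    using nn_integral_eq_integral[OF i] by simp
qed

lemma Lp_I:
  assumes g [measurable]: "g \<in> borel_measurable borel" and p: "0 < p"
    and M: "(\<integral>\<^sup>+x. ennreal (norm (g x) powr p) \<partial>lborel) \<le> ennreal (M powr p)" "0 \<le> M"
  shows "g \<in> Lp (ereal p)" "Lp_norm (ereal p) g \<le> M"
proof -
  have "integrable lborel (\<lambda>x. norm (g x) powr p)"
    using M by (intro integrableI_bounded) (auto intro: le_less_trans)
  then show *: "g \<in> Lp (ereal p)" by (simp add: Lp_def)
  have "ennreal (Lp_norm (ereal p) g powr p) \<le> ennreal (M powr p)" using M(1) unfolding Lp_D(3)[OF * p] .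
  then have "Lp_norm (ereal p) g powr p \<le> M powr p" by (subst (asm) ennreal_le_iff) auto
  then show "Lp_norm (ereal p) g \<le> M"
    using powr_less_mono2[OF p M(2), of "Lp_norm (ereal p) g"] by linarith
qed

text \<open>Each \<open>norm (f x)\<close> factors as \<open>a f x powr l * b x powr m\<close> with
  \<open>a f\<close> in \<open>L2\<close> and \<open>b\<close> a power of the bracket. Hoelder's
  inequality for the positive average with exponents \<open>l = 2 / p\<close> and
  \<open>m = 1 - 2 / p\<close> leaves the average of the \<open>a\<close>, bounded by
  \<open>avg_L2\<close>, and that of \<open>b\<close>, bounded by \<open>avg_jb_bound\<close> with
  weight \<open>s' = s / m\<close>. The hypothesis on \<open>s\<close> says exactly that
  \<open>s' > 1 / 2\<close>.\<close>

lemma T6_bounded_weighted_Lp: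
  assumes p: "2 < p" and s: "1 / 2 - 1 / p < s"
  shows "\<exists>C. T6_bounded_by (Lps (ereal p) s) (Lps_norm (ereal p) s) C"
proof -
  define l m where "l = 2 / p" and "m = 1 - 2 / p"
  have lm: "0 < l" "0 < m" "l + m = 1" using p by (simp_all add: l_def m_def field_simps)
  have p0: "0 < p" using p by simp
  have pl: "p / 2 * l = 1" "l * p = 2" using p by (simp_all add: l_def)
  define s' where "s' = s / m"
  have "m / 2 < s" using s by (simp add: m_def field_simps)
  then have s': "1 / 2 < s'" "s' * m = s" using lm by (simp_all add: s'_def field_simps)
  obtain C where C: "0 \<le> C" "\<And>x. ennreal (jb x powr s') * avg (\<lambda>_ y. jb y powr (- s')) x \<le> ennreal C"
    using avg_jb_bound[OF s'(1)] by blast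
  define b where "b = (\<lambda>y. jb y powr (- s'))"
  have bm [measurable]: "b \<in> borel_measurable borel" unfolding b_def by measurable
  have b0: "0 \<le> b y" for y by (simp add: b_def)
  have bav: "avg (\<lambda>_. b) x \<le> ennreal (C * b x)" for x
  proof -
    have "avg (\<lambda>_. b) x = ennreal (b x) * (ennreal (jb x powr s') * avg (\<lambda>_. b) x)"
    proof -
      have "ennreal (b x) * ennreal (jb x powr s') = 1"
        using jb_pos[of x] by (subst ennreal_mult[symmetric]) (auto simp: b_def powr_add[symmetric])
      then show ?thesis by (simp only: mult.assoc[symmetric] mult_1)
    qed
    also have "\<dots> \<le> ennreal (b x) * ennreal C" unfolding b_def by (intro mult_left_mono C) simp
    also have "\<dots> = ennreal (C * b x)" using C(1) b0 by (simp add: ennreal_mult mult.commute)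
    finally show ?thesis .
  qed
  define K where "K = avg_const * C powr m"
  have K0: "0 \<le> K" using avg_const_pos by (simp add: K_def)
  define a where "a = (\<lambda>f x. norm (weight s f x) powr (p / 2))"
  have a0: "0 \<le> a f x" for f x by (simp add: a_def)
  have fab: "norm (f x) = a f x powr l * b x powr m" for f x
  proof -
    have "a f x powr l = norm (weight s f x)" by (simp only: a_def powr_powr pl powr_one norm_ge_zero)
    moreover have "b x powr m = jb x powr (- s)" using s' by (simp add: b_def powr_powr)
    ultimately show ?thesis using jb_pos[of x] by (simp add: norm_weight powr_minus)
  qed
  have am: "a f \<in> borel_measurable borel" if "weight s f \<in> Lp (ereal p)" for f
    using Lp_D(1)[OF that p0] unfolding a_def by measurable
  have asq: "(\<integral>\<^sup>+x. (ennreal (a f x))\<^sup>2 \<partial>lborel) = ennreal ((Lp_norm (ereal p) (weight s f) powr (p / 2))\<^sup>2)"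
    if "weight s f \<in> Lp (ereal p)" for f
  proof -
    have "(ennreal (a f x))\<^sup>2 = ennreal (norm (weight s f x) powr p)" for x
      unfolding power2_eq_square by (subst ennreal_mult[symmetric]) (auto simp: a_def powr_add[symmetric])
    moreover have "(Lp_norm (ereal p) (weight s f) powr (p / 2))\<^sup>2 = Lp_norm (ereal p) (weight s f) powr p"
      by (simp add: power2_eq_square powr_add[symmetric])
    ultimately show ?thesis using Lp_D(3)[OF that p0] by (simp only:)
  qed
  \<comment> \<open>Embedding into \<open>L2\<close>, where \<open>T6_AE\<close> applies: Hoelder's
    inequality for the integrable functions \<open>(a f)\<^sup>2\<close> and
    \<open>b\<^sup>2\<close>.\<close>
  have FS: "f \<in> SQ" if w: "weight s f \<in> Lp (ereal p)" for f
  proof -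
    note [measurable] = am[OF w]
    have m: "f \<in> borel_measurable borel" using Lp_D(1)[OF w p0] by (rule weight_measurableD)
    have "(\<integral>\<^sup>+x. (ennreal (norm (f x)))\<^sup>2 \<partial>lborel) = (\<integral>\<^sup>+x. ennreal ((a f x)\<^sup>2 powr l * (b x)\<^sup>2 powr m) \<partial>lborel)"
    proof (rule nn_integral_cong)
      fix x
      have "(norm (f x))\<^sup>2 = (a f x)\<^sup>2 powr l * (b x)\<^sup>2 powr m"
        unfolding fab[of f x] by (simp add: power2_eq_square powr_mult mult_ac)
      then show "(ennreal (norm (f x)))\<^sup>2 = ennreal ((a f x)\<^sup>2 powr l * (b x)\<^sup>2 powr m)" by (simp add: ennreal_power)
    qed
    also have "\<dots> \<le> ennreal (((Lp_norm (ereal p) (weight s f) powr (p / 2))\<^sup>2) powr l *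
        enn2real (\<integral>\<^sup>+x. (ennreal (b x))\<^sup>2 \<partial>lborel) powr m)"
      using asq[OF w] jb_powr_sq_integral[OF s'(1)] lm
      by (intro nn_holder) (auto simp: ennreal_power[symmetric] a0 b0 b_def less_top simp del: ennreal_power)
    also have "\<dots> = ennreal ((sqrt (((Lp_norm (ereal p) (weight s f) powr (p / 2))\<^sup>2) powr l *
        enn2real (\<integral>\<^sup>+x. (ennreal (b x))\<^sup>2 \<partial>lborel) powr m))\<^sup>2)" by simp
    finally show ?thesis by (rule L2_I_nn(1)[OF m]) simp
  qed
  have pt: "ennreal (norm (weight s (avg_op F) x) powr p) \<le> ennreal (K powr p) * (avg (\<lambda>i. a (F i)) x)\<^sup>2"
    if F: "\<And>i. i < 5 \<Longrightarrow> weight s (F i) \<in> Lp (ereal p)" and fin: "avg (\<lambda>i. a (F i)) x < \<infinity>"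
    for F :: "nat \<Rightarrow> real \<Rightarrow> complex" and x
  proof -
    define \<alpha> where "\<alpha> = enn2real (avg (\<lambda>i. a (F i)) x)"
    have \<alpha>: "avg (\<lambda>i. a (F i)) x = ennreal \<alpha>" "0 \<le> \<alpha>" using fin by (simp_all add: \<alpha>_def less_top)
    have m: "F i \<in> borel_measurable borel" if "i < 5" for i using Lp_D(1)[OF F[OF that] p0] by (rule weight_measurableD)
    let ?A = "\<lambda>w :: real \<times> real \<times> real. window (fst w) * (\<Prod>i<5. a (F i) (evp i (x, w)))"
    let ?B = "\<lambda>w :: real \<times> real \<times> real. window (fst w) * (\<Prod>i<5. b (evp i (x, w)))"
    have meas: "(\<lambda>w :: real \<times> real \<times> real. window (fst w) * (\<Prod>i<5. H i (evp i (x, w)))) \<in> borel_measurable lborel"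
      if H: "\<And>i. i < 5 \<Longrightarrow> H i \<in> borel_measurable borel" for H
    proof -
      have "(\<lambda>w. H i (evp i (x, w))) \<in> borel_measurable borel" if "i < 5" for i
        using that by (intro measurable_compose[OF evp_pair_measurable H]) auto
      then have "(\<lambda>w. window (fst w) * (\<Prod>i<5. H i (evp i (x, w)))) \<in> borel_measurable borel"
        by (intro borel_measurable_times borel_measurable_prod window_fst_measurable) auto
      then show ?thesis by (simp del: evp.simps)
    qed
    have "avg (\<lambda>i x. norm (F i x)) x = (\<integral>\<^sup>+w. ennreal (?A w powr l * ?B w powr m) \<partial>lborel)"
      unfolding avg_def
    proof (rule nn_integral_cong)
      fix w :: "real \<times> real \<times> real"
      \<comment> \<open>The window takes only the values 0 and 1, so positive powers leave it
        unchanged and it can be shared between the two Hoelder factors.\<close>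
      have window_fst_measurable: "window (fst w) = window (fst w) powr l * window (fst w) powr m" by (simp add: window_def indicator_def)
      have "window (fst w) * (\<Prod>i<5. norm (F i (evp i (x, w)))) = ?A w powr l * ?B w powr m"
        unfolding fab prod.distrib prod_powr_distrib[symmetric] powr_mult
        by (subst window_fst_measurable) (simp only: mult_ac)
      then show "ennreal (window (fst w) * (\<Prod>i<5. norm (F i (evp i (x, w))))) = ennreal (?A w powr l * ?B w powr m)"
        by (simp only:)
    qed
    also have "\<dots> \<le> ennreal (\<alpha> powr l * (C * b x) powr m)"
      using \<alpha> bav[of x] C(1) b0 lm unfolding avg_def
      by (intro nn_holder meas am F bm) (auto intro!: prod_nonneg mult_nonneg_nonneg a0 b0 simp del: evp.simps)
    finally have h: "avg (\<lambda>i x. norm (F i x)) x \<le> ennreal (\<alpha> powr l * (C * b x) powr m)" .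
    have "ennreal (norm (weight s (avg_op F) x)) = ennreal (jb x powr s) * ennreal (norm (avg_op F x))"
      unfolding norm_weight by (rule ennreal_mult) auto
    also have "\<dots> \<le> ennreal (jb x powr s) * (ennreal avg_const * ennreal (\<alpha> powr l * (C * b x) powr m))"
      by (intro mult_left_mono order_trans[OF norm_avg_op_le mult_left_mono[OF h]] m) auto
    also have "\<dots> = ennreal (jb x powr s * (avg_const * (\<alpha> powr l * (C * b x) powr m)))"
      using avg_const_pos by (simp add: ennreal_mult)
    also have "jb x powr s * (avg_const * (\<alpha> powr l * (C * b x) powr m)) = K * \<alpha> powr l"
    proof -
      have "b x powr m = jb x powr (- s)" using s' by (simp add: b_def powr_powr)
      then have "jb x powr s * b x powr m = 1" using jb_pos[of x] by (simp add: powr_add[symmetric])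
      moreover have "jb x powr s * (avg_const * (\<alpha> powr l * (C * b x) powr m)) = K * \<alpha> powr l * (jb x powr s * b x powr m)"
        by (simp add: K_def powr_mult mult_ac)
      ultimately show ?thesis by simp
    qed
    finally have "norm (weight s (avg_op F) x) \<le> K * \<alpha> powr l" using K0 by (subst (asm) ennreal_le_iff) auto
    then have "norm (weight s (avg_op F) x) powr p \<le> (K * \<alpha> powr l) powr p" using p0 by (intro powr_mono2) auto
    also have "\<dots> = K powr p * \<alpha>\<^sup>2" using \<alpha>(2) by (cases "\<alpha> = 0") (simp_all add: powr_mult powr_powr pl)
    finally have "ennreal (norm (weight s (avg_op F) x) powr p) \<le> ennreal (K powr p * \<alpha>\<^sup>2)" by (rule ennreal_leI)
    then show ?thesis using \<alpha> by (simp add: ennreal_mult ennreal_power)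
  qed
  \<comment> \<open>The factor \<open>2 * pi\<close> of \<open>avg_L2\<close> occurs squared under a
    \<open>p\<close>-th root, hence the exponent \<open>l = 2 / p\<close>.\<close>
  define C' where "C' = K * (2 * pi) powr l"
  have "T6_bounded_by (Lps (ereal p) s) (Lps_norm (ereal p) s) C'"
    unfolding T6_bounded_by_def Lps_def Lps_norm_def mem_Collect_eq
  proof (intro ballI)
    fix f1 f2 f3 f4 f5
    let ?X = "{f. weight s f \<in> Lp (ereal p)}"
    assume "f1 \<in> ?X" "f2 \<in> ?X" "f3 \<in> ?X" "f4 \<in> ?X" "f5 \<in> ?X"
    then have w: "weight s f1 \<in> Lp (ereal p)" "weight s f2 \<in> Lp (ereal p)" "weight s f3 \<in> Lp (ereal p)"
      "weight s f4 \<in> Lp (ereal p)" "weight s f5 \<in> Lp (ereal p)" by auto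
    note f = w[THEN FS]
    let ?F = "(!) [f1, f2, f3, f4, f5]"
    let ?T = "T6 f1 f2 f3 f4 f5"
    have Fw: "weight s (?F i) \<in> Lp (ereal p)" if "i < 5" for i using less_5_cases[OF that] w by auto
    define N where "N i = Lp_norm (ereal p) (weight s (?F i))" for i
    have N0: "0 \<le> N i" if "i < 5" for i unfolding N_def by (rule Lp_D(2)[OF Fw[OF that] p0])
    define P where "P = (\<Prod>i<5. N i)"
    have P0: "0 \<le> P" unfolding P_def using N0 by (intro prod_nonneg) auto
    let ?av = "avg (\<lambda>i. a (?F i))"
    have avm: "?av \<in> borel_measurable borel" by (intro avg_measurable am Fw)
    have av2m: "(\<lambda>x. (?av x)\<^sup>2) \<in> borel_measurable lborel" using borel_measurable_power_ennreal[OF avm] by simp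
    have "(\<integral>\<^sup>+x. (?av x)\<^sup>2 \<partial>lborel) \<le> ennreal ((2 * pi * (\<Prod>i<5. N i powr (p / 2)))\<^sup>2)"
      using asq[OF Fw] by (intro avg_L2 am Fw a0) (simp_all add: N_def)
    also have "(\<Prod>i<5. N i powr (p / 2)) = P powr (p / 2)"
      unfolding P_def by (rule prod_powr_distrib[symmetric])
    also have "(2 * pi * P powr (p / 2))\<^sup>2 = ((2 * pi) powr l * P) powr p"
    proof -
      have "((2 * pi) powr l * P) powr p = (2 * pi) powr 2 * P powr p" by (simp add: powr_mult powr_powr pl)
      moreover have "(P powr (p / 2))\<^sup>2 = P powr p" by (simp add: power2_eq_square powr_add[symmetric])
      ultimately show ?thesis by (simp add: power_mult_distrib)
    qed
    finally have av: "(\<integral>\<^sup>+x. (?av x)\<^sup>2 \<partial>lborel) \<le> ennreal (((2 * pi) powr l * P) powr p)" .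
    then have "(\<integral>\<^sup>+x. (?av x)\<^sup>2 \<partial>lborel) \<noteq> \<infinity>" by (auto simp: top_unique)
    \<comment> \<open>\<open>pt\<close> asks for a finite average at the point; the
      \<open>L2\<close> bound just obtained supplies this almost everywhere.\<close>
    then have fin: "AE x in lborel. (?av x)\<^sup>2 \<noteq> \<infinity>" by (rule nn_integral_PInf_AE[OF av2m])
    have Tm: "weight s ?T \<in> borel_measurable borel" using T6_AE(1)[OF f] by (intro weight_measurable L2_measurable)
    have "(\<integral>\<^sup>+x. ennreal (norm (weight s ?T x) powr p) \<partial>lborel) \<le> (\<integral>\<^sup>+x. ennreal (K powr p) * (?av x)\<^sup>2 \<partial>lborel)"
    proof (rule nn_integral_mono_AE)
      show "AE x in lborel. ennreal (norm (weight s ?T x) powr p) \<le> ennreal (K powr p) * (?av x)\<^sup>2"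
        using fin T6_AE(2)[OF f]
      proof eventually_elim
        case (elim x)
        have "?av x < \<infinity>" using elim(1) by (auto simp: less_top power2_eq_square ennreal_mult_eq_top_iff)
        then have "ennreal (norm (weight s (avg_op ?F) x) powr p) \<le> ennreal (K powr p) * (?av x)\<^sup>2" by (intro pt Fw)
        moreover have "weight s ?T x = weight s (avg_op ?F) x" using elim(2) by (simp add: weight_def)
        ultimately show ?case by (simp only:)
      qed
    qed
    also have "\<dots> = ennreal (K powr p) * (\<integral>\<^sup>+x. (?av x)\<^sup>2 \<partial>lborel)" by (rule nn_integral_cmult[OF av2m])
    also have "\<dots> \<le> ennreal (K powr p) * ennreal (((2 * pi) powr l * P) powr p)" by (intro mult_left_mono av) simp
    also have "\<dots> = ennreal ((C' * P) powr p)"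
      by (subst ennreal_mult[symmetric]) (auto simp: C'_def powr_mult mult_ac)
    finally have le: "(\<integral>\<^sup>+x. ennreal (norm (weight s ?T x) powr p) \<partial>lborel) \<le> ennreal ((C' * P) powr p)" .
    have "0 \<le> C' * P" using P0 K0 by (simp add: C'_def)
    note r = Lp_I[OF Tm p0 le this]
    show "weight s ?T \<in> Lp (ereal p) \<and> Lp_norm (ereal p) (weight s ?T) \<le> C' *
       (Lp_norm (ereal p) (weight s f1) * Lp_norm (ereal p) (weight s f2) * Lp_norm (ereal p) (weight s f3) *
        Lp_norm (ereal p) (weight s f4) * Lp_norm (ereal p) (weight s f5))"
      using r by (simp add: P_def N_def prod_lessThan_5)
  qed
  then show ?thesis ..
qed

theorem theorem3p11:
  shows "T6_bounded_by L2 (Lp_norm 2) (2 * sqrt 3 / pi) \<and>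
    (\<forall>\<sigma>::real. \<sigma> \<ge> 0 \<longrightarrow> (\<exists>C. T6_bounded_by (Lps 2 \<sigma>) (Lps_norm 2 \<sigma>) C)) \<and>
    (\<forall>\<sigma>::real. \<sigma> \<ge> 0 \<longrightarrow> (\<exists>C. T6_bounded_by (Sobolev \<sigma>) (Sobolev_norm \<sigma>) C)) \<and>
    (\<forall>s::real. s > 1 / 2 \<longrightarrow> (\<exists>C. T6_bounded_by (Lps \<infinity> s) (Lps_norm \<infinity> s) C)) \<and>
    (\<forall>(p::real) s::real. p \<ge> 2 \<and> s > 1 / 2 - 1 / p \<longrightarrow>
       (\<exists>C. T6_bounded_by (Lps (ereal p) s) (Lps_norm (ereal p) s) C))"
proof (intro conjI allI impI)
  fix p s :: real assume h: "p \<ge> 2 \<and> s > 1 / 2 - 1 / p"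
  show "\<exists>C. T6_bounded_by (Lps (ereal p) s) (Lps_norm (ereal p) s) C"
  \<comment> \<open>At \<open>p = 2\<close> the Hoelder exponent \<open>m\<close> would be 0 and the
    interpolation degenerates; the hypothesis then reads \<open>s > 0\<close>, and the weighted
    \<open>L2\<close> bound applies.\<close>
  proof (cases "p = 2")
    case True
    have "ereal p = 2" unfolding True by simp
    moreover have "0 \<le> s" using h True by simp
    ultimately show ?thesis using T6_bounded_weighted_L2[of s] by auto
  qed (use h T6_bounded_weighted_Lp[of p s] in auto)
qed (use T6_bounded_L2 T6_bounded_weighted_L2 T6_bounded_Sobolev T6_bounded_weighted_Linfty in blast)+

end
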